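(* Suppose that (C1)--(C5) hold. Let $f\in L^2(\Omega)$, or more generally $f\in H^{-1}(\Omega)$ if $V_h\subset H^1_0(\Omega)$. Let $u\in V$ be the solution to $(D^2u,D^2v)_{L^2(\Omega)}=(f,v)_{L^2(\Omega)}$ for all $v\in V$, let $u_h\in V_h$ be the solution to $(D_h^2u_h,D_h^2v_h)_{L^2(\Omega)}=(f,v_h)_{L^2(\Omega)}$ for all $v_h\in V_h$ (the right-hand sides are read as duality pairings if $f\in H^{-1}(\Omega)$), and set $\sigma:=D^2u$, $\sigma_h:=D_h^2u_h$. Then $$\|\sigma-D^2_{\mathrm{pw}}u_h\|+\|\sigma-\sigma_h\|\lesssim\|(1-\Pi_0)\sigma\|+\operatorname{osc}(f,\mathcal T).$$
   Context: Setting. Let $n\in\{2,3\}$, $\Omega\subset\mathbb R^n$ an open, bounded, connected Lipschitz polytope, $V:=H^2_0(\Omega)$. $\mathcal T$ is a regular triangulation of $\Omega$ into simplices, $\mathcal F$ the set of its faces (interior and boundary). $h_T,h_F$ are the diameters of $T\in\mathcal T$, $F\in\mathcal F$. $[\cdot]_F$ is the jump across $F$ (the trace on $F$ if $F\subset\partial\Omega$), $\{\cdot\}_F$ the average of the values from the simplices adjacent to $F$ (the trace if $F\subset\partial\Omega$), $\nu_F$ a fixed unit normal of $F$ (outer if $F\subset\partial\Omega$). The index pw denotes piecewise action of a differential operator with respect to $\mathcal T$. $P_k(\mathcal T)$ is the space of piecewise polynomials of degree at most $k$; $\Pi_0$ is the $L^2$ projection onto $P_0(\mathcal T)$ (componentwise).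 $\|\cdot\|_\omega$ is the $L^2(\omega)$ norm, $\|\cdot\|=\|\cdot\|_\Omega$. $\omega_T$ is the interior of $\bigcup\{K\in\mathcal T:K\cap T\neq\emptyset\}$. Discrete spaces. $V_h$ is a space of piecewise polynomial functions, $\Theta_h$ a space of piecewise polynomial vector fields, both with respect to $\mathcal T$ and of bounded degree, $\nabla_h:V_h\to\Theta_h$ is a linear map, $D_h^2:=D_{\mathrm{pw}}\circ\nabla_h$, $\|v_h\|_h:=\|D_h^2v_h\|$. Conditions, for all $v_h\in V_h$, $T\in\mathcal T$, $F\in\mathcal F$: (C1) $\int_F[\nabla_hv_h]_F=0$. (C2) $\|[v_h]_F\|_F\lesssim h_F\|\nabla_t[v_h]_F\|_F$ with the tangential gradient $\nabla_t$. (C3) $\|D_h^2v_h-D^2v_h\|_T\lesssim\min\{\|(1-\Pi_0)D^2v_h\|_T,\|(1-\Pi_0)D_h^2v_h\|_T\}$. (C4) $\|h_T^{-1}(\nabla v_h-\nabla_hv_h)\|_T\lesssim\|D^2v_h-D_h^2v_h\|_T$. (C5) There is a bounded linear map $Q_h:V\to V_h$ with $\sum_{j=0}^2\|h_T^{j-2}D^j(v-Q_hv)\|_T\lesssim\|(1-\Pi_0)D^2v\|_{\omega_T}$ for all $v\in V$, $T\in\mathcal T$. (These conditions imply that $\|\cdot\|_h$ is a norm on $V_h$, so $u_h$ exists uniquely.) Smoothing operator. Fix a bounded linear operator $J:V_h\to V$ such that for all $v_h\in V_h$, $T\in\mathcal T$, $F\in\mathcal F$, $p\in P_2(\mathcal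 T)$: $\sum_{j=0}^2\|h_T^{j-2}D^j(v_h-Jv_h)\|_T\lesssim\min_{\psi\in V}\|D^2_{\mathrm{pw}}(\psi-v_h)\|_{\omega_T}+\|(1-\Pi_0)D^2_{\mathrm{pw}}v_h\|_{\omega_T}$, $\int_T(Jv_h-v_h)p=0$, $\int_F(\nabla Jv_h-\{\nabla_hv_h\}_F)\cdot\nu_F=0$, and such that $Jv_h$ is a piecewise polynomial of uniformly bounded degree on the Hsieh--Clough--Tocher split ($n=2$) or Worsey--Farin split ($n=3$) of $\mathcal T$. (Such $J$ exists under (C1)--(C4).) Oscillation. $\operatorname{osc}(f,\mathcal T):=\sup_{w_h\in V_h,\|w_h\|_h=1}\int_\Omega f(w_h-Jw_h)$, the integral being a duality pairing if $f\in H^{-1}(\Omega)$ and $V_h\subset H^1_0(\Omega)$. $A\lesssim B$ means $A\le CB$ with a constant $C$ that may depend on the shapes of the simplices in $\mathcal T$ (and $n$, the polynomial degrees, and the constants in the conditions on $V_h$, $Q_h$ and $J$ above), but not on the mesh size or the functions involved. *)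

theory Defs
  imports "HOL-Analysis.Analysis"
begin

section \<open>Weak derivatives and Sobolev spaces\<close>

text \<open>Elements of \<open>L\<^sup>2\<close>, \<open>H\<^sup>1\<close>, \<open>H\<^sup>2\<close> are represented by functions on the whole space; only their values
  almost everywhere on the set in question matter, and every notion below is insensitive to the choice
  of the representative.  The norm of a vector of type \<open>real^'n\<close> is Euclidean and that of a matrix of
  type \<open>real^'n^'n\<close> is the Frobenius norm.\<close>

definition l2 :: "'a measure \<Rightarrow> ('a \<Rightarrow> 'b::real_normed_vector) \<Rightarrow> real" where
  "l2 M g = sqrt (LINT x|M. (norm (g x))\<^sup>2)"

definition in_l2 :: "'a measure \<Rightarrow> ('a \<Rightarrow> real) \<Rightarrow> bool" where
  "in_l2 M g \<longleftrightarrow> g \<in> borel_measurable M \<and> integrable M (\<lambda>x. (g x)\<^sup>2)"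

definition pd :: "'n::finite \<Rightarrow> (real^'n \<Rightarrow> real) \<Rightarrow> real^'n \<Rightarrow> real" where
  "pd i \<phi> x = frechet_derivative \<phi> (at x) (axis i 1)"

primrec Ck :: "nat \<Rightarrow> (real^'n::finite \<Rightarrow> real) \<Rightarrow> bool" where
  "Ck 0 \<phi> \<longleftrightarrow> continuous_on UNIV \<phi>"
| "Ck (Suc k) \<phi> \<longleftrightarrow> \<phi> differentiable_on UNIV \<and> (\<forall>i. Ck k (pd i \<phi>))"

definition smooth :: "(real^'n::finite \<Rightarrow> real) \<Rightarrow> bool" where
  "smooth \<phi> \<longleftrightarrow> (\<forall>k. Ck k \<phi>)"

definition test_fun :: "(real^'n::finite) set \<Rightarrow> (real^'n \<Rightarrow> real) \<Rightarrow> bool" where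
  "test_fun U \<phi> \<longleftrightarrow> smooth \<phi> \<and> (\<exists>K. compact K \<and> K \<subseteq> U \<and> (\<forall>x. x \<notin> K \<longrightarrow> \<phi> x = 0))"

definition loc_integrable :: "(real^'n::finite) set \<Rightarrow> (real^'n \<Rightarrow> real) \<Rightarrow> bool" where
  "loc_integrable U w \<longleftrightarrow> (\<forall>K. compact K \<and> K \<subseteq> U \<longrightarrow> integrable (lebesgue_on K) w)"

definition weak_partial ::
  "(real^'n::finite) set \<Rightarrow> 'n \<Rightarrow> (real^'n \<Rightarrow> real) \<Rightarrow> (real^'n \<Rightarrow> real) \<Rightarrow> bool" where
  "weak_partial U i w g \<longleftrightarrow> loc_integrable U w \<and> loc_integrable U g \<and>
     (\<forall>\<phi>. test_fun U \<phi> \<longrightarrow>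
        (LINT x|lebesgue_on U. w x * pd i \<phi> x) = - (LINT x|lebesgue_on U. g x * \<phi> x))"

definition wpd :: "(real^'n::finite) set \<Rightarrow> 'n \<Rightarrow> (real^'n \<Rightarrow> real) \<Rightarrow> real^'n \<Rightarrow> real" where
  "wpd U i w = (SOME g. weak_partial U i w g)"

definition wgrad :: "(real^'n::finite) set \<Rightarrow> (real^'n \<Rightarrow> real) \<Rightarrow> real^'n \<Rightarrow> real^'n" where
  "wgrad U w x = (\<chi> i. wpd U i w x)"

definition wjac :: "(real^'n::finite) set \<Rightarrow> (real^'n \<Rightarrow> real^'n) \<Rightarrow> real^'n \<Rightarrow> real^'n^'n" where
  "wjac U \<theta> x = (\<chi> i j. wpd U j (\<lambda>y. \<theta> y $ i) x)"

definition whess :: "(real^'n::finite) set \<Rightarrow> (real^'n \<Rightarrow> real) \<Rightarrow> real^'n \<Rightarrow> real^'n^'n" where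
  "whess U w = wjac U (wgrad U w)"

definition H1 :: "(real^'n::finite) set \<Rightarrow> (real^'n \<Rightarrow> real) set" where
  "H1 U = {w. in_l2 (lebesgue_on U) w \<and>
     (\<forall>i. \<exists>g. in_l2 (lebesgue_on U) g \<and> weak_partial U i w g)}"

definition H2 :: "(real^'n::finite) set \<Rightarrow> (real^'n \<Rightarrow> real) set" where
  "H2 U = {w \<in> H1 U. \<forall>i. wpd U i w \<in> H1 U}"

definition H1_norm :: "(real^'n::finite) set \<Rightarrow> (real^'n \<Rightarrow> real) \<Rightarrow> real" where
  "H1_norm U w = sqrt ((l2 (lebesgue_on U) w)\<^sup>2 + (l2 (lebesgue_on U) (wgrad U w))\<^sup>2)"

definition H2_norm :: "(real^'n::finite) set \<Rightarrow> (real^'n \<Rightarrow> real) \<Rightarrow> real" where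
  "H2_norm U w = sqrt ((l2 (lebesgue_on U) w)\<^sup>2 + (l2 (lebesgue_on U) (wgrad U w))\<^sup>2
                       + (l2 (lebesgue_on U) (whess U w))\<^sup>2)"

definition H1_0 :: "(real^'n::finite) set \<Rightarrow> (real^'n \<Rightarrow> real) set" where
  "H1_0 U = {w \<in> H1 U. \<exists>\<phi>. (\<forall>j. test_fun U (\<phi> j)) \<and>
     (\<lambda>j::nat. H1_norm U (\<lambda>x. w x - \<phi> j x)) \<longlonglongrightarrow> 0}"

definition H2_0 :: "(real^'n::finite) set \<Rightarrow> (real^'n \<Rightarrow> real) set" where
  "H2_0 U = {w \<in> H2 U. \<exists>\<phi>. (\<forall>j. test_fun U (\<phi> j)) \<and>
     (\<lambda>j::nat. H2_norm U (\<lambda>x. w x - \<phi> j x)) \<longlonglongrightarrow> 0}"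

definition lin_space :: "('a \<Rightarrow> 'b::real_vector) set \<Rightarrow> bool" where
  "lin_space S \<longleftrightarrow> (\<lambda>x. 0) \<in> S \<and>
     (\<forall>v\<in>S. \<forall>w\<in>S. \<forall>a b. (\<lambda>x. a *\<^sub>R v x + b *\<^sub>R w x) \<in> S)"

text \<open>Linearity of a map between function spaces, with functions on \<open>U\<close> identified
  if they agree almost everywhere.\<close>

definition lin_map :: "(real^'n::finite) set \<Rightarrow> (real^'n \<Rightarrow> real) set \<Rightarrow>
    ((real^'n \<Rightarrow> real) \<Rightarrow> real^'n \<Rightarrow> 'b::real_vector) \<Rightarrow> bool" where
  "lin_map U S L \<longleftrightarrow> (\<forall>v\<in>S. \<forall>w\<in>S. \<forall>a b.
     AE x in lebesgue_on U. L (\<lambda>x. a * v x + b * w x) x = a *\<^sub>R L v x + b *\<^sub>R L w x)"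

text \<open>The functional \<open>Lf\<close> is the pairing with \<open>f\<close>.\<close>

definition L2_load :: "(real^'n::finite) set \<Rightarrow> ((real^'n \<Rightarrow> real) \<Rightarrow> real) \<Rightarrow> bool" where
  "L2_load U Lf \<longleftrightarrow> (\<exists>f. in_l2 (lebesgue_on U) f \<and> (\<forall>v. Lf v = (LINT x|lebesgue_on U. f x * v x)))"

definition Hm1_load :: "(real^'n::finite) set \<Rightarrow> ((real^'n \<Rightarrow> real) \<Rightarrow> real) \<Rightarrow> bool" where
  "Hm1_load U Lf \<longleftrightarrow>
     (\<forall>v\<in>H1_0 U. \<forall>w\<in>H1_0 U. \<forall>a b. Lf (\<lambda>x. a * v x + b * w x) = a * Lf v + b * Lf w) \<and>
     (\<exists>B. \<forall>v\<in>H1_0 U. \<bar>Lf v\<bar> \<le> B * H1_norm U v)"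


section \<open>Domain and triangulation\<close>

definition lipschitz_domain :: "(real^'n::finite) set \<Rightarrow> bool" where
  "lipschitz_domain \<Omega> \<longleftrightarrow> (\<forall>x\<in>frontier \<Omega>. \<exists>e r L g. norm e = 1 \<and> r > 0 \<and> L-lipschitz_on UNIV g \<and>
     (\<forall>y\<in>ball x r. y \<in> \<Omega> \<longleftrightarrow> g (y - (y \<bullet> e) *\<^sub>R e) < y \<bullet> e))"

definition lipschitz_polytope :: "(real^'n::finite) set \<Rightarrow> bool" where
  "lipschitz_polytope \<Omega> \<longleftrightarrow> open \<Omega> \<and> bounded \<Omega> \<and> connected \<Omega> \<and> \<Omega> \<noteq> {} \<and> lipschitz_domain \<Omega> \<and>
     (\<exists>P. finite P \<and> (\<forall>K\<in>P. polytope K) \<and> closure \<Omega> = \<Union>P)"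

definition regular_triangulation :: "(real^'n::finite) set \<Rightarrow> (real^'n) set set \<Rightarrow> bool" where
  "regular_triangulation \<Omega> \<T> \<longleftrightarrow>
     triangulation \<T> \<and> (\<forall>T\<in>\<T>. int CARD('n) simplex T) \<and> \<Union>\<T> = closure \<Omega>"

text \<open>The shapes of the simplices enter the constants through a bound on the ratio of the
  diameter to the radius of an inscribed ball.\<close>

definition shape_regular :: "real \<Rightarrow> (real^'n::finite) set set \<Rightarrow> bool" where
  "shape_regular \<kappa> \<T> \<longleftrightarrow> (\<forall>T\<in>\<T>. \<exists>z r. 0 < r \<and> cball z r \<subseteq> T \<and> diameter T \<le> \<kappa> * r)"

definition faces :: "(real^'n::finite) set set \<Rightarrow> (real^'n) set set" where
  "faces \<T> = {F. \<exists>T\<in>\<T>. F facet_of T}"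

definition adj :: "(real^'n::finite) set set \<Rightarrow> (real^'n) set \<Rightarrow> (real^'n) set set" where
  "adj \<T> F = {T\<in>\<T>. F facet_of T}"

definition patch :: "(real^'n::finite) set set \<Rightarrow> (real^'n) set \<Rightarrow> (real^'n) set" where
  "patch \<T> T = interior (\<Union>{K\<in>\<T>. K \<inter> T \<noteq> {}})"

definition outward :: "real^'n::finite \<Rightarrow> (real^'n) set \<Rightarrow> (real^'n) set \<Rightarrow> bool" where
  "outward n F T \<longleftrightarrow> (\<forall>z\<in>F. \<forall>y\<in>T. y \<bullet> n \<le> z \<bullet> n)"

definition face_normals ::
  "(real^'n::finite) set \<Rightarrow> (real^'n) set set \<Rightarrow> ((real^'n) set \<Rightarrow> real^'n) \<Rightarrow> bool" where
  "face_normals \<Omega> \<T> \<nu> \<longleftrightarrow> (\<forall>F\<in>faces \<T>. norm (\<nu> F) = 1 \<and> (\<forall>y\<in>F. \<forall>z\<in>F. (y - z) \<bullet> \<nu> F = 0) \<and>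
     (F \<subseteq> frontier \<Omega> \<longrightarrow> (\<forall>T\<in>adj \<T> F. outward (\<nu> F) F T)))"

text \<open>Surface measure on a flat face \<open>F\<close> with unit normal \<open>n\<close>: a subset of \<open>F\<close> is measured by the
  volume of the prism of height one over it (on the prism over \<open>F\<close>, the closest point of \<open>F\<close> is the
  foot of the perpendicular).\<close>

definition face_measure :: "(real^'n::finite) set \<Rightarrow> real^'n \<Rightarrow> (real^'n) measure" where
  "face_measure F n =
     distr (lebesgue_on {z + t *\<^sub>R n |z t. z \<in> F \<and> 0 \<le> t \<and> t \<le> 1}) (restrict_space borel F)
       (closest_point F)"


section \<open>Piecewise polynomials and piecewise operators\<close>

definition poly_le :: "nat \<Rightarrow> (real^'n::finite \<Rightarrow> real) \<Rightarrow> bool" where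
  "poly_le k p \<longleftrightarrow> (\<exists>a. \<forall>x. p x =
     (\<Sum>\<alpha> | sum \<alpha> (UNIV::'n set) \<le> k. a \<alpha> * (\<Prod>i\<in>UNIV. (x $ i) ^ \<alpha> i)))"

text \<open>Piecewise polynomials are normalized to vanish outside the open simplices (on the skeleton,
  a null set, and outside the domain), so that they agree almost everywhere only if they are equal.\<close>

definition Pk :: "nat \<Rightarrow> (real^'n::finite) set set \<Rightarrow> (real^'n \<Rightarrow> real) set" where
  "Pk k \<T> = {v. (\<forall>T\<in>\<T>. \<exists>p. poly_le k p \<and> (\<forall>x\<in>interior T. v x = p x)) \<and>
                (\<forall>x. x \<notin> (\<Union>T\<in>\<T>. interior T) \<longrightarrow> v x = 0)}"

definition P0 :: "(real^'n::finite) set set \<Rightarrow> (real^'n \<Rightarrow> 'b::real_vector) set" where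
  "P0 \<T> = {q. (\<forall>T\<in>\<T>. \<exists>a. \<forall>x\<in>interior T. q x = a) \<and>
              (\<forall>x. x \<notin> (\<Union>T\<in>\<T>. interior T) \<longrightarrow> q x = 0)}"

definition Pi0 ::
  "(real^'n::finite) set set \<Rightarrow> (real^'n \<Rightarrow> 'b::real_inner) \<Rightarrow> real^'n \<Rightarrow> 'b" where
  "Pi0 \<T> g = (THE q. q \<in> P0 \<T> \<and> (\<forall>p\<in>P0 \<T>. (LINT x|lebesgue_on (\<Union>\<T>). (g x - q x) \<bullet> p x) = 0))"

definition one_minus_Pi0 ::
  "(real^'n::finite) set set \<Rightarrow> (real^'n \<Rightarrow> 'b::real_inner) \<Rightarrow> real^'n \<Rightarrow> 'b" where
  "one_minus_Pi0 \<T> g x = g x - Pi0 \<T> g x"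

text \<open>Piecewise action of a differential operator \<open>D\<close>, given on every open set.\<close>

definition pw :: "(real^'n::finite) set set \<Rightarrow> ((real^'n) set \<Rightarrow> 'w \<Rightarrow> real^'n \<Rightarrow> 'b::real_vector)
    \<Rightarrow> 'w \<Rightarrow> real^'n \<Rightarrow> 'b" where
  "pw \<T> D w x = (\<Sum>T\<in>\<T>. indicat_real (interior T) x *\<^sub>R D (interior T) w x)"

definition scaled_H2 :: "(real^'n::finite) set set \<Rightarrow> (real^'n) set \<Rightarrow> (real^'n \<Rightarrow> real) \<Rightarrow> real" where
  "scaled_H2 \<T> T w = l2 (lebesgue_on T) w / (diameter T)\<^sup>2
     + l2 (lebesgue_on T) (pw \<T> wgrad w) / diameter T + l2 (lebesgue_on T) (pw \<T> whess w)"


section \<open>Traces on faces\<close>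

text \<open>Trace of a function that is polynomial in the interior of \<open>T\<close>.\<close>

definition face_val ::
  "(real^'n::finite) set \<Rightarrow> (real^'n \<Rightarrow> 'b::real_normed_vector) \<Rightarrow> real^'n \<Rightarrow> 'b" where
  "face_val T w x = Lim (at x within interior T) w"

text \<open>With two adjacent simplices this is the difference of the traces, the one from the simplex
  that \<open>\<nu> F\<close> leaves being counted positively; on a boundary face (one adjacent simplex, outer
  normal) it is the trace.\<close>

definition jump :: "(real^'n::finite) set set \<Rightarrow> ((real^'n) set \<Rightarrow> real^'n) \<Rightarrow> (real^'n) set \<Rightarrow>
    (real^'n \<Rightarrow> 'b::real_normed_vector) \<Rightarrow> real^'n \<Rightarrow> 'b" where
  "jump \<T> \<nu> F w x =
     (\<Sum>T\<in>adj \<T> F. (if outward (\<nu> F) F T then 1 else - 1) *\<^sub>R face_val T w x)"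

definition average :: "(real^'n::finite) set set \<Rightarrow> (real^'n) set \<Rightarrow>
    (real^'n \<Rightarrow> 'b::real_normed_vector) \<Rightarrow> real^'n \<Rightarrow> 'b" where
  "average \<T> F w x = (\<Sum>T\<in>adj \<T> F. face_val T w x) /\<^sub>R real (card (adj \<T> F))"

definition tgrad :: "(real^'n::finite) set \<Rightarrow> real^'n \<Rightarrow> (real^'n \<Rightarrow> real) \<Rightarrow> real^'n \<Rightarrow> real^'n" where
  "tgrad F n g x = (THE \<tau>. \<tau> \<bullet> n = 0 \<and> (g has_derivative (\<lambda>y. \<tau> \<bullet> y)) (at x within F))"

text \<open>Trace on the face \<open>F\<close> of a function in \<open>H\<^sup>1(\<Omega>)\<close>: the continuous extension of the restriction
  of smooth functions.\<close>

definition H1_trace :: "(real^'n::finite) set \<Rightarrow> (real^'n) set \<Rightarrow> real^'n \<Rightarrow>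
    (real^'n \<Rightarrow> real) \<Rightarrow> real^'n \<Rightarrow> real" where
  "H1_trace \<Omega> F n w = (SOME g. in_l2 (face_measure F n) g \<and>
     (\<exists>\<phi>. (\<forall>j. smooth (\<phi> j)) \<and>
        (\<lambda>j::nat. H1_norm \<Omega> (\<lambda>x. \<phi> j x - w x)) \<longlonglongrightarrow> 0 \<and>
        (\<lambda>j::nat. l2 (face_measure F n) (\<lambda>x. \<phi> j x - g x)) \<longlonglongrightarrow> 0))"


section \<open>Splits of a triangulation\<close>

definition barycenter :: "(real^'n::finite) set \<Rightarrow> real^'n" where
  "barycenter S = (\<Sum>z | z extreme_point_of S. z) /\<^sub>R real (card {z. z extreme_point_of S})"

definition incenter :: "(real^'n::finite) set \<Rightarrow> real^'n" where
  "incenter T = (THE z. z \<in> interior T \<and> (\<exists>r. \<forall>F. F facet_of T \<longrightarrow> infdist z (affine hull F) = r))"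

definition hct_split :: "(real^'n::finite) set set \<Rightarrow> (real^'n) set set" where
  "hct_split \<T> = {convex hull (insert (barycenter T) F) |T F. T \<in> \<T> \<and> F facet_of T}"

text \<open>The convex hull of the incenters of the two simplices adjacent to an interior face is the
  segment joining them.\<close>

definition wf_face_point :: "(real^'n::finite) set set \<Rightarrow> (real^'n) set \<Rightarrow> real^'n" where
  "wf_face_point \<T> F = (if card (adj \<T> F) = 2
     then THE z. z \<in> F \<and> z \<in> convex hull (incenter ` adj \<T> F) else barycenter F)"

definition wf_split :: "(real^'n::finite) set set \<Rightarrow> (real^'n) set set" where
  "wf_split \<T> = {convex hull ({incenter T, wf_face_point \<T> F} \<union> E) |T F E.
     T \<in> \<T> \<and> F facet_of T \<and> E facet_of F}"

definition split :: "(real^'n::finite) set set \<Rightarrow> (real^'n) set set" where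
  "split \<T> = (if CARD('n) = 2 then hct_split \<T> else wf_split \<T>)"


section \<open>Discrete spaces and the conditions on them\<close>

definition discrete_spaces :: "(real^'n::finite) set \<Rightarrow> (real^'n) set set \<Rightarrow> nat \<Rightarrow>
    (real^'n \<Rightarrow> real) set \<Rightarrow> (real^'n \<Rightarrow> real^'n) set \<Rightarrow>
    ((real^'n \<Rightarrow> real) \<Rightarrow> real^'n \<Rightarrow> real^'n) \<Rightarrow> bool" where
  "discrete_spaces \<Omega> \<T> k V\<^sub>h \<Theta>\<^sub>h G\<^sub>h \<longleftrightarrow>
     lin_space V\<^sub>h \<and> V\<^sub>h \<subseteq> Pk k \<T> \<and>
     lin_space \<Theta>\<^sub>h \<and> (\<forall>\<theta>\<in>\<Theta>\<^sub>h. \<forall>i. (\<lambda>x. \<theta> x $ i) \<in> Pk k \<T>) \<and>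
     lin_map \<Omega> V\<^sub>h G\<^sub>h \<and> (\<forall>v\<in>V\<^sub>h. G\<^sub>h v \<in> \<Theta>\<^sub>h)"

definition D2h :: "(real^'n::finite) set set \<Rightarrow> ((real^'n \<Rightarrow> real) \<Rightarrow> real^'n \<Rightarrow> real^'n) \<Rightarrow>
    (real^'n \<Rightarrow> real) \<Rightarrow> real^'n \<Rightarrow> real^'n^'n" where
  "D2h \<T> G\<^sub>h v = pw \<T> wjac (G\<^sub>h v)"

definition norm_h :: "(real^'n::finite) set \<Rightarrow> (real^'n) set set \<Rightarrow>
    ((real^'n \<Rightarrow> real) \<Rightarrow> real^'n \<Rightarrow> real^'n) \<Rightarrow> (real^'n \<Rightarrow> real) \<Rightarrow> real" where
  "norm_h \<Omega> \<T> G\<^sub>h v = l2 (lebesgue_on \<Omega>) (D2h \<T> G\<^sub>h v)"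

definition zero_mean_gradient_jump :: "(real^'n::finite) set set \<Rightarrow> ((real^'n) set \<Rightarrow> real^'n) \<Rightarrow>
    (real^'n \<Rightarrow> real) set \<Rightarrow> ((real^'n \<Rightarrow> real) \<Rightarrow> real^'n \<Rightarrow> real^'n) \<Rightarrow> bool" where
  "zero_mean_gradient_jump \<T> \<nu> V\<^sub>h G\<^sub>h \<longleftrightarrow> (\<forall>v\<in>V\<^sub>h. \<forall>F\<in>faces \<T>.
     (LINT x|face_measure F (\<nu> F). jump \<T> \<nu> F (G\<^sub>h v) x) = 0)"

definition jump_bound :: "real \<Rightarrow> (real^'n::finite) set set \<Rightarrow> ((real^'n) set \<Rightarrow> real^'n) \<Rightarrow>
    (real^'n \<Rightarrow> real) set \<Rightarrow> bool" where
  "jump_bound c \<T> \<nu> V\<^sub>h \<longleftrightarrow> (\<forall>v\<in>V\<^sub>h. \<forall>F\<in>faces \<T>.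
     l2 (face_measure F (\<nu> F)) (jump \<T> \<nu> F v)
       \<le> c * diameter F * l2 (face_measure F (\<nu> F)) (tgrad F (\<nu> F) (jump \<T> \<nu> F v)))"

definition hessian_consistency :: "real \<Rightarrow> (real^'n::finite) set set \<Rightarrow>
    (real^'n \<Rightarrow> real) set \<Rightarrow> ((real^'n \<Rightarrow> real) \<Rightarrow> real^'n \<Rightarrow> real^'n) \<Rightarrow> bool" where
  "hessian_consistency c \<T> V\<^sub>h G\<^sub>h \<longleftrightarrow> (\<forall>v\<in>V\<^sub>h. \<forall>T\<in>\<T>.
     l2 (lebesgue_on T) (\<lambda>x. D2h \<T> G\<^sub>h v x - pw \<T> whess v x)
       \<le> c * min (l2 (lebesgue_on T) (one_minus_Pi0 \<T> (pw \<T> whess v)))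
                 (l2 (lebesgue_on T) (one_minus_Pi0 \<T> (D2h \<T> G\<^sub>h v))))"

definition gradient_consistency :: "real \<Rightarrow> (real^'n::finite) set set \<Rightarrow>
    (real^'n \<Rightarrow> real) set \<Rightarrow> ((real^'n \<Rightarrow> real) \<Rightarrow> real^'n \<Rightarrow> real^'n) \<Rightarrow> bool" where
  "gradient_consistency c \<T> V\<^sub>h G\<^sub>h \<longleftrightarrow> (\<forall>v\<in>V\<^sub>h. \<forall>T\<in>\<T>.
     l2 (lebesgue_on T) (\<lambda>x. pw \<T> wgrad v x - G\<^sub>h v x) / diameter T
       \<le> c * l2 (lebesgue_on T) (\<lambda>x. pw \<T> whess v x - D2h \<T> G\<^sub>h v x))"

definition quasi_interpolation :: "real \<Rightarrow> (real^'n::finite) set \<Rightarrow> (real^'n) set set \<Rightarrow>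
    (real^'n \<Rightarrow> real) set \<Rightarrow> ((real^'n \<Rightarrow> real) \<Rightarrow> real^'n \<Rightarrow> real^'n) \<Rightarrow>
    ((real^'n \<Rightarrow> real) \<Rightarrow> real^'n \<Rightarrow> real) \<Rightarrow> bool" where
  "quasi_interpolation c \<Omega> \<T> V\<^sub>h G\<^sub>h Q\<^sub>h \<longleftrightarrow>
     lin_map \<Omega> (H2_0 \<Omega>) Q\<^sub>h \<and> (\<forall>v\<in>H2_0 \<Omega>. Q\<^sub>h v \<in> V\<^sub>h) \<and>
     (\<exists>B. \<forall>v\<in>H2_0 \<Omega>. norm_h \<Omega> \<T> G\<^sub>h (Q\<^sub>h v) \<le> B * H2_norm \<Omega> v) \<and>
     (\<forall>v\<in>H2_0 \<Omega>. \<forall>T\<in>\<T>. scaled_H2 \<T> T (\<lambda>x. v x - Q\<^sub>h v x)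
        \<le> c * l2 (lebesgue_on (patch \<T> T)) (one_minus_Pi0 \<T> (whess \<Omega> v)))"

definition smoother :: "real \<Rightarrow> nat \<Rightarrow> (real^'n::finite) set \<Rightarrow> (real^'n) set set \<Rightarrow>
    ((real^'n) set \<Rightarrow> real^'n) \<Rightarrow> (real^'n \<Rightarrow> real) set \<Rightarrow>
    ((real^'n \<Rightarrow> real) \<Rightarrow> real^'n \<Rightarrow> real^'n) \<Rightarrow>
    ((real^'n \<Rightarrow> real) \<Rightarrow> real^'n \<Rightarrow> real) \<Rightarrow> bool" where
  "smoother c m \<Omega> \<T> \<nu> V\<^sub>h G\<^sub>h J \<longleftrightarrow>
     lin_map \<Omega> V\<^sub>h J \<and> (\<forall>v\<in>V\<^sub>h. J v \<in> H2_0 \<Omega>) \<and>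
     (\<exists>B. \<forall>v\<in>V\<^sub>h. H2_norm \<Omega> (J v) \<le> B * norm_h \<Omega> \<T> G\<^sub>h v) \<and>
     (\<forall>v\<in>V\<^sub>h. \<forall>T\<in>\<T>. scaled_H2 \<T> T (\<lambda>x. v x - J v x)
        \<le> c * ((INF \<psi>\<in>H2_0 \<Omega>. l2 (lebesgue_on (patch \<T> T)) (pw \<T> whess (\<lambda>x. \<psi> x - v x)))
               + l2 (lebesgue_on (patch \<T> T)) (one_minus_Pi0 \<T> (pw \<T> whess v)))) \<and>
     (\<forall>v\<in>V\<^sub>h. \<forall>T\<in>\<T>. \<forall>p\<in>Pk 2 \<T>. (LINT x|lebesgue_on T. (J v x - v x) * p x) = 0) \<and>
     (\<forall>v\<in>V\<^sub>h. \<forall>F\<in>faces \<T>. (LINT x|face_measure F (\<nu> F).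
        H1_trace \<Omega> F (\<nu> F) (\<lambda>y. wgrad \<Omega> (J v) y \<bullet> \<nu> F) x - average \<T> F (G\<^sub>h v) x \<bullet> \<nu> F) = 0) \<and>
     (\<forall>v\<in>V\<^sub>h. \<forall>K\<in>split \<T>. \<exists>p. poly_le m p \<and> (AE x in lebesgue_on K. J v x = p x))"

text \<open>The supremum is taken in \<open>[0, \<infinity>]\<close>; in particular it is \<open>0\<close> if \<open>V\<^sub>h\<close> is trivial.  Truncating
  negative values does not change it, because \<open>V\<^sub>h\<close> contains \<open>- w\<close> with every \<open>w\<close>.\<close>

definition osc :: "(real^'n::finite) set \<Rightarrow> (real^'n) set set \<Rightarrow> (real^'n \<Rightarrow> real) set \<Rightarrow>
    ((real^'n \<Rightarrow> real) \<Rightarrow> real^'n \<Rightarrow> real^'n) \<Rightarrow> ((real^'n \<Rightarrow> real) \<Rightarrow> real^'n \<Rightarrow> real) \<Rightarrow>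
    ((real^'n \<Rightarrow> real) \<Rightarrow> real) \<Rightarrow> ennreal" where
  "osc \<Omega> \<T> V\<^sub>h G\<^sub>h J Lf =
     (SUP w\<in>{w\<in>V\<^sub>h. norm_h \<Omega> \<T> G\<^sub>h w = 1}. ennreal (Lf (\<lambda>x. w x - J w x)))"

definition solves_continuous ::
  "(real^'n::finite) set \<Rightarrow> ((real^'n \<Rightarrow> real) \<Rightarrow> real) \<Rightarrow> (real^'n \<Rightarrow> real) \<Rightarrow> bool" where
  "solves_continuous \<Omega> Lf u \<longleftrightarrow> u \<in> H2_0 \<Omega> \<and>
     (\<forall>v\<in>H2_0 \<Omega>. (LINT x|lebesgue_on \<Omega>. whess \<Omega> u x \<bullet> whess \<Omega> v x) = Lf v)"

definition solves_discrete :: "(real^'n::finite) set \<Rightarrow> (real^'n) set set \<Rightarrow>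
    (real^'n \<Rightarrow> real) set \<Rightarrow> ((real^'n \<Rightarrow> real) \<Rightarrow> real^'n \<Rightarrow> real^'n) \<Rightarrow>
    ((real^'n \<Rightarrow> real) \<Rightarrow> real) \<Rightarrow> (real^'n \<Rightarrow> real) \<Rightarrow> bool" where
  "solves_discrete \<Omega> \<T> V\<^sub>h G\<^sub>h Lf u\<^sub>h \<longleftrightarrow> u\<^sub>h \<in> V\<^sub>h \<and>
     (\<forall>v\<in>V\<^sub>h. (LINT x|lebesgue_on \<Omega>. D2h \<T> G\<^sub>h u\<^sub>h x \<bullet> D2h \<T> G\<^sub>h v x) = Lf v)"

end

theory Submission
  imports Defs
begin

text \<open>
  With \<open>\<sigma> = D\<^sup>2u\<close>, \<open>w = Q u - u\<^sub>h\<close> and \<open>z = J w\<close>, the two variational problems give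
  \<open>\<parallel>w\<parallel>\<^sub>h\<^sup>2 = (D\<^sub>h\<^sup>2Qu - \<sigma>, D\<^sub>h\<^sup>2w) + (\<sigma>, D\<^sub>h\<^sup>2w - D\<^sup>2z) - f(w - z)\<close>.  The first term is an interpolation error
  (\<open>interpolation_error\<close>), the last one an oscillation (\<open>oscillation_bound\<close>).  The difficulty is to bound
  the middle term by \<open>\<parallel>(1 - \<Pi>\<^sub>0)\<sigma>\<parallel> \<parallel>w\<parallel>\<^sub>h\<close> although \<open>\<sigma>\<close> is only in \<open>L\<^sup>2\<close> (\<open>consistency_error\<close>).

  The contribution of \<open>(1 - \<Pi>\<^sub>0)\<sigma>\<close> to it is harmless because \<open>\<parallel>D\<^sub>h\<^sup>2w - D\<^sup>2z\<parallel>\<close> is bounded by \<open>\<parallel>w\<parallel>\<^sub>h\<close>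
  (\<open>defect_le\<close>).  For that of \<open>A = \<Pi>\<^sub>0\<sigma>\<close>, the divergence theorem on every simplex leads to a sum over the
  facets \<open>F\<close> of \<open>d\<^sub>F \<bullet> A \<nu>\<close> with \<open>d\<^sub>F = \<integral>\<^sub>F (\<nabla>\<^sub>h w - \<nabla>z)\<close>.  The mean value condition on the jumps of \<open>\<nabla>\<^sub>h w\<close>
  makes \<open>d\<^sub>F\<close> the same from both sides and zero on the boundary, and the condition on the normal
  derivative of \<open>J w\<close> makes it tangential (\<open>flux_data\<close>).  So only the tangential part of the jump of
  \<open>A \<nu>\<close> across interior faces matters.  It is bounded by \<open>\<sigma> - A\<close> since \<open>d \<bullet> \<sigma> \<nu>\<close>, the derivative
  of \<open>\<partial>\<^sub>\<nu>u\<close> in a tangential direction \<open>d\<close>, does not jump; the weak form of this fact, tested with a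
  bubble function, involves no trace of \<open>\<sigma>\<close> (\<open>jump_estimate\<close>).

  Integrals over faces are accessed by the cone formula
  \<open>\<integral>\<^sub>T (n g + \<nabla>g \<bullet> (x - P)) = \<eta> \<integral>\<^sub>F g\<close> for a simplex \<open>T\<close> with facet \<open>F\<close>, opposite vertex \<open>P\<close> and height \<open>\<eta>\<close>
  (\<open>cone_formula\<close>).  It implies the divergence theorem and the trace inequality, and it passes to the
  limit in \<open>H\<^sup>1\<close>, so that face integrals of \<open>\<nabla>z\<close> are limits of face integrals of test functions.
  Weak derivatives are identified almost everywhere by the fundamental lemma of the calculus of
  variations.
\<close>

abbreviation (input) vol :: "'a::euclidean_space set \<Rightarrow> 'a measure" where
  "vol S \<equiv> lebesgue_on S"

section \<open>Square integrable functions\<close>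

definition sq_int :: "'a measure \<Rightarrow> ('a \<Rightarrow> 'b::euclidean_space) \<Rightarrow> bool" where
  "sq_int M f \<longleftrightarrow> f \<in> borel_measurable M \<and> integrable M (\<lambda>x. (norm (f x))\<^sup>2)"

lemma in_l2_iff_sq_int: "in_l2 M f \<longleftrightarrow> sq_int M f"
  by (simp add: in_l2_def sq_int_def)

lemma sq_int_measurable: "sq_int M f \<Longrightarrow> f \<in> borel_measurable M"
  by (simp add: sq_int_def)

lemma sq_int_norm: "sq_int M f \<Longrightarrow> sq_int M (\<lambda>x. norm (f x))"
  by (auto simp: sq_int_def)

lemma sq_int_inner:
  assumes "sq_int M f" "sq_int M g"
  shows "integrable M (\<lambda>x. f x \<bullet> g x)"
proof (rule Bochner_Integration.integrable_bound)
  show "integrable M (\<lambda>x. (norm (f x))\<^sup>2 + (norm (g x))\<^sup>2)"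
    using assms by (auto simp: sq_int_def)
  show "(\<lambda>x. f x \<bullet> g x) \<in> borel_measurable M"
    using assms by (auto simp: sq_int_def)
  have "\<bar>f x \<bullet> g x\<bar> \<le> (norm (f x))\<^sup>2 + (norm (g x))\<^sup>2" for x
  proof -
    have "\<bar>f x \<bullet> g x\<bar> \<le> norm (f x) * norm (g x)"
      by (rule Cauchy_Schwarz_ineq2)
    also have "\<dots> \<le> (norm (f x))\<^sup>2 + (norm (g x))\<^sup>2"
      using sum_squares_bound[of "norm (f x)" "norm (g x)"] mult_nonneg_nonneg[of "norm (f x)" "norm (g x)"]
        norm_ge_zero[of "f x"] norm_ge_zero[of "g x"] by linarith
    finally show ?thesis .
  qed
  then show "AE x in M. norm (f x \<bullet> g x) \<le> norm ((norm (f x))\<^sup>2 + (norm (g x))\<^sup>2)"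
    by (auto simp: abs_of_nonneg)
qed

lemma sq_int_scale: "sq_int M f \<Longrightarrow> sq_int M (\<lambda>x. c *\<^sub>R f x)"
  by (auto simp: sq_int_def power_mult_distrib)

lemma sq_int_zero: "sq_int M (\<lambda>x. 0)"
  by (simp add: sq_int_def)

lemma sq_int_add:
  assumes "sq_int M f" "sq_int M g"
  shows "sq_int M (\<lambda>x. f x + g x)"
proof -
  have "(norm (f x + g x))\<^sup>2 = (norm (f x))\<^sup>2 + 2 * (f x \<bullet> g x) + (norm (g x))\<^sup>2" for x
    by (simp add: power2_norm_eq_inner inner_add inner_commute)
  then show ?thesis
    using assms sq_int_inner[OF assms] by (auto simp: sq_int_def)
qed

lemma sq_int_diff:
  assumes "sq_int M f" "sq_int M g"
  shows "sq_int M (\<lambda>x. f x - g x)"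
  using sq_int_add[OF assms(1) sq_int_scale[OF assms(2), of "-1"]] by simp

lemma sq_int_uminus: "sq_int M f \<Longrightarrow> sq_int M (\<lambda>x. - f x)"
  using sq_int_scale[of M f "-1"] by simp

lemma sq_int_sum: "(\<And>i. i \<in> I \<Longrightarrow> sq_int M (f i)) \<Longrightarrow> sq_int M (\<lambda>x. \<Sum>i\<in>I. f i x)"
  by (induction I rule: infinite_finite_induct) (auto simp: sq_int_zero intro: sq_int_add)

lemma sq_int_bound:
  assumes "sq_int M f" "g \<in> borel_measurable M" "AE x in M. norm (g x) \<le> norm (f x)"
  shows "sq_int M g"
  unfolding sq_int_def
proof
  show "g \<in> borel_measurable M" by fact
  show "integrable M (\<lambda>x. (norm (g x))\<^sup>2)"
    by (rule Bochner_Integration.integrable_bound[where f = "\<lambda>x. (norm (f x))\<^sup>2"])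
      (use assms in \<open>auto simp: sq_int_def intro: power_mono\<close>)
qed

lemma sq_int_const: "finite_measure M \<Longrightarrow> sq_int M (\<lambda>x. c)"
  by (auto simp: sq_int_def finite_measure.integrable_const)

lemma sq_int_integrable:
  assumes "sq_int M f" "finite_measure M"
  shows "integrable M f"
proof (rule Bochner_Integration.integrable_bound)
  show "integrable M (\<lambda>x. 1 + (norm (f x))\<^sup>2)"
    using assms by (auto simp: sq_int_def finite_measure.integrable_const)
  show "f \<in> borel_measurable M" using assms by (simp add: sq_int_def)
  have "norm (f x) \<le> 1 + (norm (f x))\<^sup>2" for x
    using sum_squares_bound[of 1 "norm (f x)"] norm_ge_zero[of "f x"]
    unfolding one_power2 mult_1_right by linarith
  then show "AE x in M. norm (f x) \<le> norm (1 + (norm (f x))\<^sup>2)"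
    by (auto simp: abs_of_nonneg)
qed

lemma l2_nonneg: "0 \<le> l2 M f"
  unfolding l2_def by (simp add: integral_nonneg)

lemma l2_sq: "(l2 M f)\<^sup>2 = (LINT x|M. (norm (f x))\<^sup>2)"
  unfolding l2_def by (simp add: integral_nonneg)

lemma l2_sq_inner: "(l2 M f)\<^sup>2 = (LINT x|M. f x \<bullet> f x)" for f :: "_ \<Rightarrow> 'b::euclidean_space"
  unfolding l2_sq by (simp add: power2_norm_eq_inner)

lemma l2_norm: "l2 M (\<lambda>x. norm (f x)) = l2 M f"
  by (simp add: l2_def)

lemma l2_cong_AE:
  fixes f g :: "'a \<Rightarrow> 'b::euclidean_space"
  assumes "AE x in M. f x = g x" "f \<in> borel_measurable M" "g \<in> borel_measurable M"
  shows "l2 M f = l2 M g"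
  unfolding l2_def
  by (rule arg_cong[where f = sqrt], rule integral_cong_AE) (use assms in auto)

lemma l2_scale: "l2 M (\<lambda>x. c *\<^sub>R f x) = \<bar>c\<bar> * l2 M f"
  by (simp add: l2_def power_mult_distrib real_sqrt_mult)

lemma l2_uminus: "l2 M (\<lambda>x. - f x) = l2 M f"
  by (simp add: l2_def)

lemma l2_minus_commute: "l2 M (\<lambda>x. f x - g x) = l2 M (\<lambda>x. g x - f x)"
  by (simp add: l2_def norm_minus_commute)

lemma cauchy_schwarz_l2:
  assumes f: "sq_int M f" and g: "sq_int M g"
  shows "\<bar>LINT x|M. f x \<bullet> g x\<bar> \<le> l2 M f * l2 M g"
proof -
  let ?a = "(l2 M f)\<^sup>2" and ?c = "(l2 M g)\<^sup>2" and ?b = "LINT x|M. f x \<bullet> g x"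
  have "0 \<le> ?a - 2 * t * ?b + t\<^sup>2 * ?c" for t
  proof -
    have "0 \<le> (LINT x|M. (norm (f x - t *\<^sub>R g x))\<^sup>2)"
      by (simp add: integral_nonneg)
    also have "(\<lambda>x. (norm (f x - t *\<^sub>R g x))\<^sup>2)
        = (\<lambda>x. (norm (f x))\<^sup>2 - (2 * t) * (f x \<bullet> g x) + t\<^sup>2 * (norm (g x))\<^sup>2)"
      unfolding power2_norm_eq_inner
      by (auto simp: fun_eq_iff inner_diff inner_commute algebra_simps power2_eq_square)
    also have "(LINT x|M. \<dots> x) = ?a - 2 * t * ?b + t\<^sup>2 * ?c"
      using f g sq_int_inner[OF f g] by (simp add: l2_sq sq_int_def)
    finally show ?thesis .
  qed
  note quad = this
  have "?b\<^sup>2 \<le> ?a * ?c"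
  proof (cases "?c = 0")
    case True
    have "?b = 0"
    proof (rule ccontr)
      assume "?b \<noteq> 0"
      then show False
        using quad[of "(?a + 1) / (2 * ?b)"] True by (simp add: field_simps)
    qed
    then show ?thesis using True by simp
  next
    case False
    then have c: "?c > 0" using l2_nonneg[of M g] by simp
    have "0 \<le> ?a - 2 * (?b / ?c) * ?b + (?b / ?c)\<^sup>2 * ?c" by (rule quad)
    also have "\<dots> = ?a - ?b\<^sup>2 / ?c"
      using c by (simp add: power2_eq_square divide_simps)
    finally have "?b\<^sup>2 / ?c \<le> ?a" by linarith
    then show ?thesis
      using c by (simp add: pos_divide_le_eq)
  qed
  then show ?thesis
    using abs_le_square_iff[of ?b "l2 M f * l2 M g"]
    by (simp add: power_mult_distrib l2_nonneg abs_of_nonneg)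
qed

lemma cauchy_schwarz_norm_l2:
  fixes f :: "'a \<Rightarrow> 'b::euclidean_space" and g :: "'a \<Rightarrow> 'c::euclidean_space"
  assumes f: "sq_int M f" and g: "sq_int M g"
  shows "integrable M (\<lambda>x. norm (f x) * norm (g x))"
    and "(LINT x|M. norm (f x) * norm (g x)) \<le> l2 M f * l2 M g"
  using sq_int_inner[OF sq_int_norm[OF f] sq_int_norm[OF g]]
    cauchy_schwarz_l2[OF sq_int_norm[OF f] sq_int_norm[OF g]]
  by (auto simp: l2_norm)

lemma l2_triangle:
  fixes f g :: "'a \<Rightarrow> 'b::euclidean_space"
  assumes f: "sq_int M f" and g: "sq_int M g"
  shows "l2 M (\<lambda>x. f x + g x) \<le> l2 M f + l2 M g"
proof (rule power2_le_imp_le)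
  have "(norm (f x + g x))\<^sup>2 = (norm (f x))\<^sup>2 + 2 * (f x \<bullet> g x) + (norm (g x))\<^sup>2" for x
    by (simp add: power2_norm_eq_inner inner_add inner_commute)
  then have "(l2 M (\<lambda>x. f x + g x))\<^sup>2 = (l2 M f)\<^sup>2 + 2 * (LINT x|M. f x \<bullet> g x) + (l2 M g)\<^sup>2"
    using f g sq_int_inner[OF f g] by (simp add: l2_sq sq_int_def)
  also have "\<dots> \<le> (l2 M f + l2 M g)\<^sup>2"
    using cauchy_schwarz_l2[OF f g] by (simp add: power2_sum)
  finally show "(l2 M (\<lambda>x. f x + g x))\<^sup>2 \<le> (l2 M f + l2 M g)\<^sup>2" .
qed (simp add: l2_nonneg)

lemma l2_triangle_diff:
  fixes f g h :: "'a \<Rightarrow> 'b::euclidean_space"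
  assumes "sq_int M f" "sq_int M g" "sq_int M h"
  shows "l2 M (\<lambda>x. f x - h x) \<le> l2 M (\<lambda>x. f x - g x) + l2 M (\<lambda>x. g x - h x)"
  using l2_triangle[OF sq_int_diff[OF assms(1,2)] sq_int_diff[OF assms(2,3)]] by simp

lemma l2_triangle_sub:
  fixes f g :: "'a \<Rightarrow> 'b::euclidean_space"
  assumes "sq_int M f" "sq_int M g"
  shows "l2 M f \<le> l2 M g + l2 M (\<lambda>x. f x - g x)"
  using l2_triangle[OF assms(2) sq_int_diff[OF assms]] by simp

lemma sq_int_vec_iff:
  fixes f :: "'a \<Rightarrow> 'b::euclidean_space^'n::finite"
  shows "sq_int M f \<longleftrightarrow> (\<forall>i. sq_int M (\<lambda>x. f x $ i))"
proof
  assume f: "sq_int M f"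
  have "(\<lambda>x. f x $ i) \<in> borel_measurable M" for i
    by (rule borel_measurable_continuous_on[OF _ sq_int_measurable[OF f]]) (intro continuous_intros)
  then show "\<forall>i. sq_int M (\<lambda>x. f x $ i)"
    by (intro allI sq_int_bound[OF f] AE_I2) (simp_all add: Finite_Cartesian_Product.norm_nth_le)
next
  assume f: "\<forall>i. sq_int M (\<lambda>x. f x $ i)"
  have m: "f \<in> borel_measurable M"
    unfolding borel_measurable_euclidean_space[of f]
  proof
    fix b :: "'b^'n" assume "b \<in> Basis"
    then obtain i c where b: "b = axis i c" by (auto simp: Basis_vec_def)
    have "(\<lambda>x. f x \<bullet> b) = (\<lambda>x. f x $ i \<bullet> c)"
      by (simp add: b inner_axis)
    then show "(\<lambda>x. f x \<bullet> b) \<in> borel_measurable M"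
      using f by (auto simp: sq_int_def intro!: borel_measurable_inner)
  qed
  moreover have "(norm (f x))\<^sup>2 = (\<Sum>i\<in>UNIV. (norm (f x $ i))\<^sup>2)" for x
    by (simp add: norm_vec_def L2_set_def sum_nonneg)
  ultimately show "sq_int M f"
    using f by (auto simp: sq_int_def)
qed

lemma l2_vec_sq:
  fixes f :: "'a \<Rightarrow> 'b::euclidean_space^'n::finite"
  assumes "sq_int M f"
  shows "(l2 M f)\<^sup>2 = (\<Sum>i\<in>UNIV. (l2 M (\<lambda>x. f x $ i))\<^sup>2)"
proof -
  have "(norm (f x))\<^sup>2 = (\<Sum>i\<in>UNIV. (norm (f x $ i))\<^sup>2)" for x
    by (simp add: norm_vec_def L2_set_def sum_nonneg)
  moreover have "integrable M (\<lambda>x. (norm (f x $ i))\<^sup>2)" for i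
    using assms sq_int_vec_iff[of M f] by (auto simp: sq_int_def)
  ultimately show ?thesis
    by (simp add: l2_sq)
qed

lemma l2_component_le:
  fixes f :: "'a \<Rightarrow> 'b::euclidean_space^'n::finite"
  assumes "sq_int M f"
  shows "l2 M (\<lambda>x. f x $ i) \<le> l2 M f"
proof (rule power2_le_imp_le)
  show "(l2 M (\<lambda>x. f x $ i))\<^sup>2 \<le> (l2 M f)\<^sup>2"
    unfolding l2_vec_sq[OF assms] by (rule member_le_sum) auto
qed (rule l2_nonneg)

lemma l2_tendsto_inner:
  assumes "\<And>j::nat. sq_int M (f j)" "sq_int M f'" "sq_int M g" "(\<lambda>j. l2 M (\<lambda>x. f j x - f' x)) \<longlonglongrightarrow> 0"
  shows "(\<lambda>j. LINT x|M. f j x \<bullet> g x) \<longlonglongrightarrow> (LINT x|M. f' x \<bullet> g x)"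
proof -
  have "\<bar>(LINT x|M. f j x \<bullet> g x) - (LINT x|M. f' x \<bullet> g x)\<bar> \<le> l2 M (\<lambda>x. f j x - f' x) * l2 M g" for j
  proof -
    have "(LINT x|M. f j x \<bullet> g x) - (LINT x|M. f' x \<bullet> g x) = (LINT x|M. (f j x - f' x) \<bullet> g x)"
      using sq_int_inner[OF assms(1,3)] sq_int_inner[OF assms(2,3)]
      by (subst Bochner_Integration.integral_diff[symmetric]) (auto simp: inner_diff_left)
    then show ?thesis
      using cauchy_schwarz_l2[OF sq_int_diff[OF assms(1,2)] assms(3)] by simp
  qed
  then have "\<forall>\<^sub>F j in sequentially. norm ((LINT x|M. f j x \<bullet> g x) - (LINT x|M. f' x \<bullet> g x))
      \<le> l2 M (\<lambda>x. f j x - f' x) * l2 M g"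
    by simp
  from Lim_null_comparison[OF this tendsto_mult_left_zero[OF assms(4)]]
  have "(\<lambda>j. (LINT x|M. f j x \<bullet> g x) - (LINT x|M. f' x \<bullet> g x)) \<longlonglongrightarrow> 0" .
  then show ?thesis by (simp add: LIM_zero_iff)
qed


text \<open>Riesz--Fischer for finite measures.  A subsequence with
  \<open>l2 M (f (r (k+1)) - f (r k)) < 2^-k\<close> converges almost everywhere, because the
  series of the absolute differences has a finite integral; by Fatou's lemma its pointwise limit
  is a limit for \<open>l2 M\<close>.\<close>

lemma l2_complete:
  fixes f :: "nat \<Rightarrow> 'a \<Rightarrow> real"
  assumes fin: "finite_measure M" and sq: "\<And>j. sq_int M (f j)"
    and Cauchy: "\<And>e. e > 0 \<Longrightarrow> \<exists>N. \<forall>i\<ge>N. \<forall>j\<ge>N. l2 M (\<lambda>x. f i x - f j x) < e"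
  obtains g where "sq_int M g" "(\<lambda>j. l2 M (\<lambda>x. f j x - g x)) \<longlonglongrightarrow> 0"
proof -
  have [measurable]: "f j \<in> borel_measurable M" for j
    using sq[of j] by (simp add: sq_int_def)
  have "\<forall>k::nat. \<exists>N. \<forall>i\<ge>N. \<forall>j\<ge>N. l2 M (\<lambda>x. f i x - f j x) < (1/2)^k"
    using Cauchy by simp
  then obtain R where R: "\<And>k i j. i \<ge> R k \<Longrightarrow> j \<ge> R k \<Longrightarrow> l2 M (\<lambda>x. f i x - f j x) < (1/2)^k"
    by metis
  define r where "r k = (\<Sum>i\<le>k. R i) + k" for k
  have rR: "r k \<ge> R k" "r (Suc k) \<ge> R k" "r k \<ge> k" for k
    unfolding r_def by (auto simp: lessThan_Suc_atMost[symmetric])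
  define d where "d k x = \<bar>f (r (Suc k)) x - f (r k) x\<bar>" for k x
  have [measurable]: "d k \<in> borel_measurable M" for k
    unfolding d_def by measurable
  define C where "C = l2 M (\<lambda>x. 1::real)"
  have sqd: "sq_int M (d k)" for k
    using sq_int_norm[OF sq_int_diff[OF sq[of "r (Suc k)"] sq[of "r k"]]] by (simp add: d_def[abs_def])
  have "(LINT x|M. d k x) \<le> C * (1/2)^k" for k
  proof -
    have "(LINT x|M. d k x) \<le> l2 M (d k) * C"
      using cauchy_schwarz_l2[OF sqd sq_int_const[OF fin, of "1::real"], of k] by (simp add: C_def)
    also have "l2 M (d k) = l2 M (\<lambda>x. f (r (Suc k)) x - f (r k) x)"
      by (simp add: l2_def d_def)
    also have "\<dots> * C \<le> (1/2)^k * C"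
      using R[OF rR(2) rR(1), of k] by (intro mult_right_mono) (auto simp: C_def l2_nonneg)
    finally show ?thesis by (simp add: mult.commute)
  qed
  then have "(\<integral>\<^sup>+x. ennreal (d k x) \<partial>M) \<le> ennreal (C * (1/2)^k)" for k
    using sq_int_integrable[OF sqd fin, of k]
    by (subst nn_integral_eq_integral) (auto simp: d_def[abs_def] intro: ennreal_leI)
  note d_int = this
  have "(\<integral>\<^sup>+x. (\<Sum>k. ennreal (d k x)) \<partial>M) = (\<Sum>k. \<integral>\<^sup>+x. ennreal (d k x) \<partial>M)"
    by (rule nn_integral_suminf) simp
  also have "\<dots> \<le> (\<Sum>k. ennreal (C * (1/2)^k))"
    by (rule suminf_le[OF d_int]) simp_all
  also have "\<dots> = ennreal (\<Sum>k. C * (1/2)^k)"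
    by (rule suminf_ennreal2) (auto simp: C_def l2_nonneg intro!: summable_mult summable_geometric)
  also have "\<dots> < \<infinity>" by simp
  finally have "AE x in M. (\<Sum>k. ennreal (d k x)) \<noteq> \<infinity>"
    by (intro nn_integral_PInf_AE) auto
  then have conv: "AE x in M. convergent (\<lambda>k. f (r k) x)"
  proof eventually_elim
    case (elim x)
    have "summable (\<lambda>k. d k x)"
      using elim by (intro summable_suminf_not_top) (auto simp: d_def)
    then have "summable (\<lambda>k. f (r (Suc k)) x - f (r k) x)"
      by (simp add: d_def summable_rabs_cancel)
    then have "convergent (\<lambda>n. \<Sum>k<n. f (r (Suc k)) x - f (r k) x)"
      by (simp add: summable_iff_convergent)
    then have "convergent (\<lambda>n. f (r n) x - f (r 0) x)"
      using sum_lessThan_telescope[of "\<lambda>n. f (r n) x"] by simp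
    then have "convergent (\<lambda>n. (f (r n) x - f (r 0) x) + f (r 0) x)"
      by (intro convergent_add convergent_const)
    then show ?case by simp
  qed
  define g where "g x = lim (\<lambda>k. f (r k) x)" for x
  have [measurable]: "g \<in> borel_measurable M"
    unfolding g_def by measurable
  have lim: "AE x in M. (\<lambda>k. f (r k) x) \<longlonglongrightarrow> g x"
    using conv by eventually_elim (simp add: g_def convergent_LIMSEQ_iff)
  have fatou: "(\<integral>\<^sup>+x. ennreal ((f j x - g x)\<^sup>2) \<partial>M) \<le> ennreal (e\<^sup>2)"
    if e: "e > 0" and N: "\<forall>i\<ge>N. l2 M (\<lambda>x. f j x - f i x) < e" for j e N
  proof -
    have "(\<integral>\<^sup>+x. ennreal ((f j x - g x)\<^sup>2) \<partial>M)
        = (\<integral>\<^sup>+x. liminf (\<lambda>k. ennreal ((f j x - f (r k) x)\<^sup>2)) \<partial>M)"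
    proof (rule nn_integral_cong_AE)
      show "AE x in M. ennreal ((f j x - g x)\<^sup>2) = liminf (\<lambda>k. ennreal ((f j x - f (r k) x)\<^sup>2))"
        using lim
      proof eventually_elim
        case (elim x)
        then have "(\<lambda>k. ennreal ((f j x - f (r k) x)\<^sup>2)) \<longlonglongrightarrow> ennreal ((f j x - g x)\<^sup>2)"
          by (intro tendsto_ennrealI tendsto_intros)
        from lim_imp_Liminf[OF trivial_limit_sequentially this] show ?case by (rule sym)
      qed
    qed
    also have "\<dots> \<le> liminf (\<lambda>k. \<integral>\<^sup>+x. ennreal ((f j x - f (r k) x)\<^sup>2) \<partial>M)"
      by (rule nn_integral_liminf) measurable
    also have "\<dots> \<le> ennreal (e\<^sup>2)"
    proof (rule Liminf_le)
      have "(\<integral>\<^sup>+x. ennreal ((f j x - f (r k) x)\<^sup>2) \<partial>M) \<le> ennreal (e\<^sup>2)" if "k \<ge> N" for k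
      proof -
        have "(\<integral>\<^sup>+x. ennreal ((f j x - f (r k) x)\<^sup>2) \<partial>M) = ennreal ((l2 M (\<lambda>x. f j x - f (r k) x))\<^sup>2)"
          using sq_int_diff[OF sq[of j] sq[of "r k"]] unfolding l2_sq
          by (subst nn_integral_eq_integral) (auto simp: sq_int_def)
        also have "\<dots> \<le> ennreal (e\<^sup>2)"
        proof (intro ennreal_leI power_mono l2_nonneg)
          have "r k \<ge> N" using rR(3)[of k] that by linarith
          then show "l2 M (\<lambda>x. f j x - f (r k) x) \<le> e"
            using N by (meson less_imp_le)
        qed
        finally show ?thesis .
      qed
      then show "\<forall>\<^sub>F k in sequentially. (\<integral>\<^sup>+x. ennreal ((f j x - f (r k) x)\<^sup>2) \<partial>M) \<le> ennreal (e\<^sup>2)"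
        by (auto simp: eventually_sequentially)
    qed auto
    finally show ?thesis .
  qed
  have sqdiff: "sq_int M (\<lambda>x. f j x - g x)" "l2 M (\<lambda>x. f j x - g x) \<le> e"
    if e: "e > 0" and N: "\<forall>i\<ge>N. l2 M (\<lambda>x. f j x - f i x) < e" for j e N
  proof -
    show sq': "sq_int M (\<lambda>x. f j x - g x)"
      unfolding sq_int_def
    proof
      have "(\<integral>\<^sup>+x. ennreal ((f j x - g x)\<^sup>2) \<partial>M) < top"
        using fatou[OF e N] by (rule le_less_trans) (rule ennreal_less_top)
      then show "integrable M (\<lambda>x. (norm (f j x - g x))\<^sup>2)"
        by (intro integrableI_nonneg) simp_all
    qed simp
    have "(\<integral>\<^sup>+x. ennreal ((f j x - g x)\<^sup>2) \<partial>M) = ennreal (LINT x|M. (f j x - g x)\<^sup>2)"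
      by (rule nn_integral_eq_integral) (use sq' in \<open>simp_all add: sq_int_def\<close>)
    then have "ennreal ((l2 M (\<lambda>x. f j x - g x))\<^sup>2) \<le> ennreal (e\<^sup>2)"
      using fatou[OF e N] by (simp add: l2_sq)
    then have "(l2 M (\<lambda>x. f j x - g x))\<^sup>2 \<le> e\<^sup>2"
      by (simp add: ennreal_le_iff)
    then show "l2 M (\<lambda>x. f j x - g x) \<le> e"
      by (rule power2_le_imp_le) (use e in simp)
  qed
  obtain N0 where N0: "\<forall>i\<ge>N0. \<forall>j\<ge>N0. l2 M (\<lambda>x. f i x - f j x) < 1"
    using Cauchy[of 1] by auto
  have "sq_int M (\<lambda>x. f N0 x - g x)"
    using N0 sqdiff(1)[of 1 N0 N0] by simp
  then have "sq_int M g"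
    using sq_int_diff[OF sq[of N0], of "\<lambda>x. f N0 x - g x"] by simp
  moreover have "(\<lambda>j. l2 M (\<lambda>x. f j x - g x)) \<longlonglongrightarrow> 0"
  proof (rule LIMSEQ_I)
    fix e :: real assume "e > 0"
    then obtain N where N: "\<forall>i\<ge>N. \<forall>j\<ge>N. l2 M (\<lambda>x. f i x - f j x) < e/2"
      using Cauchy[of "e/2"] by auto
    have "norm (l2 M (\<lambda>x. f j x - g x) - 0) < e" if "j \<ge> N" for j
      using sqdiff(2)[of "e/2" N j] N that \<open>e > 0\<close> by (simp add: l2_nonneg)
    then show "\<exists>no. \<forall>n\<ge>no. norm (l2 M (\<lambda>x. f n x - g x) - 0) < e"
      by blast
  qed
  ultimately show ?thesis by (rule that)
qed

section \<open>Smooth functions and integration by parts\<close>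

lemma pd_eqI: "(f has_derivative f') (at x) \<Longrightarrow> pd i f x = f' (axis i 1)"
  unfolding pd_def using frechet_derivative_at[of f f' x] by simp

lemma Ck_differentiable: "Ck (Suc k) f \<Longrightarrow> f differentiable (at x)"
  by (simp add: differentiable_on_def)

lemma Ck_Suc_imp: "Ck (Suc k) f \<Longrightarrow> Ck k f"
proof (induction k arbitrary: f)
  case 0
  then show ?case by (simp add: differentiable_imp_continuous_on)
next
  case (Suc k)
  then show ?case by (metis Ck.simps(2))
qed

lemma Ck_mono: "Ck k f \<Longrightarrow> j \<le> k \<Longrightarrow> Ck j f"
  by (induction k) (auto simp: le_Suc_eq simp del: Ck.simps dest: Ck_Suc_imp)

lemma Ck_continuous: "Ck k f \<Longrightarrow> continuous_on UNIV f"
  using Ck_mono[of k f 0] by simp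

lemma Ck_pd: "Ck (Suc k) f \<Longrightarrow> Ck k (pd i f)"
  by simp

lemma frechet_derivative_eq_pd_sum:
  fixes f :: "real^'n::finite \<Rightarrow> real"
  assumes "f differentiable (at x)"
  shows "frechet_derivative f (at x) h = (\<Sum>i\<in>UNIV. h $ i * pd i f x)"
proof -
  have lin: "linear (frechet_derivative f (at x))"
    using assms by (simp add: linear_frechet_derivative)
  have "h = (\<Sum>i\<in>UNIV. (h $ i) *\<^sub>R axis i 1)"
    by (simp add: basis_expansion scalar_mult_eq_scaleR[symmetric])
  then have "frechet_derivative f (at x) h = frechet_derivative f (at x) (\<Sum>i\<in>UNIV. (h $ i) *\<^sub>R axis i 1)"
    by simp
  also have "\<dots> = (\<Sum>i\<in>UNIV. h $ i * pd i f x)"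
    by (simp add: linear_sum[OF lin] linear_cmul[OF lin] pd_def)
  finally show ?thesis .
qed

lemma Ck_has_derivative:
  fixes f :: "real^'n::finite \<Rightarrow> real"
  assumes "Ck (Suc k) f"
  shows "(f has_derivative (\<lambda>h. \<Sum>i\<in>UNIV. h $ i * pd i f x)) (at x)"
proof -
  have d: "f differentiable (at x)" using Ck_differentiable[OF assms] .
  have "(f has_derivative frechet_derivative f (at x)) (at x)"
    using d by (simp add: frechet_derivative_works)
  moreover have "frechet_derivative f (at x) = (\<lambda>h. \<Sum>i\<in>UNIV. h $ i * pd i f x)"
    using frechet_derivative_eq_pd_sum[OF d] by auto
  ultimately show ?thesis by simp
qed

lemma pd_const: "pd i (\<lambda>x. c) = (\<lambda>x. 0)"
  by (simp add: pd_def fun_eq_iff)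

lemma Ck_const: "Ck k (\<lambda>x. c)"
  by (induction k arbitrary: c) (auto simp: pd_const)

lemma pd_coord: "pd j (\<lambda>x::real^'n::finite. x $ i) = (\<lambda>x. if j = i then 1 else 0)"
proof
  fix x :: "real^'n"
  have "((\<lambda>x::real^'n. x $ i) has_derivative (\<lambda>h. h $ i)) (at x)"
    by (rule bounded_linear.has_derivative[OF bounded_linear_vec_nth has_derivative_ident])
  then show "pd j (\<lambda>x::real^'n. x $ i) x = (if j = i then 1 else 0)"
    by (simp add: pd_eqI axis_def)
qed

lemma Ck_coord: "Ck k (\<lambda>x. x $ i)"
  by (cases k) (auto simp: pd_coord differentiable_on_def intro!: Ck_const continuous_intros
      bounded_linear_imp_differentiable bounded_linear_vec_nth)

lemma pd_add:
  assumes "f differentiable (at x)" "g differentiable (at x)"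
  shows "pd i (\<lambda>x. f x + g x) x = pd i f x + pd i g x"
proof -
  have "((\<lambda>x. f x + g x) has_derivative (\<lambda>h. frechet_derivative f (at x) h + frechet_derivative g (at x) h)) (at x)"
    using assms by (intro has_derivative_add) (auto simp: frechet_derivative_works)
  then show ?thesis by (simp add: pd_eqI) (simp add: pd_def)
qed

lemma pd_mult:
  assumes "f differentiable (at x)" "g differentiable (at x)"
  shows "pd i (\<lambda>x. f x * g x) x = f x * pd i g x + pd i f x * g x"
proof -
  have "((\<lambda>x. f x * g x) has_derivative (\<lambda>h. f x * frechet_derivative g (at x) h + frechet_derivative f (at x) h * g x)) (at x)"
    using assms by (intro has_derivative_mult) (auto simp: frechet_derivative_works)
  then show ?thesis by (simp add: pd_eqI) (simp add: pd_def)
qed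

lemma Ck_add: "Ck k f \<Longrightarrow> Ck k g \<Longrightarrow> Ck k (\<lambda>x. f x + g x)"
proof (induction k arbitrary: f g)
  case 0
  then show ?case by (simp add: continuous_on_add)
next
  case (Suc k)
  have "pd i (\<lambda>x. f x + g x) = (\<lambda>x. pd i f x + pd i g x)" for i
    using Suc.prems by (intro ext pd_add) (rule Ck_differentiable, assumption)+
  then show ?case using Suc by (simp add: differentiable_on_add)
qed

lemma Ck_mult: "Ck k f \<Longrightarrow> Ck k g \<Longrightarrow> Ck k (\<lambda>x. f x * g x)"
proof (induction k arbitrary: f g)
  case 0
  then show ?case by (simp add: continuous_on_mult)
next
  case (Suc k)
  have "pd i (\<lambda>x. f x * g x) = (\<lambda>x. f x * pd i g x + pd i f x * g x)" for i
    using Suc.prems by (intro ext pd_mult) (rule Ck_differentiable, assumption)+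
  moreover have "Ck k (\<lambda>x. f x * pd i g x + pd i f x * g x)" for i
    by (intro Ck_add Suc.IH Ck_Suc_imp[OF Suc.prems(1)] Ck_Suc_imp[OF Suc.prems(2)] Ck_pd Suc.prems)
  ultimately show ?case using Suc.prems by (simp add: differentiable_on_mult)
qed

lemma Ck_cmult: "Ck k f \<Longrightarrow> Ck k (\<lambda>x. c * f x)"
  by (intro Ck_mult Ck_const)

lemma Ck_diff: "Ck k f \<Longrightarrow> Ck k g \<Longrightarrow> Ck k (\<lambda>x. f x - g x)"
  using Ck_add[OF _ Ck_cmult[of k g "-1"], of f] by simp

lemma Ck_sum: "(\<And>i. i \<in> I \<Longrightarrow> Ck k (f i)) \<Longrightarrow> Ck k (\<lambda>x. \<Sum>i\<in>I. f i x)"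
  by (induction I rule: infinite_finite_induct) (simp_all add: Ck_const Ck_add del: Ck.simps)

lemma Ck_prod: "(\<And>i. i \<in> I \<Longrightarrow> Ck k (f i)) \<Longrightarrow> Ck k (\<lambda>x. \<Prod>i\<in>I. f i x)"
  by (induction I rule: infinite_finite_induct) (simp_all add: Ck_const Ck_mult del: Ck.simps)

lemma Ck_power: "Ck k f \<Longrightarrow> Ck k (\<lambda>x. f x ^ m)"
  by (induction m) (simp_all add: Ck_const Ck_mult del: Ck.simps)

lemma pd_linear_comb:
  assumes "Ck (Suc 0) f" "Ck (Suc 0) g"
  shows "pd i (\<lambda>x. a * f x + b * g x) = (\<lambda>x. a * pd i f x + b * pd i g x)"
proof
  fix x
  have d: "f differentiable (at x)" "g differentiable (at x)"
    using assms by (blast intro: Ck_differentiable)+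
  have "pd i (\<lambda>x. a * f x + b * g x) x = pd i (\<lambda>x. a * f x) x + pd i (\<lambda>x. b * g x) x"
    by (rule pd_add) (use d in \<open>auto intro!: differentiable_mult\<close>)
  also have "\<dots> = a * pd i f x + b * pd i g x"
    using pd_mult[OF _ d(1), of "\<lambda>_. a"] pd_mult[OF _ d(2), of "\<lambda>_. b"] by (simp add: pd_const)
  finally show "pd i (\<lambda>x. a * f x + b * g x) x = a * pd i f x + b * pd i g x" .
qed

lemma pd_zero_outside:
  assumes "closed K" "\<And>x. x \<notin> K \<Longrightarrow> f x = 0" "x \<notin> K"
  shows "pd i f x = 0"
proof -
  have "((\<lambda>_. 0) has_derivative (\<lambda>h. 0)) (at x)" by simp
  then have "(f has_derivative (\<lambda>h. 0)) (at x)"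
    by (rule has_derivative_transform_within_open[of _ _ _ _ "- K"]) (use assms in auto)
  then show ?thesis by (simp add: pd_eqI)
qed

lemma integrable_lborel_compact_support:
  fixes f :: "'a::euclidean_space \<Rightarrow> real"
  assumes "continuous_on UNIV f" "compact K" "\<And>x. x \<notin> K \<Longrightarrow> f x = 0"
  shows "integrable lborel f"
proof -
  have "integrable lborel (\<lambda>x. indicator K x *\<^sub>R f x)"
    using assms by (intro borel_integrable_compact continuous_on_subset[OF assms(1)]) auto
  moreover have "(\<lambda>x. indicator K x *\<^sub>R f x) = f"
    using assms(3) by (auto simp: indicator_def fun_eq_iff)
  ultimately show ?thesis by simp
qed

lemma bounded_compact_support:
  fixes f :: "'a::euclidean_space \<Rightarrow> real"
  assumes "continuous_on UNIV f" "compact K" "\<And>x. x \<notin> K \<Longrightarrow> f x = 0"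
  obtains B where "0 \<le> B" "\<And>x. \<bar>f x\<bar> \<le> B"
proof -
  have "bounded (f ` K)"
    using assms by (intro compact_imp_bounded compact_continuous_image continuous_on_subset[OF assms(1)]) auto
  then obtain B where B: "\<forall>x\<in>K. \<bar>f x\<bar> \<le> B" by (auto simp: bounded_iff)
  have "\<bar>f x\<bar> \<le> max B 0" for x
    using B assms(3)[of x] by (cases "x \<in> K") (auto simp: le_max_iff_disj)
  then show thesis by (intro that[of "max B 0"]) auto
qed

lemma Ck_line_derivative:
  fixes f :: "real^'n::finite \<Rightarrow> real"
  assumes "Ck (Suc 0) f"
  shows "((\<lambda>t. f (x + t *\<^sub>R v)) has_real_derivative (\<Sum>i\<in>UNIV. v $ i * pd i f (x + t *\<^sub>R v))) (at t)"
proof -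
  have "((f \<circ> (\<lambda>t. x + t *\<^sub>R v)) has_derivative
      (\<lambda>h. \<Sum>i\<in>UNIV. h $ i * pd i f (x + t *\<^sub>R v)) \<circ> (\<lambda>r. r *\<^sub>R v)) (at t)"
    by (intro diff_chain_at Ck_has_derivative[OF assms]) (auto intro!: derivative_eq_intros)
  then have "((\<lambda>t. f (x + t *\<^sub>R v)) has_derivative
      (\<lambda>h. \<Sum>i\<in>UNIV. h $ i * pd i f (x + t *\<^sub>R v)) \<circ> (\<lambda>r. r *\<^sub>R v)) (at t)"
    by (simp only: o_def)
  then show ?thesis
    unfolding has_field_derivative_def
    by (rule back_subst[of "\<lambda>D. (_ has_derivative D) _"])
      (auto simp: fun_eq_iff o_def sum_distrib_left sum_distrib_right mult_ac intro!: sum.cong)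
qed

text \<open>The integral of a directional derivative vanishes because the integral of \<open>f\<close> is invariant under
  translations: the integrals of the difference quotients are all zero.  This also holds over any set
  that is invariant under the translations in question, such as a half space and a direction in its
  boundary.\<close>

lemma integral_directional_derivative_eq_0:
  fixes f :: "real^'n::finite \<Rightarrow> real"
  assumes f: "Ck (Suc 0) f" and K: "compact K" "\<And>x. x \<notin> K \<Longrightarrow> f x = 0"
    and H [measurable]: "H \<in> sets borel" and inv: "\<And>x t. x + t *\<^sub>R v \<in> H \<longleftrightarrow> x \<in> H"
  shows "(LINT x|lborel. indicator H x * (\<Sum>i\<in>UNIV. v $ i * pd i f x)) = 0"
proof -
  let ?D = "\<lambda>x. \<Sum>i\<in>UNIV. v $ i * pd i f x"
  let ?h = "\<lambda>x. indicator H x * f x"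
  define q where "q n x = indicator H x * ((f ((1 / real (Suc n)) *\<^sub>R v + x) - f x) * real (Suc n))" for n x
  have cf: "continuous_on UNIV f" using Ck_continuous[OF f] .
  have cD: "continuous_on UNIV ?D" using f by (intro continuous_intros) simp
  have [measurable]: "f \<in> borel_measurable borel" "?D \<in> borel_measurable borel"
    using cf cD by (auto intro: borel_measurable_continuous_onI)
  have int_f: "integrable lborel ?h"
    using integrable_mult_indicator[OF _ integrable_lborel_compact_support[OF cf K], of H] by simp
  have shift: "integrable lborel (\<lambda>x. ?h (c + x)) \<and> (LINT x|lborel. ?h (c + x)) = (LINT x|lborel. ?h x)" for c
  proof -
    have i: "integrable (distr lborel borel ((+) c)) ?h \<longleftrightarrow> integrable lborel (\<lambda>x. ?h (c + x))"
      by (rule integrable_distr_eq) auto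
    have j: "integral\<^sup>L (distr lborel borel ((+) c)) ?h = (LINT x|lborel. ?h (c + x))"
      by (rule integral_distr) auto
    show ?thesis using i j int_f by (simp add: lborel_distr_plus)
  qed
  have qh: "q n x = (?h ((1 / real (Suc n)) *\<^sub>R v + x) - ?h x) * real (Suc n)" for n x
    using inv[of x "1 / real (Suc n)"] by (auto simp: q_def indicator_def add.commute)
  have q0: "(LINT x|lborel. q n x) = 0" for n
    using shift[of "(1 / real (Suc n)) *\<^sub>R v"] int_f unfolding qh by simp
  obtain R where R: "R > 0" "K \<subseteq> cball 0 R"
    using bounded_pos[THEN iffD1, OF compact_imp_bounded[OF K(1)]] by (metis mem_cball_0 subsetI)
  have D0: "?D x = 0" if "x \<notin> K" for x
    using pd_zero_outside[OF compact_imp_closed[OF K(1)] K(2) that] by simp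
  obtain B where B: "0 \<le> B" "\<And>x. \<bar>?D x\<bar> \<le> B"
    using bounded_compact_support[OF cD K(1) D0] by blast
  have qb: "\<bar>q n x\<bar> \<le> B * indicator (cball 0 (R + norm v)) x" for n x
  proof (cases "norm x \<le> R + norm v")
    case True
    obtain z where "f (x + (1 / real (Suc n)) *\<^sub>R v) - f (x + 0 *\<^sub>R v)
        = (1 / real (Suc n) - 0) * ?D (x + z *\<^sub>R v)"
      using MVT2[of 0 "1 / real (Suc n)" "\<lambda>t. f (x + t *\<^sub>R v)" "\<lambda>t. ?D (x + t *\<^sub>R v)"]
        Ck_line_derivative[OF f] by auto
    then have "q n x = indicator H x * ?D (x + z *\<^sub>R v)"
      by (simp add: q_def add.commute field_simps)
    then have "\<bar>q n x\<bar> \<le> \<bar>?D (x + z *\<^sub>R v)\<bar>" by (simp add: abs_mult indicator_def)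
    also have "\<dots> \<le> B" by (rule B(2))
    finally show ?thesis using True by (simp add: indicator_def)
  next
    case False
    have "norm ((1 / real (Suc n)) *\<^sub>R v) \<le> 1 * norm v" unfolding norm_scaleR by (intro mult_right_mono) auto
    then have "norm ((1 / real (Suc n)) *\<^sub>R v + x) > R"
      using False norm_triangle_ineq4[of "(1 / real (Suc n)) *\<^sub>R v + x" "(1 / real (Suc n)) *\<^sub>R v"]
      unfolding add_diff_cancel_left' by linarith
    moreover have "f y = 0" if "norm y > R" for y
      using K(2)[of y] R(2) that by (meson mem_cball_0 linorder_not_less subsetD)
    moreover have "norm x > R" using False norm_ge_zero[of v] by linarith
    ultimately have "q n x = 0" by (simp add: q_def)
    then show ?thesis by (simp add: B(1) indicator_def)
  qed
  have "(\<lambda>n. LINT x|lborel. q n x) \<longlonglongrightarrow> (LINT x|lborel. indicator H x * ?D x)"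
  proof (rule integral_dominated_convergence)
    show "integrable lborel (\<lambda>x. B * indicator (cball 0 (R + norm v)) x :: real)"
      by (intro integrable_mult_right integrable_real_indicator)
        (use emeasure_lborel_cball_finite[of 0 "R + norm v"] in \<open>simp_all add: infinity_ennreal_def\<close>)
    show "AE x in lborel. norm (q n x) \<le> B * indicator (cball 0 (R + norm v)) x" for n
      using qb by simp
    show "AE x in lborel. (\<lambda>n. q n x) \<longlonglongrightarrow> indicator H x * ?D x"
      unfolding q_def
    proof (intro AE_I2 tendsto_mult tendsto_const)
      fix x
      have "((\<lambda>h. (f (x + (0 + h) *\<^sub>R v) - f (x + 0 *\<^sub>R v)) / h) \<longlongrightarrow> ?D x) (at 0)"
        using Ck_line_derivative[OF f, of x v 0] by (simp add: DERIV_def)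
      moreover have "filterlim (\<lambda>n. 1 / real (Suc n)) (at 0) sequentially"
        unfolding filterlim_at using LIMSEQ_inverse_real_of_nat by (simp add: inverse_eq_divide)
      ultimately have "(\<lambda>n. (f (x + (0 + 1 / real (Suc n)) *\<^sub>R v) - f (x + 0 *\<^sub>R v)) / (1 / real (Suc n))) \<longlonglongrightarrow> ?D x"
        by (rule filterlim_compose)
      then show "(\<lambda>n. (f ((1 / real (Suc n)) *\<^sub>R v + x) - f x) * real (Suc n)) \<longlonglongrightarrow> ?D x"
        by (simp add: add.commute)
    qed
    show "q n \<in> borel_measurable lborel" for n unfolding q_def by measurable
  qed simp
  then show ?thesis using q0 by (simp add: LIMSEQ_const_iff)
qed

lemma integral_pd_eq_0:
  fixes f :: "real^'n::finite \<Rightarrow> real"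
  assumes "Ck (Suc 0) f" "compact K" "\<And>x. x \<notin> K \<Longrightarrow> f x = 0"
  shows "(LINT x|lborel. pd i f x) = 0"
proof -
  have "(\<Sum>j\<in>UNIV. axis i 1 $ j * pd j f x) = pd i f x" for x
  proof -
    have "(\<Sum>j\<in>UNIV. axis i 1 $ j * pd j f x) = (\<Sum>j\<in>UNIV. if j = i then pd j f x else 0)"
      by (intro sum.cong refl) (auto simp: axis_def)
    then show ?thesis by simp
  qed
  then show ?thesis
    using integral_directional_derivative_eq_0[OF assms, of UNIV "axis i 1"] by simp
qed

text \<open>Schwarz's theorem: both mixed derivatives are the limit of the second difference
  \<open>(f (x + h e\<^sub>i + h e\<^sub>j) - f (x + h e\<^sub>i) - f (x + h e\<^sub>j) + f x) / h\<^sup>2\<close>.\<close>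

lemma second_difference:
  fixes f :: "real^'n::finite \<Rightarrow> real"
  assumes f: "Ck (Suc (Suc 0)) f" and h: "h > 0"
  obtains y where "dist y x \<le> 2 * h"
    "f (x + h *\<^sub>R axis i 1 + h *\<^sub>R axis j 1) - f (x + h *\<^sub>R axis i 1) - f (x + h *\<^sub>R axis j 1) + f x = h\<^sup>2 * pd j (pd i f) y"
proof -
  let ?i = "axis i (1::real) :: real^'n" and ?j = "axis j (1::real) :: real^'n"
  have ax: "(\<Sum>k\<in>UNIV. axis l 1 $ k * pd k g y) = pd l g y" for l :: 'n and g y
  proof -
    have "(\<Sum>k\<in>UNIV. axis l 1 $ k * pd k g y) = (\<Sum>k\<in>UNIV. if k = l then pd k g y else 0)"
      by (intro sum.cong refl) (auto simp: axis_def)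
    then show ?thesis by simp
  qed
  have f1: "Ck (Suc 0) f" by (rule Ck_Suc_imp[OF f])
  let ?u = "\<lambda>s. f ((x + h *\<^sub>R ?j) + s *\<^sub>R ?i) - f (x + s *\<^sub>R ?i)"
  have "DERIV ?u s :> pd i f ((x + h *\<^sub>R ?j) + s *\<^sub>R ?i) - pd i f (x + s *\<^sub>R ?i)" for s
    using DERIV_diff[OF Ck_line_derivative[OF f1, of "x + h *\<^sub>R ?j" ?i s] Ck_line_derivative[OF f1, of x ?i s]]
    unfolding ax .
  then obtain s where s: "0 < s" "s < h" "?u h - ?u 0 = (h - 0) * (pd i f ((x + h *\<^sub>R ?j) + s *\<^sub>R ?i) - pd i f (x + s *\<^sub>R ?i))"
    using MVT2[OF h, of ?u "\<lambda>s. pd i f ((x + h *\<^sub>R ?j) + s *\<^sub>R ?i) - pd i f (x + s *\<^sub>R ?i)"] by blast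
  let ?w = "\<lambda>t. pd i f ((x + s *\<^sub>R ?i) + t *\<^sub>R ?j)"
  have "DERIV ?w t :> pd j (pd i f) ((x + s *\<^sub>R ?i) + t *\<^sub>R ?j)" for t
    using Ck_line_derivative[OF Ck_pd[OF f], of i "x + s *\<^sub>R ?i" ?j t] unfolding ax .
  then obtain t where t: "0 < t" "t < h" "?w h - ?w 0 = (h - 0) * pd j (pd i f) ((x + s *\<^sub>R ?i) + t *\<^sub>R ?j)"
    using MVT2[OF h, of ?w "\<lambda>t. pd j (pd i f) ((x + s *\<^sub>R ?i) + t *\<^sub>R ?j)"] by blast
  have "norm (s *\<^sub>R ?i + t *\<^sub>R ?j) \<le> norm (s *\<^sub>R ?i) + norm (t *\<^sub>R ?j)" by (rule norm_triangle_ineq)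
  then have "dist ((x + s *\<^sub>R ?i) + t *\<^sub>R ?j) x \<le> 2 * h"
    using s t by (simp add: dist_norm add.assoc)
  moreover have "f (x + h *\<^sub>R ?i + h *\<^sub>R ?j) - f (x + h *\<^sub>R ?i) - f (x + h *\<^sub>R ?j) + f x = ?u h - ?u 0"
    by (simp add: add.assoc add.commute[of "h *\<^sub>R ?i"])
  moreover have "?u h - ?u 0 = h * (?w h - ?w 0)"
    using s(3) by (simp add: add.assoc add.commute[of "s *\<^sub>R ?i"])
  ultimately show thesis
    using t(3) by (intro that[of "(x + s *\<^sub>R ?i) + t *\<^sub>R ?j"]) (auto simp: power2_eq_square)
qed

lemma pd_commute:
  fixes f :: "real^'n::finite \<Rightarrow> real"
  assumes f: "Ck (Suc (Suc 0)) f"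
  shows "pd i (pd j f) x = pd j (pd i f) x"
proof -
  let ?d = "\<lambda>i j h. f (x + h *\<^sub>R axis i 1 + h *\<^sub>R axis j 1) - f (x + h *\<^sub>R axis i 1) - f (x + h *\<^sub>R axis j 1) + f x"
  let ?h = "\<lambda>k. inverse (real (Suc k))"
  have lim: "(\<lambda>k. ?d i j (?h k) / (?h k)\<^sup>2) \<longlonglongrightarrow> pd j (pd i f) x" for i j
  proof -
    have "\<exists>y. dist y x \<le> 2 * ?h k \<and> ?d i j (?h k) = (?h k)\<^sup>2 * pd j (pd i f) y" for k
      using second_difference[OF f, of "?h k" x i j] by (metis inverse_positive_iff_positive of_nat_0_less_iff zero_less_Suc)
    then obtain y where y: "\<And>k. dist (y k) x \<le> 2 * ?h k" "\<And>k. ?d i j (?h k) = (?h k)\<^sup>2 * pd j (pd i f) (y k)"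
      by metis
    have "(\<lambda>k. dist (y k) x) \<longlonglongrightarrow> 0"
    proof (rule real_tendsto_sandwich[OF _ _ tendsto_const])
      show "(\<lambda>k. 2 * ?h k) \<longlonglongrightarrow> 0" using tendsto_mult_right_zero[OF LIMSEQ_inverse_real_of_nat] .
    qed (use y(1) in auto)
    then have "y \<longlonglongrightarrow> x" by (rule tendsto_dist_iff[THEN iffD2])
    moreover have "isCont (pd j (pd i f)) x"
      using f by (simp add: continuous_on_eq_continuous_at)
    ultimately have "(\<lambda>k. pd j (pd i f) (y k)) \<longlonglongrightarrow> pd j (pd i f) x"
      by (simp add: isCont_tendsto_compose)
    moreover have "?d i j (?h k) / (?h k)\<^sup>2 = pd j (pd i f) (y k)" for k
      unfolding y(2) by simp
    ultimately show ?thesis by simp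
  qed
  have e: "?d j i h = ?d i j h" for h by (simp add: add.assoc add.commute[of "_ *\<^sub>R axis i 1"])
  show ?thesis
    by (rule LIMSEQ_unique[OF lim[of j i, unfolded e] lim[of i j]])
qed

lemma integral_lebesgue_on_eq_superset:
  assumes "S \<in> sets lebesgue" "U \<in> sets lebesgue" "S \<subseteq> U" "\<And>x. x \<in> U \<Longrightarrow> x \<notin> S \<Longrightarrow> f x = 0"
  shows "(LINT x|vol S. f x) = (LINT x|vol U. f x :: 'b::{banach, second_countable_topology})"
proof -
  have "(\<lambda>x. indicator S x *\<^sub>R f x) = (\<lambda>x. indicator U x *\<^sub>R f x)"
    using assms(3,4) by (auto simp: indicator_def fun_eq_iff)
  then show ?thesis
    using assms(1,2) by (simp add: integral_restrict_space)
qed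

lemma integral_lebesgue_on_support:
  fixes f :: "'a::euclidean_space \<Rightarrow> real"
  assumes "continuous_on UNIV f" "U \<in> sets lebesgue" "\<And>x. x \<notin> U \<Longrightarrow> f x = 0"
  shows "(LINT x|vol U. f x) = (LINT x|lborel. f x)"
proof -
  have "(LINT x|vol U. f x) = (LINT x|vol UNIV. f x)"
    by (rule integral_lebesgue_on_eq_superset) (use assms in auto)
  also have "\<dots> = (LINT x|lebesgue. f x)" by (simp add: lebesgue_on_UNIV_eq)
  also have "\<dots> = (LINT x|lborel. f x)"
    by (rule integral_completion) (use assms in \<open>simp add: borel_measurable_continuous_onI\<close>)
  finally show ?thesis .
qed

lemma integration_by_parts_compact_support:
  fixes f g :: "real^'n::finite \<Rightarrow> real"
  assumes f: "Ck (Suc 0) f" and g: "Ck (Suc 0) g" and U: "open U"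
    and K: "compact K" "K \<subseteq> U" "\<And>x. x \<notin> K \<Longrightarrow> g x = 0"
  shows "(LINT x|vol U. f x * pd i g x) = - (LINT x|vol U. pd i f x * g x)"
proof -
  have pdg: "pd i g x = 0" if "x \<notin> K" for x
    using pd_zero_outside[OF compact_imp_closed[OF K(1)] K(3) that] .
  have c: "continuous_on UNIV (\<lambda>x. f x * pd i g x)" "continuous_on UNIV (\<lambda>x. pd i f x * g x)"
    using f g Ck_continuous[OF f] Ck_continuous[OF g] by (auto intro!: continuous_intros)
  have e: "pd i (\<lambda>x. f x * g x) = (\<lambda>x. f x * pd i g x + pd i f x * g x)"
    by (intro ext pd_mult Ck_differentiable[OF f] Ck_differentiable[OF g])
  have "(LINT x|lborel. pd i (\<lambda>x. f x * g x) x) = 0"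
    by (rule integral_pd_eq_0[OF Ck_mult[OF f g] K(1)]) (simp add: K(3))
  then have "(LINT x|lborel. f x * pd i g x) + (LINT x|lborel. pd i f x * g x) = 0"
    unfolding e using K pdg
    by (subst (asm) Bochner_Integration.integral_add)
      (auto intro!: integrable_lborel_compact_support[OF c(1) K(1)] integrable_lborel_compact_support[OF c(2) K(1)])
  moreover have "U \<in> sets lebesgue" using U by (simp add: lmeasurable_open borel_open sets_completionI_sets)
  moreover have "f x * pd i g x = 0" "pd i f x * g x = 0" if "x \<notin> U" for x
    using that K pdg by auto
  ultimately show ?thesis
    using integral_lebesgue_on_support[OF c(1), of U] integral_lebesgue_on_support[OF c(2), of U] by simp
qed

section \<open>Test functions and the fundamental lemma of the calculus of variations\<close>

lemma smoothD: "smooth f \<Longrightarrow> Ck k f"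
  by (simp add: smooth_def)

lemma smooth_pd: "smooth f \<Longrightarrow> smooth (pd i f)"
  unfolding smooth_def by (metis Ck.simps(2))

lemma test_fun_obtain:
  assumes "test_fun U f"
  obtains K where "compact K" "K \<subseteq> U" "\<And>x. x \<notin> K \<Longrightarrow> f x = 0" "smooth f"
  using assms by (auto simp: test_fun_def)

lemma test_fun_smooth: "test_fun U f \<Longrightarrow> smooth f"
  by (simp add: test_fun_def)

lemma test_fun_pd: "test_fun U f \<Longrightarrow> test_fun U (pd i f)"
  unfolding test_fun_def by (metis compact_imp_closed pd_zero_outside smooth_pd)

lemma test_fun_mono: "test_fun U f \<Longrightarrow> U \<subseteq> W \<Longrightarrow> test_fun W f"
  unfolding test_fun_def by blast

text \<open>The functions \<open>exp (- 1 / t)\<close> times a polynomial in \<open>1 / t\<close>, extended by zero, form a class that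
  is closed under differentiation.\<close>

definition flat :: "real poly \<Rightarrow> real \<Rightarrow> real" where
  "flat q t = (if t > 0 then poly q (1 / t) * exp (- 1 / t) else 0)"

lemma poly_exp_tendsto_0: "((\<lambda>s::real. s ^ k * poly q s * exp (- s)) \<longlongrightarrow> 0) at_top"
proof (induction q arbitrary: k)
  case 0
  then show ?case by simp
next
  case (pCons a p)
  have 1: "((\<lambda>s::real. a * (s ^ k / exp s)) \<longlongrightarrow> a * 0) at_top"
    by (intro tendsto_mult tendsto_const tendsto_power_div_exp_0)
  have "((\<lambda>s::real. a * (s ^ k / exp s) + s ^ Suc k * poly p s * exp (- s)) \<longlongrightarrow> a * 0 + 0) at_top"
    by (rule tendsto_add[OF 1 pCons(2)])
  then show ?case
    by (simp add: algebra_simps exp_minus divide_inverse)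
qed

lemma flat_has_derivative: "(flat q has_real_derivative flat ((q - pderiv q) * [:0, 0, 1:]) t) (at t)"
proof -
  consider "t > 0" | "t < 0" | "t = 0" by linarith
  then show ?thesis
  proof cases
    case 1
    have "((\<lambda>t. poly q (1 / t) * exp (- 1 / t)) has_real_derivative
        flat ((q - pderiv q) * [:0, 0, 1:]) t) (at t)"
      using 1 by (auto intro!: derivative_eq_intros simp: flat_def power2_eq_square divide_simps)
        (auto simp: algebra_simps)
    then show ?thesis
      by (rule has_field_derivative_transform_within_open[of _ _ _ "{0<..}"]) (use 1 in \<open>auto simp: flat_def\<close>)
  next
    case 2
    have "((\<lambda>t. 0) has_real_derivative 0) (at t)" by simp
    then have "(flat q has_real_derivative 0) (at t)"
      by (rule has_field_derivative_transform_within_open[of _ _ _ "{..<0}"]) (use 2 in \<open>auto simp: flat_def\<close>)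
    then show ?thesis using 2 by (simp add: flat_def)
  next
    case 3
    have "((\<lambda>s. flat q (inverse s) / inverse s) \<longlongrightarrow> 0) at_top"
    proof (rule Lim_transform_eventually[OF poly_exp_tendsto_0[of 1 q]])
      show "\<forall>\<^sub>F s in at_top. s ^ 1 * poly q s * exp (- s) = flat q (inverse s) / inverse s"
        using eventually_gt_at_top[of 0] by eventually_elim (auto simp: flat_def field_simps)
    qed
    then have r: "((\<lambda>h. flat q h / h) \<longlongrightarrow> 0) (at_right 0)"
      by (simp add: filterlim_at_right_to_top)
    have l: "((\<lambda>h. flat q h / h) \<longlongrightarrow> 0) (at_left 0)"
    proof (rule Lim_transform_eventually[OF tendsto_const[of 0]])
      show "\<forall>\<^sub>F h in at_left 0. 0 = flat q h / h"
        by (auto simp: eventually_at_left_field flat_def intro!: exI[of _ "-1"])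
    qed
    from filterlim_split_at[OF l r] have "((\<lambda>h. flat q h / h) \<longlongrightarrow> 0) (at 0)" .
    then show ?thesis using 3 by (simp add: DERIV_def flat_def)
  qed
qed

lemma Ck_flat: "Ck k (\<lambda>x::real^'n::finite. flat q (c * x $ i + d))"
proof (induction k arbitrary: q)
  case 0
  have "continuous_on UNIV (flat q)"
    using flat_has_derivative by (intro continuous_at_imp_continuous_on ballI DERIV_isCont)
  then have "continuous_on UNIV (flat q \<circ> (\<lambda>x::real^'n. c * x $ i + d))"
    by (intro continuous_on_compose continuous_intros) (auto intro: continuous_on_subset)
  then show ?case by (simp add: o_def)
next
  case (Suc k)
  let ?q = "(q - pderiv q) * [:0, 0, 1:]"
  have D: "((\<lambda>x::real^'n. flat q (c * x $ i + d)) has_derivative (\<lambda>h. flat ?q (c * x $ i + d) * (c * h $ i))) (at x)" for x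
  proof -
    have a: "((\<lambda>x::real^'n. c * x $ i + d) has_derivative (\<lambda>h. c * h $ i)) (at x)"
      by (auto intro!: derivative_eq_intros bounded_linear.has_derivative[OF bounded_linear_vec_nth])
    have b: "(flat q has_derivative (\<lambda>s. flat ?q (c * x $ i + d) * s)) (at (c * x $ i + d))"
      using flat_has_derivative[of q "c * x $ i + d"] by (simp add: has_field_derivative_def)
    show ?thesis using diff_chain_at[OF a b] by (simp add: o_def)
  qed
  have "pd j (\<lambda>x::real^'n. flat q (c * x $ i + d)) = (\<lambda>x. (if j = i then c else 0) * flat ?q (c * x $ i + d))" for j
    using pd_eqI[OF D] by (auto simp: axis_def fun_eq_iff)
  then show ?case
    using Suc.IH[of ?q] D by (auto simp: differentiable_on_def differentiable_def simp del: mult_pCons_right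
        intro!: Ck_cmult Ck_const)
qed

text \<open>The boxes generate the Borel sets and are closed under intersection.\<close>

lemma AE_zero_if_box_integrals_zero:
  fixes g :: "'a::euclidean_space \<Rightarrow> real"
  assumes g: "integrable lborel g" and box: "\<And>a b. (LINT x:box a b|lborel. g x) = 0"
  shows "AE x in lborel. g x = 0"
proof -
  have sets_g: "set_integrable lborel A g" if "A \<in> sets borel" for A
    unfolding set_integrable_def using integrable_mult_indicator[OF _ g, of A] that by simp
  let ?B = "\<lambda>n::nat. box (- (real n *\<^sub>R One)) (real n *\<^sub>R One) :: 'a set"
  have "(\<lambda>n. LINT x:?B n|lborel. g x) \<longlonglongrightarrow> (LINT x|lborel. g x)"
    unfolding set_lebesgue_integral_def
  proof (rule integral_dominated_convergence[where w = "\<lambda>x. norm (g x)"])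
    show "AE x in lborel. (\<lambda>n. indicator (?B n) x *\<^sub>R g x) \<longlonglongrightarrow> g x"
    proof (rule AE_I2)
      fix x :: 'a
      obtain N where N: "x \<in> ?B N" using UN_box_eq_UNIV by blast
      have "x \<in> ?B n" if "n \<ge> N" for n
        using N that by (auto simp: mem_box inner_diff_left)
      then have "\<forall>n\<ge>N. indicator (?B n) x *\<^sub>R g x = g x" by simp
      then have "\<forall>\<^sub>F n in sequentially. indicator (?B n) x *\<^sub>R g x = g x"
        unfolding eventually_sequentially by blast
      then show "(\<lambda>n. indicator (?B n) x *\<^sub>R g x) \<longlonglongrightarrow> g x" by (rule tendsto_eventually)
    qed
    show "AE x in lborel. norm (indicator (?B n) x *\<^sub>R g x) \<le> norm (g x)" for n
      by (auto simp: indicator_def)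
  qed (use g in auto)
  then have tot: "(LINT x|lborel. g x) = 0"
    using box by (simp add: LIMSEQ_const_iff)
  have "(LINT x:A|lborel. g x) = 0" if "A \<in> sets borel" for A
  proof -
    have "Int_stable (range (\<lambda>(a, b). box a b::'a set))"
      by (auto simp: Int_stable_def box_Int_box)
    moreover have "range (\<lambda>(a, b). box a b::'a set) \<subseteq> Pow UNIV" by simp
    moreover have "A \<in> sigma_sets UNIV (range (\<lambda>(a, b). box a b::'a set))"
      using that by (simp add: borel_eq_box)
    ultimately show ?thesis
    proof (induction rule: sigma_sets_induct_disjoint)
      case (basic A)
      then show ?case using box by auto
    next
      case empty
      then show ?case by (simp add: set_lebesgue_integral_def)
    next
      case (compl A)
      have A: "A \<in> sets borel" using compl by (simp add: borel_eq_box)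
      have "(LINT x|lborel. g x) = (LINT x:A|lborel. g x) + (LINT x:UNIV - A|lborel. g x)"
        using set_integral_Un[of A "UNIV - A" lborel g] sets_g[OF A] sets_g[of "UNIV - A"] A
        by (simp add: Un_absorb1 set_lebesgue_integral_def)
      then show ?case using tot compl by simp
    next
      case (union A)
      have A: "A i \<in> sets borel" for i using union(2) by (simp add: borel_eq_box image_subset_iff)
      have "(LINT x:(\<Union>i. A i)|lborel. g x) = (\<Sum>i. LINT x:A i|lborel. g x)"
        using A union(1) by (intro lebesgue_integral_countable_add sets_g) (auto simp: disjoint_family_on_def)
      then show ?case using union(3) by simp
    qed
  qed
  then have "AE x in lborel. g x = (\<lambda>_. 0) x"
    by (intro density_unique_real g) (auto simp: set_lebesgue_integral_def)
  then show ?thesis by simp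
qed


lemma sets_lebesgue_open: "open U \<Longrightarrow> U \<in> sets lebesgue"
  by (simp add: borel_open sets_completionI_sets)

lemma sets_lebesgue_compact: "compact K \<Longrightarrow> K \<in> sets lebesgue"
  by (simp add: borel_compact sets_completionI_sets)

lemma loc_integrable_mult_continuous:
  assumes g: "loc_integrable U g" and U: "U \<in> sets lebesgue" and f: "continuous_on UNIV f"
    and K: "compact K" "K \<subseteq> U" "\<And>x. x \<notin> K \<Longrightarrow> f x = 0"
  shows "integrable (vol U) (\<lambda>x. g x * f x)"
proof -
  obtain B where B: "0 \<le> B" "\<And>x. \<bar>f x\<bar> \<le> B"
    using bounded_compact_support[OF f K(1,3)] by blast
  have g': "integrable (vol K) g" using g K by (simp add: loc_integrable_def)
  have fm: "f \<in> borel_measurable (vol K)"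
    using continuous_imp_measurable_on_sets_lebesgue[OF continuous_on_subset[OF f subset_UNIV] sets_lebesgue_compact[OF K(1)]] .
  have "integrable (vol K) (\<lambda>x. g x * f x)"
  proof (rule Bochner_Integration.integrable_bound[OF integrable_mult_right[OF g', of B]])
    show "(\<lambda>x. g x * f x) \<in> borel_measurable (vol K)"
      using fm g' by (intro borel_measurable_times) auto
    show "AE x in vol K. norm (g x * f x) \<le> norm (B * g x)"
      using B by (auto simp: abs_mult mult.commute intro!: mult_right_mono)
  qed
  moreover have "(\<lambda>x. indicator K x *\<^sub>R (g x * f x)) = (\<lambda>x. indicator U x *\<^sub>R (g x * f x))"
    using K by (auto simp: indicator_def fun_eq_iff)
  ultimately show ?thesis
    using U sets_lebesgue_compact[OF K(1)] by (simp add: integrable_restrict_space)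
qed

lemma loc_integrable_mult_test_fun:
  assumes "loc_integrable U g" "open U" "test_fun U f"
  shows "integrable (vol U) (\<lambda>x. g x * f x)"
proof -
  obtain K where K: "compact K" "K \<subseteq> U" "\<And>x. x \<notin> K \<Longrightarrow> f x = 0" "smooth f"
    using test_fun_obtain[OF assms(3)] by blast
  show ?thesis
    by (rule loc_integrable_mult_continuous[OF assms(1) sets_lebesgue_open[OF assms(2)]
          Ck_continuous[OF smoothD[OF K(4), of 0]] K(1-3)])
qed

text \<open>Smooth cut-off functions of a box: they take values in \<open>[0, 1]\<close>, vanish outside the box and increase
  to its indicator function.\<close>

definition box_bump :: "real^'n::finite \<Rightarrow> real^'n \<Rightarrow> nat \<Rightarrow> real^'n \<Rightarrow> real" where
  "box_bump a b k x = (\<Prod>i\<in>UNIV. flat 1 (real (Suc k) * x $ i + (- real (Suc k) * a $ i))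
     * flat 1 (- real (Suc k) * x $ i + real (Suc k) * b $ i))"

lemma flat_1_bounds: "0 \<le> flat 1 t" "flat 1 t \<le> 1"
  by (auto simp: flat_def)

lemma smooth_box_bump: "smooth (box_bump a b k)"
  unfolding smooth_def box_bump_def[abs_def] by (intro allI Ck_prod Ck_mult Ck_flat)

lemma box_bump_bounds: "0 \<le> box_bump a b k x" "box_bump a b k x \<le> 1"
  unfolding box_bump_def
  by (auto intro!: prod_nonneg mult_nonneg_nonneg prod_le_1 mult_le_one flat_1_bounds)

lemma box_bump_outside:
  assumes "x \<notin> box a b"
  shows "box_bump a b k x = 0"
proof -
  obtain i where "\<not> (a $ i < x $ i \<and> x $ i < b $ i)" using assms by (auto simp: mem_box_cart)
  then have "real (Suc k) * (x $ i - a $ i) \<le> 0 \<or> real (Suc k) * (b $ i - x $ i) \<le> 0"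
    by (auto simp: mult_le_0_iff)
  then have "flat 1 (real (Suc k) * x $ i + (- real (Suc k) * a $ i)) = 0
      \<or> flat 1 (- real (Suc k) * x $ i + real (Suc k) * b $ i) = 0"
    by (auto simp: flat_def algebra_simps)
  then show ?thesis unfolding box_bump_def by (intro prod_zero) auto
qed

lemma box_bump_tendsto: "(\<lambda>k. box_bump a b k x) \<longlonglongrightarrow> indicator (box a b) x"
proof (cases "x \<in> box a b")
  case True
  have *: "(\<lambda>k. flat 1 (real (Suc k) * c)) \<longlonglongrightarrow> 1" if "c > 0" for c
  proof -
    have "(\<lambda>k. exp (- (1 / c) * inverse (real (Suc k)))) \<longlonglongrightarrow> exp (- (1 / c) * 0)"
      by (intro tendsto_exp tendsto_mult tendsto_const LIMSEQ_inverse_real_of_nat)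
    moreover have "flat 1 (real (Suc k) * c) = exp (- (1 / c) * inverse (real (Suc k)))" for k
      using that by (simp add: flat_def divide_simps add_pos_nonneg)
    ultimately show ?thesis by simp
  qed
  have "(\<lambda>k. \<Prod>i\<in>UNIV. flat 1 (real (Suc k) * (x $ i - a $ i)) * flat 1 (real (Suc k) * (b $ i - x $ i)))
      \<longlonglongrightarrow> (\<Prod>i\<in>(UNIV::'a set). 1 * 1)"
    by (intro tendsto_prod tendsto_mult *) (use True in \<open>auto simp: mem_box_cart\<close>)
  then show ?thesis using True by (simp add: box_bump_def algebra_simps)
next
  case False
  then show ?thesis by (simp add: box_bump_outside)
qed

text \<open>The integral of \<open>g\<close> over a box in \<open>U\<close> is, by dominated
  convergence, a limit of integrals against cut-off functions of the box.\<close>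

theorem fundamental_lemma:
  fixes g :: "real^'n::finite \<Rightarrow> real"
  assumes U: "open U" and g: "loc_integrable U g"
    and zero: "\<And>\<phi>. test_fun U \<phi> \<Longrightarrow> (LINT x|vol U. g x * \<phi> x) = 0"
  shows "AE x in vol U. g x = 0"
proof -
  have UL: "U \<in> sets lebesgue" using sets_lebesgue_open[OF U] .
  have box0: "(LINT x|lebesgue. indicator (box a b) x * g x) = 0" if ab: "cbox a b \<subseteq> U" for a b
  proof -
    have gi: "integrable (vol (cbox a b)) g" using g ab by (simp add: loc_integrable_def)
    have t: "test_fun U (box_bump a b k)" for k
      unfolding test_fun_def using ab box_bump_outside[of _ a b k] box_subset_cbox[of a b]
      by (intro conjI smooth_box_bump exI[of _ "cbox a b"]) auto
    have "(LINT x|vol (cbox a b). g x * box_bump a b k x) = (LINT x|vol U. g x * box_bump a b k x)" for k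
      by (rule integral_lebesgue_on_eq_superset) (use ab UL box_bump_outside[of _ a b k] box_subset_cbox[of a b] in auto)
    then have z: "(LINT x|vol (cbox a b). g x * box_bump a b k x) = 0" for k
      using zero[OF t] by simp
    have "(\<lambda>k. LINT x|vol (cbox a b). g x * box_bump a b k x)
        \<longlonglongrightarrow> (LINT x|vol (cbox a b). g x * indicator (box a b) x)"
    proof (rule integral_dominated_convergence[where w = "\<lambda>x. norm (g x)"])
      show "AE x in vol (cbox a b). (\<lambda>k. g x * box_bump a b k x) \<longlonglongrightarrow> g x * indicator (box a b) x"
        by (intro AE_I2 tendsto_mult tendsto_const box_bump_tendsto)
      show "AE x in vol (cbox a b). norm (g x * box_bump a b k x) \<le> norm (g x)" for k
        using box_bump_bounds[of a b k] by (auto simp: abs_mult intro!: mult_left_le)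
      show "(\<lambda>x. g x * box_bump a b k x) \<in> borel_measurable (vol (cbox a b))" for k
      proof (rule borel_measurable_times)
        show "box_bump a b k \<in> borel_measurable (vol (cbox a b))"
          by (rule continuous_imp_measurable_on_sets_lebesgue[OF
              continuous_on_subset[OF Ck_continuous[OF smoothD[OF smooth_box_bump, of 0]] subset_UNIV]]) simp
      qed (use gi in auto)
      show "(\<lambda>x. g x * indicator (box a b) x) \<in> borel_measurable (vol (cbox a b))"
      proof (rule borel_measurable_times)
        have "(indicator (box a b) :: _ \<Rightarrow> real) \<in> borel_measurable lebesgue"
          by (intro borel_measurable_indicator sets_lebesgue_open open_box)
        then show "(indicator (box a b) :: _ \<Rightarrow> real) \<in> borel_measurable (vol (cbox a b))"
          by (rule measurable_restrict_space1)
      qed (use gi in auto)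
    qed (use gi in auto)
    then have "(LINT x|vol (cbox a b). g x * indicator (box a b) x) = 0"
      unfolding z by (simp add: LIMSEQ_const_iff)
    moreover have "(\<lambda>x. indicator (cbox a b) x *\<^sub>R (g x * indicator (box a b) x)) = (\<lambda>x. indicator (box a b) x * g x)"
      using box_subset_cbox[of a b] by (auto simp: indicator_def fun_eq_iff)
    ultimately show ?thesis by (simp add: integral_restrict_space)
  qed
  have AE_box: "AE x in lebesgue. x \<in> cbox a b \<longrightarrow> g x = 0" if ab: "cbox a b \<subseteq> U" for a b
  proof -
    let ?g = "\<lambda>x. indicator (box a b) x * g x"
    have "integrable (vol (cbox a b)) g" using g ab by (simp add: loc_integrable_def)
    then have "integrable lebesgue (\<lambda>x. indicator (cbox a b) x *\<^sub>R g x)"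
      by (simp add: integrable_restrict_space)
    then have "integrable lebesgue (\<lambda>x. indicator (box a b) x *\<^sub>R (indicator (cbox a b) x *\<^sub>R g x))"
      by (rule integrable_mult_indicator[OF sets_lebesgue_open[OF open_box]])
    moreover have "(\<lambda>x. indicator (box a b) x *\<^sub>R (indicator (cbox a b) x *\<^sub>R g x)) = ?g"
      using box_subset_cbox[of a b] by (auto simp: indicator_def fun_eq_iff)
    ultimately have gi: "integrable lebesgue ?g" by simp
    obtain h where h: "h \<in> borel_measurable lborel" "AE x in lborel. ?g x = h x"
      using completion_ex_borel_measurable_real[of ?g lborel] gi by auto
    then have hAE: "AE x in lebesgue. ?g x = h x" by (simp add: AE_completion)
    have hL: "h \<in> borel_measurable lebesgue" using h(1) by (rule measurable_completion)
    have "integrable lebesgue h"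
      using integrable_cong_AE_imp[OF gi hL] hAE by auto
    then have hi: "integrable lborel h" using integrable_completion[OF h(1)] by simp
    have "AE x in lborel. h x = 0"
    proof (rule AE_zero_if_box_integrals_zero[OF hi])
      fix c d :: "real^'n"
      obtain p q where pq: "box a b \<inter> box c d = box p q" "box p q = {} \<or> cbox p q \<subseteq> cbox a b"
      proof (cases "box a b \<inter> box c d = {}")
        case True
        then show thesis using that[of 0 0] by simp
      next
        case False
        let ?p = "\<chi> i. max (a $ i) (c $ i)" and ?q = "\<chi> i. min (b $ i) (d $ i)"
        have "box a b \<inter> box c d = box ?p ?q"
          by (auto simp: mem_box_cart)
        moreover have "cbox ?p ?q \<subseteq> cbox a b" by (auto simp: mem_box_cart)
        ultimately show thesis by (intro that[of ?p ?q]) auto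
      qed
      have hm: "(\<lambda>x. indicator (box c d) x *\<^sub>R h x) \<in> borel_measurable lborel"
        using h(1) by measurable
      have "(LINT x:box c d|lborel. h x) = (LINT x|lebesgue. indicator (box c d) x *\<^sub>R h x)"
        unfolding set_lebesgue_integral_def using integral_completion[OF hm] by simp
      also have "\<dots> = (LINT x|lebesgue. indicator (box c d) x *\<^sub>R ?g x)"
      proof (rule integral_cong_AE)
        show "(\<lambda>x. indicator (box c d) x *\<^sub>R h x) \<in> borel_measurable lebesgue"
          using hm by (rule measurable_completion)
        show "(\<lambda>x. indicator (box c d) x *\<^sub>R ?g x) \<in> borel_measurable lebesgue"
          using integrable_mult_indicator[OF sets_lebesgue_open[OF open_box] gi, of c d] by (rule borel_measurable_integrable)
        show "AE x in lebesgue. indicator (box c d) x *\<^sub>R h x = indicator (box c d) x *\<^sub>R ?g x"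
          using hAE by eventually_elim simp
      qed
      also have "\<dots> = (LINT x|lebesgue. indicator (box p q) x * g x)"
        by (intro arg_cong[where f = "integral\<^sup>L lebesgue"]) (auto simp: pq(1)[symmetric] indicator_def fun_eq_iff)
      also have "\<dots> = 0"
        using pq(2) box0[of p q] ab by (cases "box p q = {}") auto
      finally show "(LINT x:box c d|lborel. h x) = 0" .
    qed
    then have "AE x in lebesgue. h x = 0" by (simp add: AE_completion)
    moreover have "AE x in lebesgue. x \<notin> cbox a b - box a b"
      by (intro AE_not_in) (use null_sets_cbox_Diff_box[of a b] in \<open>auto intro: null_sets_completionI\<close>)
    ultimately show ?thesis
      using hAE by eventually_elim (auto simp: indicator_def)
  qed
  obtain D where D: "countable D" "D \<subseteq> Pow U" "\<And>X. X \<in> D \<Longrightarrow> \<exists>a b. X = cbox a b" "\<Union>D = U"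
    using open_countable_Union_open_cbox[OF U] by blast
  have "AE x in lebesgue. \<forall>X\<in>D. x \<in> X \<longrightarrow> g x = 0"
    unfolding AE_ball_countable[OF D(1)]
  proof
    fix X assume X: "X \<in> D"
    then obtain a b where "X = cbox a b" "cbox a b \<subseteq> U" using D(2,3) by blast
    then show "AE x in lebesgue. x \<in> X \<longrightarrow> g x = 0" using AE_box by simp
  qed
  then have "AE x in lebesgue. x \<in> U \<longrightarrow> g x = 0"
    by eventually_elim (use D(4) in blast)
  then show ?thesis using UL by (simp add: AE_restrict_space_iff)
qed

section \<open>Weak derivatives\<close>

lemma loc_integrable_linear_comb:
  assumes "loc_integrable U f" "loc_integrable U g"
  shows "loc_integrable U (\<lambda>x. a * f x + b * g x)"
  using assms by (auto simp: loc_integrable_def)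

lemma loc_integrable_continuous:
  fixes f :: "real^'n::finite \<Rightarrow> real"
  assumes "continuous_on UNIV f"
  shows "loc_integrable U f"
  unfolding loc_integrable_def
proof (intro allI impI)
  fix K :: "(real^'n) set" assume K: "compact K \<and> K \<subseteq> U"
  have "integrable lborel (\<lambda>x. indicator K x *\<^sub>R f x)"
    using K by (intro borel_integrable_compact continuous_on_subset[OF assms]) auto
  moreover have "(\<lambda>x. indicator K x *\<^sub>R f x) \<in> borel_measurable lborel"
    using calculation by (rule borel_measurable_integrable)
  ultimately have "integrable lebesgue (\<lambda>x. indicator K x *\<^sub>R f x)"
    by (simp add: integrable_completion)
  then show "integrable (vol K) f"
    using K by (simp add: integrable_restrict_space sets_lebesgue_compact)
qed

lemma loc_integrable_mono: "loc_integrable U f \<Longrightarrow> W \<subseteq> U \<Longrightarrow> loc_integrable W f"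
  unfolding loc_integrable_def by blast

lemma loc_integrable_cong_AE:
  assumes f: "loc_integrable U f" and U: "U \<in> sets lebesgue" and g: "g \<in> borel_measurable (vol U)"
    and AE: "AE x in vol U. f x = g x"
  shows "loc_integrable U g"
  unfolding loc_integrable_def
proof (intro allI impI)
  fix K :: "(real^'a) set" assume K: "compact K \<and> K \<subseteq> U"
  have KL: "K \<in> sets lebesgue" using K sets_lebesgue_compact by blast
  have "g \<in> borel_measurable (vol K)"
    using measurable_restrict_mono[OF g] K by blast
  moreover have "AE x in vol K. f x = g x"
    using AE K U KL by (auto simp: AE_restrict_space_iff elim!: eventually_mono)
  moreover have "integrable (vol K) f" using f K by (simp add: loc_integrable_def)
  ultimately show "integrable (vol K) g"
    by (intro integrable_cong_AE_imp[of "vol K" f g])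
qed

lemma weak_partial_linear_comb:
  assumes U: "open U" and w: "weak_partial U i w g" "weak_partial U i w' g'"
  shows "weak_partial U i (\<lambda>x. a * w x + b * w' x) (\<lambda>x. a * g x + b * g' x)"
  unfolding weak_partial_def
proof (intro conjI allI impI)
  have l: "loc_integrable U w" "loc_integrable U w'" "loc_integrable U g" "loc_integrable U g'"
    using w by (auto simp: weak_partial_def)
  show "loc_integrable U (\<lambda>x. a * w x + b * w' x)" "loc_integrable U (\<lambda>x. a * g x + b * g' x)"
    using l by (auto intro: loc_integrable_linear_comb)
  fix \<phi> :: "real^'a \<Rightarrow> real" assume \<phi>: "test_fun U \<phi>"
  have lin: "(LINT x|vol U. (a * p x + b * q x) * \<psi> x)
      = a * (LINT x|vol U. p x * \<psi> x) + b * (LINT x|vol U. q x * \<psi> x)"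
    if "loc_integrable U p" "loc_integrable U q" "test_fun U \<psi>" for p q \<psi>
    using loc_integrable_mult_test_fun[OF that(1) U that(3)] loc_integrable_mult_test_fun[OF that(2) U that(3)]
    by (simp add: distrib_right mult.assoc)
  show "(LINT x|vol U. (a * w x + b * w' x) * pd i \<phi> x)
      = - (LINT x|vol U. (a * g x + b * g' x) * \<phi> x)"
    using lin[OF l(1,2) test_fun_pd[OF \<phi>]] lin[OF l(3,4) \<phi>] w \<phi> by (simp add: weak_partial_def)
qed

lemma weak_partial_unique:
  assumes U: "open U" and w: "weak_partial U i w g" "weak_partial U i w g'"
  shows "AE x in vol U. g x = g' x"
proof -
  have z: "weak_partial U i (\<lambda>x. 1 * w x + (- 1) * w x) (\<lambda>x. 1 * g x + (- 1) * g' x)"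
    by (rule weak_partial_linear_comb[OF U w])
  have "AE x in vol U. 1 * g x + (- 1) * g' x = 0"
  proof (rule fundamental_lemma[OF U])
    show "loc_integrable U (\<lambda>x. 1 * g x + (- 1) * g' x)" using z by (simp only: weak_partial_def)
    show "(LINT x|vol U. (1 * g x + (- 1) * g' x) * \<phi> x) = 0" if "test_fun U \<phi>" for \<phi>
      using z that by (simp add: weak_partial_def)
  qed
  then show ?thesis by simp
qed

lemma weak_partial_wpd: "weak_partial U i w g \<Longrightarrow> weak_partial U i w (wpd U i w)"
  unfolding wpd_def by (rule someI[of "weak_partial U i w"])

lemma wpd_AE_eq: "open U \<Longrightarrow> weak_partial U i w g \<Longrightarrow> AE x in vol U. wpd U i w x = g x"
  using weak_partial_unique weak_partial_wpd by blast

lemma weak_partial_mono: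
  assumes w: "weak_partial U i w g" and U: "open U" "open W" "W \<subseteq> U"
  shows "weak_partial W i w g"
  unfolding weak_partial_def
proof (intro conjI allI impI)
  show "loc_integrable W w" "loc_integrable W g"
    using w U(3) by (auto simp: weak_partial_def intro: loc_integrable_mono)
  fix \<phi> assume \<phi>: "test_fun W \<phi>"
  have L: "U \<in> sets lebesgue" "W \<in> sets lebesgue" using U by (auto intro: sets_lebesgue_open)
  have e: "(LINT x|vol W. f x * \<psi> x) = (LINT x|vol U. f x * \<psi> x)" if \<psi>: "test_fun W \<psi>" for f \<psi>
  proof (rule integral_lebesgue_on_eq_superset[OF L(2,1) U(3)])
    obtain K where "K \<subseteq> W" "\<And>x. x \<notin> K \<Longrightarrow> \<psi> x = 0" using test_fun_obtain[OF \<psi>] by metis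
    then show "f x * \<psi> x = 0" if "x \<notin> W" for x using that by auto
  qed
  show "(LINT x|vol W. w x * pd i \<phi> x) = - (LINT x|vol W. g x * \<phi> x)"
    using w test_fun_mono[OF \<phi> U(3)] unfolding e[OF \<phi>] e[OF test_fun_pd[OF \<phi>]] by (simp add: weak_partial_def)
qed

lemma weak_partial_cong_AE:
  assumes w: "weak_partial U i w g" and U: "open U"
    and m: "w' \<in> borel_measurable (vol U)" "g' \<in> borel_measurable (vol U)"
    and AE: "AE x in vol U. w x = w' x" "AE x in vol U. g x = g' x"
  shows "weak_partial U i w' g'"
  unfolding weak_partial_def
proof (intro conjI allI impI)
  have l: "loc_integrable U w" "loc_integrable U g" using w by (auto simp: weak_partial_def)
  show l': "loc_integrable U w'" "loc_integrable U g'"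
    using loc_integrable_cong_AE[OF l(1) sets_lebesgue_open[OF U] m(1) AE(1)]
      loc_integrable_cong_AE[OF l(2) sets_lebesgue_open[OF U] m(2) AE(2)] by auto
  fix \<phi> assume \<phi>: "test_fun U \<phi>"
  have e: "(LINT x|vol U. p x * \<psi> x) = (LINT x|vol U. q x * \<psi> x)"
    if "loc_integrable U p" "loc_integrable U q" "AE x in vol U. p x = q x" "test_fun U \<psi>" for p q \<psi>
    using loc_integrable_mult_test_fun[OF that(1) U that(4)] loc_integrable_mult_test_fun[OF that(2) U that(4)] that(3)
    by (intro integral_cong_AE) auto
  show "(LINT x|vol U. w' x * pd i \<phi> x) = - (LINT x|vol U. g' x * \<phi> x)"
    unfolding e[OF l(1) l'(1) AE(1) test_fun_pd[OF \<phi>], symmetric] e[OF l(2) l'(2) AE(2) \<phi>, symmetric]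
    using w \<phi> by (simp add: weak_partial_def)
qed

lemma weak_partial_classical:
  assumes f: "Ck (Suc 0) f" and U: "open U"
  shows "weak_partial U i f (pd i f)"
  unfolding weak_partial_def
proof (intro conjI allI impI)
  show "loc_integrable U f" "loc_integrable U (pd i f)"
    using f Ck_continuous[OF f] by (auto intro: loc_integrable_continuous)
  fix \<phi> assume \<phi>: "test_fun U \<phi>"
  obtain K where K: "compact K" "K \<subseteq> U" "\<And>x. x \<notin> K \<Longrightarrow> \<phi> x = 0" "smooth \<phi>"
    using test_fun_obtain[OF \<phi>] by blast
  show "(LINT x|vol U. f x * pd i \<phi> x) = - (LINT x|vol U. pd i f x * \<phi> x)"
    by (rule integration_by_parts_compact_support[OF f smoothD[OF K(4)] U K(1-3)])
qed

section \<open>The cone formula\<close>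

definition prism :: "(real^'n::finite) set \<Rightarrow> real^'n \<Rightarrow> (real^'n) set" where
  "prism F n = {z + t *\<^sub>R n |z t. z \<in> F \<and> 0 \<le> t \<and> t \<le> 1}"

locale flat_face =
  fixes F :: "(real^'n::finite) set" and n :: "real^'n" and z0 :: "real^'n"
  assumes F: "compact F" "convex F" "z0 \<in> F" and n: "norm n = 1"
    and flat: "\<And>z. z \<in> F \<Longrightarrow> (z - z0) \<bullet> n = 0"
begin

definition height :: "real^'n \<Rightarrow> real" where "height y = (y - z0) \<bullet> n"

definition foot :: "real^'n \<Rightarrow> real^'n" where "foot y = y - height y *\<^sub>R n"

lemma nn: "n \<bullet> n = 1"
  using n by (simp add: dot_square_norm)

lemma height_add: "height (x + c *\<^sub>R n) = height x + c"
  by (simp add: height_def inner_diff_left inner_add_left nn)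

lemma height_foot: "height (foot y) = 0"
  by (simp add: foot_def height_def inner_diff_left nn)

lemma foot_add: "foot (x + c *\<^sub>R n) = foot x"
  by (simp add: foot_def height_add algebra_simps)

lemma foot_decomp: "y = foot y + height y *\<^sub>R n"
  by (simp add: foot_def)

lemma height_F: "z \<in> F \<Longrightarrow> height z = 0"
  by (simp add: height_def flat)

lemma foot_F: "z \<in> F \<Longrightarrow> foot z = z"
  by (simp add: foot_def height_F)

lemma continuous_height: "continuous_on S height" and continuous_foot: "continuous_on S foot"
  unfolding height_def[abs_def] foot_def[abs_def] by (intro continuous_intros)+

lemma height_borel [measurable]: "height \<in> borel_measurable borel"
  and foot_borel [measurable]: "foot \<in> borel_measurable borel"
  by (auto intro!: borel_measurable_continuous_onI continuous_height continuous_foot)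

lemma prism_iff: "y \<in> prism F n \<longleftrightarrow> 0 \<le> height y \<and> height y \<le> 1 \<and> foot y \<in> F"
proof
  assume "y \<in> prism F n"
  then obtain z t where "y = z + t *\<^sub>R n" "z \<in> F" "0 \<le> t" "t \<le> 1" by (auto simp: prism_def)
  then show "0 \<le> height y \<and> height y \<le> 1 \<and> foot y \<in> F"
    by (simp add: height_add height_F foot_add foot_F)
next
  assume "0 \<le> height y \<and> height y \<le> 1 \<and> foot y \<in> F"
  then show "y \<in> prism F n" unfolding prism_def using foot_decomp[of y] by blast
qed

lemma compact_prism: "compact (prism F n)"
proof -
  have "prism F n = (\<lambda>p. fst p + snd p *\<^sub>R n) ` (F \<times> {0..1})"
    by (force simp: prism_def image_def)
  moreover have "compact ((\<lambda>p. fst p + snd p *\<^sub>R n) ` (F \<times> {0..1}))"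
    by (intro compact_continuous_image continuous_intros compact_Times F compact_Icc)
  ultimately show ?thesis by simp
qed

lemma convex_prism: "convex (prism F n)"
proof -
  have "prism F n = (\<lambda>p. fst p + snd p *\<^sub>R n) ` (F \<times> {0..1})"
    by (force simp: prism_def image_def)
  moreover have "linear (\<lambda>p. fst p + snd p *\<^sub>R n)"
    by (rule linearI) (auto simp: algebra_simps)
  ultimately show ?thesis
    using convex_linear_image[of "\<lambda>p. fst p + snd p *\<^sub>R n" "F \<times> {0..1}"] F(2) by (simp add: convex_Times)
qed

lemma prism_borel [measurable]: "prism F n \<in> sets borel"
  by (simp add: borel_compact compact_prism)

lemma closest_point_foot:
  assumes "foot y \<in> F"
  shows "closest_point F y = foot y"
proof -
  have "dist y (foot y) \<le> dist y z" if "z \<in> F" for z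
  proof -
    have "(y - z) \<bullet> n = height y"
      using height_F[OF that] by (simp add: height_def inner_diff_left)
    then have "\<bar>height y\<bar> \<le> norm (y - z)"
      using Cauchy_Schwarz_ineq2[of "y - z" n] n by simp
    then show ?thesis using n by (simp add: dist_norm foot_def)
  qed
  then show ?thesis
    using closest_point_unique[OF F(2) compact_imp_closed[OF F(1)] assms] by simp
qed

lemma closest_point_measurable:
  "closest_point F \<in> vol (prism F n) \<rightarrow>\<^sub>M restrict_space borel F"
proof (rule measurable_restrict_space2)
  show "closest_point F \<in> space (vol (prism F n)) \<rightarrow> F"
    using F closest_point_in_set[OF compact_imp_closed[OF F(1)]] by auto
  show "closest_point F \<in> borel_measurable (vol (prism F n))"
    by (rule continuous_imp_measurable_on_sets_lebesgue)
      (use F in \<open>auto intro!: continuous_on_closest_point compact_imp_closed sets_lebesgue_compact compact_prism\<close>)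
qed

lemma face_measure_eq:
  "face_measure F n = distr (vol (prism F n)) (restrict_space borel F) (closest_point F)"
  by (simp add: face_measure_def prism_def)

lemma space_face_measure: "space (face_measure F n) = F"
  by (simp add: face_measure_eq space_restrict_space)

lemma finite_face_measure: "finite_measure (face_measure F n)"
proof
  have "emeasure (face_measure F n) F = emeasure (vol (prism F n)) (closest_point F -` F \<inter> prism F n)"
    unfolding face_measure_eq
    by (subst emeasure_distr[OF closest_point_measurable]) (auto simp: sets_restrict_space_iff F borel_compact)
  also have "\<dots> \<le> emeasure (vol (prism F n)) (prism F n)"
    by (rule emeasure_mono) auto
  also have "\<dots> = emeasure lebesgue (prism F n)"
    by (simp add: emeasure_restrict_space sets_lebesgue_compact[OF compact_prism])
  also have "\<dots> < \<infinity>" using emeasure_compact_finite[OF compact_prism] by simp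
  finally show "emeasure (face_measure F n) (space (face_measure F n)) \<noteq> \<infinity>"
    by (simp add: space_face_measure)
qed

lemma face_measurable_continuous:
  fixes g :: "real^'n \<Rightarrow> 'b::{second_countable_topology, banach}"
  shows "continuous_on F g \<Longrightarrow> g \<in> borel_measurable (face_measure F n)"
  unfolding face_measure_eq using borel_measurable_continuous_on_restrict[of F g]
  by (simp add: measurable_distr_eq1)

lemma face_integral_eq:
  fixes g :: "real^'n \<Rightarrow> real"
  assumes g: "continuous_on UNIV g"
  shows "(LINT x|face_measure F n. g x) = (LINT y|lborel. indicator (prism F n) y * g (foot y))"
proof -
  have gm: "g \<in> borel_measurable (restrict_space borel F)"
    by (rule borel_measurable_continuous_on_restrict[OF continuous_on_subset[OF g]]) simp
  have "(LINT x|face_measure F n. g x) = (LINT y|vol (prism F n). g (closest_point F y))"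
    unfolding face_measure_eq by (rule integral_distr[OF closest_point_measurable gm])
  also have "\<dots> = (LINT y|vol (prism F n). g (foot y))"
    by (intro Bochner_Integration.integral_cong refl) (simp add: closest_point_foot prism_iff)
  also have "\<dots> = (LINT y|lebesgue. indicator (prism F n) y *\<^sub>R g (foot y))"
    using sets_lebesgue_compact[OF compact_prism] by (simp add: integral_restrict_space)
  also have "\<dots> = (LINT y|lborel. indicator (prism F n) y *\<^sub>R g (foot y))"
  proof (rule integral_completion)
    have [measurable]: "g \<in> borel_measurable borel" using g by (rule borel_measurable_continuous_onI)
    show "(\<lambda>y. indicator (prism F n) y *\<^sub>R g (foot y)) \<in> borel_measurable lborel" by measurable
  qed
  finally show ?thesis by simp
qed

lemma integral_shift:
  fixes h :: "real^'n \<Rightarrow> real"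
  assumes [measurable]: "h \<in> borel_measurable borel"
  shows "(LINT y|lborel. h (c + y)) = (LINT y|lborel. h y)"
proof -
  have "integral\<^sup>L (distr lborel borel ((+) c)) h = (LINT y|lborel. h (c + y))"
    by (rule integral_distr) auto
  then show ?thesis by (simp add: lborel_distr_plus)
qed

lemma integrable_shift:
  fixes h :: "real^'n \<Rightarrow> real"
  assumes [measurable]: "h \<in> borel_measurable borel"
  shows "integrable lborel (\<lambda>y. h (c + y)) \<longleftrightarrow> integrable lborel h"
proof -
  have "integrable (distr lborel borel ((+) c)) h \<longleftrightarrow> integrable lborel (\<lambda>y. h (c + y))"
    by (rule integrable_distr_eq) auto
  then show ?thesis by (simp add: lborel_distr_plus)
qed

text \<open>Cutting the slab \<open>0 \<le> height < 1\<close> into \<open>k\<close> slabs of thickness \<open>1 / k\<close> and translating each of them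
  to the bottom one replaces the stretching of a thin layer, so that only the translation
  invariance of the Lebesgue measure is used.\<close>

definition squeeze :: "nat \<Rightarrow> real^'n \<Rightarrow> real^'n" where
  "squeeze k y = y - (real_of_int \<lfloor>real k * height y\<rfloor> / real k) *\<^sub>R n"

lemma height_squeeze:
  assumes "k > 0"
  shows "0 \<le> height (squeeze k y)" "height (squeeze k y) < 1 / real k"
proof -
  define f where "f = real_of_int \<lfloor>real k * height y\<rfloor>"
  have f: "f \<le> real k * height y" "real k * height y < f + 1" unfolding f_def by linarith+
  have h: "height (squeeze k y) = height y - f / real k"
    using height_add[of y "- (f / real k)"] by (simp add: squeeze_def f_def)
  have "f / real k \<le> height y" using f(1) assms by (simp add: pos_divide_le_eq mult.commute)
  moreover have "height y < (f + 1) / real k" using f(2) assms by (simp add: pos_less_divide_eq mult.commute)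
  ultimately show "0 \<le> height (squeeze k y)" "height (squeeze k y) < 1 / real k"
    unfolding h by (simp_all add: add_divide_distrib)
qed

lemma foot_squeeze: "foot (squeeze k y) = foot y"
  using foot_add[of y "- (real_of_int \<lfloor>real k * height y\<rfloor> / real k)"] by (simp add: squeeze_def)

lemma squeeze_decomp: "squeeze k y = foot y + height (squeeze k y) *\<^sub>R n"
  using foot_decomp[of "squeeze k y"] unfolding foot_squeeze .

lemma squeeze_tendsto: "(\<lambda>k. squeeze (Suc k) y) \<longlonglongrightarrow> foot y"
proof -
  have "(\<lambda>k. height (squeeze (Suc k) y)) \<longlonglongrightarrow> 0"
  proof (rule real_tendsto_sandwich)
    show "\<forall>\<^sub>F k in sequentially. 0 \<le> height (squeeze (Suc k) y)"
      using height_squeeze(1)[of "Suc _" y] by simp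
    show "\<forall>\<^sub>F k in sequentially. height (squeeze (Suc k) y) \<le> inverse (real (Suc k))"
      using height_squeeze(2)[of "Suc _" y] by (simp add: inverse_eq_divide less_imp_le)
  qed (use LIMSEQ_inverse_real_of_nat in auto)
  then have "(\<lambda>k. foot y + height (squeeze (Suc k) y) *\<^sub>R n) \<longlonglongrightarrow> foot y + 0 *\<^sub>R n"
    by (intro tendsto_intros)
  moreover have "foot y + height (squeeze (Suc k) y) *\<^sub>R n = squeeze (Suc k) y" for k
    using squeeze_decomp[of "Suc k" y] by simp
  ultimately show ?thesis by simp
qed

lemma squeeze_borel [measurable]: "squeeze k \<in> borel_measurable borel"
  unfolding squeeze_def[abs_def] by measurable

lemma integral_squeeze:
  fixes h :: "real^'n \<Rightarrow> real"
  assumes h[measurable]: "h \<in> borel_measurable borel" and hi: "integrable lborel h" and k: "k > 0"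
  shows "(LINT y|lborel. of_bool (0 \<le> height y \<and> height y < 1) * h (squeeze k y))
       = real k * (LINT y|lborel. of_bool (0 \<le> height y \<and> height y < 1 / real k) * h y)"
proof -
  let ?b = "\<lambda>y. of_bool (0 \<le> height y \<and> height y < 1 / real k) * h y"
  let ?c = "\<lambda>j::nat. (- (real j / real k)) *\<^sub>R n"
  have bm [measurable]: "?b \<in> borel_measurable borel" by measurable
  have bi: "integrable lborel ?b"
    by (rule Bochner_Integration.integrable_bound[OF hi]) (auto intro!: AE_I2)
  have split: "of_bool (0 \<le> height y \<and> height y < 1) * h (squeeze k y) = (\<Sum>j<k. ?b (?c j + y))" for y
  proof -
    have hc: "height (?c j + y) = height y - real j / real k" for j
      using height_add[of y "- (real j / real k)"] by (simp add: add.commute)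
    have in_iff: "(0 \<le> height (?c j + y) \<and> height (?c j + y) < 1 / real k) \<longleftrightarrow> \<lfloor>real k * height y\<rfloor> = int j" for j
    proof -
      have "(0 \<le> height (?c j + y) \<and> height (?c j + y) < 1 / real k) \<longleftrightarrow> real j \<le> real k * height y \<and> real k * height y < real j + 1"
      proof -
        have "height (?c j + y) = (real k * height y - real j) / real k"
          unfolding hc using k by (simp add: diff_divide_distrib)
        then show ?thesis using k by (simp only: divide_less_cancel zero_le_divide_iff) auto
      qed
      also have "\<dots> \<longleftrightarrow> \<lfloor>real k * height y\<rfloor> = int j" by (simp add: floor_eq_iff)
      finally show ?thesis .
    qed
    have sq: "h (?c j + y) = h (squeeze k y)" if "\<lfloor>real k * height y\<rfloor> = int j" for j
      using that by (simp add: squeeze_def)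
    have "(\<Sum>j<k. ?b (?c j + y)) = (\<Sum>j<k. if \<lfloor>real k * height y\<rfloor> = int j then h (squeeze k y) else 0)"
      by (intro sum.cong refl) (simp only: in_iff, simp add: sq[simplified])
    also have "\<dots> = of_bool (0 \<le> height y \<and> height y < 1) * h (squeeze k y)"
    proof (cases "0 \<le> height y \<and> height y < 1")
      case True
      define j0 where "j0 = nat \<lfloor>real k * height y\<rfloor>"
      have p: "0 \<le> real k * height y" "real k * height y < real k" using True k by auto
      have j0: "\<lfloor>real k * height y\<rfloor> = int j0" "j0 < k"
        unfolding j0_def using p by (auto simp: nat_less_iff floor_less_iff)
      have "(\<Sum>j<k. if \<lfloor>real k * height y\<rfloor> = int j then h (squeeze k y) else 0) = (\<Sum>j<k. if j = j0 then h (squeeze k y) else 0)"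
        by (intro sum.cong refl) (auto simp: j0(1))
      then show ?thesis using True j0(2) by simp
    next
      case False
      have "\<lfloor>real k * height y\<rfloor> \<noteq> int j" if "j < k" for j
      proof
        assume "\<lfloor>real k * height y\<rfloor> = int j"
        then have "real j \<le> real k * height y" "real k * height y < real j + 1" by linarith+
        moreover have "real j + 1 \<le> real k" using that by simp
        ultimately have "0 \<le> real k * height y" "real k * height y < real k * 1" by linarith+
        then show False using False k by (auto simp: zero_le_mult_iff)
      qed
      then show ?thesis using False by simp
    qed
    finally show ?thesis by simp
  qed
  have "(LINT y|lborel. (\<Sum>j<k. ?b (?c j + y))) = (\<Sum>j<k. LINT y|lborel. ?b (?c j + y))"
    by (rule Bochner_Integration.integral_sum) (simp only: integrable_shift[OF bm] bi)
  also have "\<dots> = (\<Sum>j<k. LINT y|lborel. ?b y)"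
    by (simp only: integral_shift[OF bm])
  finally show ?thesis using split by simp
qed

end

lemma face_integral_neg:
  assumes "flat_face F n z0" and g: "continuous_on UNIV (g :: real^'n::finite \<Rightarrow> real)"
  shows "(LINT x|face_measure F (- n). g x) = (LINT x|face_measure F n. g x)"
proof -
  interpret p: flat_face F n z0 by fact
  interpret m: flat_face F "- n" z0
    using p.F p.n p.flat by unfold_locales auto
  have [measurable]: "g \<in> borel_measurable borel" using g by (rule borel_measurable_continuous_onI)
  let ?h = "\<lambda>y. indicator (prism F n) y * g (p.foot y)"
  have hm: "m.height y = - p.height y" "m.foot y = p.foot y" for y
    by (auto simp: m.height_def p.height_def m.foot_def p.foot_def)
  have "?h (n + y) = indicator (prism F (- n)) y * g (m.foot y)" for y
    using p.height_add[of y 1] p.foot_add[of y 1]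
    by (auto simp: indicator_def m.prism_iff p.prism_iff hm add.commute)
  moreover have "(LINT y|lborel. ?h (n + y)) = (LINT y|lborel. ?h y)"
    by (rule p.integral_shift) measurable
  ultimately show ?thesis by (simp add: p.face_integral_eq[OF g] m.face_integral_eq[OF g])
qed

lemma integral_homothety:
  fixes f :: "real^'n::finite \<Rightarrow> real"
  assumes [measurable]: "f \<in> borel_measurable borel" and s: "s > 0"
  shows "(LINT x|lborel. f x) = s ^ CARD('n) * (LINT x|lborel. f (t + s *\<^sub>R x))"
proof -
  have "(LINT x|lborel. f x) = integral\<^sup>L (density (distr lborel borel (\<lambda>x. t + s *\<^sub>R x)) (\<lambda>_. ennreal (\<bar>s\<bar> ^ DIM(real^'n)))) f"
    using lborel_affine[of s t] s by simp
  also have "\<dots> = integral\<^sup>L (distr lborel borel (\<lambda>x. t + s *\<^sub>R x)) (\<lambda>x. \<bar>s\<bar> ^ DIM(real^'n) *\<^sub>R f x)"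
    by (rule integral_density) (use s in auto)
  also have "\<dots> = (LINT x|lborel. \<bar>s\<bar> ^ DIM(real^'n) *\<^sub>R f (t + s *\<^sub>R x))"
    by (rule integral_distr) auto
  finally show ?thesis using s by simp
qed

locale solid_cone = flat_face F n z0
  for F :: "(real^'n::finite) set" and n z0 +
  fixes P :: "real^'n"
  assumes apex: "0 < (P - z0) \<bullet> n"
begin

definition eta :: real where "eta = (P - z0) \<bullet> n"

definition T :: "(real^'n) set" where "T = convex hull (insert P F)"

lemma eta_pos: "eta > 0" using apex by (simp add: eta_def)

lemma T_iff: "x \<in> T \<longleftrightarrow> (\<exists>t z. 0 \<le> t \<and> t \<le> 1 \<and> z \<in> F \<and> x = (1 - t) *\<^sub>R z + t *\<^sub>R P)"
proof -
  have "F \<noteq> {}" using F by auto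
  then have "T = {x. \<exists>u\<ge>0. \<exists>v\<ge>0. \<exists>b. u + v = 1 \<and> b \<in> F \<and> x = u *\<^sub>R P + v *\<^sub>R b}"
    unfolding T_def by (subst convex_hull_insert) (auto simp: convex_hull_eq[THEN iffD2, OF F(2)])
  moreover have "(\<exists>u\<ge>0. \<exists>v\<ge>0. \<exists>b. u + v = 1 \<and> b \<in> F \<and> x = u *\<^sub>R P + v *\<^sub>R b)
      \<longleftrightarrow> (\<exists>t z. 0 \<le> t \<and> t \<le> 1 \<and> z \<in> F \<and> x = (1 - t) *\<^sub>R z + t *\<^sub>R P)" (is "?L \<longleftrightarrow> ?R")
  proof
    assume ?L
    then obtain u v b where u: "0 \<le> u" "0 \<le> v" "u + v = 1" "b \<in> F" "x = u *\<^sub>R P + v *\<^sub>R b" by blast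
    then have "v = 1 - u" by simp
    then show ?R using u by (intro exI[of _ u] exI[of _ b]) (auto simp: add.commute)
  next
    assume ?R
    then obtain t z where t: "0 \<le> t" "t \<le> 1" "z \<in> F" "x = (1 - t) *\<^sub>R z + t *\<^sub>R P" by blast
    show ?L
      by (rule exI[of _ t], intro conjI t(1), rule exI[of _ "1 - t"], intro conjI, use t in simp, rule exI[of _ z])
        (use t in \<open>simp add: add.commute\<close>)
  qed
  ultimately show ?thesis by blast
qed

lemma height_segment: "z \<in> F \<Longrightarrow> height ((1 - t) *\<^sub>R z + t *\<^sub>R P) = t * eta"
  using flat[of z] by (simp add: height_def eta_def algebra_simps inner_diff_left inner_add_left)

lemma compact_T: "compact T"
  unfolding T_def by (intro compact_convex_hull compact_insert F)

lemma convex_T: "convex T" unfolding T_def by simp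

lemma T_borel [measurable]: "T \<in> sets borel"
  by (simp add: borel_compact compact_T)

lemma height_T: "x \<in> T \<Longrightarrow> 0 \<le> height x \<and> height x \<le> eta"
  using eta_pos by (auto simp: T_iff height_segment)

lemma T_iff_base:
  assumes "0 \<le> height x" "height x < eta"
  shows "x \<in> T \<longleftrightarrow> (1 / (1 - height x / eta)) *\<^sub>R (x - (height x / eta) *\<^sub>R P) \<in> F"
proof
  let ?t = "height x / eta"
  have t: "0 \<le> ?t" "?t < 1" using assms eta_pos by auto
  {
    assume "x \<in> T"
    then obtain t z where tz: "z \<in> F" "x = (1 - t) *\<^sub>R z + t *\<^sub>R P" by (auto simp: T_iff)
    then have "?t = t" using eta_pos by (simp add: height_segment)
    then show "(1 / (1 - ?t)) *\<^sub>R (x - ?t *\<^sub>R P) \<in> F" using tz t by simp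
  next
    assume z: "(1 / (1 - ?t)) *\<^sub>R (x - ?t *\<^sub>R P) \<in> F"
    have c: "(1 - ?t) * (1 / (1 - ?t)) = 1" using t(2) by (metis diff_gt_0_iff_gt less_irrefl nonzero_mult_div_cancel_left times_divide_eq_right mult.right_neutral)
    have "x = (1 - ?t) *\<^sub>R ((1 / (1 - ?t)) *\<^sub>R (x - ?t *\<^sub>R P)) + ?t *\<^sub>R P"
      by (simp only: scaleR_scaleR c scaleR_one diff_add_cancel)
    then show "x \<in> T" unfolding T_iff using z t by (meson less_imp_le)
  }
qed

text \<open>Removing the layer of relative height \<open>e\<close> at the base leaves a homothetic copy
  of the cone; the integral over the layer is therefore a difference of integrals over the cone.\<close>

lemma homothety_iff:
  assumes e: "0 < e" "e < 1"
  shows "(P + (1 - e) *\<^sub>R (x - P) \<in> T \<and> e * eta \<le> height (P + (1 - e) *\<^sub>R (x - P))) \<longleftrightarrow> x \<in> T"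
proof
  assume "x \<in> T"
  then obtain t z where tz: "0 \<le> t" "t \<le> 1" "z \<in> F" "x = (1 - t) *\<^sub>R z + t *\<^sub>R P" by (auto simp: T_iff)
  let ?t = "1 - (1 - e) * (1 - t)"
  have x: "P + (1 - e) *\<^sub>R (x - P) = (1 - ?t) *\<^sub>R z + ?t *\<^sub>R P"
    by (simp add: tz(4) algebra_simps)
  have "(1 - e) * (1 - t) \<le> 1 - e" "0 \<le> (1 - e) * (1 - t)"
    using e tz by (auto simp: mult_left_le)
  then have t: "e \<le> ?t" "?t \<le> 1" "0 \<le> ?t" using e by linarith+
  have "P + (1 - e) *\<^sub>R (x - P) \<in> T" unfolding T_iff x using t tz(3) by blast
  moreover have "e * eta \<le> height (P + (1 - e) *\<^sub>R (x - P))"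
    unfolding x height_segment[OF tz(3)] using t(1) eta_pos by simp
  ultimately show "P + (1 - e) *\<^sub>R (x - P) \<in> T \<and> e * eta \<le> height (P + (1 - e) *\<^sub>R (x - P))" by simp
next
  assume A: "P + (1 - e) *\<^sub>R (x - P) \<in> T \<and> e * eta \<le> height (P + (1 - e) *\<^sub>R (x - P))"
  then obtain t z where tz: "0 \<le> t" "t \<le> 1" "z \<in> F" "P + (1 - e) *\<^sub>R (x - P) = (1 - t) *\<^sub>R z + t *\<^sub>R P" by (auto simp: T_iff)
  have "e * eta \<le> t * eta" using A unfolding tz(4) height_segment[OF tz(3)] by simp
  then have t: "e \<le> t" using eta_pos by simp
  let ?t = "1 - (1 - t) / (1 - e)"
  have "(1 - e) *\<^sub>R (x - P) = (1 - t) *\<^sub>R (z - P)" using tz(4) by (simp add: algebra_simps)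
  then have "x - P = (1 / (1 - e)) *\<^sub>R ((1 - t) *\<^sub>R (z - P))"
  proof -
    have "x - P = (1 / (1 - e)) *\<^sub>R ((1 - e) *\<^sub>R (x - P))" using e by simp
    then show ?thesis using \<open>(1 - e) *\<^sub>R (x - P) = (1 - t) *\<^sub>R (z - P)\<close> by simp
  qed
  then have "x = P + ((1 - t) / (1 - e)) *\<^sub>R (z - P)" by (simp add: diff_eq_eq add.commute)
  moreover have "P + c *\<^sub>R (z - P) = (1 - (1 - c)) *\<^sub>R z + (1 - c) *\<^sub>R P" for c :: real
    by (simp add: algebra_simps)
  ultimately have "x = (1 - ?t) *\<^sub>R z + ?t *\<^sub>R P" by simp
  moreover have "0 \<le> ?t" "?t \<le> 1" using t tz e by (auto simp: field_simps)
  ultimately show "x \<in> T" unfolding T_iff using tz(3) by blast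
qed

text \<open>Inside the prism over the relative interior of the base, the layer of \<open>T\<close> near the base is, after
  squeezing, eventually everything.\<close>

lemma indicator_squeeze_tendsto:
  assumes y: "y \<notin> frontier (prism F n)"
  shows "(\<lambda>k. of_bool (0 \<le> height y \<and> height y < 1) * indicat_real T (squeeze (Suc k) y))
    \<longlonglongrightarrow> indicator (prism F n) y"
proof -
  let ?x = "\<lambda>k. squeeze (Suc k) y"
  let ?z = "\<lambda>k. (1 / (1 - height (?x k) / eta)) *\<^sub>R (?x k - (height (?x k) / eta) *\<^sub>R P)"
  have hx: "(\<lambda>k. height (?x k)) \<longlonglongrightarrow> 0"
  proof -
    have "isCont height (foot y)" using continuous_height[of UNIV] by (simp add: continuous_on_eq_continuous_at)
    from isCont_tendsto_compose[OF this squeeze_tendsto[of y]] show ?thesis by (simp add: height_foot)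
  qed
  have ev: "\<forall>\<^sub>F k in sequentially. height (?x k) < eta"
    using order_tendstoD(2)[OF hx eta_pos] .
  have z: "?z \<longlonglongrightarrow> foot y"
  proof -
    have "?z \<longlonglongrightarrow> (1 / (1 - 0 / eta)) *\<^sub>R (foot y - (0 / eta) *\<^sub>R P)"
      using eta_pos by (intro tendsto_intros hx squeeze_tendsto) auto
    then show ?thesis by simp
  qed
  have iff: "\<forall>\<^sub>F k in sequentially. ?x k \<in> T \<longleftrightarrow> ?z k \<in> F"
    using ev by eventually_elim (rule T_iff_base, use height_squeeze(1)[of "Suc _" y] in auto)
  show ?thesis
  proof (cases "y \<in> prism F n")
    case True
    then have yi: "y \<in> interior (prism F n)"
      using y closure_closed[OF compact_imp_closed[OF compact_prism]] by (simp add: frontier_def)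
    have "(\<lambda>k. ?z k + height y *\<^sub>R n) \<longlonglongrightarrow> foot y + height y *\<^sub>R n"
      by (intro tendsto_intros z)
    then have "(\<lambda>k. ?z k + height y *\<^sub>R n) \<longlonglongrightarrow> y" using foot_decomp[of y] by simp
    then have "\<forall>\<^sub>F k in sequentially. ?z k + height y *\<^sub>R n \<in> interior (prism F n)"
      using topological_tendstoD[OF _ open_interior yi] by blast
    then have in_F: "\<forall>\<^sub>F k in sequentially. ?z k \<in> F"
      using ev
    proof eventually_elim
      case (elim k)
      have "foot (?z k + height y *\<^sub>R n) \<in> F" using elim(1) interior_subset prism_iff by blast
      moreover have "height (?z k) = 0"
      proof -
        let ?t = "height (?x k) / eta"
        have "(v - t *\<^sub>R P - (1 - t) *\<^sub>R z0) \<bullet> n = height v - t * eta" for v t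
          by (simp add: height_def eta_def algebra_simps inner_diff_left)
        then have "(?x k - ?t *\<^sub>R P - (1 - ?t) *\<^sub>R z0) \<bullet> n = height (?x k) - ?t * eta" .
        also have "\<dots> = 0" using eta_pos by simp
        finally have 0: "(?x k - ?t *\<^sub>R P - (1 - ?t) *\<^sub>R z0) \<bullet> n = 0" .
        have "?z k - z0 = (1 / (1 - ?t)) *\<^sub>R (?x k - ?t *\<^sub>R P - (1 - ?t) *\<^sub>R z0)"
          using elim(2) eta_pos by (simp add: scaleR_diff_right)
        then show ?thesis using 0 by (simp add: height_def)
      qed
      ultimately show ?case by (simp add: foot_add) (simp add: foot_def)
    qed
    have h: "0 \<le> height y \<and> height y < 1"
    proof -
      obtain e where e: "e > 0" "ball y e \<subseteq> prism F n" using yi by (auto simp: mem_interior)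
      have "y + (e / 2) *\<^sub>R n \<in> ball y e" using e n by (simp add: dist_norm)
      then have "height y + e / 2 \<le> 1" using e(2) by (auto simp: prism_iff height_add subset_iff)
      then show ?thesis using True e(1) by (simp add: prism_iff)
    qed
    have "\<forall>\<^sub>F k in sequentially. of_bool (0 \<le> height y \<and> height y < 1) * indicat_real T (?x k) = indicator (prism F n) y"
      using in_F iff by eventually_elim (use h True in simp)
    then show ?thesis by (rule tendsto_eventually)
  next
    case False
    show ?thesis
    proof (cases "0 \<le> height y \<and> height y < 1")
      case h: True
      then have "foot y \<in> - F" using False by (simp add: prism_iff)
      then have "\<forall>\<^sub>F k in sequentially. ?z k \<in> - F"
        using topological_tendstoD[OF z, of "- F"] F(1) by (simp add: compact_imp_closed open_Compl)
      then have "\<forall>\<^sub>F k in sequentially. of_bool (0 \<le> height y \<and> height y < 1) * indicat_real T (?x k) = indicator (prism F n) y"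
        using iff by eventually_elim (use False in simp)
      then show ?thesis by (rule tendsto_eventually)
    qed (use False in auto)
  qed
qed

text \<open>The integral over a thin layer at the base, divided by the thickness, is by squeezing an
  integral over the slab of height one, where the dominated convergence theorem applies.\<close>

lemma layer_limit:
  fixes g :: "real^'n \<Rightarrow> real"
  assumes g: "continuous_on UNIV g"
  shows "(\<lambda>k. real (Suc k) * (LINT x|lborel. of_bool (0 \<le> height x \<and> height x < 1 / real (Suc k)) * (indicator T x * g x)))
    \<longlonglongrightarrow> (LINT x|face_measure F n. g x)"
proof -
  have [measurable]: "g \<in> borel_measurable borel" using g by (rule borel_measurable_continuous_onI)
  let ?h = "\<lambda>x. indicator T x * g x"
  have hi: "integrable lborel ?h"
    using borel_integrable_compact[OF compact_T continuous_on_subset[OF g]] by simp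
  let ?q = "\<lambda>k y. of_bool (0 \<le> height y \<and> height y < 1) * ?h (squeeze (Suc k) y)"
  have eq: "real (Suc k) * (LINT x|lborel. of_bool (0 \<le> height x \<and> height x < 1 / real (Suc k)) * ?h x) = (LINT y|lborel. ?q k y)" for k
    by (rule integral_squeeze[symmetric]) (use hi in auto)
  obtain B where B: "\<And>x. x \<in> T \<Longrightarrow> \<bar>g x\<bar> \<le> B"
    using compact_imp_bounded[OF compact_continuous_image[OF continuous_on_subset[OF g] compact_T]]
    by (auto simp: bounded_iff)
  obtain R where R: "\<And>x. x \<in> T \<Longrightarrow> norm x \<le> R"
    using compact_imp_bounded[OF compact_T] by (auto simp: bounded_iff)
  have "(\<lambda>k. LINT y|lborel. ?q k y) \<longlonglongrightarrow> (LINT y|lborel. indicator (prism F n) y * g (foot y))"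
  proof (rule integral_dominated_convergence)
    show "integrable lborel (\<lambda>y. max B 0 * indicator (cball 0 (R + 1)) y :: real)"
      using emeasure_lborel_cball_finite[of 0 "R + 1"]
      by (intro integrable_mult_right integrable_real_indicator) (simp_all add: infinity_ennreal_def)
    show "AE y in lborel. norm (?q k y) \<le> max B 0 * indicator (cball 0 (R + 1)) y" for k
    proof (rule AE_I2)
      fix y
      show "norm (?q k y) \<le> max B 0 * indicator (cball 0 (R + 1)) y"
      proof (cases "0 \<le> height y \<and> height y < 1 \<and> squeeze (Suc k) y \<in> T")
        case True
        have "y = squeeze (Suc k) y + (height y - height (squeeze (Suc k) y)) *\<^sub>R n"
        proof -
          have "y = foot y + c *\<^sub>R n + (height y - c) *\<^sub>R n" for c by (simp add: foot_def algebra_simps)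
          from this[of "height (squeeze (Suc k) y)"] show ?thesis by (simp flip: squeeze_decomp)
        qed
        then have "norm y \<le> norm (squeeze (Suc k) y) + \<bar>height y - height (squeeze (Suc k) y)\<bar>"
          using norm_triangle_ineq[of "squeeze (Suc k) y" "(height y - height (squeeze (Suc k) y)) *\<^sub>R n"] n by simp
        moreover have "\<bar>height y - height (squeeze (Suc k) y)\<bar> \<le> 1"
        proof -
          have "1 / real (Suc k) \<le> 1" by simp
          then show ?thesis using True height_squeeze[of "Suc k" y] by linarith
        qed
        moreover have "norm (squeeze (Suc k) y) \<le> R" using R True by blast
        ultimately have "norm y \<le> R + 1" by linarith
        then show ?thesis using True B[of "squeeze (Suc k) y"] by (simp add: abs_mult le_max_iff_disj)
      qed (auto simp: abs_mult)
    qed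
    have "frontier (prism F n) \<in> null_sets lborel"
      using negligible_convex_frontier[OF convex_prism] 
      by (simp add: negligible_iff_null_sets null_sets_completion_iff borel_closed)
    then have "AE y in lborel. y \<notin> frontier (prism F n)" by (rule AE_not_in)
    then show "AE y in lborel. (\<lambda>k. ?q k y) \<longlonglongrightarrow> indicator (prism F n) y * g (foot y)"
    proof eventually_elim
      case (elim y)
      have "isCont g (foot y)" using g by (simp add: continuous_on_eq_continuous_at)
      from tendsto_mult[OF indicator_squeeze_tendsto[OF elim] isCont_tendsto_compose[OF this squeeze_tendsto]]
      show ?case by (simp add: mult.assoc)
    qed
  qed measurable
  then show ?thesis unfolding eq face_integral_eq[OF g] .
qed

text \<open>Up to the factor \<open>eta\<close>, both sides are the limit of the integral of
  \<open>g\<close> over a thin layer at the base, divided by its thickness: the layer is the difference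
  of the cone and a homothetic copy, and the integrand on the left-hand side is the negative derivative
  of \<open>(1 - e)\<^sup>n g(P + (1 - e)(x - P))\<close> at \<open>e = 0\<close>.\<close>

theorem cone_formula:
  fixes g :: "real^'n \<Rightarrow> real"
  assumes g: "Ck (Suc 0) g"
  shows "(LINT x|vol T. real CARD('n) * g x + (\<Sum>i\<in>UNIV. (x - P) $ i * pd i g x))
    = eta * (LINT x|face_measure F n. g x)"
proof -
  let ?N = "CARD('n)"
  let ?G = "\<lambda>x. real ?N * g x + (\<Sum>i\<in>UNIV. (x - P) $ i * pd i g x)"
  have cg: "continuous_on UNIV g" using Ck_continuous[OF g] .
  have cpd: "continuous_on UNIV (pd i g)" for i using g by simp
  have cG: "continuous_on UNIV ?G" by (intro continuous_intros cg cpd)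
  have gm [measurable]: "g \<in> borel_measurable borel" "?G \<in> borel_measurable borel"
    using cg cG by (auto intro: borel_measurable_continuous_onI)
  define e where "e k = 1 / (eta * real (Suc k))" for k
  define q where "q k x = (g x - (1 - e k) ^ ?N * g (P + (1 - e k) *\<^sub>R (x - P))) / e k" for k x
  have e0: "0 < e k" for k using eta_pos by (simp add: e_def)
  have elim: "e \<longlonglongrightarrow> 0"
  proof -
    have "(\<lambda>k. (1 / eta) * inverse (real (Suc k))) \<longlonglongrightarrow> (1 / eta) * 0"
      by (intro tendsto_intros LIMSEQ_inverse_real_of_nat)
    moreover have "(\<lambda>k. (1 / eta) * inverse (real (Suc k))) = e"
      by (simp add: e_def fun_eq_iff divide_inverse)
    ultimately show ?thesis by simp
  qed
  have e1: "\<forall>\<^sub>F k in sequentially. e k < 1" using order_tendstoD(2)[OF elim, of 1] by simp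
  have ig: "integrable lborel (\<lambda>x. indicator T x * f x)" if "continuous_on UNIV f" for f :: "_ \<Rightarrow> real"
    using borel_integrable_compact[OF compact_T continuous_on_subset[OF that]] by simp
  have layer: "real (Suc k) * (LINT x|lborel. of_bool (0 \<le> height x \<and> height x < 1 / real (Suc k)) * (indicator T x * g x))
      = (1 / eta) * (LINT x|lborel. indicator T x * q k x)" if k: "e k < 1" for k
  proof -
    let ?s = "1 - e k"
    have ek: "e k * eta = 1 / real (Suc k)" using eta_pos by (simp add: e_def)
    have ek': "real (Suc k) * e k = 1 / eta" by (simp add: e_def del: of_nat_Suc)
    have "(LINT x|lborel. of_bool (0 \<le> height x \<and> height x < 1 / real (Suc k)) * (indicator T x * g x))
        = (LINT x|lborel. indicator T x * g x - of_bool (x \<in> T \<and> e k * eta \<le> height x) * g x)"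
      unfolding ek using height_T by (intro Bochner_Integration.integral_cong refl) (auto simp: indicator_def)
    also have "\<dots> = (LINT x|lborel. indicator T x * g x) - (LINT x|lborel. of_bool (x \<in> T \<and> e k * eta \<le> height x) * g x)"
      by (intro Bochner_Integration.integral_diff ig cg Bochner_Integration.integrable_bound[OF ig[OF cg]]) (auto intro!: AE_I2)
    also have "(LINT x|lborel. of_bool (x \<in> T \<and> e k * eta \<le> height x) * g x)
        = ?s ^ ?N * (LINT x|lborel. indicator T x * g (P + ?s *\<^sub>R (x - P)))"
    proof -
      let ?t = "P - ?s *\<^sub>R P"
      have "(LINT x|lborel. of_bool (x \<in> T \<and> e k * eta \<le> height x) * g x)
          = ?s ^ ?N * (LINT x|lborel. of_bool (?t + ?s *\<^sub>R x \<in> T \<and> e k * eta \<le> height (?t + ?s *\<^sub>R x)) * g (?t + ?s *\<^sub>R x))"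
        by (rule integral_homothety) (use k in auto)
      moreover have "?t + ?s *\<^sub>R x = P + ?s *\<^sub>R (x - P)" for x by (simp add: algebra_simps)
      moreover have "of_bool (P + ?s *\<^sub>R (x - P) \<in> T \<and> e k * eta \<le> height (P + ?s *\<^sub>R (x - P))) = (indicator T x :: real)" for x
        using homothety_iff[OF e0 k, of x] by (simp add: indicator_def)
      ultimately show ?thesis by simp
    qed
    also have "(LINT x|lborel. indicator T x * g x) - ?s ^ ?N * (LINT x|lborel. indicator T x * g (P + ?s *\<^sub>R (x - P)))
        = (LINT x|lborel. indicator T x * g x - ?s ^ ?N * (indicator T x * g (P + ?s *\<^sub>R (x - P))))"
      by (subst Bochner_Integration.integral_diff)
        (auto intro!: ig cg continuous_on_compose2[OF cg] continuous_intros)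
    also have "\<dots> = (LINT x|lborel. e k * (indicator T x * q k x))"
    proof (intro Bochner_Integration.integral_cong refl)
      fix x
      have "e k * q k x = g x - ?s ^ ?N * g (P + ?s *\<^sub>R (x - P))" using e0[of k] by (simp add: q_def)
      then show "indicator T x * g x - ?s ^ ?N * (indicator T x * g (P + ?s *\<^sub>R (x - P))) = e k * (indicator T x * q k x)"
        by (simp add: mult.left_commute[of "e k"] right_diff_distrib mult.left_commute)
    qed
    finally have "(LINT x|lborel. of_bool (0 \<le> height x \<and> height x < 1 / real (Suc k)) * (indicator T x * g x))
        = e k * (LINT x|lborel. indicator T x * q k x)" by (simp only: integral_mult_right_zero)
    then show ?thesis by (simp only: mult.assoc[symmetric] ek')
  qed
  have "(\<lambda>k. LINT x|lborel. indicator T x * q k x) \<longlonglongrightarrow> (LINT x|lborel. indicator T x * ?G x)"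
  proof -
    obtain B where B: "\<And>x. x \<in> T \<Longrightarrow> \<bar>g x\<bar> \<le> B"
      using compact_imp_bounded[OF compact_continuous_image[OF continuous_on_subset[OF cg] compact_T]]
      by (auto simp: bounded_iff)
    have "\<exists>C. \<forall>x\<in>T. \<bar>pd i g x\<bar> \<le> C" for i
      using compact_imp_bounded[OF compact_continuous_image[OF continuous_on_subset[OF cpd[of i]] compact_T]]
      by (auto simp: bounded_iff)
    then obtain C where C: "\<And>i x. x \<in> T \<Longrightarrow> \<bar>pd i g x\<bar> \<le> C i" by metis
    obtain R where R: "\<And>x. x \<in> T \<Longrightarrow> norm (x - P) \<le> R"
      using compact_imp_bounded[OF compact_T] bounded_translation_minus[of T P] by (auto simp: bounded_iff)
    define \<Phi> where "\<Phi> x s = s ^ ?N * g (P + s *\<^sub>R (x - P))" for x s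
    define \<Phi>' where "\<Phi>' x s = real ?N * s ^ (?N - 1) * g (P + s *\<^sub>R (x - P)) + s ^ ?N * (\<Sum>i\<in>UNIV. (x - P) $ i * pd i g (P + s *\<^sub>R (x - P)))" for x s
    have D: "(\<Phi> x has_real_derivative \<Phi>' x s) (at s)" for x s
      unfolding \<Phi>_def[abs_def] \<Phi>'_def
      by (rule DERIV_cong[OF DERIV_mult[OF DERIV_power[OF DERIV_ident] Ck_line_derivative[OF g]]]) simp
    have qb: "\<bar>q k x\<bar> \<le> real ?N * \<bar>B\<bar> + (\<Sum>i\<in>UNIV. \<bar>R\<bar> * \<bar>C i\<bar>)" if x: "x \<in> T" and k: "e k < 1" for k x
    proof -
      obtain s where s: "1 - e k < s" "s < 1" "\<Phi> x 1 - \<Phi> x (1 - e k) = (1 - (1 - e k)) * \<Phi>' x s"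
        using MVT2[of "1 - e k" 1 "\<Phi> x" "\<Phi>' x"] e0[of k] D by auto
      have s01: "0 \<le> s" "s \<le> 1" using s k by auto
      have "P + s *\<^sub>R (x - P) = (1 - s) *\<^sub>R P + s *\<^sub>R x" by (simp add: algebra_simps)
      then have xs: "P + s *\<^sub>R (x - P) \<in> T"
        using convexD_alt[OF convex_T _ x, of P s] s01 hull_subset[of "insert P F"] by (auto simp: T_def)
      have "q k x = \<Phi>' x s"
      proof -
        have "q k x = (\<Phi> x 1 - \<Phi> x (1 - e k)) / e k" by (simp add: q_def \<Phi>_def)
        then show ?thesis unfolding s(3) using e0[of k] by simp
      qed
      also have "\<bar>\<dots>\<bar> \<le> \<bar>real ?N * s ^ (?N - 1) * g (P + s *\<^sub>R (x - P))\<bar> + \<bar>s ^ ?N * (\<Sum>i\<in>UNIV. (x - P) $ i * pd i g (P + s *\<^sub>R (x - P)))\<bar>"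
        unfolding \<Phi>'_def by (rule abs_triangle_ineq)
      also have "\<dots> \<le> real ?N * \<bar>B\<bar> + (\<Sum>i\<in>UNIV. \<bar>R\<bar> * \<bar>C i\<bar>)"
      proof (rule add_mono)
        have "s ^ (?N - 1) * \<bar>g (P + s *\<^sub>R (x - P))\<bar> \<le> 1 * \<bar>B\<bar>"
          using B[OF xs] s01 by (intro mult_mono power_le_one) auto
        then show "\<bar>real ?N * s ^ (?N - 1) * g (P + s *\<^sub>R (x - P))\<bar> \<le> real ?N * \<bar>B\<bar>"
          using s01 by (simp add: abs_mult mult.assoc)
        have "\<bar>s ^ ?N * (\<Sum>i\<in>UNIV. (x - P) $ i * pd i g (P + s *\<^sub>R (x - P)))\<bar> \<le> 1 * \<bar>\<Sum>i\<in>UNIV. (x - P) $ i * pd i g (P + s *\<^sub>R (x - P))\<bar>"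
          unfolding abs_mult using s01 by (intro mult_right_mono) (auto simp: power_le_one)
        also have "\<dots> \<le> (\<Sum>i\<in>UNIV. \<bar>(x - P) $ i * pd i g (P + s *\<^sub>R (x - P))\<bar>)" by simp
        also have "\<dots> \<le> (\<Sum>i\<in>UNIV. \<bar>R\<bar> * \<bar>C i\<bar>)"
          unfolding abs_mult
        proof (intro sum_mono mult_mono)
          fix i
          show "\<bar>(x - P) $ i\<bar> \<le> \<bar>R\<bar>" using component_le_norm_cart[of "x - P" i] R[OF x] by linarith
          show "\<bar>pd i g (P + s *\<^sub>R (x - P))\<bar> \<le> \<bar>C i\<bar>" using C[OF xs, of i] by linarith
        qed auto
        finally show "\<bar>s ^ ?N * (\<Sum>i\<in>UNIV. (x - P) $ i * pd i g (P + s *\<^sub>R (x - P)))\<bar> \<le> (\<Sum>i\<in>UNIV. \<bar>R\<bar> * \<bar>C i\<bar>)" .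
      qed
      finally show ?thesis .
    qed
    obtain k0 where k0: "\<And>k. k \<ge> k0 \<Longrightarrow> e k < 1" using e1 by (auto simp: eventually_sequentially)
    let ?W = "real ?N * \<bar>B\<bar> + (\<Sum>i\<in>UNIV. \<bar>R\<bar> * \<bar>C i\<bar>)"
    have "(\<lambda>k. LINT x|lborel. indicator T x * q (k + k0) x) \<longlonglongrightarrow> (LINT x|lborel. indicator T x * ?G x)"
    proof (rule integral_dominated_convergence)
      show "integrable lborel (\<lambda>x. indicator T x * ?W)" by (rule ig) simp
      show "AE x in lborel. norm (indicator T x * q (k + k0) x) \<le> indicator T x * ?W" for k
      proof (rule AE_I2)
        fix x show "norm (indicator T x * q (k + k0) x) \<le> indicator T x * ?W"
          using qb[of x "k + k0"] k0[of "k + k0"] by (cases "x \<in> T") (simp_all del: of_nat_add)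
      qed
      show "AE x in lborel. (\<lambda>k. indicator T x * q (k + k0) x) \<longlonglongrightarrow> indicator T x * ?G x"
      proof (intro AE_I2 tendsto_mult tendsto_const)
        fix x
        have "((\<lambda>h. (\<Phi> x (1 + h) - \<Phi> x 1) / h) \<longlongrightarrow> \<Phi>' x 1) (at 0)" using D[of x 1] by (simp add: DERIV_def)
        moreover have "filterlim (\<lambda>k. - e k) (at 0) sequentially"
          unfolding filterlim_at using tendsto_minus[OF elim] e0 by (auto simp: less_imp_neq[THEN not_sym] intro!: always_eventually)
        ultimately have "(\<lambda>k. (\<Phi> x (1 + - e k) - \<Phi> x 1) / (- e k)) \<longlonglongrightarrow> \<Phi>' x 1"
          by (rule filterlim_compose)
        moreover have "(\<Phi> x (1 + - e k) - \<Phi> x 1) / (- e k) = q k x" for k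
          using minus_divide_left[of "\<Phi> x 1 - \<Phi> x (1 - e k)" "e k"]
          by (simp add: q_def \<Phi>_def minus_divide_left)
        moreover have "\<Phi>' x 1 = ?G x" by (simp add: \<Phi>'_def)
        ultimately have "(\<lambda>k. q k x) \<longlonglongrightarrow> ?G x" by simp
        then show "(\<lambda>k. q (k + k0) x) \<longlonglongrightarrow> ?G x" by (rule LIMSEQ_ignore_initial_segment)
      qed
      show "(\<lambda>x. indicator T x * ?G x) \<in> borel_measurable lborel"
        using borel_measurable_integrable[OF ig[OF cG]] .
      show "(\<lambda>x. indicator T x * q (k + k0) x) \<in> borel_measurable lborel" for k
        unfolding q_def by measurable
    qed
    then show ?thesis by (rule LIMSEQ_offset)
  qed
  then have "(\<lambda>k. (1 / eta) * (LINT x|lborel. indicator T x * q k x)) \<longlonglongrightarrow> (1 / eta) * (LINT x|lborel. indicator T x * ?G x)"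
    by (intro tendsto_mult tendsto_const)
  moreover have "(\<lambda>k. (1 / eta) * (LINT x|lborel. indicator T x * q k x)) \<longlonglongrightarrow> (LINT x|face_measure F n. g x)"
  proof (rule Lim_transform_eventually[OF layer_limit[OF cg]])
    show "\<forall>\<^sub>F k in sequentially. real (Suc k) * (LINT x|lborel. of_bool (0 \<le> height x \<and> height x < 1 / real (Suc k)) * (indicator T x * g x))
      = (1 / eta) * (LINT x|lborel. indicator T x * q k x)"
      using e1 by eventually_elim (rule layer)
  qed
  ultimately have "(1 / eta) * (LINT x|lborel. indicator T x * ?G x) = (LINT x|face_measure F n. g x)"
    by (rule LIMSEQ_unique)
  moreover have "(LINT x|vol T. ?G x) = (LINT x|lborel. indicator T x * ?G x)"
  proof -
    have "(\<lambda>x. indicator T x *\<^sub>R ?G x) \<in> borel_measurable lborel" by measurable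
    from integral_completion[OF this] show ?thesis
      using sets_lebesgue_compact[OF compact_T] by (simp add: integral_restrict_space)
  qed
  ultimately show ?thesis using eta_pos by (simp add: field_simps)
qed

end

section \<open>The divergence theorem on a simplex\<close>

definition unit_normal :: "(real^'n::finite) set \<Rightarrow> real^'n \<Rightarrow> bool" where
  "unit_normal F n \<longleftrightarrow> norm n = 1 \<and> (\<forall>y\<in>F. \<forall>z\<in>F. (y - z) \<bullet> n = 0)"

lemma unit_normal_uminus: "unit_normal F n \<Longrightarrow> unit_normal F (- n)"
  by (simp add: unit_normal_def)

lemma diff_inner: "(a - b) \<bullet> n = n \<bullet> a - n \<bullet> b" for a b n :: "'a::real_inner"
  by (simp add: inner_commute[of _ n] inner_diff_right)

lemma unit_normal_const: "unit_normal F n \<Longrightarrow> y \<in> F \<Longrightarrow> z \<in> F \<Longrightarrow> n \<bullet> y = n \<bullet> z"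
  unfolding unit_normal_def diff_inner by (metis eq_iff_diff_eq_0)

lemma affine_hull_full_simplex:
  fixes C :: "(real^'n::finite) set"
  assumes "\<not> affine_dependent C" "int (card C) = int CARD('n) + 1"
  shows "affine hull C = UNIV"
  using affine_independent_span_gt[OF assms(1)] assms(2) by simp

text \<open>The point \<open>P\<close> is the vertex opposite to the facet.\<close>

lemma simplex_facet:
  fixes T :: "(real^'n::finite) set"
  assumes T: "int CARD('n) simplex T" and F: "F facet_of T"
  shows "\<exists>P. P \<in> T \<and> T = convex hull (insert P F) \<and> (\<forall>n z. unit_normal F n \<longrightarrow> z \<in> F \<longrightarrow> (P - z) \<bullet> n \<noteq> 0)"
    and "compact F" "convex F" "F \<noteq> {}"
proof -
  obtain C where C: "finite C" "\<not> affine_dependent C" "int (card C) = int CARD('n) + 1" "T = convex hull C"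
    using T by (auto simp: simplex)
  obtain P where P: "P \<in> C" "F = convex hull (C - {P})" "2 \<le> card C"
    using F unfolding C(4) facet_of_convex_hull_affine_independent_alt[OF C(2)] by blast
  have ne: "C - {P} \<noteq> {}"
  proof
    assume "C - {P} = {}"
    then have "C \<subseteq> {P}" by blast
    then show False using P(3) card_mono[of "{P}" C] by simp
  qed
  have TPF: "T = convex hull (insert P F)"
    unfolding C(4) P(2) hull_insert[of convex P "C - {P}", symmetric] by (simp add: insert_absorb P(1))
  have F': "compact F" "convex F" "F \<noteq> {}"
    unfolding P(2) using C(1) ne by (auto intro: finite_imp_compact_convex_hull)
  have "(P - z) \<bullet> n \<noteq> 0" if n: "unit_normal F n" and z: "z \<in> F" for n z
  proof
    assume 0: "(P - z) \<bullet> n = 0"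
    have "C \<subseteq> {x. n \<bullet> x = n \<bullet> z}"
    proof
      fix c assume c: "c \<in> C"
      show "c \<in> {x. n \<bullet> x = n \<bullet> z}"
      proof (cases "c = P")
        case True
        then show ?thesis using 0 by (simp add: diff_inner)
      next
        case False
        then have "c \<in> F" using c unfolding P(2) by (auto intro: hull_inc)
        then have "(c - z) \<bullet> n = 0" using n z by (simp add: unit_normal_def)
        then show ?thesis by (simp add: diff_inner)
      qed
    qed
    then have "affine hull C \<subseteq> {x. n \<bullet> x = n \<bullet> z}"
      by (rule hull_minimal) (rule affine_hyperplane)
    then have "z + n \<in> {x. n \<bullet> x = n \<bullet> z}"
      unfolding affine_hull_full_simplex[OF C(2,3)] by blast
    then show False using n by (simp add: unit_normal_def inner_add_right dot_square_norm)
  qed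
  then show "\<exists>P. P \<in> T \<and> T = convex hull (insert P F) \<and> (\<forall>n z. unit_normal F n \<longrightarrow> z \<in> F \<longrightarrow> (P - z) \<bullet> n \<noteq> 0)"
    by (intro exI[of _ P] conjI TPF allI impI) (simp_all add: C(4) hull_inc P(1))
  show "compact F" "convex F" "F \<noteq> {}" using F' by auto
qed

definition apex :: "(real^'n::finite) set \<Rightarrow> (real^'n) set \<Rightarrow> real^'n" where
  "apex T F = (SOME P. P \<in> T \<and> T = convex hull (insert P F) \<and>
     (\<forall>n z. unit_normal F n \<longrightarrow> z \<in> F \<longrightarrow> (P - z) \<bullet> n \<noteq> 0))"

lemma apex:
  fixes T :: "(real^'n::finite) set"
  assumes "int CARD('n) simplex T" "F facet_of T"
  shows "apex T F \<in> T" "T = convex hull (insert (apex T F) F)"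
    "unit_normal F n \<Longrightarrow> z \<in> F \<Longrightarrow> (apex T F - z) \<bullet> n \<noteq> 0"
  using someI_ex[OF simplex_facet(1)[OF assms]] unfolding apex_def[symmetric] by auto

lemma flat_face_unit_normal:
  assumes "unit_normal F n" "compact F" "convex F" "z \<in> F"
  shows "flat_face F n z"
  using assms by unfold_locales (auto simp: unit_normal_def)

lemma solid_cone_oriented:
  assumes n: "unit_normal F n" and F: "compact F" "convex F" "z \<in> F" and P: "(P - z) \<bullet> n \<noteq> 0"
  defines "m \<equiv> (if (P - z) \<bullet> n > 0 then n else - n)"
  shows "solid_cone F m z P" "unit_normal F m"
proof -
  show m: "unit_normal F m" using n unit_normal_uminus[OF n] by (simp add: m_def)
  have "0 < (P - z) \<bullet> m" using P by (auto simp: m_def)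
  then show "solid_cone F m z P"
    using flat_face_unit_normal[OF m F] by (simp add: solid_cone_def solid_cone_axioms_def)
qed

text \<open>The relation between a function \<open>g\<close> on \<open>T\<close>, its gradient \<open>G\<close> and its integrals \<open>I F\<close> over the
  facets that the cone formula expresses.  It is linear and passes to limits, so that it also makes
  sense for functions in \<open>H\<^sup>1\<close>; the divergence theorem follows from it.\<close>

definition cone_id :: "((real^'n::finite) set \<Rightarrow> real^'n) \<Rightarrow> (real^'n) set \<Rightarrow> (real^'n \<Rightarrow> real) \<Rightarrow>
    (real^'n \<Rightarrow> real^'n) \<Rightarrow> ((real^'n) set \<Rightarrow> real) \<Rightarrow> bool" where
  "cone_id \<nu> T g G I \<longleftrightarrow> (\<forall>F P z. F facet_of T \<longrightarrow> P \<in> T \<longrightarrow> T = convex hull (insert P F) \<longrightarrow> z \<in> F \<longrightarrow>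
     (LINT x|vol T. real CARD('n) * g x + (x - P) \<bullet> G x) = \<bar>(P - z) \<bullet> \<nu> F\<bar> * I F)"

definition grad :: "(real^'n::finite \<Rightarrow> real) \<Rightarrow> real^'n \<Rightarrow> real^'n" where
  "grad g x = (\<chi> i. pd i g x)"

lemma inner_grad: "v \<bullet> grad g x = (\<Sum>i\<in>UNIV. v $ i * pd i g x)"
  by (simp add: grad_def inner_vec_def)

lemma cone_id_smooth:
  fixes T :: "(real^'n::finite) set"
  assumes T: "int CARD('n) simplex T" and N: "\<And>F. F facet_of T \<Longrightarrow> unit_normal F (\<nu> F)" and g: "Ck (Suc 0) g"
  shows "cone_id \<nu> T g (grad g) (\<lambda>F. LINT x|face_measure F (\<nu> F). g x)"
  unfolding cone_id_def
proof (intro allI impI)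
  fix F P z assume F: "F facet_of T" and P: "P \<in> T" "T = convex hull (insert P F)" and z: "z \<in> F"
  have P': "compact F" "convex F" using simplex_facet[OF T F] by auto
  have n: "unit_normal F (\<nu> F)" using N[OF F] .
  have "(P - z) \<bullet> \<nu> F \<noteq> 0"
  proof
    assume 0: "(P - z) \<bullet> \<nu> F = 0"
    have "insert P F \<subseteq> {x. \<nu> F \<bullet> x = \<nu> F \<bullet> z}"
      using 0 unit_normal_const[OF n _ z] by (auto simp: diff_inner)
    then have "T \<subseteq> {x. \<nu> F \<bullet> x = \<nu> F \<bullet> z}"
      unfolding P(2) by (rule hull_minimal) (rule convex_hyperplane)
    then have "(apex T F - z) \<bullet> \<nu> F = 0" using apex(1)[OF T F] by (auto simp: diff_inner)
    then show False using apex(3)[OF T F n z] by simp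
  qed
  note o = solid_cone_oriented[OF n P' z this]
  define m where "m = (if (P - z) \<bullet> \<nu> F > 0 then \<nu> F else - \<nu> F)"
  interpret c: solid_cone F m z P using o(1) by (simp add: m_def)
  have Teq: "c.T = T" by (simp add: c.T_def P(2))
  have eta: "c.eta = \<bar>(P - z) \<bullet> \<nu> F\<bar>" proof -
    have "c.eta = (P - z) \<bullet> m" by (rule c.eta_def)
    then show ?thesis by (auto simp: m_def)
  qed
  have fi: "(LINT x|face_measure F m. g x) = (LINT x|face_measure F (\<nu> F). g x)"
    using face_integral_neg[OF flat_face_unit_normal[OF n P' z] Ck_continuous[OF g]] by (simp add: m_def)
  show "(LINT x|vol T. real CARD('n) * g x + (x - P) \<bullet> grad g x)
      = \<bar>(P - z) \<bullet> \<nu> F\<bar> * (LINT x|face_measure F (\<nu> F). g x)"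
    using c.cone_formula[OF g] unfolding Teq eta fi inner_grad .
qed

definition outer :: "((real^'n::finite) set \<Rightarrow> real^'n) \<Rightarrow> (real^'n) set \<Rightarrow> (real^'n) set \<Rightarrow> real^'n" where
  "outer \<nu> F T = (if outward (\<nu> F) F T then \<nu> F else - \<nu> F)"

lemma outward_iff:
  assumes T: "T = convex hull (insert P F)" and n: "unit_normal F n" and z: "z \<in> F"
  shows "outward n F T \<longleftrightarrow> (P - z) \<bullet> n \<le> 0"
proof
  assume "outward n F T"
  then show "(P - z) \<bullet> n \<le> 0"
    using z hull_inc[of P "insert P F" convex] by (auto simp: outward_def T inner_diff_left)
next
  assume P: "(P - z) \<bullet> n \<le> 0"
  have "insert P F \<subseteq> {y. n \<bullet> y \<le> n \<bullet> z}"
    using P unit_normal_const[OF n _ z] by (auto simp: diff_inner)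
  then have "T \<subseteq> {y. n \<bullet> y \<le> n \<bullet> z}"
    unfolding T by (rule hull_minimal) (rule convex_halfspace_le)
  moreover have "n \<bullet> w = n \<bullet> z" if "w \<in> F" for w using unit_normal_const[OF n that z] .
  ultimately show "outward n F T" unfolding outward_def inner_commute[of _ n] by auto
qed

text \<open>For an affinely independent set \<open>C\<close> of \<open>n + 1\<close> vertices, a constant field \<open>v\<close> is a combination
  \<open>\<Sum>P. a P * (x - P)\<close> with \<open>\<Sum>P. a P = 0\<close>, so that the divergence theorem is a linear
  combination of the cone formulas with the apexes \<open>P\<close>.\<close>

lemma divergence_simplex:
  fixes T :: "(real^'n::finite) set" and v :: "real^'n"
  assumes T: "int CARD('n) simplex T" and N: "\<And>F. F facet_of T \<Longrightarrow> unit_normal F (\<nu> F)"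
    and g: "integrable (vol T) g" and G: "\<And>P. integrable (vol T) (\<lambda>x. (x - P) \<bullet> G x)"
    and cone: "cone_id \<nu> T g G I"
  shows "(LINT x|vol T. v \<bullet> G x) = (\<Sum>F | F facet_of T. (v \<bullet> outer \<nu> F T) * I F)"
proof -
  obtain C where C: "finite C" "\<not> affine_dependent C" "int (card C) = int CARD('n) + 1" "T = convex hull C"
    using T by (auto simp: simplex)
  have card2: "2 \<le> card C" using C(3) zero_less_card_finite[where 'a = 'n] by linarith
  define \<Phi> where "\<Phi> P = convex hull (C - {P})" for P
  have facets: "{F. F facet_of T} = \<Phi> ` C"
    unfolding C(4) facet_of_convex_hull_affine_independent_alt[OF C(2)] \<Phi>_def using card2 by auto
  have inj: "inj_on \<Phi> C"
  proof (rule inj_onI, rule ccontr)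
    fix P Q assume PQ: "P \<in> C" "Q \<in> C" "\<Phi> P = \<Phi> Q" "P \<noteq> Q"
    then have "Q \<in> convex hull (C - {Q})" using hull_inc[of Q "C - {P}"] by (auto simp: \<Phi>_def)
    then have "Q \<in> affine hull (C - {Q})" using convex_hull_subset_affine_hull by blast
    then show False using C(2) PQ(2) by (auto simp: affine_dependent_def)
  qed
  have TPF: "T = convex hull (insert P (\<Phi> P))" if "P \<in> C" for P
    unfolding C(4) \<Phi>_def hull_insert[of convex P "C - {P}", symmetric] by (simp add: insert_absorb that)
  have PT: "P \<in> T" if "P \<in> C" for P using that by (simp add: C(4) hull_inc)
  have bary: "\<exists>u. sum u C = 1 \<and> (\<Sum>P\<in>C. u P *\<^sub>R P) = w" for w
    using affine_hull_full_simplex[OF C(2,3)] affine_hull_finite[OF C(1)] by auto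
  obtain u0 where u0: "sum u0 C = 1" "(\<Sum>P\<in>C. u0 P *\<^sub>R P) = 0" using bary by blast
  obtain w where w: "sum w C = 1" "(\<Sum>P\<in>C. w P *\<^sub>R P) = v" using bary by blast
  define a where "a P = u0 P - w P" for P
  have a: "sum a C = 0" "(\<Sum>P\<in>C. a P *\<^sub>R P) = - v"
    using u0 w by (simp_all add: a_def sum_subtractf scaleR_diff_left)
  have coef: "a P * \<bar>(P - z) \<bullet> \<nu> (\<Phi> P)\<bar> = v \<bullet> outer \<nu> (\<Phi> P) T" if P: "P \<in> C" and z: "z \<in> \<Phi> P" for P z
  proof -
    have Fp: "\<Phi> P facet_of T" using facets P by blast
    note n = N[OF Fp]
    have "v \<bullet> \<nu> (\<Phi> P) = - (\<Sum>Q\<in>C. a Q * (Q \<bullet> \<nu> (\<Phi> P)))"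
    proof -
      have "(\<Sum>Q\<in>C. a Q * (Q \<bullet> \<nu> (\<Phi> P))) = (\<Sum>Q\<in>C. a Q *\<^sub>R Q) \<bullet> \<nu> (\<Phi> P)" by (simp add: inner_sum_left)
      then show ?thesis by (simp add: a(2))
    qed
    also have "(\<Sum>Q\<in>C. a Q * (Q \<bullet> \<nu> (\<Phi> P))) = (\<Sum>Q\<in>C. a Q * ((Q - z) \<bullet> \<nu> (\<Phi> P)))"
      using a(1) by (simp add: inner_diff_left right_diff_distrib sum_subtractf flip: sum_distrib_right)
    also have "\<dots> = (\<Sum>Q\<in>C. if Q = P then a P * ((P - z) \<bullet> \<nu> (\<Phi> P)) else 0)"
    proof (intro sum.cong refl)
      fix Q assume Q: "Q \<in> C"
      have "(Q - z) \<bullet> \<nu> (\<Phi> P) = 0" if "Q \<noteq> P"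
      proof -
        have "Q \<in> \<Phi> P" unfolding \<Phi>_def using Q that by (intro hull_inc) auto
        then show ?thesis using n z by (simp add: unit_normal_def)
      qed
      then show "a Q * ((Q - z) \<bullet> \<nu> (\<Phi> P)) = (if Q = P then a P * ((P - z) \<bullet> \<nu> (\<Phi> P)) else 0)" by auto
    qed
    also have "\<dots> = a P * ((P - z) \<bullet> \<nu> (\<Phi> P))" using C(1) P by simp
    finally have "v \<bullet> \<nu> (\<Phi> P) = - (a P * ((P - z) \<bullet> \<nu> (\<Phi> P)))" .
    then show ?thesis
      using outward_iff[OF TPF[OF P] n z] by (auto simp: outer_def)
  qed
  have "(LINT x|vol T. v \<bullet> G x) = (LINT x|vol T. (\<Sum>P\<in>C. a P * (real CARD('n) * g x + (x - P) \<bullet> G x)))"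
  proof (intro Bochner_Integration.integral_cong refl)
    fix x
    have "(\<Sum>P\<in>C. a P * (real CARD('n) * g x + (x - P) \<bullet> G x))
        = sum a C * (real CARD('n) * g x + x \<bullet> G x) - (\<Sum>P\<in>C. a P * (P \<bullet> G x))"
      unfolding sum_distrib_right sum_subtractf[symmetric]
      by (intro sum.cong refl) (simp add: inner_diff_left algebra_simps)
    also have "\<dots> = - ((\<Sum>P\<in>C. a P *\<^sub>R P) \<bullet> G x)" by (simp add: a(1) inner_sum_left)
    finally show "v \<bullet> G x = (\<Sum>P\<in>C. a P * (real CARD('n) * g x + (x - P) \<bullet> G x))" by (simp add: a(2))
  qed
  also have "\<dots> = (\<Sum>P\<in>C. a P * (LINT x|vol T. real CARD('n) * g x + (x - P) \<bullet> G x))"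
    using g G by (subst Bochner_Integration.integral_sum) auto
  also have "\<dots> = (\<Sum>P\<in>C. (v \<bullet> outer \<nu> (\<Phi> P) T) * I (\<Phi> P))"
  proof (intro sum.cong refl)
    fix P assume P: "P \<in> C"
    have Fp: "\<Phi> P facet_of T" using facets P by blast
    obtain z where z: "z \<in> \<Phi> P" using simplex_facet(4)[OF T Fp] by blast
    have "(LINT x|vol T. real CARD('n) * g x + (x - P) \<bullet> G x) = \<bar>(P - z) \<bullet> \<nu> (\<Phi> P)\<bar> * I (\<Phi> P)"
      using cone Fp PT[OF P] TPF[OF P] z unfolding cone_id_def by blast
    then show "a P * (LINT x|vol T. real CARD('n) * g x + (x - P) \<bullet> G x) = (v \<bullet> outer \<nu> (\<Phi> P) T) * I (\<Phi> P)"
      using coef[OF P z] by (simp add: mult.assoc[symmetric])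
  qed
  also have "\<dots> = (\<Sum>F | F facet_of T. (v \<bullet> outer \<nu> F T) * I F)"
    unfolding facets by (simp add: sum.reindex[OF inj])
  finally show ?thesis .
qed

lemma card_facets_simplex:
  fixes T :: "(real^'n::finite) set"
  assumes T: "int CARD('n) simplex T"
  shows "finite {F. F facet_of T}" "card {F. F facet_of T} \<le> CARD('n) + 1"
proof -
  obtain C where C: "finite C" "\<not> affine_dependent C" "int (card C) = int CARD('n) + 1" "T = convex hull C"
    using T by (auto simp: simplex)
  have facets: "{F. F facet_of T} \<subseteq> (\<lambda>P. convex hull (C - {P})) ` C"
    unfolding C(4) facet_of_convex_hull_affine_independent_alt[OF C(2)] by auto
  show "finite {F. F facet_of T}" using finite_subset[OF facets] C(1) by blast
  have "card {F. F facet_of T} \<le> card C"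
    using surj_card_le[OF C(1) facets] .
  then show "card {F. F facet_of T} \<le> CARD('n) + 1" using C(3) by linarith
qed

text \<open>The slab between the face and the parallel plane through the apex contains \<open>T\<close>, hence the
  inscribed ball.\<close>

lemma height_ge_inradius:
  fixes T :: "(real^'n::finite) set"
  assumes T: "T = convex hull (insert P F)" and n: "unit_normal F n" and z: "z \<in> F"
    and ball: "cball c r \<subseteq> T" "0 < r"
  shows "2 * r \<le> \<bar>(P - z) \<bullet> n\<bar>"
proof -
  have nn: "n \<bullet> n = 1" using n by (simp add: unit_normal_def dot_square_norm)
  let ?h = "(P - z) \<bullet> n"
  have Fz: "n \<bullet> w = n \<bullet> z" if "w \<in> F" for w using unit_normal_const[OF n that z] .
  have "P \<in> {y. n \<bullet> y \<le> n \<bullet> z + max 0 ?h}" "P \<in> {y. n \<bullet> y \<ge> n \<bullet> z + min 0 ?h}"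
    by (simp_all add: diff_inner)
  then have 1: "insert P F \<subseteq> {y. n \<bullet> y \<le> n \<bullet> z + max 0 ?h}" and 2: "insert P F \<subseteq> {y. n \<bullet> y \<ge> n \<bullet> z + min 0 ?h}"
    using Fz by (auto simp: max_def min_def)
  have "T \<subseteq> {y. n \<bullet> y \<le> n \<bullet> z + max 0 ?h}"
    unfolding T using 1 by (rule hull_minimal) (rule convex_halfspace_le)
  moreover have "T \<subseteq> {y. n \<bullet> y \<ge> n \<bullet> z + min 0 ?h}"
    unfolding T using 2 by (rule hull_minimal) (rule convex_halfspace_ge)
  moreover have "c + r *\<^sub>R n \<in> T" "c - r *\<^sub>R n \<in> T"
    using ball n by (auto simp: unit_normal_def dist_norm subset_iff)
  ultimately have "n \<bullet> (c + r *\<^sub>R n) \<le> n \<bullet> z + max 0 ?h" "n \<bullet> (c - r *\<^sub>R n) \<ge> n \<bullet> z + min 0 ?h" by blast+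
  then show ?thesis by (auto simp: inner_add_right inner_diff_right nn)
qed

text \<open>The cone formula bounds the integral over a facet, since the height is at least the diameter of an
  inscribed ball.\<close>

lemma cone_id_bound:
  fixes T :: "(real^'n::finite) set"
  assumes T: "int CARD('n) simplex T" and F: "F facet_of T" and n: "unit_normal F (\<nu> F)"
    and g: "integrable (vol T) g" and Gm: "G \<in> borel_measurable (vol T)"
    and G: "integrable (vol T) (\<lambda>x. norm (G x))"
    and cone: "cone_id \<nu> T g G I" and ball: "cball c r \<subseteq> T" "0 < r"
  shows "2 * r * \<bar>I F\<bar> \<le> real CARD('n) * (LINT x|vol T. \<bar>g x\<bar>) + diameter T * (LINT x|vol T. norm (G x))"
proof -
  define P where "P = apex T F"
  note P = apex(1,2)[OF T F, folded P_def]
  obtain z where z: "z \<in> F" using simplex_facet(4)[OF T F] by blast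
  have bT: "bounded T" using compact_simplex[OF T] by (rule compact_imp_bounded)
  have "2 * r * \<bar>I F\<bar> \<le> \<bar>(P - z) \<bullet> \<nu> F\<bar> * \<bar>I F\<bar>"
    using height_ge_inradius[OF P(2) n z ball] by (rule mult_right_mono) simp
  also have "\<dots> = \<bar>LINT x|vol T. real CARD('n) * g x + (x - P) \<bullet> G x\<bar>"
    using cone F P z unfolding cone_id_def by (simp add: abs_mult)
  also have "\<dots> \<le> (LINT x|vol T. real CARD('n) * \<bar>g x\<bar> + diameter T * norm (G x))"
  proof (rule order_trans[OF integral_abs_bound integral_mono_AE'])
    show "integrable (vol T) (\<lambda>x. real CARD('n) * \<bar>g x\<bar> + diameter T * norm (G x))"
      using g G by auto
    show "AE x in vol T. \<bar>real CARD('n) * g x + (x - P) \<bullet> G x\<bar> \<le> real CARD('n) * \<bar>g x\<bar> + diameter T * norm (G x)"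
    proof (rule AE_I2)
      fix x assume "x \<in> space (vol T)"
      then have "norm (x - P) \<le> diameter T"
        using diameter_bounded_bound[OF bT, of x P] P(1) by (simp add: dist_norm)
      then have "\<bar>(x - P) \<bullet> G x\<bar> \<le> diameter T * norm (G x)"
        by (meson Cauchy_Schwarz_ineq2 mult_right_mono norm_ge_zero order_trans)
      then show "\<bar>real CARD('n) * g x + (x - P) \<bullet> G x\<bar> \<le> real CARD('n) * \<bar>g x\<bar> + diameter T * norm (G x)"
        using abs_triangle_ineq[of "real CARD('n) * g x" "(x - P) \<bullet> G x"] by (simp add: abs_mult)
    qed
  qed (auto intro!: AE_I2 add_nonneg_nonneg mult_nonneg_nonneg diameter_ge_0[OF bT])
  also have "\<dots> = real CARD('n) * (LINT x|vol T. \<bar>g x\<bar>) + diameter T * (LINT x|vol T. norm (G x))"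
    using g G by simp
  finally show ?thesis .
qed

section \<open>Balls around a point of a face\<close>

text \<open>The section of the inscribed ball through its centre is projected from the apex to the face,
  which enlarges it.\<close>

lemma disc_in_face:
  fixes T :: "(real^'n::finite) set"
  assumes T: "int CARD('n) simplex T" and F: "F facet_of T" and n: "unit_normal F n"
    and ball: "cball c r \<subseteq> T" "0 < r"
  obtains x0 where "x0 \<in> F" "\<And>y. (y - x0) \<bullet> n = 0 \<Longrightarrow> norm (y - x0) \<le> r \<Longrightarrow> y \<in> F"
proof -
  define P where "P = apex T F"
  note P = apex(1,2)[OF T F, folded P_def] simplex_facet(2-4)[OF T F] apex(3)[OF T F, folded P_def]
  obtain z where z: "z \<in> F" using P(5) by blast
  note o = solid_cone_oriented[OF n P(3,4) z P(6)[OF n z]]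
  define m where "m = (if (P - z) \<bullet> n > 0 then n else - n)"
  interpret k: solid_cone F m z P using o(1) by (simp add: m_def)
  have Teq: "k.T = T" by (simp add: k.T_def P(2))
  have up: "c + r *\<^sub>R m \<in> k.T" "c + (- r) *\<^sub>R m \<in> k.T" "c \<in> k.T"
    using ball k.n unfolding Teq by (auto simp: dist_norm subset_iff)
  have hc: "0 < k.height c" "k.height c < k.eta"
    using k.height_T[OF up(1)] k.height_T[OF up(2)] ball(2) unfolding k.height_add by linarith+
  let ?t = "k.height c / k.eta"
  have t: "0 < ?t" "?t < 1" using hc k.eta_pos by auto
  let ?x0 = "(1 / (1 - ?t)) *\<^sub>R (c - ?t *\<^sub>R P)"
  have x0: "?x0 \<in> F" using k.T_iff_base[of c] hc up(3) by simp
  moreover have "y \<in> F" if y: "(y - ?x0) \<bullet> n = 0" "norm (y - ?x0) \<le> r" for y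
  proof -
    let ?c = "c + (1 - ?t) *\<^sub>R (y - ?x0)"
    have "norm ((1 - ?t) *\<^sub>R (y - ?x0)) \<le> 1 * r"
      unfolding norm_scaleR using t y(2) by (intro mult_mono) auto
    then have "?c \<in> k.T" using ball(1) unfolding Teq by (auto simp: dist_norm subset_iff)
    moreover have h: "k.height ?c = k.height c"
    proof -
      have "w \<bullet> m = 0" if "w \<bullet> n = 0" for w using that by (simp add: m_def)
      then have "(y - ?x0) \<bullet> m = 0" using y(1) .
      moreover have "k.height (c + w) = k.height c + w \<bullet> m" for w
        by (simp add: k.height_def inner_add_left inner_diff_left)
      ultimately show ?thesis by (simp only: inner_scaleR_left mult_zero_right add_0_right)
    qed
    ultimately have "(1 / (1 - ?t)) *\<^sub>R (?c - ?t *\<^sub>R P) \<in> F"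
      using k.T_iff_base[of ?c] hc by simp
    moreover have "(1 / (1 - ?t)) *\<^sub>R (?c - ?t *\<^sub>R P) = y"
    proof -
      have "?c - ?t *\<^sub>R P = (c - ?t *\<^sub>R P) + (1 - ?t) *\<^sub>R (y - ?x0)" by (simp only: add_diff_eq diff_add_eq)
      then have "(1 / (1 - ?t)) *\<^sub>R (?c - ?t *\<^sub>R P) = ?x0 + ((1 / (1 - ?t)) * (1 - ?t)) *\<^sub>R (y - ?x0)"
        by (simp only: scaleR_add_right scaleR_scaleR)
      moreover have "u \<noteq> 0 \<Longrightarrow> (1 / u) * u = 1" for u :: real by simp
      then have "(1 / (1 - ?t)) * (1 - ?t) = 1" using t(2) by (metis diff_gt_0_iff_gt less_irrefl)
      ultimately show ?thesis by (simp only: scaleR_one add_diff_cancel_left' diff_add_cancel add.commute[of _ "y - _"])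
    qed
    ultimately show ?thesis by simp
  qed
  ultimately show thesis by (rule that)
qed

text \<open>A point \<open>y\<close> of the half ball lies on a segment from the centre of the inscribed
  ball to a point of the disc.\<close>

lemma half_ball_in_simplex:
  fixes T :: "(real^'n::finite) set"
  assumes T: "int CARD('n) simplex T" and F: "F facet_of T" and n: "unit_normal F n"
    and ball: "cball c r \<subseteq> T" "0 < r" and h: "diameter T \<le> \<kappa> * r"
    and disc: "x0 \<in> F" "\<And>y. (y - x0) \<bullet> n = 0 \<Longrightarrow> norm (y - x0) \<le> R \<Longrightarrow> y \<in> F"
    and \<rho>: "2 * \<rho> \<le> r" "2 * (1 + \<kappa>) * \<rho> \<le> R" and inner: "\<not> outward n F T"
    and y: "norm (y - x0) \<le> \<rho>" "0 \<le> (y - x0) \<bullet> n"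
  shows "y \<in> T"
proof -
  define P where "P = apex T F"
  note P = apex(1,2)[OF T F, folded P_def] simplex_facet(2-4)[OF T F] apex(3)[OF T F, folded P_def]
  have Pn: "(P - x0) \<bullet> n > 0" using outward_iff[OF P(2) n disc(1)] inner by linarith
  interpret k: solid_cone F n x0 P
    using flat_face_unit_normal[OF n P(3,4) disc(1)] Pn by (simp add: solid_cone_def solid_cone_axioms_def)
  have Teq: "k.T = T" by (simp add: k.T_def P(2))
  have up: "c + (- r) *\<^sub>R n \<in> k.T" "c \<in> k.T"
    using ball k.n unfolding Teq by (auto simp: dist_norm subset_iff)
  have hc: "r \<le> k.height c"
    using k.height_T[OF up(1)] unfolding k.height_add by linarith
  let ?a = "(y - x0) \<bullet> n"
  have a: "?a \<le> \<rho>" using y(1) Cauchy_Schwarz_ineq2[of "y - x0" n] k.n by simp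
  have \<rho>0: "0 \<le> \<rho>" using y(1) norm_ge_zero order_trans by blast
  let ?s = "?a / k.height c"
  have s: "0 \<le> ?s" "?s \<le> 1 / 2" "?s \<le> \<rho> / r"
  proof -
    show "0 \<le> ?s" using y(2) hc ball(2) by simp
    have "?s \<le> \<rho> / r" using a hc ball(2) \<rho>0 y(2) by (intro frac_le) auto
    then show "?s \<le> \<rho> / r" .
    also have "\<rho> / r \<le> 1 / 2" using \<rho>(1) ball(2) by (simp add: field_simps)
    finally show "?s \<le> 1 / 2" .
  qed
  let ?d = "(1 / (1 - ?s)) *\<^sub>R (y - ?s *\<^sub>R c)"
  have s1: "1 - ?s > 0" using s(2) by linarith
  have dd: "?d - x0 = (1 / (1 - ?s)) *\<^sub>R ((y - x0) - ?s *\<^sub>R (c - x0))"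
  proof -
    have "u \<noteq> 0 \<Longrightarrow> (1 / u) * u = 1" for u :: real by simp
    then have "(1 / (1 - ?s)) * (1 - ?s) = 1" using s1 by (metis less_irrefl)
    then have "x0 = (1 / (1 - ?s)) *\<^sub>R ((1 - ?s) *\<^sub>R x0)" by (simp only: scaleR_scaleR scaleR_one)
    then have "?d - x0 = ?d - (1 / (1 - ?s)) *\<^sub>R ((1 - ?s) *\<^sub>R x0)" by simp
    also have "\<dots> = (1 / (1 - ?s)) *\<^sub>R ((y - ?s *\<^sub>R c) - (1 - ?s) *\<^sub>R x0)" by (simp only: scaleR_diff_right)
    also have "(y - ?s *\<^sub>R c) - (1 - ?s) *\<^sub>R x0 = (y - x0) - ?s *\<^sub>R (c - x0)" by (simp only: scaleR_diff_left scaleR_diff_right scaleR_one algebra_simps)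
    finally show ?thesis .
  qed
  have "?d \<in> F"
  proof (rule disc(2))
    have "((y - x0) - ?s *\<^sub>R (c - x0)) \<bullet> n = ?a - ?s * k.height c"
      by (simp only: inner_diff_left[of "y - x0"] inner_scaleR_left k.height_def)
    also have "\<dots> = 0" using hc ball(2) by simp
    finally show "(?d - x0) \<bullet> n = 0" unfolding dd by simp
    have x0T: "x0 \<in> T" using disc(1) P(2) hull_inc[of x0 "insert P F"] by simp
    have "norm (c - x0) \<le> \<kappa> * r"
      using diameter_bounded_bound[OF compact_imp_bounded[OF compact_simplex[OF T]], of c x0] up(2) x0T h
      unfolding Teq by (simp add: dist_norm)
    then have "norm (?s *\<^sub>R (c - x0)) \<le> (\<rho> / r) * (\<kappa> * r)"
      unfolding norm_scaleR using s \<rho>0 ball(2) by (intro mult_mono) auto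
    then have sb: "norm (?s *\<^sub>R (c - x0)) \<le> \<kappa> * \<rho>" using ball(2) by (simp add: mult.commute)
    have "norm ((y - x0) - ?s *\<^sub>R (c - x0)) \<le> (1 + \<kappa>) * \<rho>"
      using norm_triangle_ineq4[of "y - x0" "?s *\<^sub>R (c - x0)"] y(1) sb by (simp add: distrib_right)
    moreover have "t \<le> 1 / 2 \<Longrightarrow> 1 / (1 - t) \<le> 2" for t :: real by (simp add: divide_le_eq)
    then have "1 / (1 - ?s) \<le> 2" using s(2) .
    ultimately have "norm (?d - x0) \<le> 2 * ((1 + \<kappa>) * \<rho>)"
      unfolding dd norm_scaleR using s1 by (intro mult_mono) auto
    also have "\<dots> \<le> R" using \<rho>(2) by (simp only: mult.assoc)
    finally show "norm (?d - x0) \<le> R" .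
  qed
  then have "?d \<in> T" using P(2) hull_inc[of ?d "insert P F"] by simp
  moreover have "y = (1 - ?s) *\<^sub>R ?d + ?s *\<^sub>R c"
  proof -
    have "u \<noteq> 0 \<Longrightarrow> u * (1 / u) = 1" for u :: real by simp
    then have "(1 - ?s) * (1 / (1 - ?s)) = 1" using s1 by (metis less_irrefl)
    then show ?thesis by (simp only: scaleR_scaleR scaleR_one diff_add_cancel)
  qed
  moreover have "convex T" using convex_simplex[OF T] .
  ultimately show ?thesis
    using convexD_alt[of T ?d c ?s] s up(2) unfolding Teq by (simp only:)
qed

section \<open>A bubble function\<close>

text \<open>The square makes this function continuously differentiable.\<close>

definition bubble :: "real^'n::finite \<Rightarrow> real \<Rightarrow> real^'n \<Rightarrow> real" where
  "bubble x0 \<rho> x = (max 0 (\<rho>\<^sup>2 - (norm (x - x0))\<^sup>2))\<^sup>2"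

lemma DERIV_max_0_square: "((\<lambda>t. (max 0 t)\<^sup>2) has_real_derivative 2 * max 0 t) (at t)" for t :: real
proof -
  consider "t > 0" | "t < 0" | "t = 0" by linarith
  then show ?thesis
  proof cases
    case 1
    have "((\<lambda>t. t\<^sup>2) has_real_derivative 2 * t) (at t)" by (auto intro!: derivative_eq_intros)
    then have "((\<lambda>t. (max 0 t)\<^sup>2) has_real_derivative 2 * t) (at t)"
      by (rule has_field_derivative_transform_within_open[of _ _ _ "{0<..}"]) (use 1 in auto)
    then show ?thesis using 1 by simp
  next
    case 2
    have "((\<lambda>t. 0) has_real_derivative 0) (at t)" by simp
    then have "((\<lambda>t. (max 0 t)\<^sup>2) has_real_derivative 0) (at t)"
      by (rule has_field_derivative_transform_within_open[of _ _ _ "{..<0}"]) (use 2 in auto)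
    then show ?thesis using 2 by simp
  next
    case 3
    have "((\<lambda>h. (max 0 h)\<^sup>2 / h) \<longlongrightarrow> 0) (at (0::real))"
    proof (rule Lim_null_comparison[where g = "\<lambda>h. \<bar>h\<bar>"])
      show "\<forall>\<^sub>F h in at 0. norm ((max 0 h)\<^sup>2 / h) \<le> \<bar>h :: real\<bar>"
        by (rule always_eventually) (auto simp: max_def power2_eq_square)
      show "((\<lambda>h::real. \<bar>h\<bar>) \<longlongrightarrow> 0) (at 0)"
        by (rule tendsto_rabs_zero) (rule tendsto_ident_at)
    qed
    then show ?thesis using 3 by (simp add: DERIV_def)
  qed
qed

lemma bubble_has_derivative:
  "(bubble x0 \<rho> has_derivative (\<lambda>h. - 4 * max 0 (\<rho>\<^sup>2 - (norm (x - x0))\<^sup>2) * ((x - x0) \<bullet> h))) (at x)"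
proof -
  have a: "((\<lambda>x. \<rho>\<^sup>2 - (x - x0) \<bullet> (x - x0)) has_derivative (\<lambda>h. - 2 * ((x - x0) \<bullet> h))) (at x)"
    by (auto intro!: derivative_eq_intros simp: inner_commute)
  have b: "((\<lambda>t. (max 0 t)\<^sup>2) has_derivative (*) (2 * max 0 (\<rho>\<^sup>2 - (x - x0) \<bullet> (x - x0)))) (at (\<rho>\<^sup>2 - (x - x0) \<bullet> (x - x0)))"
    using DERIV_max_0_square by (simp add: has_field_derivative_def)
  from diff_chain_at[OF a b] show ?thesis
    by (simp add: o_def bubble_def[abs_def] power2_norm_eq_inner mult.assoc[symmetric])
qed

lemma pd_bubble: "pd i (bubble x0 \<rho>) x = - 4 * max 0 (\<rho>\<^sup>2 - (norm (x - x0))\<^sup>2) * (x - x0) $ i"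
  using pd_eqI[OF bubble_has_derivative, of i] by (simp add: inner_axis)

lemma Ck_bubble: "Ck (Suc 0) (bubble x0 \<rho>)"
proof -
  have "pd i (bubble x0 \<rho>) = (\<lambda>x. - 4 * max 0 (\<rho>\<^sup>2 - (norm (x - x0))\<^sup>2) * (x - x0) $ i)" for i
    by (simp add: fun_eq_iff pd_bubble)
  moreover have "bubble x0 \<rho> differentiable (at x)" for x
    using bubble_has_derivative by (rule differentiableI)
  ultimately show ?thesis
    by (auto simp: differentiable_on_def intro!: continuous_intros)
qed

lemma bubble_outside: "0 \<le> \<rho> \<Longrightarrow> x \<notin> cball x0 \<rho> \<Longrightarrow> bubble x0 \<rho> x = 0"
  by (auto simp: bubble_def dist_norm norm_minus_commute max_def power_mono)

lemma grad_bubble: "grad (bubble x0 \<rho>) x = (- 4 * max 0 (\<rho>\<^sup>2 - (norm (x - x0))\<^sup>2)) *\<^sub>R (x - x0)"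
  by (simp add: grad_def pd_bubble vec_eq_iff)

lemma norm_grad_bubble:
  assumes "0 \<le> \<rho>"
  shows "norm (grad (bubble x0 \<rho>) x) \<le> 4 * \<rho> ^ 3 * indicator (cball x0 \<rho>) x"
proof (cases "x \<in> cball x0 \<rho>")
  case True
  then have n: "norm (x - x0) \<le> \<rho>" by (simp add: dist_norm norm_minus_commute)
  have "norm (grad (bubble x0 \<rho>) x) = 4 * (max 0 (\<rho>\<^sup>2 - (norm (x - x0))\<^sup>2) * norm (x - x0))"
    by (simp add: grad_bubble)
  also have "\<dots> \<le> 4 * (\<rho>\<^sup>2 * \<rho>)"
    using n assms by (intro mult_left_mono mult_mono) auto
  finally show ?thesis using True by (simp add: power2_eq_square power3_eq_cube)
next
  case False
  then have "\<rho>\<^sup>2 \<le> (norm (x - x0))\<^sup>2" using assms by (intro power_mono) (auto simp: dist_norm norm_minus_commute)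
  then show ?thesis using False by (simp add: grad_bubble)
qed

definition unit_vol :: "'n::finite itself \<Rightarrow> real" where
  "unit_vol _ = measure lborel (ball (0 :: real^'n) 1)"

lemma unit_vol_pos: "unit_vol TYPE('n::finite) > 0"
  unfolding unit_vol_def using content_ball_pos[of 1 "0 :: real^'n"] by simp

lemma measure_ball: "r \<ge> 0 \<Longrightarrow> measure lborel (ball (x :: real^'n::finite) r) = r ^ CARD('n) * unit_vol TYPE('n)"
  and measure_cball: "r \<ge> 0 \<Longrightarrow> measure lborel (cball (x :: real^'n::finite) r) = r ^ CARD('n) * unit_vol TYPE('n)"
  using content_ball[of r x] content_ball[of 1 "0 :: real^'n"] content_cball[of r x] by (simp_all add: unit_vol_def)

text \<open>By the divergence theorem in the half space, the last integral is the integral of the bubble over the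
  bounding hyperplane; in this form it needs no surface measure.\<close>

lemma bubble_half_space:
  fixes x0 n :: "real^'n::finite"
  assumes n: "norm n = 1" and \<rho>: "\<rho> > 0"
  defines "H \<equiv> {x. 0 \<le> (x - x0) \<bullet> n}"
  shows "\<And>d. d \<bullet> n = 0 \<Longrightarrow> (LINT x|lborel. indicator H x * (d \<bullet> grad (bubble x0 \<rho>) x)) = 0"
    and "\<rho> ^ 3 / 4 * ((\<rho> / 4) ^ CARD('n) * unit_vol TYPE('n)) \<le> - (LINT x|lborel. indicator H x * (n \<bullet> grad (bubble x0 \<rho>) x))"
proof -
  have nn: "n \<bullet> n = 1" using n by (simp add: dot_square_norm)
  have Hm [measurable]: "H \<in> sets borel"
    unfolding H_def by (intro borel_closed closed_Collect_le continuous_intros)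
  show "(LINT x|lborel. indicator H x * (d \<bullet> grad (bubble x0 \<rho>) x)) = 0" if "d \<bullet> n = 0" for d
    unfolding inner_grad
    by (rule integral_directional_derivative_eq_0[OF Ck_bubble compact_cball[of x0 \<rho>] bubble_outside Hm])
      (use \<rho> that in \<open>auto simp: H_def inner_add_left inner_diff_left\<close>)
  let ?c = "x0 + (\<rho> / 2) *\<^sub>R n"
  have low: "\<rho> ^ 3 / 4 * indicator (ball ?c (\<rho> / 4)) x \<le> - (indicator H x * (n \<bullet> grad (bubble x0 \<rho>) x))" for x
  proof (cases "x \<in> ball ?c (\<rho> / 4)")
    case True
    let ?e = "x - ?c"
    have e: "norm ?e < \<rho> / 4" using True by (simp add: dist_norm norm_minus_commute)
    have x: "x - x0 = ?e + (\<rho> / 2) *\<^sub>R n" by simp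
    have "norm (x - x0) \<le> norm ?e + norm ((\<rho> / 2) *\<^sub>R n)" unfolding x by (rule norm_triangle_ineq)
    then have nx: "norm (x - x0) \<le> 3 / 4 * \<rho>" using e n \<rho> by simp
    have "\<bar>?e \<bullet> n\<bar> \<le> \<rho> / 4" using Cauchy_Schwarz_ineq2[of ?e n] n e by simp
    moreover have "(x - x0) \<bullet> n = ?e \<bullet> n + \<rho> / 2" by (subst x) (simp only: inner_add_left inner_scaleR_left nn mult_1_right)
    ultimately have ip: "(x - x0) \<bullet> n \<ge> \<rho> / 4" by linarith
    have "(norm (x - x0))\<^sup>2 \<le> (3 / 4 * \<rho>)\<^sup>2" using nx by (rule power_mono) simp
    then have q: "\<rho>\<^sup>2 - (norm (x - x0))\<^sup>2 \<ge> \<rho>\<^sup>2 / 4"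
      by (simp add: power_mult_distrib power2_eq_square) (use mult_nonneg_nonneg[of \<rho> \<rho>] \<rho> in linarith)
    have q0: "0 \<le> \<rho>\<^sup>2 - (norm (x - x0))\<^sup>2" using q zero_le_power2[of \<rho>] by linarith
    have H: "x \<in> H" unfolding H_def using ip \<rho> by simp
    have mx: "max 0 (\<rho>\<^sup>2 - (norm (x - x0))\<^sup>2) = \<rho>\<^sup>2 - (norm (x - x0))\<^sup>2" using q0 by (rule max_absorb2)
    have "\<rho> ^ 3 / 4 = 4 * ((\<rho>\<^sup>2 / 4) * (\<rho> / 4))" by (simp add: power2_eq_square power3_eq_cube)
    also have "\<dots> \<le> 4 * ((\<rho>\<^sup>2 - (norm (x - x0))\<^sup>2) * ((x - x0) \<bullet> n))"
      using mult_mono[OF q ip q0] \<rho> by (intro mult_left_mono) auto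
    also have "\<dots> = - (indicator H x * (n \<bullet> grad (bubble x0 \<rho>) x))"
      using H by (simp add: grad_bubble mx inner_commute[of n] algebra_simps)
    finally show ?thesis using True by simp
  next
    case False
    then show ?thesis by (auto simp: indicator_def H_def grad_bubble inner_commute)
  qed
  have cG: "continuous_on UNIV (\<lambda>x. n \<bullet> grad (bubble x0 \<rho>) x)"
    unfolding inner_grad using Ck_bubble[of x0 \<rho>] by (intro continuous_intros) simp
  have out: "n \<bullet> grad (bubble x0 \<rho>) x = 0" if "x \<notin> cball x0 \<rho>" for x
  proof -
    have "norm (grad (bubble x0 \<rho>) x) \<le> 0" using norm_grad_bubble[of \<rho> x0 x] \<rho> that by simp
    then show ?thesis by simp
  qed
  have iG: "integrable lborel (\<lambda>x. indicator H x * (n \<bullet> grad (bubble x0 \<rho>) x))"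
    using integrable_mult_indicator[OF _ integrable_lborel_compact_support[OF cG compact_cball[of x0 \<rho>]], of H]
      out by simp
  have "\<rho> ^ 3 / 4 * ((\<rho> / 4) ^ CARD('n) * unit_vol TYPE('n)) = (LINT x|lborel. \<rho> ^ 3 / 4 * indicator (ball ?c (\<rho> / 4)) x)"
    using \<rho> by (simp add: measure_ball)
  also have "\<dots> \<le> (LINT x|lborel. - (indicator H x * (n \<bullet> grad (bubble x0 \<rho>) x)))"
  proof (rule integral_mono)
    show "integrable lborel (\<lambda>x. \<rho> ^ 3 / 4 * indicator (ball ?c (\<rho> / 4)) x :: real)"
      by (intro integrable_mult_right integrable_real_indicator)
        (use emeasure_lborel_ball_finite[of ?c "\<rho> / 4"] in \<open>simp_all add: infinity_ennreal_def\<close>)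
  qed (use iG low in auto)
  finally show "\<rho> ^ 3 / 4 * ((\<rho> / 4) ^ CARD('n) * unit_vol TYPE('n)) \<le> - (LINT x|lborel. indicator H x * (n \<bullet> grad (bubble x0 \<rho>) x))"
    by simp
qed

section \<open>Inclusion of sets up to null sets\<close>

text \<open>Closed simplices, open simplices, patches and the domain are compared in this sense, which
  ignores the skeleton of the triangulation.\<close>

definition sub_ae :: "'a::euclidean_space set \<Rightarrow> 'a set \<Rightarrow> bool" where
  "sub_ae S S' \<longleftrightarrow> S \<in> sets lebesgue \<and> S' \<in> sets lebesgue \<and> (AE x in lebesgue. x \<in> S \<longrightarrow> x \<in> S')"

lemma borel_measurable_AE_on:
  fixes f g :: "'a::euclidean_space \<Rightarrow> 'b::euclidean_space"
  assumes S: "S \<in> sets lebesgue" and f: "f \<in> borel_measurable (vol S)" and AE: "AE x in vol S. f x = g x"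
  shows "g \<in> borel_measurable (vol S)"
proof -
  have "(\<lambda>x. indicator S x *\<^sub>R f x) \<in> borel_measurable lebesgue"
    using f S by (simp add: borel_measurable_restrict_space_iff)
  moreover have "AE x in lebesgue. indicator S x *\<^sub>R f x = indicator S x *\<^sub>R g x"
    using AE S by (auto simp: AE_restrict_space_iff indicator_def elim!: eventually_mono)
  ultimately have "(\<lambda>x. indicator S x *\<^sub>R g x) \<in> borel_measurable lebesgue"
    by (rule borel_measurable_AE)
  then show ?thesis using S by (simp add: borel_measurable_restrict_space_iff)
qed

lemma sq_int_cong_AE:
  fixes f g :: "'a::euclidean_space \<Rightarrow> 'b::euclidean_space"
  assumes "S \<in> sets lebesgue" "sq_int (vol S) f" "AE x in vol S. f x = g x"
  shows "sq_int (vol S) g"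
proof (rule sq_int_bound[OF assms(2)])
  show "g \<in> borel_measurable (vol S)"
    using borel_measurable_AE_on[OF assms(1) _ assms(3)] assms(2) by (simp add: sq_int_def)
  show "AE x in vol S. norm (g x) \<le> norm (f x)"
    using assms(3) by eventually_elim simp
qed

lemma l2_cong_AE_on:
  fixes f g :: "'a::euclidean_space \<Rightarrow> 'b::euclidean_space"
  assumes "S \<in> sets lebesgue" "f \<in> borel_measurable (vol S)" "AE x in vol S. f x = g x"
  shows "l2 (vol S) f = l2 (vol S) g"
  using l2_cong_AE[OF assms(3,2) borel_measurable_AE_on[OF assms]] .

lemma sub_ae_subset: "S \<in> sets lebesgue \<Longrightarrow> S' \<in> sets lebesgue \<Longrightarrow> S \<subseteq> S' \<Longrightarrow> sub_ae S S'"
  by (auto simp: sub_ae_def)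

lemma sub_ae_trans: "sub_ae S S' \<Longrightarrow> sub_ae S' S'' \<Longrightarrow> sub_ae S S''"
  by (auto simp: sub_ae_def elim: eventually_elim2)

lemma sub_ae_AE:
  assumes "sub_ae S S'" "AE x in vol S'. P x"
  shows "AE x in vol S. P x"
  using assms by (auto simp: sub_ae_def AE_restrict_space_iff elim: eventually_elim2)

lemma sub_ae_measurable:
  fixes f :: "'a::euclidean_space \<Rightarrow> 'b::euclidean_space"
  assumes s: "sub_ae S S'" and f: "f \<in> borel_measurable (vol S')"
  shows "f \<in> borel_measurable (vol S)"
proof -
  have S: "S \<in> sets lebesgue" "S' \<in> sets lebesgue" using s by (auto simp: sub_ae_def)
  have "(\<lambda>x. indicator S' x *\<^sub>R f x) \<in> borel_measurable lebesgue"
    using f S by (simp add: borel_measurable_restrict_space_iff)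
  then have "(\<lambda>x. indicator S' x *\<^sub>R f x) \<in> borel_measurable (vol S)"
    by (rule measurable_restrict_space1)
  then show ?thesis
  proof (rule borel_measurable_AE_on[OF S(1)])
    show "AE x in vol S. indicator S' x *\<^sub>R f x = f x"
      using s by (auto simp: sub_ae_def AE_restrict_space_iff elim!: eventually_mono)
  qed
qed

lemma sub_ae_sq_int:
  fixes f :: "'a::euclidean_space \<Rightarrow> 'b::euclidean_space"
  assumes s: "sub_ae S S'" and f: "sq_int (vol S') f"
  shows "sq_int (vol S) f" "l2 (vol S) f \<le> l2 (vol S') f"
proof -
  have S: "S \<in> sets lebesgue" "S' \<in> sets lebesgue" using s by (auto simp: sub_ae_def)
  have m: "f \<in> borel_measurable (vol S)" using sub_ae_measurable[OF s sq_int_measurable[OF f]] .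
  then have m': "(\<lambda>x. indicator S x *\<^sub>R (norm (f x))\<^sup>2) \<in> borel_measurable lebesgue"
    using S by (subst borel_measurable_restrict_space_iff[symmetric]) auto
  have i: "integrable lebesgue (\<lambda>x. indicator S' x *\<^sub>R (norm (f x))\<^sup>2)"
    using f S by (simp add: sq_int_def integrable_restrict_space)
  have le: "AE x in lebesgue. indicator S x *\<^sub>R (norm (f x))\<^sup>2 \<le> indicator S' x *\<^sub>R (norm (f x))\<^sup>2"
    using s by (auto simp: sub_ae_def indicator_def elim!: eventually_mono)
  have i': "integrable lebesgue (\<lambda>x. indicator S x *\<^sub>R (norm (f x))\<^sup>2)"
    by (rule Bochner_Integration.integrable_bound[OF i m']) (use le in \<open>auto simp: abs_mult elim!: eventually_mono\<close>)
  then show "sq_int (vol S) f" using m S by (simp add: sq_int_def integrable_restrict_space)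
  show "l2 (vol S) f \<le> l2 (vol S') f"
    unfolding l2_def using S integral_mono_AE[OF i' i le] by (simp add: integral_restrict_space)
qed

lemma sub_ae_integrable:
  fixes f :: "'a::euclidean_space \<Rightarrow> real"
  assumes s: "sub_ae S S'" and f: "integrable (vol S') f"
  shows "integrable (vol S) f"
proof -
  have S: "S \<in> sets lebesgue" "S' \<in> sets lebesgue" using s by (auto simp: sub_ae_def)
  have m: "f \<in> borel_measurable (vol S)" using sub_ae_measurable[OF s] f by auto
  then have m': "(\<lambda>x. indicator S x *\<^sub>R f x) \<in> borel_measurable lebesgue"
    using S by (simp add: borel_measurable_restrict_space_iff)
  have i: "integrable lebesgue (\<lambda>x. indicator S' x *\<^sub>R f x)"
    using f S by (simp add: integrable_restrict_space)
  have "integrable lebesgue (\<lambda>x. indicator S x *\<^sub>R f x)"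
    by (rule Bochner_Integration.integrable_bound[OF i m'])
      (use s in \<open>auto simp: sub_ae_def abs_mult indicator_def elim!: eventually_mono\<close>)
  then show ?thesis using S by (simp add: integrable_restrict_space)
qed

lemma same_ae_integral:
  fixes f :: "'a::euclidean_space \<Rightarrow> real"
  assumes "sub_ae S S'" "sub_ae S' S"
  shows "(LINT x|vol S. f x) = (LINT x|vol S'. f x)"
proof (cases "integrable (vol S) f")
  case True
  have S: "S \<in> sets lebesgue" "S' \<in> sets lebesgue" using assms by (auto simp: sub_ae_def)
  have T: "integrable (vol S') f" using sub_ae_integrable[OF assms(2) True] .
  have "AE x in lebesgue. indicator S x *\<^sub>R f x = indicator S' x *\<^sub>R f x"
    using assms by (auto simp: sub_ae_def indicator_def elim: eventually_elim2)
  then show ?thesis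
    using S True T by (auto simp: integral_restrict_space integrable_restrict_space intro!: integral_cong_AE)
next
  case False
  then have "\<not> integrable (vol S') f" using sub_ae_integrable[OF assms(1)] by blast
  then show ?thesis using False by (simp add: not_integrable_integral_eq)
qed

section \<open>Weak derivatives of Sobolev functions\<close>

lemma finite_measure_bounded_on: "bounded S \<Longrightarrow> S \<in> sets lebesgue \<Longrightarrow> finite_measure (vol S)"
  by (rule finite_measure_lebesgue_on) (rule bounded_set_imp_lmeasurable)

lemma sq_int_continuous:
  fixes f :: "'a::euclidean_space \<Rightarrow> 'b::euclidean_space"
  assumes S: "bounded S" "S \<in> sets lebesgue" and f: "continuous_on UNIV f"
  shows "sq_int (vol S) f"
proof -
  have "bounded (f ` closure S)"
    using S by (intro compact_imp_bounded compact_continuous_image continuous_on_subset[OF f]) auto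
  then obtain B where B: "\<And>x. x \<in> closure S \<Longrightarrow> norm (f x) \<le> B" by (auto simp: bounded_iff)
  show ?thesis
  proof (rule sq_int_bound[OF sq_int_const[OF finite_measure_bounded_on[OF S], of B]])
    show "f \<in> borel_measurable (vol S)"
      by (rule continuous_imp_measurable_on_sets_lebesgue[OF continuous_on_subset[OF f] S(2)]) simp
    show "AE x in vol S. norm (f x) \<le> norm B"
    proof (rule AE_I2)
      fix x assume "x \<in> space (vol S)"
      then have "norm (f x) \<le> B" using B closure_subset by (auto simp: subset_iff)
      then show "norm (f x) \<le> norm B" by simp
    qed
  qed
qed

lemma loc_integrable_measurable:
  assumes U: "open U" and f: "loc_integrable U f"
  shows "f \<in> borel_measurable (vol U)"
proof -
  obtain D where D: "countable D" "D \<subseteq> Pow U" "\<And>X. X \<in> D \<Longrightarrow> \<exists>a b. X = cbox a b" "\<Union>D = U"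
    using open_countable_Union_open_cbox[OF U] by blast
  show ?thesis
  proof (rule measurable_piecewise_restrict[OF D(1)])
    fix X assume X: "X \<in> D"
    then have c: "compact X" "X \<subseteq> U" using D(2,3) by (auto dest: D(3))
    then show "X \<inter> space (vol U) \<in> sets (vol U)"
      using U by (auto simp: sets_restrict_space_iff sets_lebesgue_open sets_lebesgue_compact Int_absorb2)
    have "f \<in> borel_measurable (vol X)"
      using f c by (auto simp: loc_integrable_def)
    then show "f \<in> borel_measurable (restrict_space (vol U) X)"
      using c by (simp add: restrict_restrict_space sets_lebesgue_open[OF U] sets_lebesgue_compact Int_absorb1)
  qed (use D(4) in auto)
qed

lemma wpd_measurable: "open U \<Longrightarrow> weak_partial U i w g \<Longrightarrow> wpd U i w \<in> borel_measurable (vol U)"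
  using loc_integrable_measurable weak_partial_wpd[of U i w g] by (auto simp: weak_partial_def)

lemma wgrad_AE:
  assumes U: "open U" and w: "\<And>i. weak_partial U i w (g i)"
  shows "AE x in vol U. wgrad U w x = (\<chi> i. g i x)"
proof -
  have "AE x in vol U. \<forall>i\<in>UNIV. wpd U i w x = g i x"
    using wpd_AE_eq[OF U w] by (intro AE_finite_allI) auto
  then show ?thesis by eventually_elim (simp add: wgrad_def)
qed

lemma weak_partial_wpd_wpd:
  assumes U: "open U" and w: "weak_partial U i w g" and g: "weak_partial U j g h"
  shows "weak_partial U j (wpd U i w) h"
proof (rule weak_partial_cong_AE[OF g U])
  show "wpd U i w \<in> borel_measurable (vol U)" using wpd_measurable[OF U w] .
  show "h \<in> borel_measurable (vol U)"
    using loc_integrable_measurable[OF U] g by (auto simp: weak_partial_def)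
  show "AE x in vol U. g x = wpd U i w x" using wpd_AE_eq[OF U w] by eventually_elim simp
qed simp

lemma wjac_AE:
  assumes U: "open U" and w: "\<And>i j. weak_partial U j (\<lambda>y. \<theta> y $ i) (g i j)"
  shows "AE x in vol U. wjac U \<theta> x = (\<chi> i j. g i j x)"
proof -
  have r: "AE x in vol U. \<forall>j\<in>UNIV. wpd U j (\<lambda>y. \<theta> y $ i) x = g i j x" for i
    using wpd_AE_eq[OF U w] by (intro AE_finite_allI) auto
  have "AE x in vol U. \<forall>i\<in>UNIV. \<forall>j\<in>UNIV. wpd U j (\<lambda>y. \<theta> y $ i) x = g i j x"
    by (rule AE_finite_allI[OF finite r])
  then show ?thesis by eventually_elim (simp add: wjac_def)
qed

lemma wgrad_nth: "(\<lambda>y. wgrad U w y $ i) = wpd U i w"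
  by (simp add: wgrad_def)

lemma whess_AE:
  assumes U: "open U" and w: "\<And>i. weak_partial U i w (g i)" and g: "\<And>i j. weak_partial U j (g i) (h i j)"
  shows "AE x in vol U. whess U w x = (\<chi> i j. h i j x)"
  unfolding whess_def
  by (rule wjac_AE[OF U]) (simp only: wgrad_nth weak_partial_wpd_wpd[OF U w g])

lemma sq_int_chi: "(\<And>i. sq_int M (g i)) \<Longrightarrow> sq_int M (\<lambda>x. \<chi> i. g i x)"
  by (simp add: sq_int_vec_iff)

lemma l2_chi_sq:
  assumes "\<And>i. sq_int M (g i)"
  shows "(l2 M (\<lambda>x. \<chi> i. g i x))\<^sup>2 = (\<Sum>i\<in>UNIV. (l2 M (g i))\<^sup>2)"
  using l2_vec_sq[OF sq_int_chi[OF assms]] by simp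

lemma H1_norm_sq:
  assumes U: "open U" and w: "sq_int (vol U) w" "\<And>i. weak_partial U i w (g i)"
    and g: "\<And>i. sq_int (vol U) (g i)"
  shows "(H1_norm U w)\<^sup>2 = (l2 (vol U) w)\<^sup>2 + (\<Sum>i\<in>UNIV. (l2 (vol U) (g i))\<^sup>2)"
proof -
  have UL: "U \<in> sets lebesgue" using sets_lebesgue_open[OF U] .
  have "AE x in vol U. (\<chi> i. g i x) = wgrad U w x"
    using wgrad_AE[OF U w(2)] by eventually_elim simp
  then have "l2 (vol U) (\<lambda>x. \<chi> i. g i x) = l2 (vol U) (wgrad U w)"
    by (rule l2_cong_AE_on[OF UL sq_int_measurable[OF sq_int_chi[OF g]]])
  then show ?thesis using l2_chi_sq[of "vol U" g] g by (simp add: H1_norm_def sum_nonneg)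
qed

lemma H2_norm_sq:
  assumes U: "open U" and w: "sq_int (vol U) w" "\<And>i. weak_partial U i w (g i)"
    and g: "\<And>i. sq_int (vol U) (g i)" "\<And>i j. weak_partial U j (g i) (h i j)"
    and h: "\<And>i j. sq_int (vol U) (h i j)"
  shows "(H2_norm U w)\<^sup>2 = (l2 (vol U) w)\<^sup>2 + (\<Sum>i\<in>UNIV. (l2 (vol U) (g i))\<^sup>2)
    + (\<Sum>i\<in>UNIV. \<Sum>j\<in>UNIV. (l2 (vol U) (h i j))\<^sup>2)"
proof -
  have UL: "U \<in> sets lebesgue" using sets_lebesgue_open[OF U] .
  have "AE x in vol U. (\<chi> i. \<chi> j. h i j x) = whess U w x"
    using whess_AE[OF U w(2) g(2)] by eventually_elim simp
  then have "l2 (vol U) (\<lambda>x. \<chi> i. \<chi> j. h i j x) = l2 (vol U) (whess U w)"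
    by (rule l2_cong_AE_on[OF UL sq_int_measurable[OF sq_int_chi[OF sq_int_chi[OF h]]]])
  then have "(l2 (vol U) (whess U w))\<^sup>2 = (\<Sum>i\<in>UNIV. \<Sum>j\<in>UNIV. (l2 (vol U) (h i j))\<^sup>2)"
    using l2_chi_sq[of "vol U" "\<lambda>i x. \<chi> j. h i j x", OF sq_int_chi[OF h]]
      l2_chi_sq[of "vol U" "h _", OF h] by simp
  then show ?thesis using H1_norm_sq[OF U w g(1)] by (simp add: H1_norm_def H2_norm_def sum_nonneg)
qed

lemma H1_props:
  assumes U: "open U" and w: "w \<in> H1 U"
  shows "sq_int (vol U) w" "weak_partial U i w (wpd U i w)" "sq_int (vol U) (wpd U i w)"
proof -
  obtain g where g: "in_l2 (vol U) g" "weak_partial U i w g" using w by (auto simp: H1_def)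
  show "sq_int (vol U) w" using w by (simp add: H1_def in_l2_iff_sq_int)
  show "weak_partial U i w (wpd U i w)" using weak_partial_wpd[OF g(2)] .
  have "AE x in vol U. g x = wpd U i w x" using wpd_AE_eq[OF U g(2)] by eventually_elim simp
  then show "sq_int (vol U) (wpd U i w)"
    using sq_int_cong_AE[OF sets_lebesgue_open[OF U]] g(1) by (auto simp: in_l2_iff_sq_int)
qed

lemma H2_props:
  assumes U: "open U" and w: "w \<in> H2 U"
  shows "w \<in> H1 U" "wpd U i w \<in> H1 U"
  using w by (auto simp: H2_def)

lemma weak_partial_diff:
  "open U \<Longrightarrow> weak_partial U i w g \<Longrightarrow> weak_partial U i w' g' \<Longrightarrow> weak_partial U i (\<lambda>x. w x - w' x) (\<lambda>x. g x - g' x)"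
  using weak_partial_linear_comb[of U i w g w' g' 1 "-1"] by simp

lemma tendsto_zero_of_square_le:
  fixes a b :: "nat \<Rightarrow> real"
  assumes "b \<longlonglongrightarrow> 0" "\<And>j. (a j)\<^sup>2 \<le> (b j)\<^sup>2"
  shows "a \<longlonglongrightarrow> 0"
proof (rule Lim_null_comparison[of _ "\<lambda>j. \<bar>b j\<bar>"])
  show "\<forall>\<^sub>F j in sequentially. norm (a j) \<le> \<bar>b j\<bar>" using assms(2) by (simp add: abs_le_square_iff)
  show "(\<lambda>j. \<bar>b j\<bar>) \<longlonglongrightarrow> 0" using assms(1) by (rule tendsto_rabs_zero)
qed

text \<open>Convergence in \<open>H\<^sup>1\<close>, where \<open>W i\<close> are the weak derivatives of \<open>w\<close>.\<close>

definition H1_conv :: "(real^'n::finite) set \<Rightarrow> (real^'n \<Rightarrow> real) \<Rightarrow> ('n \<Rightarrow> real^'n \<Rightarrow> real) \<Rightarrow> (nat \<Rightarrow> real^'n \<Rightarrow> real) \<Rightarrow> bool" where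
  "H1_conv U w W \<phi> \<longleftrightarrow> sq_int (vol U) w \<and> (\<forall>i. sq_int (vol U) (W i)) \<and> (\<forall>j. Ck (Suc 0) (\<phi> j)) \<and>
     (\<lambda>j. l2 (vol U) (\<lambda>x. w x - \<phi> j x)) \<longlonglongrightarrow> 0 \<and>
     (\<forall>i. (\<lambda>j. l2 (vol U) (\<lambda>x. W i x - pd i (\<phi> j) x)) \<longlonglongrightarrow> 0)"

lemma member_le_sum_squares: "finite I \<Longrightarrow> i \<in> I \<Longrightarrow> (f i)\<^sup>2 \<le> (\<Sum>i\<in>I. (f i :: real)\<^sup>2)"
  by (rule member_le_sum) auto

lemma H1_norm_conv_iff:
  assumes U: "open U" "bounded U" and w: "sq_int (vol U) w" "\<And>i. weak_partial U i w (W i)" "\<And>i. sq_int (vol U) (W i)"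
    and \<phi>: "\<And>j. Ck (Suc 0) (\<phi> j)"
  shows "(\<lambda>j. H1_norm U (\<lambda>x. w x - \<phi> j x)) \<longlonglongrightarrow> 0 \<longleftrightarrow> H1_conv U w W \<phi>"
    and "H1_norm U (\<lambda>x. \<phi> j x - w x) = H1_norm U (\<lambda>x. w x - \<phi> j x)"
proof -
  have UL: "U \<in> sets lebesgue" using sets_lebesgue_open[OF U(1)] .
  have s: "sq_int (vol U) (\<phi> j)" "sq_int (vol U) (pd i (\<phi> j))" for i j
    using \<phi>[of j] Ck_continuous[OF \<phi>[of j]] by (auto intro: sq_int_continuous[OF U(2) UL])
  have wp: "weak_partial U i (\<phi> j) (pd i (\<phi> j))" for i j by (rule weak_partial_classical[OF \<phi> U(1)])
  have e: "(H1_norm U (\<lambda>x. w x - \<phi> j x))\<^sup>2 = (l2 (vol U) (\<lambda>x. w x - \<phi> j x))\<^sup>2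
      + (\<Sum>i\<in>UNIV. (l2 (vol U) (\<lambda>x. W i x - pd i (\<phi> j) x))\<^sup>2)" for j
    by (rule H1_norm_sq[OF U(1) sq_int_diff[OF w(1) s(1)] weak_partial_diff[OF U(1) w(2) wp] sq_int_diff[OF w(3) s(2)]])
  have e': "(H1_norm U (\<lambda>x. \<phi> j x - w x))\<^sup>2 = (l2 (vol U) (\<lambda>x. \<phi> j x - w x))\<^sup>2
      + (\<Sum>i\<in>UNIV. (l2 (vol U) (\<lambda>x. pd i (\<phi> j) x - W i x))\<^sup>2)" for j
    by (rule H1_norm_sq[OF U(1) sq_int_diff[OF s(1) w(1)] weak_partial_diff[OF U(1) wp w(2)] sq_int_diff[OF s(2) w(3)]])
  have n0: "0 \<le> H1_norm U f" for f by (simp add: H1_norm_def)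
  have "(H1_norm U (\<lambda>x. \<phi> j x - w x))\<^sup>2 = (H1_norm U (\<lambda>x. w x - \<phi> j x))\<^sup>2" for j
    unfolding e e' by (simp add: l2_minus_commute[of _ w] l2_minus_commute[of _ "W _"])
  then show "H1_norm U (\<lambda>x. \<phi> j x - w x) = H1_norm U (\<lambda>x. w x - \<phi> j x)" for j
    using n0 by (metis abs_of_nonneg real_sqrt_abs)
  show "(\<lambda>j. H1_norm U (\<lambda>x. w x - \<phi> j x)) \<longlonglongrightarrow> 0 \<longleftrightarrow> H1_conv U w W \<phi>"
  proof
    assume L: "(\<lambda>j. H1_norm U (\<lambda>x. w x - \<phi> j x)) \<longlonglongrightarrow> 0"
    have "(\<lambda>j. l2 (vol U) (\<lambda>x. w x - \<phi> j x)) \<longlonglongrightarrow> 0"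
      by (rule tendsto_zero_of_square_le[OF L]) (simp add: e sum_nonneg)
    moreover have "(\<lambda>j. l2 (vol U) (\<lambda>x. W i x - pd i (\<phi> j) x)) \<longlonglongrightarrow> 0" for i
    proof (rule tendsto_zero_of_square_le[OF L])
      fix j
      show "(l2 (vol U) (\<lambda>x. W i x - pd i (\<phi> j) x))\<^sup>2 \<le> (H1_norm U (\<lambda>x. w x - \<phi> j x))\<^sup>2"
        unfolding e using member_le_sum_squares[of UNIV i "\<lambda>i. l2 (vol U) (\<lambda>x. W i x - pd i (\<phi> j) x)"]
        by (simp add: add_increasing)
    qed
    ultimately show "H1_conv U w W \<phi>" using w \<phi> by (simp add: H1_conv_def)
  next
    assume R: "H1_conv U w W \<phi>"
    have "(\<lambda>j. sqrt ((l2 (vol U) (\<lambda>x. w x - \<phi> j x))\<^sup>2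
      + (\<Sum>i\<in>UNIV. (l2 (vol U) (\<lambda>x. W i x - pd i (\<phi> j) x))\<^sup>2))) \<longlonglongrightarrow> sqrt (0\<^sup>2 + (\<Sum>i\<in>(UNIV::'a set). 0\<^sup>2))"
      using R unfolding H1_conv_def by (intro tendsto_intros) auto
    then show "(\<lambda>j. H1_norm U (\<lambda>x. w x - \<phi> j x)) \<longlonglongrightarrow> 0"
      unfolding e[symmetric] by (simp add: n0)
  qed
qed

lemma H2_0_props:
  assumes U: "open U" and u: "u \<in> H2_0 U"
  shows "sq_int (vol U) u" "weak_partial U i u (wpd U i u)" "sq_int (vol U) (wpd U i u)"
    "weak_partial U j (wpd U i u) (wpd U j (wpd U i u))" "sq_int (vol U) (wpd U j (wpd U i u))"
proof -
  have "u \<in> H2 U" using u by (simp add: H2_0_def)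
  then have 1: "u \<in> H1 U" "wpd U i u \<in> H1 U" using H2_props[OF U] by auto
  show "sq_int (vol U) u" "weak_partial U i u (wpd U i u)" "sq_int (vol U) (wpd U i u)"
    "weak_partial U j (wpd U i u) (wpd U j (wpd U i u))" "sq_int (vol U) (wpd U j (wpd U i u))"
    using H1_props[OF U 1(1)] H1_props[OF U 1(2)] by auto
qed

text \<open>The test functions that converge to \<open>u\<close> in \<open>H\<^sup>2\<close> have
  partial derivatives that converge to those of \<open>u\<close> in \<open>H\<^sup>1\<close>.\<close>

lemma H2_0_approx:
  assumes U: "open U" "bounded U" and u: "u \<in> H2_0 U"
  shows "\<exists>\<phi>. (\<forall>j. test_fun U (\<phi> j)) \<and> H1_conv U u (\<lambda>i. wpd U i u) \<phi> \<and>
    (\<forall>i. H1_conv U (wpd U i u) (\<lambda>k. wpd U k (wpd U i u)) (\<lambda>j. pd i (\<phi> j)))"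
proof -
  note p = H2_0_props[OF U(1) u]
  obtain \<phi> where \<phi>: "\<forall>j. test_fun U (\<phi> j)" "(\<lambda>j::nat. H2_norm U (\<lambda>x. u x - \<phi> j x)) \<longlonglongrightarrow> 0"
    using u by (auto simp: H2_0_def)
  have UL: "U \<in> sets lebesgue" using sets_lebesgue_open[OF U(1)] .
  have sm: "smooth (\<phi> j)" for j using \<phi>(1) test_fun_smooth by blast
  have C: "Ck k (\<phi> j)" "Ck k (pd i (\<phi> j))" "Ck k (pd k' (pd i (\<phi> j)))" for k k' i j
    using sm[of j] by (auto intro!: smoothD smooth_pd)
  have s: "sq_int (vol U) (\<phi> j)" "sq_int (vol U) (pd i (\<phi> j))" "sq_int (vol U) (pd k (pd i (\<phi> j)))" for i j k
    using C(1)[of 0] C(2)[of 0] C(3)[of 0] by (auto intro!: sq_int_continuous[OF U(2) UL])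
  have wp: "weak_partial U i (\<phi> j) (pd i (\<phi> j))" "weak_partial U k (pd i (\<phi> j)) (pd k (pd i (\<phi> j)))" for i j k
    by (rule weak_partial_classical[OF C(1) U(1)], rule weak_partial_classical[OF C(2) U(1)])
  have e: "(H2_norm U (\<lambda>x. u x - \<phi> j x))\<^sup>2 = (l2 (vol U) (\<lambda>x. u x - \<phi> j x))\<^sup>2
      + (\<Sum>i\<in>UNIV. (l2 (vol U) (\<lambda>x. wpd U i u x - pd i (\<phi> j) x))\<^sup>2)
      + (\<Sum>i\<in>UNIV. \<Sum>k\<in>UNIV. (l2 (vol U) (\<lambda>x. wpd U k (wpd U i u) x - pd k (pd i (\<phi> j)) x))\<^sup>2)" for j
    by (rule H2_norm_sq[OF U(1) sq_int_diff[OF p(1) s(1)] weak_partial_diff[OF U(1) p(2) wp(1)] sq_int_diff[OF p(3) s(2)]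
          weak_partial_diff[OF U(1) p(4) wp(2)] sq_int_diff[OF p(5) s(3)]])
  have nn: "0 \<le> (\<Sum>i\<in>UNIV. \<Sum>k\<in>UNIV. (l2 (vol U) (\<lambda>x. wpd U k (wpd U i u) x - pd k (pd i (\<phi> j)) x))\<^sup>2)"
    "0 \<le> (\<Sum>i\<in>UNIV. (l2 (vol U) (\<lambda>x. wpd U i u x - pd i (\<phi> j) x))\<^sup>2)" for j by (simp_all add: sum_nonneg)
  have t0: "(\<lambda>j. l2 (vol U) (\<lambda>x. u x - \<phi> j x)) \<longlonglongrightarrow> 0"
    by (rule tendsto_zero_of_square_le[OF \<phi>(2)]) (use nn in \<open>simp add: e\<close>)
  have t1: "(\<lambda>j. l2 (vol U) (\<lambda>x. wpd U i u x - pd i (\<phi> j) x)) \<longlonglongrightarrow> 0" for i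
  proof (rule tendsto_zero_of_square_le[OF \<phi>(2)])
    fix j
    show "(l2 (vol U) (\<lambda>x. wpd U i u x - pd i (\<phi> j) x))\<^sup>2 \<le> (H2_norm U (\<lambda>x. u x - \<phi> j x))\<^sup>2"
      using member_le_sum_squares[OF finite UNIV_I, of "\<lambda>i. l2 (vol U) (\<lambda>x. wpd U i u x - pd i (\<phi> j) x)" i] nn(1)[of j]
        zero_le_power2[of "l2 (vol U) (\<lambda>x. u x - \<phi> j x)"]
      unfolding e by linarith
  qed
  have t2: "(\<lambda>j. l2 (vol U) (\<lambda>x. wpd U k (wpd U i u) x - pd k (pd i (\<phi> j)) x)) \<longlonglongrightarrow> 0" for i k
  proof (rule tendsto_zero_of_square_le[OF \<phi>(2)])
    fix j
    have "(l2 (vol U) (\<lambda>x. wpd U k (wpd U i u) x - pd k (pd i (\<phi> j)) x))\<^sup>2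
        \<le> (\<Sum>k\<in>UNIV. (l2 (vol U) (\<lambda>x. wpd U k (wpd U i u) x - pd k (pd i (\<phi> j)) x))\<^sup>2)"
      using member_le_sum_squares[of UNIV k "\<lambda>k. l2 (vol U) (\<lambda>x. wpd U k (wpd U i u) x - pd k (pd i (\<phi> j)) x)"] by simp
    also have "\<dots> \<le> (\<Sum>i\<in>UNIV. \<Sum>k\<in>UNIV. (l2 (vol U) (\<lambda>x. wpd U k (wpd U i u) x - pd k (pd i (\<phi> j)) x))\<^sup>2)"
      by (rule member_le_sum) (auto simp: sum_nonneg)
    also have "\<dots> \<le> (H2_norm U (\<lambda>x. u x - \<phi> j x))\<^sup>2" unfolding e using nn(2)[of j] by simp
    finally show "(l2 (vol U) (\<lambda>x. wpd U k (wpd U i u) x - pd k (pd i (\<phi> j)) x))\<^sup>2 \<le> (H2_norm U (\<lambda>x. u x - \<phi> j x))\<^sup>2" .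
  qed
  show ?thesis
    using \<phi>(1) t0 t1 t2 p C by (intro exI[of _ \<phi>] conjI allI) (simp_all add: H1_conv_def del: Ck.simps)
qed

lemma H2_0_subset_H1_0:
  assumes U: "open U" "bounded U" and u: "u \<in> H2_0 U"
  shows "u \<in> H1_0 U"
proof -
  have h1: "u \<in> H1 U" using u by (simp add: H2_0_def H2_def)
  obtain \<phi> where \<phi>: "\<forall>j. test_fun U (\<phi> j)" "H1_conv U u (\<lambda>i. wpd U i u) \<phi>" using H2_0_approx[OF U u] by blast
  have "Ck (Suc 0) (\<phi> j)" for j using \<phi>(2) unfolding H1_conv_def by blast
  then have "(\<lambda>j. H1_norm U (\<lambda>x. u x - \<phi> j x)) \<longlonglongrightarrow> 0"
    using H1_norm_conv_iff(1)[OF U H1_props[OF U(1) h1]] \<phi>(2) by blast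
  then show ?thesis using h1 \<phi>(1) by (auto simp: H1_0_def)
qed

lemma zero_test_fun: "test_fun U (\<lambda>x. 0)"
  by (auto simp: test_fun_def smooth_def Ck_const intro!: exI[of _ "{}"])

lemma zero_H2_0:
  assumes U: "open U"
  shows "(\<lambda>x. 0) \<in> H2_0 U"
proof -
  have wz: "weak_partial U i (\<lambda>x. 0) (\<lambda>x. 0)" for i :: 'a
    using weak_partial_classical[OF Ck_const[of "Suc 0" 0] U, of i] by (simp add: pd_const)
  have H1z: "w \<in> H1 U" if "w \<in> borel_measurable (vol U)" "AE x in vol U. 0 = w x" for w
  proof -
    have "weak_partial U i w (\<lambda>x. 0)" for i
      by (rule weak_partial_cong_AE[OF wz U that(1) _ that(2)]) auto
    moreover have "sq_int (vol U) w"
      by (rule sq_int_cong_AE[OF sets_lebesgue_open[OF U] sq_int_zero that(2)])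
    ultimately show ?thesis by (auto simp: H1_def in_l2_iff_sq_int intro!: exI[of _ "\<lambda>x. 0"] sq_int_zero)
  qed
  have a: "AE x in vol U. 0 = wpd U i (\<lambda>x. 0) x" for i
    using wpd_AE_eq[OF U wz] by eventually_elim simp
  have "(\<lambda>x. 0) \<in> H2 U"
    unfolding H2_def using H1z[OF wpd_measurable[OF U wz] a] H1z[of "\<lambda>x. 0"] by auto
  moreover have "(H2_norm U (\<lambda>x. 0 - 0))\<^sup>2 = 0"
    using H2_norm_sq[OF U sq_int_zero wz sq_int_zero wz sq_int_zero] by (simp add: l2_def)
  ultimately show ?thesis
    unfolding H2_0_def using zero_test_fun by (auto intro!: exI[of _ "\<lambda>_ _. 0"])
qed

text \<open>Integrating by parts twice, for functions in \<open>H\<^sup>2\<^sub>0\<close>: for smooth functions both sides equal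
  \<open>- \<integral> b \<partial>\<^sub>i \<partial>\<^sub>j\<^sup>2 \<phi>\<close>.\<close>

lemma H2_0_double_parts:
  fixes U :: "(real^'n::finite) set"
  assumes U: "open U" "bounded U" and u: "u \<in> H2_0 U" and b: "Ck (Suc 0) b"
    and K: "compact K" "K \<subseteq> U" "\<And>x. x \<notin> K \<Longrightarrow> b x = 0"
  shows "(LINT x|vol U. wpd U j (wpd U i u) x * pd j b x) = (LINT x|vol U. wpd U j (wpd U j u) x * pd i b x)"
proof -
  have UL: "U \<in> sets lebesgue" using sets_lebesgue_open[OF U(1)] .
  obtain \<phi> where \<phi>: "\<forall>j. test_fun U (\<phi> j)" "\<And>i. H1_conv U (wpd U i u) (\<lambda>k. wpd U k (wpd U i u)) (\<lambda>j. pd i (\<phi> j))"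
    using H2_0_approx[OF U u] by blast
  have sm: "smooth (\<phi> m)" for m using \<phi>(1) test_fun_smooth by blast
  have C: "Ck k (\<phi> m)" "Ck k (pd i (\<phi> m))" "Ck k (pd k' (pd i (\<phi> m)))" for k k' i m
    using sm[of m] by (auto intro!: smoothD smooth_pd)
  have ip: "(LINT x|vol U. pd j (pd i (\<phi> m)) x * pd j b x) = (LINT x|vol U. pd j (pd j (\<phi> m)) x * pd i b x)" for m
  proof -
    have "(LINT x|vol U. pd j (pd i (\<phi> m)) x * pd j b x) = - (LINT x|vol U. pd j (pd j (pd i (\<phi> m))) x * b x)"
      by (rule integration_by_parts_compact_support[OF C(3) b U(1) K])
    also have "pd j (pd j (pd i (\<phi> m))) = pd i (pd j (pd j (\<phi> m)))"
    proof -
      have "pd j (pd i (\<phi> m)) = pd i (pd j (\<phi> m))" by (rule ext) (rule pd_commute[OF C(1)])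
      moreover have "pd j (pd i (pd j (\<phi> m))) = pd i (pd j (pd j (\<phi> m)))" by (rule ext) (rule pd_commute[OF C(2)])
      ultimately show ?thesis by simp
    qed
    also have "- (LINT x|vol U. pd i (pd j (pd j (\<phi> m))) x * b x) = (LINT x|vol U. pd j (pd j (\<phi> m)) x * pd i b x)"
      by (rule integration_by_parts_compact_support[OF C(3) b U(1) K, symmetric])
    finally show ?thesis .
  qed
  have lim: "(\<lambda>m. LINT x|vol U. pd k (pd i (\<phi> m)) x * pd l b x) \<longlonglongrightarrow> (LINT x|vol U. wpd U k (wpd U i u) x * pd l b x)" for i k l
  proof -
    have "(\<lambda>m. LINT x|vol U. pd k (pd i (\<phi> m)) x \<bullet> pd l b x) \<longlonglongrightarrow> (LINT x|vol U. wpd U k (wpd U i u) x \<bullet> pd l b x)"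
    proof (rule l2_tendsto_inner)
      show "sq_int (vol U) (pd k (pd i (\<phi> m)))" for m
        using C(3)[of 0] by (auto intro!: sq_int_continuous[OF U(2) UL])
      show "sq_int (vol U) (wpd U k (wpd U i u))" using \<phi>(2)[of i] by (simp add: H1_conv_def)
      show "sq_int (vol U) (pd l b)" using b by (auto intro!: sq_int_continuous[OF U(2) UL])
      have "(\<lambda>m. l2 (vol U) (\<lambda>x. wpd U k (wpd U i u) x - pd k (pd i (\<phi> m)) x)) \<longlonglongrightarrow> 0"
        using \<phi>(2)[of i] by (simp add: H1_conv_def)
      then show "(\<lambda>m. l2 (vol U) (\<lambda>x. pd k (pd i (\<phi> m)) x - wpd U k (wpd U i u) x)) \<longlonglongrightarrow> 0"
        by (simp only: l2_minus_commute[of _ "wpd U k (wpd U i u)"])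
    qed
    then show ?thesis by simp
  qed
  show ?thesis
    using LIMSEQ_unique[OF lim[of j i j, unfolded ip] lim[of j j i]] .
qed

section \<open>Integrals of traces over faces\<close>

lemma inner_position_sum: "(x - P) \<bullet> (\<chi> i. W i x) = (\<Sum>i\<in>UNIV. W i x * (x - P) $ i)"
  by (simp add: inner_vec_def mult.commute)

lemma sq_int_inner_mult:
  fixes f g :: "'a \<Rightarrow> real"
  shows "sq_int M f \<Longrightarrow> sq_int M g \<Longrightarrow> integrable M (\<lambda>x. f x * g x)"
  using sq_int_inner[of M f g] by simp

lemma cone_integral_tendsto:
  fixes T U :: "(real^'n::finite) set"
  assumes TU: "sub_ae T U" and T: "compact T" and U: "bounded U" and conv: "H1_conv U w W \<phi>"
  shows "(\<lambda>j. LINT x|vol T. real CARD('n) * \<phi> j x + (x - P) \<bullet> grad (\<phi> j) x)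
    \<longlonglongrightarrow> (LINT x|vol T. real CARD('n) * w x + (x - P) \<bullet> (\<chi> i. W i x))"
proof -
  have TL: "T \<in> sets lebesgue" and UL: "U \<in> sets lebesgue" using TU by (auto simp: sub_ae_def)
  have bT: "bounded T" using T by (rule compact_imp_bounded)
  have fm: "finite_measure (vol T)" using finite_measure_bounded_on[OF bT TL] .
  have lim: "(\<lambda>j. LINT x|vol T. f j x * g x) \<longlonglongrightarrow> (LINT x|vol T. f' x * g x)"
    if f: "\<And>j. continuous_on UNIV (f j)" "sq_int (vol U) f'" "(\<lambda>j. l2 (vol U) (\<lambda>x. f' x - f j x)) \<longlonglongrightarrow> 0"
      and g: "continuous_on UNIV g" for f :: "nat \<Rightarrow> real^'n \<Rightarrow> real" and f' g
  proof -
    have sT: "sq_int (vol T) (f j)" "sq_int (vol U) (f j)" for j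
      using f(1) by (auto intro!: sq_int_continuous bT TL U UL)
    have "(\<lambda>j. LINT x|vol T. f j x \<bullet> g x) \<longlonglongrightarrow> (LINT x|vol T. f' x \<bullet> g x)"
    proof (rule l2_tendsto_inner[OF sT(1) sub_ae_sq_int(1)[OF TU f(2)] sq_int_continuous[OF bT TL g]])
      show "(\<lambda>j. l2 (vol T) (\<lambda>x. f j x - f' x)) \<longlonglongrightarrow> 0"
      proof (rule tendsto_zero_of_square_le[OF f(3)])
        fix j
        have "l2 (vol T) (\<lambda>x. f j x - f' x) \<le> l2 (vol U) (\<lambda>x. f j x - f' x)"
          by (rule sub_ae_sq_int(2)[OF TU sq_int_diff[OF sT(2) f(2)]])
        also have "\<dots> = l2 (vol U) (\<lambda>x. f' x - f j x)" by (rule l2_minus_commute)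
        finally show "(l2 (vol T) (\<lambda>x. f j x - f' x))\<^sup>2 \<le> (l2 (vol U) (\<lambda>x. f' x - f j x))\<^sup>2"
          by (rule power_mono) (rule l2_nonneg)
      qed
    qed
    then show ?thesis by simp
  qed
  have C: "Ck (Suc 0) (\<phi> j)" for j using conv unfolding H1_conv_def by blast
  have c: "continuous_on UNIV (\<phi> j)" "continuous_on UNIV (pd i (\<phi> j))" for i j
    using C[of j] Ck_continuous[OF C[of j]] by auto
  have cx: "continuous_on UNIV (\<lambda>x::real^'n. (x - P) $ i)" for i by (intro continuous_intros)
  have sw: "sq_int (vol U) w" "sq_int (vol U) (W i)" for i using conv by (auto simp: H1_conv_def)
  have swT: "sq_int (vol T) w" "sq_int (vol T) (W i)" for i
    using sub_ae_sq_int(1)[OF TU] sw by auto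
  have e: "(LINT x|vol T. real CARD('n) * v x + (x - P) \<bullet> (\<chi> i. V i x))
      = (LINT x|vol T. v x * real CARD('n)) + (\<Sum>i\<in>UNIV. LINT x|vol T. V i x * (x - P) $ i)"
    if "sq_int (vol T) v" "\<And>i. sq_int (vol T) (V i)" for v V
  proof -
    have 1: "integrable (vol T) (\<lambda>x. v x * real CARD('n))"
      using sq_int_integrable[OF that(1) fm] by simp
    have 2: "integrable (vol T) (\<lambda>x. V i x * (x - P) $ i)" for i
      by (rule sq_int_inner_mult[OF that(2) sq_int_continuous[OF bT TL cx]])
    have "(LINT x|vol T. real CARD('n) * v x + (x - P) \<bullet> (\<chi> i. V i x))
        = (LINT x|vol T. v x * real CARD('n) + (\<Sum>i\<in>UNIV. V i x * (x - P) $ i))"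
      unfolding inner_position_sum by (simp add: mult.commute)
    also have "\<dots> = (LINT x|vol T. v x * real CARD('n)) + (LINT x|vol T. (\<Sum>i\<in>UNIV. V i x * (x - P) $ i))"
      by (rule Bochner_Integration.integral_add[OF 1 Bochner_Integration.integrable_sum[OF 2]])
    also have "(LINT x|vol T. (\<Sum>i\<in>UNIV. V i x * (x - P) $ i)) = (\<Sum>i\<in>UNIV. LINT x|vol T. V i x * (x - P) $ i)"
      by (rule Bochner_Integration.integral_sum[OF 2])
    finally show ?thesis .
  qed
  have "(\<lambda>j. (LINT x|vol T. \<phi> j x * real CARD('n)) + (\<Sum>i\<in>UNIV. LINT x|vol T. pd i (\<phi> j) x * (x - P) $ i))
    \<longlonglongrightarrow> (LINT x|vol T. w x * real CARD('n)) + (\<Sum>i\<in>UNIV. LINT x|vol T. W i x * (x - P) $ i)"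
  proof (intro tendsto_add tendsto_sum)
    show "(\<lambda>j. LINT x|vol T. \<phi> j x * real CARD('n)) \<longlonglongrightarrow> (LINT x|vol T. w x * real CARD('n))"
      by (rule lim[OF c(1) sw(1)]) (use conv in \<open>auto simp: H1_conv_def\<close>)
    show "(\<lambda>j. LINT x|vol T. pd i (\<phi> j) x * (x - P) $ i) \<longlonglongrightarrow> (LINT x|vol T. W i x * (x - P) $ i)" for i
      by (rule lim[OF c(2) sw(2) _ cx]) (use conv in \<open>auto simp: H1_conv_def\<close>)
  qed
  then show ?thesis
    unfolding e[OF swT]
    by (simp only: grad_def e[of "\<phi> _" "\<lambda>i. pd i (\<phi> _)", OF sq_int_continuous[OF bT TL c(1)] sq_int_continuous[OF bT TL c(2)]])
qed

text \<open>The cone formula expresses face integrals by integrals over the simplex, which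
  converge.\<close>

lemma face_integral_tendsto:
  fixes T U :: "(real^'n::finite) set"
  assumes TU: "sub_ae T U" and T: "int CARD('n) simplex T" and U: "bounded U" and conv: "H1_conv U w W \<phi>"
    and N: "\<And>F. F facet_of T \<Longrightarrow> unit_normal F (\<nu> F)"
  defines "I \<equiv> (\<lambda>F. lim (\<lambda>j. LINT x|face_measure F (\<nu> F). \<phi> j x))"
  shows "cone_id \<nu> T w (\<lambda>x. \<chi> i. W i x) I"
    and "\<And>F. F facet_of T \<Longrightarrow> (\<lambda>j. LINT x|face_measure F (\<nu> F). \<phi> j x) \<longlonglongrightarrow> I F"
proof -
  have C: "Ck (Suc 0) (\<phi> j)" for j using conv unfolding H1_conv_def by blast
  have co: "(LINT x|vol T. real CARD('n) * \<phi> j x + (x - P) \<bullet> grad (\<phi> j) x)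
      = \<bar>(P - z) \<bullet> \<nu> F\<bar> * (LINT x|face_measure F (\<nu> F). \<phi> j x)"
    if "F facet_of T" "P \<in> T" "T = convex hull (insert P F)" "z \<in> F" for F P z j
    by (rule cone_id_smooth[OF T N C, unfolded cone_id_def, rule_format, OF _ that])
  have lim: "(\<lambda>j. \<bar>(P - z) \<bullet> \<nu> F\<bar> * (LINT x|face_measure F (\<nu> F). \<phi> j x))
      \<longlonglongrightarrow> (LINT x|vol T. real CARD('n) * w x + (x - P) \<bullet> (\<chi> i. W i x))"
    if "F facet_of T" "P \<in> T" "T = convex hull (insert P F)" "z \<in> F" for F P z
    using cone_integral_tendsto[OF TU compact_simplex[OF T] U conv, of P] unfolding co[OF that] .
  show conv': "(\<lambda>j. LINT x|face_measure F (\<nu> F). \<phi> j x) \<longlonglongrightarrow> I F" if F: "F facet_of T" for F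
  proof -
    obtain z where z: "z \<in> F" using simplex_facet(4)[OF T F] by blast
    let ?h = "\<bar>(apex T F - z) \<bullet> \<nu> F\<bar>"
    have h: "?h \<noteq> 0" using apex(3)[OF T F N[OF F] z] by simp
    have "(\<lambda>j. (?h * (LINT x|face_measure F (\<nu> F). \<phi> j x)) / ?h)
      \<longlonglongrightarrow> (LINT x|vol T. real CARD('n) * w x + (x - apex T F) \<bullet> (\<chi> i. W i x)) / ?h"
      by (rule tendsto_divide[OF lim[OF F apex(1,2)[OF T F] z] tendsto_const h])
    then have "convergent (\<lambda>j. LINT x|face_measure F (\<nu> F). \<phi> j x)"
      using h by (auto simp: convergent_def)
    then show ?thesis unfolding I_def by (simp add: convergent_LIMSEQ_iff)
  qed
  show "cone_id \<nu> T w (\<lambda>x. \<chi> i. W i x) I"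
    unfolding cone_id_def
  proof (intro allI impI)
    fix F P z assume A: "F facet_of T" "P \<in> T" "T = convex hull (insert P F)" "z \<in> F"
    show "(LINT x|vol T. real CARD('n) * w x + (x - P) \<bullet> (\<chi> i. W i x)) = \<bar>(P - z) \<bullet> \<nu> F\<bar> * I F"
      by (rule LIMSEQ_unique[OF lim[OF A] tendsto_mult[OF tendsto_const conv'[OF A(1)]]])
  qed
qed

lemma face_sq_int:
  fixes \<psi> :: "real^'n::finite \<Rightarrow> real"
  assumes F: "unit_normal F n" "compact F" "convex F" "F \<noteq> {}" and \<psi>: "continuous_on UNIV \<psi>"
  shows "finite_measure (face_measure F n)" "sq_int (face_measure F n) \<psi>"
proof -
  obtain z where z: "z \<in> F" using F(4) by blast
  interpret f: flat_face F n z by (rule flat_face_unit_normal[OF F(1-3) z])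
  show fm: "finite_measure (face_measure F n)" by (rule f.finite_face_measure)
  have "bounded (\<psi> ` F)"
    using F(2) by (intro compact_imp_bounded compact_continuous_image continuous_on_subset[OF \<psi>]) auto
  then obtain B where B: "\<And>x. x \<in> F \<Longrightarrow> norm (\<psi> x) \<le> B" by (auto simp: bounded_iff)
  show "sq_int (face_measure F n) \<psi>"
  proof (rule sq_int_bound[OF sq_int_const[OF fm, of B]])
    show "\<psi> \<in> borel_measurable (face_measure F n)"
      by (rule f.face_measurable_continuous[OF continuous_on_subset[OF \<psi>]]) simp
    show "AE x in face_measure F n. norm (\<psi> x) \<le> norm B"
    proof (rule AE_I2)
      fix x assume "x \<in> space (face_measure F n)"
      then have "norm (\<psi> x) \<le> B" using B by (simp add: f.space_face_measure)
      then show "norm (\<psi> x) \<le> norm B" by simp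
    qed
  qed
qed

text \<open>This is the cone formula for \<open>\<psi>\<^sup>2\<close>.\<close>

lemma trace_inequality:
  fixes T :: "(real^'n::finite) set" and \<psi> :: "real^'n \<Rightarrow> real"
  assumes T: "int CARD('n) simplex T" and F: "F facet_of T" and N: "\<And>F. F facet_of T \<Longrightarrow> unit_normal F (\<nu> F)"
    and z: "z \<in> F" and \<psi>: "Ck (Suc 0) \<psi>"
  shows "\<bar>(apex T F - z) \<bullet> \<nu> F\<bar> * (l2 (face_measure F (\<nu> F)) \<psi>)\<^sup>2
    \<le> (real CARD('n) + diameter T) * ((l2 (vol T) \<psi>)\<^sup>2 + (\<Sum>i\<in>UNIV. (l2 (vol T) (pd i \<psi>))\<^sup>2))"
proof -
  let ?P = "apex T F" and ?D = "diameter T"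
  have cT: "compact T" using compact_simplex[OF T] .
  have TL: "T \<in> sets lebesgue" using sets_lebesgue_compact[OF cT] .
  have bT: "bounded T" using compact_imp_bounded[OF cT] .
  have D0: "0 \<le> ?D" using diameter_ge_0[OF bT] .
  have c: "continuous_on UNIV \<psi>" "continuous_on UNIV (pd i \<psi>)" for i using \<psi> Ck_continuous[OF \<psi>] by auto
  have s: "sq_int (vol T) \<psi>" "sq_int (vol T) (pd i \<psi>)" for i
    using c by (auto intro!: sq_int_continuous bT TL)
  have gr: "grad \<psi> = (\<lambda>x. \<chi> i. pd i \<psi> x)" by (simp add: grad_def fun_eq_iff)
  have sg: "sq_int (vol T) (grad \<psi>)"
    unfolding gr by (rule sq_int_chi[OF s(2)])
  have lg: "(l2 (vol T) (grad \<psi>))\<^sup>2 = (\<Sum>i\<in>UNIV. (l2 (vol T) (pd i \<psi>))\<^sup>2)"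
    unfolding gr by (rule l2_chi_sq[OF s(2)])
  have C2: "Ck (Suc 0) (\<lambda>x. \<psi> x * \<psi> x)" by (rule Ck_mult[OF \<psi> \<psi>])
  have g2: "grad (\<lambda>x. \<psi> x * \<psi> x) x = (2 * \<psi> x) *\<^sub>R grad \<psi> x" for x
    using pd_mult[OF Ck_differentiable[OF \<psi>] Ck_differentiable[OF \<psi>]] by (simp add: grad_def vec_eq_iff)
  have "\<bar>(?P - z) \<bullet> \<nu> F\<bar> * (l2 (face_measure F (\<nu> F)) \<psi>)\<^sup>2 = \<bar>(?P - z) \<bullet> \<nu> F\<bar> * (LINT x|face_measure F (\<nu> F). \<psi> x * \<psi> x)"
    unfolding l2_sq by (simp add: power2_eq_square)
  also have "\<dots> = (LINT x|vol T. real CARD('n) * (\<psi> x * \<psi> x) + (x - ?P) \<bullet> grad (\<lambda>x. \<psi> x * \<psi> x) x)"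
    by (rule cone_id_smooth[OF T N C2, unfolded cone_id_def, rule_format, OF _ F apex(1,2)[OF T F] z, symmetric])
  also have "\<dots> \<le> (LINT x|vol T. (real CARD('n) + ?D) * (norm (\<psi> x))\<^sup>2 + ?D * (norm (grad \<psi> x))\<^sup>2)"
  proof (rule integral_mono_AE')
    show "integrable (vol T) (\<lambda>x. (real CARD('n) + ?D) * (norm (\<psi> x))\<^sup>2 + ?D * (norm (grad \<psi> x))\<^sup>2)"
      using s(1) sg by (auto simp: sq_int_def)
    show "AE x in vol T. real CARD('n) * (\<psi> x * \<psi> x) + (x - ?P) \<bullet> grad (\<lambda>x. \<psi> x * \<psi> x) x
        \<le> (real CARD('n) + ?D) * (norm (\<psi> x))\<^sup>2 + ?D * (norm (grad \<psi> x))\<^sup>2"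
    proof (rule AE_I2)
      fix x assume "x \<in> space (vol T)"
      then have "norm (x - ?P) \<le> ?D"
        using diameter_bounded_bound[OF bT, of x ?P] apex(1)[OF T F] by (simp add: dist_norm)
      then have "\<bar>(x - ?P) \<bullet> grad \<psi> x\<bar> \<le> ?D * norm (grad \<psi> x)"
        by (meson Cauchy_Schwarz_ineq2 mult_right_mono norm_ge_zero order_trans)
      then have "\<bar>(2 * \<psi> x) * ((x - ?P) \<bullet> grad \<psi> x)\<bar> \<le> (2 * \<bar>\<psi> x\<bar>) * (?D * norm (grad \<psi> x))"
        unfolding abs_mult by (intro mult_mono) auto
      also have "\<dots> = ?D * (2 * \<bar>\<psi> x\<bar> * norm (grad \<psi> x))" by simp
      also have "\<dots> \<le> ?D * ((norm (\<psi> x))\<^sup>2 + (norm (grad \<psi> x))\<^sup>2)"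
        using sum_squares_bound[of "\<bar>\<psi> x\<bar>" "norm (grad \<psi> x)"] by (intro mult_left_mono D0) simp
      finally have "(2 * \<psi> x) * ((x - ?P) \<bullet> grad \<psi> x) \<le> ?D * (norm (\<psi> x))\<^sup>2 + ?D * (norm (grad \<psi> x))\<^sup>2"
        by (simp only: distrib_left)
      then show "real CARD('n) * (\<psi> x * \<psi> x) + (x - ?P) \<bullet> grad (\<lambda>x. \<psi> x * \<psi> x) x
        \<le> (real CARD('n) + ?D) * (norm (\<psi> x))\<^sup>2 + ?D * (norm (grad \<psi> x))\<^sup>2"
        by (simp add: g2 power2_eq_square distrib_right)
    qed
    show "AE x in vol T. 0 \<le> (real CARD('n) + ?D) * (norm (\<psi> x))\<^sup>2 + ?D * (norm (grad \<psi> x))\<^sup>2"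
      using D0 by (intro AE_I2 add_nonneg_nonneg mult_nonneg_nonneg) auto
  qed
  also have "\<dots> = (real CARD('n) + ?D) * (l2 (vol T) \<psi>)\<^sup>2 + ?D * (l2 (vol T) (grad \<psi>))\<^sup>2"
    using s(1) sg by (simp add: l2_sq sq_int_def)
  also have "\<dots> \<le> (real CARD('n) + ?D) * (l2 (vol T) \<psi>)\<^sup>2 + (real CARD('n) + ?D) * (l2 (vol T) (grad \<psi>))\<^sup>2"
    by (intro add_left_mono mult_right_mono) auto
  finally show ?thesis by (simp add: lg distrib_left)
qed

text \<open>The trace in the definition of \<open>H1_trace\<close> exists by the trace inequality and the completeness of
  \<open>L\<^sup>2(F)\<close>; its integral is determined by the cone formula.\<close>

lemma H1_trace_integral:
  fixes T U :: "(real^'n::finite) set"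
  assumes TU: "sub_ae T U" and T: "int CARD('n) simplex T" and U: "open U" "bounded U"
    and W: "\<And>i. weak_partial U i w (W i)" and conv: "H1_conv U w W \<phi>" and sm: "\<And>j. smooth (\<phi> j)"
    and N: "\<And>F. F facet_of T \<Longrightarrow> unit_normal F (\<nu> F)" and F: "F facet_of T"
  shows "(LINT x|face_measure F (\<nu> F). H1_trace U F (\<nu> F) w x) = lim (\<lambda>j. LINT x|face_measure F (\<nu> F). \<phi> j x)"
    and "integrable (face_measure F (\<nu> F)) (H1_trace U F (\<nu> F) w)"
proof -
  let ?M = "face_measure F (\<nu> F)"
  obtain z where z: "z \<in> F" using simplex_facet(4)[OF T F] by blast
  define h where "h = \<bar>(apex T F - z) \<bullet> \<nu> F\<bar>"
  have h: "h > 0" using apex(3)[OF T F N[OF F] z] by (simp add: h_def)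
  note Fs = N[OF F] simplex_facet(2-4)[OF T F]
  have sw: "sq_int (vol U) w" "\<And>i. sq_int (vol U) (W i)" using conv by (auto simp: H1_conv_def)
  have UL: "U \<in> sets lebesgue" using sets_lebesgue_open[OF U(1)] .
  have C: "Ck (Suc 0) (\<phi> j)" for j using smoothD[OF sm] .
  have fm: "finite_measure ?M" using face_sq_int(1)[OF Fs continuous_on_const[of UNIV 0]] .
  have sM: "sq_int ?M \<psi>" if "continuous_on UNIV \<psi>" for \<psi> :: "real^'n \<Rightarrow> real" by (rule face_sq_int(2)[OF Fs that])
  define a where "a j = l2 (vol U) (\<lambda>x. w x - \<phi> j x) + (\<Sum>i\<in>UNIV. l2 (vol U) (\<lambda>x. W i x - pd i (\<phi> j) x))" for j
  have a0: "a \<longlonglongrightarrow> 0"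
  proof -
    have "(\<lambda>j. l2 (vol U) (\<lambda>x. w x - \<phi> j x) + (\<Sum>i\<in>UNIV. l2 (vol U) (\<lambda>x. W i x - pd i (\<phi> j) x))) \<longlonglongrightarrow> 0 + (\<Sum>i\<in>(UNIV::'n set). 0)"
      using conv unfolding H1_conv_def by (intro tendsto_add tendsto_sum) auto
    then show ?thesis by (simp add: a_def[abs_def])
  qed
  define c where "c = (real CARD('n) + diameter T) / h"
  have D0: "0 \<le> diameter T" using diameter_ge_0[OF compact_imp_bounded[OF compact_simplex[OF T]]] .
  have c0: "0 \<le> c" using D0 h by (simp add: c_def)
  have diff_bound: "l2 ?M (\<lambda>x. \<phi> i x - \<phi> j x) \<le> sqrt c * (a i + a j)" for i j
  proof (rule power2_le_imp_le)
    let ?\<psi> = "\<lambda>x. \<phi> i x - \<phi> j x"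
    have C\<psi>: "Ck (Suc 0) ?\<psi>" by (rule Ck_diff[OF C C])
    have pd\<psi>: "pd k ?\<psi> = (\<lambda>x. pd k (\<phi> i) x - pd k (\<phi> j) x)" for k
      using pd_linear_comb[OF C C, of k 1 i "-1" j] by simp
    have tri: "l2 (vol T) (\<lambda>x. p x - q x) \<le> l2 (vol U) (\<lambda>x. f x - p x) + l2 (vol U) (\<lambda>x. f x - q x)"
      if "continuous_on UNIV p" "continuous_on UNIV q" "sq_int (vol U) f" for p q f :: "real^'n \<Rightarrow> real"
    proof -
      have s: "sq_int (vol U) p" "sq_int (vol U) q"
        using that by (auto intro: sq_int_continuous[OF U(2) UL])
      have "l2 (vol T) (\<lambda>x. p x - q x) \<le> l2 (vol U) (\<lambda>x. p x - q x)"
        by (rule sub_ae_sq_int(2)[OF TU sq_int_diff[OF s]])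
      also have "\<dots> \<le> l2 (vol U) (\<lambda>x. p x - f x) + l2 (vol U) (\<lambda>x. f x - q x)"
        by (rule l2_triangle_diff[OF s(1) that(3) s(2)])
      finally show ?thesis by (simp only: l2_minus_commute[of _ p f])
    qed
    have cp: "continuous_on UNIV (\<phi> k)" "continuous_on UNIV (pd l (\<phi> k))" for k l
      using C[of k] Ck_continuous[OF C[of k]] by auto
    let ?s = "l2 (vol T) ?\<psi>" and ?t = "\<lambda>k. l2 (vol T) (pd k ?\<psi>)"
    have "?s + (\<Sum>k\<in>UNIV. ?t k) \<le> (l2 (vol U) (\<lambda>x. w x - \<phi> i x) + l2 (vol U) (\<lambda>x. w x - \<phi> j x))
        + (\<Sum>k\<in>UNIV. l2 (vol U) (\<lambda>x. W k x - pd k (\<phi> i) x) + l2 (vol U) (\<lambda>x. W k x - pd k (\<phi> j) x))"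
      unfolding pd\<psi> by (intro add_mono sum_mono tri cp sw)
    then have le: "?s + (\<Sum>k\<in>UNIV. ?t k) \<le> a i + a j" by (simp add: a_def sum.distrib)
    have t0: "0 \<le> (\<Sum>k\<in>UNIV. ?t k)" by (intro sum_nonneg l2_nonneg)
    have "(\<Sum>k\<in>UNIV. (?t k)\<^sup>2) \<le> (\<Sum>k\<in>UNIV. ?t k * (\<Sum>l\<in>UNIV. ?t l))"
      unfolding power2_eq_square by (intro sum_mono mult_left_mono member_le_sum l2_nonneg) auto
    then have "?s\<^sup>2 + (\<Sum>k\<in>UNIV. (?t k)\<^sup>2) \<le> ?s\<^sup>2 + (\<Sum>k\<in>UNIV. ?t k)\<^sup>2"
      by (simp add: power2_eq_square sum_distrib_right)
    also have "\<dots> \<le> (?s + (\<Sum>k\<in>UNIV. ?t k))\<^sup>2"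
      unfolding power2_sum using mult_nonneg_nonneg[OF l2_nonneg t0, of "vol T" ?\<psi>] by simp
    also have "\<dots> \<le> (a i + a j)\<^sup>2"
      using le by (rule power_mono) (intro add_nonneg_nonneg sum_nonneg l2_nonneg)
    finally have "(real CARD('n) + diameter T) * (?s\<^sup>2 + (\<Sum>k\<in>UNIV. (?t k)\<^sup>2)) \<le> (real CARD('n) + diameter T) * (a i + a j)\<^sup>2"
      using D0 by (intro mult_left_mono) auto
    then have "h * (l2 ?M ?\<psi>)\<^sup>2 \<le> (real CARD('n) + diameter T) * (a i + a j)\<^sup>2"
      using order_trans[OF trace_inequality[OF T F N z C\<psi>]] unfolding h_def by blast
    then have "(l2 ?M ?\<psi>)\<^sup>2 \<le> c * (a i + a j)\<^sup>2"
      using h by (simp add: c_def pos_le_divide_eq mult.commute)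
    then show "(l2 ?M ?\<psi>)\<^sup>2 \<le> (sqrt c * (a i + a j))\<^sup>2" using c0 by (simp add: power_mult_distrib)
    have "0 \<le> a k" for k unfolding a_def by (intro add_nonneg_nonneg sum_nonneg l2_nonneg)
    then show "0 \<le> sqrt c * (a i + a j)" using c0 by simp
  qed
  obtain g where g: "sq_int ?M g" "(\<lambda>j. l2 ?M (\<lambda>x. \<phi> j x - g x)) \<longlonglongrightarrow> 0"
  proof (rule l2_complete[OF fm, of \<phi>])
    show "sq_int ?M (\<phi> j)" for j using sM[OF Ck_continuous[OF C]] .
    fix e :: real assume e: "e > 0"
    define d where "d = e / (2 * (sqrt c + 1))"
    have sc: "sqrt c + 1 > 0" using c0 by (simp add: add_nonneg_pos)
    have d: "d > 0" using e sc by (simp add: d_def)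
    obtain N where N: "\<And>j. j \<ge> N \<Longrightarrow> a j < d"
      using order_tendstoD(2)[OF a0 d] by (auto simp: eventually_sequentially)
    have "l2 ?M (\<lambda>x. \<phi> i x - \<phi> j x) < e" if "i \<ge> N" "j \<ge> N" for i j
    proof -
      have "l2 ?M (\<lambda>x. \<phi> i x - \<phi> j x) \<le> sqrt c * (a i + a j)" by (rule diff_bound)
      also have "\<dots> \<le> sqrt c * (2 * d)" using N[OF that(1)] N[OF that(2)] c0 by (intro mult_left_mono) auto
      also have "\<dots> < (sqrt c + 1) * (2 * d)" using d by simp
      also have "\<dots> = e"
      proof -
        have "s * (2 * (e / (2 * s))) = e" if "s > 0" for s :: real using that by simp
        then show ?thesis using sc unfolding d_def .
      qed
      finally show ?thesis .
    qed
    then show "\<exists>N. \<forall>i\<ge>N. \<forall>j\<ge>N. l2 ?M (\<lambda>x. \<phi> i x - \<phi> j x) < e" by blast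
  qed auto
  let ?Q = "\<lambda>g. in_l2 ?M g \<and> (\<exists>\<psi>. (\<forall>j. smooth (\<psi> j)) \<and> (\<lambda>j::nat. H1_norm U (\<lambda>x. \<psi> j x - w x)) \<longlonglongrightarrow> 0 \<and>
        (\<lambda>j::nat. l2 ?M (\<lambda>x. \<psi> j x - g x)) \<longlonglongrightarrow> 0)"
  have Hconv: "(\<lambda>j. H1_norm U (\<lambda>x. \<psi> j x - w x)) \<longlonglongrightarrow> 0 \<longleftrightarrow> H1_conv U w W \<psi>" if "\<And>j. smooth (\<psi> j)" for \<psi>
  proof -
    have "(\<lambda>j. H1_norm U (\<lambda>x. \<psi> j x - w x)) = (\<lambda>j. H1_norm U (\<lambda>x. w x - \<psi> j x))"
      by (rule ext) (rule H1_norm_conv_iff(2)[OF U sw(1) W sw(2) smoothD[OF that]])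
    then show ?thesis using H1_norm_conv_iff(1)[OF U sw(1) W sw(2) smoothD[OF that]] by simp
  qed
  have "?Q g" using g sm conv Hconv[OF sm] by (intro conjI exI[of _ \<phi>] allI) (simp_all add: in_l2_iff_sq_int)
  then have "?Q (H1_trace U F (\<nu> F) w)" unfolding H1_trace_def by (rule someI[of ?Q])
  then obtain \<psi> where \<psi>: "in_l2 ?M (H1_trace U F (\<nu> F) w)" "\<forall>j. smooth (\<psi> j)"
    "(\<lambda>j::nat. H1_norm U (\<lambda>x. \<psi> j x - w x)) \<longlonglongrightarrow> 0" "(\<lambda>j::nat. l2 ?M (\<lambda>x. \<psi> j x - H1_trace U F (\<nu> F) w x)) \<longlonglongrightarrow> 0"
    by (elim conjE exE)
  have c\<psi>: "H1_conv U w W \<psi>" using Hconv[of \<psi>] \<psi>(2,3) by blast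
  have "(\<lambda>j. LINT x|?M. \<psi> j x \<bullet> 1) \<longlonglongrightarrow> (LINT x|?M. H1_trace U F (\<nu> F) w x \<bullet> 1)"
  proof (rule l2_tendsto_inner)
    show "sq_int ?M (\<psi> j)" for j
    proof -
      have "Ck 0 (\<psi> j)" using \<psi>(2) smoothD by blast
      then show ?thesis using sM Ck_continuous by blast
    qed
    show "sq_int ?M (H1_trace U F (\<nu> F) w)" using \<psi>(1) by (simp add: in_l2_iff_sq_int)
    show "sq_int ?M (\<lambda>x. 1)" by (rule sq_int_const[OF fm])
  qed (rule \<psi>(4))
  then have "(\<lambda>j. LINT x|?M. \<psi> j x) \<longlonglongrightarrow> (LINT x|?M. H1_trace U F (\<nu> F) w x)" by simp
  then have 1: "lim (\<lambda>j. LINT x|?M. \<psi> j x) = (LINT x|?M. H1_trace U F (\<nu> F) w x)" by (rule limI)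
  have "h * lim (\<lambda>j. LINT x|?M. \<psi> j x) = h * lim (\<lambda>j. LINT x|?M. \<phi> j x)"
    unfolding h_def
    by (rule trans[OF face_integral_tendsto(1)[OF TU T U(2) c\<psi> N, unfolded cone_id_def, rule_format, OF _ F apex(1,2)[OF T F] z, symmetric]
          face_integral_tendsto(1)[OF TU T U(2) conv N, unfolded cone_id_def, rule_format, OF _ F apex(1,2)[OF T F] z]])
  then show "(LINT x|?M. H1_trace U F (\<nu> F) w x) = lim (\<lambda>j. LINT x|?M. \<phi> j x)" using h 1 by simp
  show "integrable ?M (H1_trace U F (\<nu> F) w)"
    using \<psi>(1) by (intro sq_int_integrable fm) (simp add: in_l2_iff_sq_int)
qed

section \<open>Geometry of shape-regular triangulations\<close>

text \<open>The points on the other side of the graph show that no boundary point is interior to the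
  closure.  For a slit domain the equality would fail, and faces in the slit would look like interior
  ones.\<close>

lemma lipschitz_domain_interior_closure:
  fixes \<Omega> :: "(real^'n::finite) set"
  assumes lip: "lipschitz_domain \<Omega>" and op: "open \<Omega>"
  shows "interior (closure \<Omega>) = \<Omega>"
proof
  show "\<Omega> \<subseteq> interior (closure \<Omega>)"
    using op closure_subset by (rule interior_maximal[rotated])
  show "interior (closure \<Omega>) \<subseteq> \<Omega>"
  proof (rule ccontr)
    assume "\<not> interior (closure \<Omega>) \<subseteq> \<Omega>"
    then obtain x where x: "x \<in> interior (closure \<Omega>)" "x \<notin> \<Omega>" by blast
    then have "x \<in> frontier \<Omega>" using interior_subset[of "closure \<Omega>"] op by (auto simp: frontier_def interior_open)
    then obtain e r L g where e: "norm e = 1" "r > 0" "L-lipschitz_on UNIV g"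
      "\<forall>y\<in>ball x r. y \<in> \<Omega> \<longleftrightarrow> g (y - (y \<bullet> e) *\<^sub>R e) < y \<bullet> e"
      using lip unfolding lipschitz_domain_def by blast
    have ee: "e \<bullet> e = 1" using e(1) by (simp add: dot_square_norm)
    have cg: "continuous_on UNIV g" using lipschitz_on_continuous_on[OF e(3)] .
    let ?k = "\<lambda>y. y \<bullet> e - g (y - (y \<bullet> e) *\<^sub>R e)"
    have ck: "continuous_on UNIV ?k"
      by (intro continuous_intros continuous_on_compose2[OF cg]) auto
    have kx: "?k x \<le> 0" using e(4) x(2) e(2) by (metis centre_in_ball diff_le_0_iff_le linorder_not_less)
    obtain \<delta> where \<delta>: "\<delta> > 0" "ball x \<delta> \<subseteq> closure \<Omega>" using x(1) by (auto simp: mem_interior)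
    define t where "t = min \<delta> r / 2"
    have t: "t > 0" "t < \<delta>" "t < r" using \<delta>(1) e(2) by (auto simp: t_def)
    let ?y = "x - t *\<^sub>R e"
    have yb: "?y \<in> ball x \<delta>" "?y \<in> ball x r" using t e(1) by (auto simp: dist_norm)
    have "?y - (?y \<bullet> e) *\<^sub>R e = x - (x \<bullet> e) *\<^sub>R e" by (simp add: inner_diff_left ee algebra_simps)
    then have "?k ?y = ?y \<bullet> e - g (x - (x \<bullet> e) *\<^sub>R e)" by (simp only:)
    also have "\<dots> = ?k x - t" by (simp add: inner_diff_left ee)
    finally have "?k ?y = ?k x - t" .
    then have ky: "?k ?y < 0" using kx t(1) by linarith
    have "open {y. ?k y < 0}" by (rule open_Collect_less[OF ck continuous_on_const])
    then have "open ({y. ?k y < 0} \<inter> ball x r)" by blast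
    moreover have "?y \<in> {y. ?k y < 0} \<inter> ball x r" using ky yb by blast
    moreover have "{y. ?k y < 0} \<inter> ball x r \<inter> \<Omega> = {}" using e(4) by auto
    ultimately have "?y \<notin> closure \<Omega>" by (meson disjoint_iff open_Int_closure_eq_empty)
    then show False using yb(1) \<delta>(2) by blast
  qed
qed

locale mesh =
  fixes \<Omega> :: "(real^'n::finite) set" and \<T> \<nu> \<kappa>
  assumes dom: "lipschitz_polytope \<Omega>" and tri: "regular_triangulation \<Omega> \<T>"
    and shape: "shape_regular \<kappa> \<T>" and nor: "face_normals \<Omega> \<T> \<nu>" and dim2: "2 \<le> CARD('n)"
begin

lemma open_dom: "open \<Omega>" and bounded_dom: "bounded \<Omega>"
  using dom by (auto simp: lipschitz_polytope_def)

lemma dom_lebesgue: "\<Omega> \<in> sets lebesgue" using sets_lebesgue_open[OF open_dom] .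

lemma int_clos: "interior (closure \<Omega>) = \<Omega>"
  using dom lipschitz_domain_interior_closure by (auto simp: lipschitz_polytope_def)

lemma finite_T: "finite \<T>" and simplex_T: "T \<in> \<T> \<Longrightarrow> int CARD('n) simplex T" and Union_T: "\<Union>\<T> = closure \<Omega>"
  using tri by (auto simp: regular_triangulation_def triangulation_def)

lemma face_inter: "T \<in> \<T> \<Longrightarrow> K \<in> \<T> \<Longrightarrow> T \<inter> K face_of T"
  using tri by (auto simp: regular_triangulation_def triangulation_def)

lemma compact_T: "T \<in> \<T> \<Longrightarrow> compact T" and convex_T: "T \<in> \<T> \<Longrightarrow> convex T"
  using compact_simplex[OF simplex_T] convex_simplex[OF simplex_T] by auto

lemma bounded_T: "T \<in> \<T> \<Longrightarrow> bounded T" using compact_imp_bounded[OF compact_T] .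

lemma T_lebesgue: "T \<in> \<T> \<Longrightarrow> T \<in> sets lebesgue" using sets_lebesgue_compact[OF compact_T] .

lemma finite_T_measure: "T \<in> \<T> \<Longrightarrow> finite_measure (vol T)"
  using finite_measure_bounded_on[OF bounded_T T_lebesgue] .

lemma inball: "T \<in> \<T> \<Longrightarrow> \<exists>z r. 0 < r \<and> cball z r \<subseteq> T \<and> diameter T \<le> \<kappa> * r"
  using shape by (auto simp: shape_regular_def)

lemma interior_T_ne: "T \<in> \<T> \<Longrightarrow> interior T \<noteq> {}"
proof -
  assume "T \<in> \<T>"
  then obtain z r where "0 < r" "cball z r \<subseteq> T" using inball by blast
  then have "z \<in> interior T" by (meson ball_subset_cball centre_in_ball interior_maximal open_ball subset_iff subset_trans)
  then show ?thesis by blast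
qed

lemma interior_T_dom: "T \<in> \<T> \<Longrightarrow> interior T \<subseteq> \<Omega>"
  using Union_T int_clos interior_mono[of T "closure \<Omega>"] by blast

lemma interior_disjoint:
  assumes "T \<in> \<T>" "K \<in> \<T>" "T \<noteq> K"
  shows "interior T \<inter> interior K = {}"
proof (rule ccontr)
  assume ne: "interior T \<inter> interior K \<noteq> {}"
  have "T \<inter> K = T"
  proof (rule ccontr)
    assume "T \<inter> K \<noteq> T"
    then have "T \<inter> K \<inter> interior T = {}" using face_of_disjoint_interior[OF face_inter[OF assms(1,2)]] by simp
    then show False using ne interior_subset by blast
  qed
  moreover have "K \<inter> T = K"
  proof (rule ccontr)
    assume "K \<inter> T \<noteq> K"
    then have "K \<inter> T \<inter> interior K = {}" using face_of_disjoint_interior[OF face_inter[OF assms(2,1)]] by simp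
    then show False using ne interior_subset by blast
  qed
  ultimately show False using assms(3) by blast
qed

lemma frontier_null: "T \<in> \<T> \<Longrightarrow> AE x in lebesgue. x \<notin> frontier T"
  using negligible_convex_frontier[OF convex_T] by (intro AE_not_in) (simp add: negligible_iff_null_sets)

lemma AE_skeleton: "AE x in lebesgue. \<forall>T\<in>\<T>. x \<notin> frontier T"
  using frontier_null finite_T by (intro AE_finite_allI)

lemma interior_T_iff: "T \<in> \<T> \<Longrightarrow> x \<notin> frontier T \<Longrightarrow> x \<in> interior T \<longleftrightarrow> x \<in> T"
  using closure_closed[OF compact_imp_closed[OF compact_T]] interior_subset by (auto simp: frontier_def)

lemma sub_ae_T_interior:
  assumes T: "T \<in> \<T>"
  shows "sub_ae T (interior T)"
proof -
  have "AE x in lebesgue. x \<in> T \<longrightarrow> x \<in> interior T"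
    using frontier_null[OF T] by eventually_elim (simp add: interior_T_iff[OF T])
  then show ?thesis by (simp add: sub_ae_def T_lebesgue[OF T] sets_lebesgue_open)
qed

lemma sub_ae_interior_T: "T \<in> \<T> \<Longrightarrow> sub_ae (interior T) T"
  by (rule sub_ae_subset) (auto simp: T_lebesgue sets_lebesgue_open interior_subset)

lemma sub_ae_interior_dom: "T \<in> \<T> \<Longrightarrow> sub_ae (interior T) \<Omega>"
  by (rule sub_ae_subset) (auto simp: dom_lebesgue sets_lebesgue_open dest: interior_T_dom)

lemma sub_ae_T_dom: "T \<in> \<T> \<Longrightarrow> sub_ae T \<Omega>"
  using sub_ae_trans[OF sub_ae_T_interior sub_ae_interior_dom] .

lemma indicator_sum_AE: "AE x in lebesgue. (\<Sum>T\<in>\<T>. indicat_real T x) = indicator \<Omega> x"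
  using AE_skeleton
proof eventually_elim
  case (elim x)
  show ?case
  proof (cases "x \<in> \<Omega>")
    case True
    then obtain T where T: "T \<in> \<T>" "x \<in> T" using Union_T closure_subset by blast
    have "indicat_real K x = (if K = T then 1 else 0)" if "K \<in> \<T>" for K
      using interior_disjoint[OF that T(1)] interior_T_iff[OF that] interior_T_iff[OF T(1)] elim that T
      by (auto simp: indicator_def)
    then have "(\<Sum>K\<in>\<T>. indicat_real K x) = (\<Sum>K\<in>\<T>. if K = T then 1 else 0)" by (intro sum.cong) auto
    then show ?thesis using T(1) finite_T True by simp
  next
    case False
    have "indicat_real K x = 0" if "K \<in> \<T>" for K
      using interior_T_iff[OF that] elim that interior_T_dom[OF that] False by (auto simp: indicator_def)
    then show ?thesis using False by simp
  qed
qed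

lemma integral_mesh:
  fixes f :: "real^'n \<Rightarrow> real"
  assumes f: "integrable (vol \<Omega>) f"
  shows "(LINT x|vol \<Omega>. f x) = (\<Sum>T\<in>\<T>. LINT x|vol T. f x)"
proof -
  have i: "integrable lebesgue (\<lambda>x. indicator T x * f x)" if "T \<in> \<T>" for T
    using sub_ae_integrable[OF sub_ae_T_dom[OF that] f] T_lebesgue[OF that] by (simp add: integrable_restrict_space)
  have i\<Omega>: "integrable lebesgue (\<lambda>x. indicator \<Omega> x * f x)"
    using f dom_lebesgue by (simp add: integrable_restrict_space)
  have "(LINT x|vol \<Omega>. f x) = (LINT x|lebesgue. indicator \<Omega> x * f x)"
    using dom_lebesgue by (simp add: integral_restrict_space)
  also have "\<dots> = (LINT x|lebesgue. (\<Sum>T\<in>\<T>. indicator T x * f x))"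
  proof (rule integral_cong_AE)
    show "(\<lambda>x. indicator \<Omega> x * f x) \<in> borel_measurable lebesgue" using i\<Omega> by (rule borel_measurable_integrable)
    show "(\<lambda>x. \<Sum>T\<in>\<T>. indicator T x * f x) \<in> borel_measurable lebesgue"
      using i by (intro borel_measurable_sum) (rule borel_measurable_integrable)
    show "AE x in lebesgue. indicator \<Omega> x * f x = (\<Sum>T\<in>\<T>. indicator T x * f x)"
      using indicator_sum_AE by eventually_elim (simp flip: sum_distrib_right)
  qed
  also have "\<dots> = (\<Sum>T\<in>\<T>. LINT x|lebesgue. indicator T x * f x)"
    by (rule Bochner_Integration.integral_sum) (rule i)
  also have "\<dots> = (\<Sum>T\<in>\<T>. LINT x|vol T. f x)"
    using T_lebesgue by (intro sum.cong refl) (simp add: integral_restrict_space)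
  finally show ?thesis .
qed

lemma measurable_mesh:
  fixes f :: "real^'n \<Rightarrow> 'b::euclidean_space"
  assumes "\<And>T. T \<in> \<T> \<Longrightarrow> f \<in> borel_measurable (vol T)"
  shows "f \<in> borel_measurable (vol \<Omega>)"
proof -
  have "(\<lambda>x. \<Sum>T\<in>\<T>. indicator T x *\<^sub>R f x) \<in> borel_measurable lebesgue"
    using assms T_lebesgue by (intro borel_measurable_sum) (simp add: borel_measurable_restrict_space_iff)
  moreover have "AE x in lebesgue. (\<Sum>T\<in>\<T>. indicator T x *\<^sub>R f x) = indicator \<Omega> x *\<^sub>R f x"
    using indicator_sum_AE by eventually_elim (simp flip: scaleR_sum_left)
  ultimately have "(\<lambda>x. indicator \<Omega> x *\<^sub>R f x) \<in> borel_measurable lebesgue" by (rule borel_measurable_AE)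
  then show ?thesis using dom_lebesgue by (simp add: borel_measurable_restrict_space_iff)
qed

lemma sq_int_mesh:
  fixes f :: "real^'n \<Rightarrow> 'b::euclidean_space"
  assumes f: "\<And>T. T \<in> \<T> \<Longrightarrow> sq_int (vol T) f"
  shows "sq_int (vol \<Omega>) f"
proof -
  have m: "f \<in> borel_measurable (vol \<Omega>)"
    using f by (intro measurable_mesh) (simp add: sq_int_def)
  have i: "integrable lebesgue (\<lambda>x. indicator T x * (norm (f x))\<^sup>2)" if "T \<in> \<T>" for T
    using f[OF that] T_lebesgue[OF that] by (simp add: sq_int_def integrable_restrict_space)
  have "integrable lebesgue (\<lambda>x. \<Sum>T\<in>\<T>. indicator T x * (norm (f x))\<^sup>2)"
    by (rule Bochner_Integration.integrable_sum) (rule i)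
  moreover have "(\<lambda>x. indicator \<Omega> x * (norm (f x))\<^sup>2) \<in> borel_measurable lebesgue"
  proof -
    have "(\<lambda>x. (norm (f x))\<^sup>2) \<in> borel_measurable (vol \<Omega>)" using m by measurable
    then show ?thesis using dom_lebesgue by (simp add: borel_measurable_restrict_space_iff)
  qed
  moreover have "AE x in lebesgue. (\<Sum>T\<in>\<T>. indicator T x * (norm (f x))\<^sup>2) = indicator \<Omega> x * (norm (f x))\<^sup>2"
    using indicator_sum_AE by eventually_elim (simp flip: sum_distrib_right)
  ultimately have "integrable lebesgue (\<lambda>x. indicator \<Omega> x * (norm (f x))\<^sup>2)"
    by (rule integrable_cong_AE_imp[where g = "\<lambda>x. \<Sum>T\<in>\<T>. indicator T x * (norm (f x))\<^sup>2"])
  then show ?thesis using m dom_lebesgue by (simp add: sq_int_def integrable_restrict_space)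
qed

lemma l2_mesh:
  fixes f :: "real^'n \<Rightarrow> 'b::euclidean_space"
  assumes "sq_int (vol \<Omega>) f"
  shows "(l2 (vol \<Omega>) f)\<^sup>2 = (\<Sum>T\<in>\<T>. (l2 (vol T) f)\<^sup>2)"
  unfolding l2_sq using assms by (intro integral_mesh) (simp add: sq_int_def)

definition nbrs :: "(real^'n) set \<Rightarrow> (real^'n) set set" where
  "nbrs T = {K \<in> \<T>. K \<inter> T \<noteq> {}}"

lemma patch_eq: "patch \<T> T = interior (\<Union>(nbrs T))"
  by (simp add: patch_def nbrs_def)

lemma finite_nbrs: "finite (nbrs T)" using finite_T by (simp add: nbrs_def)

lemma T_in_nbrs: "T \<in> \<T> \<Longrightarrow> T \<in> nbrs T"
  using interior_T_ne interior_subset by (auto simp: nbrs_def)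

lemma sub_ae_patch_dom: "sub_ae (patch \<T> T) \<Omega>"
proof (rule sub_ae_subset)
  have "interior (\<Union>(nbrs T)) \<subseteq> interior (closure \<Omega>)"
    using Union_T by (intro interior_mono) (auto simp: nbrs_def)
  then show "patch \<T> T \<subseteq> \<Omega>" by (simp add: patch_eq int_clos)
qed (auto simp: patch_eq sets_lebesgue_open dom_lebesgue)

lemma l2_patch_le:
  fixes f :: "real^'n \<Rightarrow> 'b::euclidean_space"
  assumes f: "sq_int (vol \<Omega>) f"
  shows "(l2 (vol (patch \<T> T)) f)\<^sup>2 \<le> (\<Sum>K\<in>nbrs T. (l2 (vol K) f)\<^sup>2)"
proof -
  have PL: "patch \<T> T \<in> sets lebesgue" by (simp add: patch_eq sets_lebesgue_open)
  have i: "integrable lebesgue (\<lambda>x. indicator K x * (norm (f x))\<^sup>2)" if "K \<in> nbrs T" for K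
    using sub_ae_sq_int(1)[OF sub_ae_T_dom f] T_lebesgue that by (simp add: nbrs_def sq_int_def integrable_restrict_space)
  have iP: "integrable lebesgue (\<lambda>x. indicator (patch \<T> T) x * (norm (f x))\<^sup>2)"
    using sub_ae_sq_int(1)[OF sub_ae_patch_dom[of T] f] PL by (simp add: sq_int_def integrable_restrict_space)
  have "(l2 (vol (patch \<T> T)) f)\<^sup>2 = (LINT x|lebesgue. indicator (patch \<T> T) x * (norm (f x))\<^sup>2)"
    using PL by (simp add: l2_sq integral_restrict_space)
  also have "\<dots> \<le> (LINT x|lebesgue. (\<Sum>K\<in>nbrs T. indicator K x * (norm (f x))\<^sup>2))"
  proof (rule integral_mono[OF iP Bochner_Integration.integrable_sum[OF i]])
    fix x
    show "indicator (patch \<T> T) x * (norm (f x))\<^sup>2 \<le> (\<Sum>K\<in>nbrs T. indicator K x * (norm (f x))\<^sup>2)"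
    proof (cases "x \<in> patch \<T> T")
      case True
      then obtain K where K: "K \<in> nbrs T" "x \<in> K" using interior_subset by (auto simp: patch_eq)
      have "indicator K x * (norm (f x))\<^sup>2 \<le> (\<Sum>K\<in>nbrs T. indicator K x * (norm (f x))\<^sup>2)"
        by (rule member_le_sum[OF K(1)]) (auto simp: finite_nbrs)
      then show ?thesis using True K(2) by simp
    qed (simp add: sum_nonneg)
  qed
  also have "\<dots> = (\<Sum>K\<in>nbrs T. LINT x|lebesgue. indicator K x * (norm (f x))\<^sup>2)"
    by (rule Bochner_Integration.integral_sum) (rule i)
  also have "\<dots> = (\<Sum>K\<in>nbrs T. (l2 (vol K) f)\<^sup>2)"
    using T_lebesgue by (intro sum.cong refl) (simp add: nbrs_def l2_sq integral_restrict_space)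
  finally show ?thesis .
qed

lemma kappa_ge_1: "T \<in> \<T> \<Longrightarrow> 1 \<le> \<kappa>"
proof -
  assume T: "T \<in> \<T>"
  obtain z r where zr: "0 < r" "cball z r \<subseteq> T" "diameter T \<le> \<kappa> * r" using inball[OF T] by blast
  obtain e :: "real^'n" where e: "norm e = 1" using vector_choose_size[of 1] by auto
  have "z \<in> T" "z + r *\<^sub>R e \<in> T" using zr e by (auto simp: dist_norm subset_iff)
  then have "dist z (z + r *\<^sub>R e) \<le> diameter T" using diameter_bounded_bound[OF bounded_T[OF T]] by blast
  then have "r \<le> diameter T" using zr(1) e by (simp add: dist_norm)
  then have "1 * r \<le> \<kappa> * r" using zr(3) by linarith
  then show ?thesis using zr(1) by (simp only: mult_le_cancel_right_pos)
qed

lemma diameter_pos: "T \<in> \<T> \<Longrightarrow> 0 < diameter T"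
proof -
  assume T: "T \<in> \<T>"
  obtain z r where zr: "0 < r" "cball z r \<subseteq> T" using inball[OF T] by blast
  obtain e :: "real^'n" where e: "norm e = 1" using vector_choose_size[of 1] by auto
  have "z \<in> T" "z + r *\<^sub>R e \<in> T" using zr e by (auto simp: dist_norm subset_iff)
  then have "dist z (z + r *\<^sub>R e) \<le> diameter T" using diameter_bounded_bound[OF bounded_T[OF T]] by blast
  then show ?thesis using zr(1) e by (simp add: dist_norm)
qed

text \<open>The simplices at a vertex, scaled towards it to the diameter \<open>\<epsilon>\<close>, contain disjoint balls of radius
  \<open>\<epsilon> / \<kappa>\<close> inside the ball of radius \<open>\<epsilon>\<close>.\<close>

lemma card_at_vertex:
  assumes T0: "\<T> \<noteq> {}"
  shows "real (card {K \<in> \<T>. v \<in> K}) \<le> \<kappa> ^ CARD('n)"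
proof (cases "{K \<in> \<T>. v \<in> K} = {}")
  case True
  have "0 \<le> \<kappa>" using kappa_ge_1 T0 by fastforce
  then show ?thesis unfolding True by simp
next
  case False
  let ?K = "{K \<in> \<T>. v \<in> K}"
  have fin: "finite ?K" using finite_T by simp
  have k1: "1 \<le> \<kappa>" using T0 kappa_ge_1 by blast
  have "\<forall>K\<in>?K. \<exists>z r. 0 < r \<and> cball z r \<subseteq> K \<and> diameter K \<le> \<kappa> * r" using inball by blast
  then obtain z r where zr: "\<And>K. K \<in> ?K \<Longrightarrow> 0 < r K \<and> cball (z K) (r K) \<subseteq> K \<and> diameter K \<le> \<kappa> * r K"
    by metis
  define \<epsilon> where "\<epsilon> = Min ((\<lambda>K. \<kappa> * r K) ` ?K)"
  have \<epsilon>: "\<epsilon> > 0" "\<And>K. K \<in> ?K \<Longrightarrow> \<epsilon> \<le> \<kappa> * r K"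
    unfolding \<epsilon>_def using fin False zr k1 by (auto simp: Min_gr_iff)
  define s where "s K = \<epsilon> / (\<kappa> * r K)" for K
  have s: "0 < s K" "s K \<le> 1" "s K * r K = \<epsilon> / \<kappa>" "s K * (\<kappa> * r K) = \<epsilon>" if "K \<in> ?K" for K
    using zr[OF that] \<epsilon>(1) \<epsilon>(2)[OF that] k1 by (auto simp: s_def)
  let ?B = "\<lambda>K. ball (v + s K *\<^sub>R (z K - v)) (\<epsilon> / \<kappa>)"
  have ek: "\<epsilon> / \<kappa> > 0" using \<epsilon>(1) k1 by simp
  have Bsub: "?B K \<subseteq> interior K \<and> ?B K \<subseteq> cball v \<epsilon>" if K: "K \<in> ?K" for K
  proof -
    have "x \<in> K \<and> x \<in> cball v \<epsilon>" if x: "x \<in> ?B K" for x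
    proof -
      define y where "y = v + (1 / s K) *\<^sub>R (x - v)"
      have xy: "x = (1 - s K) *\<^sub>R v + s K *\<^sub>R y" using s(1)[OF K] by (simp add: y_def algebra_simps)
      have "y - z K = (1 / s K) *\<^sub>R (x - (v + s K *\<^sub>R (z K - v)))" using s(1)[OF K] by (simp add: y_def algebra_simps)
      then have "norm (y - z K) = norm (x - (v + s K *\<^sub>R (z K - v))) / s K" using s(1)[OF K] by simp
      also have "\<dots> \<le> (s K * r K) / s K"
        using x s(3)[OF K] s(1)[OF K] by (intro divide_right_mono) (simp_all add: dist_norm norm_minus_commute)
      also have "\<dots> = r K" using s(1)[OF K] by simp
      finally have y: "y \<in> K" using zr[OF K] by (auto simp: dist_norm norm_minus_commute subset_iff)
      have "x \<in> K" unfolding xy using K y s(1,2)[OF K] convexD_alt[OF convex_T] by (simp add: less_imp_le)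
      moreover have "norm (x - v) \<le> \<epsilon>"
      proof -
        have "x - v = s K *\<^sub>R (y - v)" by (simp add: xy algebra_simps)
        moreover have "norm (y - v) \<le> \<kappa> * r K"
          using diameter_bounded_bound[OF bounded_T, of K y v] K y zr[OF K] by (simp add: dist_norm)
        ultimately have "norm (x - v) \<le> s K * (\<kappa> * r K)" using s(1)[OF K] by simp
        then show ?thesis using s(4)[OF K] by simp
      qed
      ultimately show ?thesis by (simp add: dist_norm norm_minus_commute)
    qed
    then show ?thesis by (meson interior_maximal open_ball subsetI)
  qed
  have le: "(\<Sum>K\<in>?K. indicat_real (?B K) x) \<le> indicator (cball v \<epsilon>) x" for x
  proof (cases "\<exists>K\<in>?K. x \<in> ?B K")
    case True
    then obtain K where K: "K \<in> ?K" "x \<in> ?B K" by blast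
    have "indicat_real (?B L) x = (if L = K then 1 else 0)" if L: "L \<in> ?K" for L
    proof -
      have "x \<notin> ?B L" if "L \<noteq> K"
      proof
        assume "x \<in> ?B L"
        then have "x \<in> interior L" "x \<in> interior K" using Bsub[OF L] Bsub[OF K(1)] K(2) by auto
        then show False using interior_disjoint[of L K] L K(1) that by auto
      qed
      then show ?thesis using K(2) by (auto simp: indicator_def simp del: mem_ball)
    qed
    then have "(\<Sum>L\<in>?K. indicat_real (?B L) x) = (\<Sum>L\<in>?K. if L = K then 1 else 0)" by (intro sum.cong) auto
    also have "\<dots> = 1" using fin K(1) by (subst sum.delta) auto
    also have "\<dots> = indicator (cball v \<epsilon>) x" using Bsub[OF K(1)] K(2) by (auto simp: indicator_def simp del: mem_ball mem_cball)
    finally show ?thesis by simp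
  next
    case False
    then have "(\<Sum>L\<in>?K. indicat_real (?B L) x) = 0" by (intro sum.neutral) (auto simp: indicator_def simp del: mem_ball)
    then show ?thesis by simp
  qed
  have ib: "integrable lborel (\<lambda>x. indicat_real (?B K) x)" for K
    using emeasure_lborel_ball_finite[of "v + s K *\<^sub>R (z K - v)" "\<epsilon> / \<kappa>"] by (intro integrable_real_indicator) (simp_all add: infinity_ennreal_def)
  have ic: "integrable lborel (\<lambda>x. indicat_real (cball v \<epsilon>) x)"
    using emeasure_lborel_cball_finite[of v \<epsilon>] by (intro integrable_real_indicator) (simp_all add: infinity_ennreal_def)
  have "(LINT x|lborel. (\<Sum>K\<in>?K. indicat_real (?B K) x)) \<le> (LINT x|lborel. indicat_real (cball v \<epsilon>) x)"
    by (rule integral_mono[OF Bochner_Integration.integrable_sum[OF ib] ic le])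
  moreover have "(LINT x|lborel. (\<Sum>K\<in>?K. indicat_real (?B K) x)) = (\<Sum>K\<in>?K. measure lborel (?B K))"
    by (subst Bochner_Integration.integral_sum[OF ib]) simp
  ultimately have "real (card ?K) * ((\<epsilon> / \<kappa>) ^ CARD('n) * unit_vol TYPE('n)) \<le> \<epsilon> ^ CARD('n) * unit_vol TYPE('n)"
    using ek \<epsilon>(1) by (simp add: measure_ball measure_cball)
  then have "real (card ?K) * (\<epsilon> / \<kappa>) ^ CARD('n) \<le> \<epsilon> ^ CARD('n)"
    using unit_vol_pos[where 'n = 'n] by (simp only: mult.assoc[symmetric] mult_le_cancel_right_pos)
  then show ?thesis
    using \<epsilon>(1) k1 by (simp add: power_divide pos_divide_le_eq)
qed

lemma card_nbrs:
  assumes T: "T \<in> \<T>"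
  shows "real (card (nbrs T)) \<le> (real CARD('n) + 1) * \<kappa> ^ CARD('n)"
proof -
  obtain C where C: "finite C" "\<not> affine_dependent C" "int (card C) = int CARD('n) + 1" "T = convex hull C"
    using simplex_T[OF T] by (auto simp: simplex)
  have sub: "nbrs T \<subseteq> (\<Union>v\<in>C. {K \<in> \<T>. v \<in> K})"
  proof
    fix K assume "K \<in> nbrs T"
    then have K: "K \<in> \<T>" "T \<inter> K \<noteq> {}" by (auto simp: nbrs_def)
    have "compact (T \<inter> K)" "convex (T \<inter> K)"
      using compact_T[OF T] compact_T[OF K(1)] convex_T[OF T] convex_T[OF K(1)] by (auto simp: compact_Int convex_Int)
    then obtain v where v: "v extreme_point_of (T \<inter> K)"
      using extreme_point_exists_convex K(2) by blast
    then have "v extreme_point_of T" using extreme_point_of_face[OF face_inter[OF T K(1)]] by blast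
    then have "v \<in> C" unfolding C(4) by (rule extreme_point_of_convex_hull)
    moreover have "v \<in> K" using v by (simp add: extreme_point_of_def)
    ultimately show "K \<in> (\<Union>v\<in>C. {K \<in> \<T>. v \<in> K})" using K(1) by blast
  qed
  have "card (nbrs T) \<le> card (\<Union>v\<in>C. {K \<in> \<T>. v \<in> K})"
    using sub C(1) finite_T by (intro card_mono) auto
  also have "\<dots> \<le> (\<Sum>v\<in>C. card {K \<in> \<T>. v \<in> K})" by (rule card_UN_le[OF C(1)])
  finally have "real (card (nbrs T)) \<le> real (\<Sum>v\<in>C. card {K \<in> \<T>. v \<in> K})" by (rule of_nat_mono)
  then have "real (card (nbrs T)) \<le> (\<Sum>v\<in>C. real (card {K \<in> \<T>. v \<in> K}))" by (simp only: of_nat_sum)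
  also have "\<dots> \<le> (\<Sum>v\<in>C. \<kappa> ^ CARD('n))" using T by (intro sum_mono card_at_vertex) auto
  also have "\<dots> = (real CARD('n) + 1) * \<kappa> ^ CARD('n)"
  proof -
    have "real (card C) = real CARD('n) + 1" using C(3) by linarith
    then show ?thesis by simp
  qed
  finally show ?thesis .
qed

text \<open>Summing patch quantities over all simplices counts every simplex a bounded number of times.\<close>

lemma sum_nbrs_le:
  assumes a: "\<And>T. T \<in> \<T> \<Longrightarrow> 0 \<le> a T"
  shows "(\<Sum>T\<in>\<T>. \<Sum>K\<in>nbrs T. a K) \<le> (real CARD('n) + 1) * \<kappa> ^ CARD('n) * (\<Sum>T\<in>\<T>. a T)"
proof -
  have "(\<Sum>T\<in>\<T>. \<Sum>K\<in>nbrs T. a K) = (\<Sum>T\<in>\<T>. \<Sum>K\<in>\<T>. if K \<inter> T \<noteq> {} then a K else 0)"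
    unfolding nbrs_def sum.inter_filter[OF finite_T] by (rule refl)
  also have "\<dots> = (\<Sum>K\<in>\<T>. \<Sum>T\<in>\<T>. if T \<inter> K \<noteq> {} then a K else 0)"
    by (subst sum.swap) (simp add: Int_commute)
  also have "\<dots> = (\<Sum>K\<in>\<T>. \<Sum>T\<in>nbrs K. a K)"
    unfolding nbrs_def sum.inter_filter[OF finite_T] by (rule refl)
  also have "\<dots> \<le> (\<Sum>K\<in>\<T>. (real CARD('n) + 1) * \<kappa> ^ CARD('n) * a K)"
    using card_nbrs a by (intro sum_mono) (auto intro!: mult_right_mono)
  finally show ?thesis by (simp only: sum_distrib_left)
qed

section \<open>Simplices at a face\<close>

lemma adj_iff: "T \<in> adj \<T> F \<longleftrightarrow> T \<in> \<T> \<and> F facet_of T" by (simp add: adj_def)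

lemma normal: "T \<in> \<T> \<Longrightarrow> F facet_of T \<Longrightarrow> unit_normal F (\<nu> F)"
  using nor by (auto simp: face_normals_def faces_def unit_normal_def)

lemma outer_cases: "outer \<nu> F T = \<nu> F \<or> outer \<nu> F T = - \<nu> F"
  by (simp add: outer_def)

lemma outer_normal: "T \<in> \<T> \<Longrightarrow> F facet_of T \<Longrightarrow> unit_normal F (outer \<nu> F T)"
  using normal unit_normal_uminus by (auto simp: outer_def)

lemma inner_not_outward:
  assumes "T \<in> \<T>" "F facet_of T"
  shows "\<not> outward (- outer \<nu> F T) F T" "outward (outer \<nu> F T) F T"
proof -
  note s = simplex_T[OF assms(1)]
  obtain z where z: "z \<in> F" using simplex_facet(4)[OF s assms(2)] by blast
  note n = normal[OF assms]
  have ne: "(apex T F - z) \<bullet> \<nu> F \<noteq> 0" using apex(3)[OF s assms(2) n z] .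
  note i = outward_iff[OF apex(2)[OF s assms(2)] _ z]
  show "outward (outer \<nu> F T) F T" "\<not> outward (- outer \<nu> F T) F T"
    using i[OF n] i[OF unit_normal_uminus[OF n]] ne by (auto simp: outer_def)
qed

text \<open>A ball of radius comparable to the diameter which is divided by the face into halves that
  lie in the adjacent simplices; the bubble function is supported there.\<close>

lemma half_balls:
  assumes T: "T \<in> \<T>" and F: "F facet_of T"
  obtains x0 \<rho> where "x0 \<in> F" "0 < \<rho>" "diameter T \<le> 4 * \<kappa> * (1 + \<kappa>) * \<rho>"
    "\<forall>K\<in>adj \<T> F. \<forall>y. norm (y - x0) \<le> 2 * \<rho> \<longrightarrow> (y - x0) \<bullet> outer \<nu> F K \<le> 0 \<longrightarrow> y \<in> K"
proof -
  obtain z r where zr: "0 < r" "cball z r \<subseteq> T" "diameter T \<le> \<kappa> * r" using inball[OF T] by blast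
  note n = normal[OF T F]
  obtain x0 where x0: "x0 \<in> F" "\<And>y. (y - x0) \<bullet> \<nu> F = 0 \<Longrightarrow> norm (y - x0) \<le> r \<Longrightarrow> y \<in> F"
    using disc_in_face[OF simplex_T[OF T] F n zr(2,1)] by metis
  have k1: "1 \<le> \<kappa>" using kappa_ge_1[OF T] .
  \<comment> \<open>The disc of radius \<open>r\<close> about \<open>x0\<close> in \<open>F\<close> belongs to every simplex at \<open>F\<close>, whose inscribed ball has a radius of at least \<open>r / \<kappa>\<close>.\<close>
  define \<rho> where "\<rho> = r / (4 * (1 + \<kappa>))"
  have \<rho>: "\<rho> > 0" "4 * (1 + \<kappa>) * \<rho> = r" using zr(1) k1 by (auto simp: \<rho>_def)
  obtain e where e: "e \<noteq> 0" "orthogonal (\<nu> F) e"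
    using orthogonal_to_vector_exists[of "\<nu> F"] dim2 by auto
  define \<tau> where "\<tau> = (r / norm e) *\<^sub>R e"
  have \<tau>: "norm \<tau> = r" "\<tau> \<bullet> \<nu> F = 0" using e zr(1) by (auto simp: \<tau>_def orthogonal_def inner_commute)
  have xt: "x0 + \<tau> \<in> F" using x0(2)[of "x0 + \<tau>"] \<tau> by simp
  have half: "y \<in> K" if K: "K \<in> adj \<T> F" and y: "norm (y - x0) \<le> 2 * \<rho>" "(y - x0) \<bullet> outer \<nu> F K \<le> 0" for K y
  proof -
    have K': "K \<in> \<T>" "F facet_of K" using K by (auto simp: adj_iff)
    obtain c q where cq: "0 < q" "cball c q \<subseteq> K" "diameter K \<le> \<kappa> * q" using inball[OF K'(1)] by blast
    have FK: "F \<subseteq> K" using K'(2) facet_of_imp_subset by blast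
    have "dist x0 (x0 + \<tau>) \<le> diameter K"
      using diameter_bounded_bound[OF bounded_T[OF K'(1)], of x0 "x0 + \<tau>"] x0(1) xt FK by blast
    then have "r \<le> \<kappa> * q" using \<tau>(1) cq(3) by (simp add: dist_norm)
    then have "(1 + \<kappa>) * (4 * \<rho>) \<le> (1 + \<kappa>) * q" using \<rho>(2) cq(1) by (simp add: algebra_simps)
    then have q: "2 * (2 * \<rho>) \<le> q" using k1 by (simp add: mult_le_cancel_left_pos)
    show "y \<in> K"
    proof (rule half_ball_in_simplex[OF simplex_T[OF K'(1)] K'(2) unit_normal_uminus[OF outer_normal[OF K']] cq(2,1,3) x0(1) _ q])
      show "y \<in> F" if "(y - x0) \<bullet> - outer \<nu> F K = 0" "norm (y - x0) \<le> r" for y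
        using that x0(2)[of y] outer_cases[of F K] by auto
      have "2 * (1 + \<kappa>) * (2 * \<rho>) = 4 * (1 + \<kappa>) * \<rho>" by (simp add: algebra_simps)
      then show "2 * (1 + \<kappa>) * (2 * \<rho>) \<le> r" using \<rho>(2) by linarith
      show "\<not> outward (- outer \<nu> F K) F K" using inner_not_outward[OF K'] by simp
      show "norm (y - x0) \<le> 2 * \<rho>" "0 \<le> (y - x0) \<bullet> - outer \<nu> F K" using y by auto
    qed
  qed
  have "\<kappa> * r = 4 * \<kappa> * (1 + \<kappa>) * \<rho>" unfolding \<rho>(2)[symmetric] by (simp only: mult_ac)
  then have "diameter T \<le> 4 * \<kappa> * (1 + \<kappa>) * \<rho>" using zr(3) by (simp only:)
  then show thesis using that[OF x0(1) \<rho>(1)] half by blast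
qed

text \<open>Two simplices on the same side would share a half ball.\<close>

lemma outer_opposite:
  assumes T: "T \<in> adj \<T> F" and K: "K \<in> adj \<T> F" and ne: "T \<noteq> K"
  shows "outer \<nu> F K = - outer \<nu> F T"
proof (rule ccontr)
  assume "outer \<nu> F K \<noteq> - outer \<nu> F T"
  then have eq: "outer \<nu> F K = outer \<nu> F T" using outer_cases[of F K] outer_cases[of F T] by auto
  have T': "T \<in> \<T>" "F facet_of T" and K': "K \<in> \<T>" using T K by (auto simp: adj_iff)
  obtain x0 \<rho> where x0: "0 < \<rho>" "\<forall>K\<in>adj \<T> F. \<forall>y. norm (y - x0) \<le> 2 * \<rho> \<longrightarrow> (y - x0) \<bullet> outer \<nu> F K \<le> 0 \<longrightarrow> y \<in> K"
    using half_balls[OF T'] by metis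
  let ?m = "outer \<nu> F T"
  have m: "norm ?m = 1" "?m \<bullet> ?m = 1" using outer_normal[OF T'] by (auto simp: unit_normal_def dot_square_norm)
  have sub: "ball (x0 - \<rho> *\<^sub>R ?m) \<rho> \<subseteq> T \<inter> K"
  proof
    fix y assume "y \<in> ball (x0 - \<rho> *\<^sub>R ?m) \<rho>"
    then have d: "norm (y - (x0 - \<rho> *\<^sub>R ?m)) < \<rho>" by (simp add: dist_norm norm_minus_commute)
    have e: "y - x0 = (y - (x0 - \<rho> *\<^sub>R ?m)) - \<rho> *\<^sub>R ?m" by simp
    have 1: "norm (y - x0) \<le> 2 * \<rho>"
      using norm_triangle_ineq4[of "y - (x0 - \<rho> *\<^sub>R ?m)" "\<rho> *\<^sub>R ?m"] d m(1) x0(1) unfolding e[symmetric] by simp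
    have "\<bar>(y - (x0 - \<rho> *\<^sub>R ?m)) \<bullet> ?m\<bar> \<le> \<rho>"
      using Cauchy_Schwarz_ineq2[of "y - (x0 - \<rho> *\<^sub>R ?m)" ?m] d m(1) by simp
    moreover have "(y - x0) \<bullet> ?m = (y - (x0 - \<rho> *\<^sub>R ?m)) \<bullet> ?m - \<rho>"
      by (subst e) (simp only: inner_diff_left[of "y - _"] inner_scaleR_left m(2) mult_1_right)
    ultimately have 2: "(y - x0) \<bullet> ?m \<le> 0" by linarith
    show "y \<in> T \<inter> K" using x0(2) T K 1 2 eq by auto
  qed
  have "ball (x0 - \<rho> *\<^sub>R ?m) \<rho> \<subseteq> interior T" "ball (x0 - \<rho> *\<^sub>R ?m) \<rho> \<subseteq> interior K"
    using interior_maximal[OF _ open_ball, of "x0 - \<rho> *\<^sub>R ?m" \<rho>] sub by blast+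
  moreover have "x0 - \<rho> *\<^sub>R ?m \<in> ball (x0 - \<rho> *\<^sub>R ?m) \<rho>" using x0(1) by simp
  ultimately show False using interior_disjoint[OF T'(1) K' ne] by blast
qed

text \<open>The outer normals of any two of three simplices would be opposite.\<close>

lemma adj_pair:
  assumes T: "T \<in> adj \<T> F" and K: "K \<in> adj \<T> F" and ne: "T \<noteq> K"
  shows "adj \<T> F = {T, K}"
proof (rule ccontr)
  assume "adj \<T> F \<noteq> {T, K}"
  then obtain L where L: "L \<in> adj \<T> F" "L \<noteq> T" "L \<noteq> K" using T K by blast
  have "outer \<nu> F T = - outer \<nu> F L" "outer \<nu> F K = - outer \<nu> F L" "outer \<nu> F K = - outer \<nu> F T"
    using outer_opposite[OF L(1) T] outer_opposite[OF L(1) K] outer_opposite[OF T K ne] L by auto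
  then have e: "outer \<nu> F L = - outer \<nu> F L" by simp
  have "norm (outer \<nu> F L) = 1" using L(1) outer_normal[of L F] by (auto simp: adj_iff unit_normal_def)
  then have "outer \<nu> F L \<bullet> outer \<nu> F L = 1" by (simp add: dot_square_norm)
  then have "(- outer \<nu> F L) \<bullet> outer \<nu> F L = - 1" by simp
  then show False using \<open>outer \<nu> F L \<bullet> outer \<nu> F L = 1\<close> unfolding e[symmetric] by simp
qed

text \<open>Near a point of the relative interior of \<open>F\<close> in \<open>\<Omega>\<close>, a
  point beyond \<open>F\<close> lies in a simplex \<open>K \<noteq> T\<close> that contains the former
  point; as \<open>K \<inter> T\<close> is a face of \<open>T\<close>, it equals
  \<open>F\<close>.\<close>

lemma boundary_face:
  assumes adj1: "adj \<T> F = {T}"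
  shows "F \<subseteq> - \<Omega>"
proof (rule ccontr)
  assume "\<not> F \<subseteq> - \<Omega>"
  then obtain x1 where x1: "x1 \<in> F" "x1 \<in> \<Omega>" by blast
  have T: "T \<in> \<T>" "F facet_of T" using adj1 by (auto simp: adj_def)
  note s = simplex_T[OF T(1)]
  have cF: "convex F" using simplex_facet(3)[OF s T(2)] .
  have "x1 \<in> closure (rel_interior F)" using x1(1) convex_closure_rel_interior[OF cF] closure_subset by blast
  then obtain x where x: "x \<in> rel_interior F" "x \<in> \<Omega>"
    using open_Int_closure_eq_empty[OF open_dom, of "rel_interior F"] x1(2) by blast
  have xF: "x \<in> F" using x(1) rel_interior_subset by blast
  let ?m = "outer \<nu> F T"
  have m: "norm ?m = 1" "?m \<bullet> ?m = 1" using outer_normal[OF T] by (auto simp: unit_normal_def dot_square_norm)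
  let ?far = "\<Union>{K \<in> \<T>. x \<notin> K}"
  have "closed ?far" using finite_T by (intro closed_Union) (auto intro: compact_imp_closed compact_T)
  then have "open (\<Omega> - ?far)" using open_dom by (simp add: open_Diff)
  moreover have "x \<in> \<Omega> - ?far" using x(2) by blast
  ultimately obtain \<delta> where \<delta>: "\<delta> > 0" "ball x \<delta> \<subseteq> \<Omega> - ?far" using open_contains_ball by blast
  let ?y = "x + (\<delta> / 2) *\<^sub>R ?m"
  have "?y \<in> ball x \<delta>" using \<delta>(1) m(1) by (simp add: dist_norm)
  then have y: "?y \<in> \<Omega>" "?y \<notin> ?far" using \<delta>(2) by auto
  then obtain K where K: "K \<in> \<T>" "?y \<in> K" using Union_T closure_subset by blast
  then have xK: "x \<in> K" using y(2) by blast
  have "?y \<notin> T"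
  proof
    assume "?y \<in> T"
    then have "?y \<bullet> ?m \<le> x \<bullet> ?m" using inner_not_outward(2)[OF T] xF by (auto simp: outward_def)
    then show False using \<delta>(1) by (simp add: inner_add_left m(2))
  qed
  then have KT: "K \<noteq> T" using K(2) by blast
  have f: "T \<inter> K face_of T" using face_inter[OF T(1) K(1)] .
  have FT: "F \<subseteq> T" using facet_of_imp_subset[OF T(2)] .
  have "F \<subseteq> T \<inter> K"
    by (rule subset_of_face_of[OF f FT]) (use x(1) xF FT xK in blast)
  moreover have ne: "T \<inter> K \<noteq> T"
  proof
    assume "T \<inter> K = T"
    then have "interior T \<subseteq> interior K" by (metis inf.orderI interior_mono)
    then show False using interior_disjoint[OF T(1) K(1)] KT interior_T_ne[OF T(1)] by blast
  qed
  ultimately have "F face_of (T \<inter> K)" using face_of_subset[of F T "T \<inter> K"] facet_of_imp_face_of[OF T(2)] by blast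
  have lt: "aff_dim (T \<inter> K) < aff_dim T" using face_of_aff_dim_lt[OF convex_T[OF T(1)] f ne] .
  have dF: "aff_dim F = aff_dim T - 1" using T(2) by (simp add: facet_of_def)
  have "F = T \<inter> K"
  proof (rule ccontr)
    assume "F \<noteq> T \<inter> K"
    then have "aff_dim F < aff_dim (T \<inter> K)"
      using face_of_aff_dim_lt[OF face_of_imp_convex[OF f] \<open>F face_of (T \<inter> K)\<close>] by blast
    then show False using lt dF by linarith
  qed
  then have "F face_of K" using face_inter[OF K(1) T(1)] by (simp add: Int_commute)
  moreover have "aff_dim K = aff_dim T" using aff_dim_simplex[OF simplex_T[OF K(1)]] aff_dim_simplex[OF s] by simp
  ultimately have "F facet_of K" using dF x1(1) by (auto simp: facet_of_def)
  then have "K \<in> adj \<T> F" using K(1) by (simp add: adj_iff)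
  then show False using adj1 KT by blast
qed

end

section \<open>The jump of a piecewise constant approximation of a Hessian\<close>

lemma norm_nth_cart_le: "norm (x $ i) \<le> norm x" for x :: "'b::real_normed_vector^'n::finite"
  by (rule Finite_Cartesian_Product.norm_nth_le)

lemma norm_matrix_vector_le:
  fixes M :: "real^'n::finite^'n"
  shows "norm (M *v x) \<le> real CARD('n) * norm M * norm x"
proof -
  have "norm (M *v x) \<le> (\<Sum>i\<in>UNIV. \<bar>(M *v x) $ i\<bar>)" by (rule norm_le_l1_cart)
  also have "\<dots> \<le> (\<Sum>i\<in>(UNIV::'n set). norm M * norm x)"
  proof (rule sum_mono)
    fix i
    have "(M *v x) $ i = M $ i \<bullet> x" by (simp add: matrix_vector_mult_def inner_vec_def)
    then have "\<bar>(M *v x) $ i\<bar> \<le> norm (M $ i) * norm x" by (simp add: Cauchy_Schwarz_ineq2)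
    also have "\<dots> \<le> norm M * norm x" by (intro mult_right_mono norm_nth_cart_le) simp
    finally show "\<bar>(M *v x) $ i\<bar> \<le> norm M * norm x" .
  qed
  finally show ?thesis by (simp add: mult.assoc)
qed

lemma abs_trace_le: "\<bar>trace M\<bar> \<le> real CARD('n) * norm M" for M :: "real^'n::finite^'n"
proof -
  have "\<bar>trace M\<bar> \<le> (\<Sum>i\<in>UNIV. \<bar>M $ i $ i\<bar>)" unfolding trace_def by (rule sum_abs)
  also have "\<dots> \<le> (\<Sum>i\<in>(UNIV::'n set). norm M)"
  proof (rule sum_mono)
    fix i
    have "\<bar>M $ i $ i\<bar> \<le> norm (M $ i)" using norm_nth_cart_le[of "M $ i" i] by simp
    also have "\<dots> \<le> norm M" by (rule norm_nth_cart_le)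
    finally show "\<bar>M $ i $ i\<bar> \<le> norm M" .
  qed
  finally show ?thesis by simp
qed

lemma inner_matrix_vector: "d \<bullet> (M *v x) = (\<Sum>i\<in>UNIV. \<Sum>j\<in>UNIV. d $ i * (M $ i $ j * x $ j))"
  for M :: "real^'n::finite^'n"
  by (simp add: inner_vec_def matrix_vector_mult_def sum_distrib_left)

lemma whess_nth: "whess U w x $ i $ j = wpd U j (wpd U i w) x"
  by (simp add: whess_def wjac_def wgrad_nth)

lemma sq_int_whess:
  assumes "open U" "u \<in> H2_0 U"
  shows "sq_int (vol U) (whess U u)"
  using H2_0_props(5)[OF assms] by (simp add: sq_int_vec_iff whess_nth)

context mesh
begin

lemma pair_integral:
  fixes f :: "real^'n \<Rightarrow> real"
  assumes f: "integrable (vol \<Omega>) f" and L: "T \<in> \<T>" "K \<in> \<T>" "T \<noteq> K"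
    and supp: "\<And>x. x \<notin> T \<union> K \<Longrightarrow> f x = 0"
  shows "(LINT x|vol \<Omega>. f x) = (LINT x|vol T. f x) + (LINT x|vol K. f x)"
proof -
  have z: "(LINT x|vol M. f x) = 0" if M: "M \<in> \<T> - {T, K}" for M
  proof -
    have M': "M \<in> \<T>" "M \<noteq> T" "M \<noteq> K" using M by auto
    have "AE x in lebesgue. x \<in> M \<longrightarrow> f x = 0"
      using AE_skeleton
    proof eventually_elim
      case (elim x)
      show ?case
      proof
        assume "x \<in> M"
        then have xi: "x \<in> interior M" using interior_T_iff[OF M'(1)] elim M'(1) by blast
        have "x \<notin> T" using interior_T_iff[OF L(1), of x] elim L(1) interior_disjoint[OF M'(1) L(1) M'(2)] xi by blast
        moreover have "x \<notin> K" using interior_T_iff[OF L(2), of x] elim L(2) interior_disjoint[OF M'(1) L(2) M'(3)] xi by blast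
        ultimately show "f x = 0" using supp by blast
      qed
    qed
    then have "AE x in vol M. f x = 0" using T_lebesgue[OF M'(1)] by (simp add: AE_restrict_space_iff)
    moreover have "f \<in> borel_measurable (vol M)"
      using sub_ae_integrable[OF sub_ae_T_dom[OF M'(1)] f] by (rule borel_measurable_integrable)
    ultimately show ?thesis by (simp add: integral_eq_zero_AE)
  qed
  have "(LINT x|vol \<Omega>. f x) = (\<Sum>M\<in>\<T>. LINT x|vol M. f x)" by (rule integral_mesh[OF f])
  also have "\<dots> = (\<Sum>M\<in>{T, K}. LINT x|vol M. f x)"
    using finite_T L z by (intro sum.mono_neutral_right) auto
  finally show ?thesis using L(3) by simp
qed

definition jump_const :: real where
  "jump_const = sqrt ((4 * \<kappa> * (1 + \<kappa>)) ^ CARD('n) / unit_vol TYPE('n)) * (32 * real CARD('n) * 4 ^ CARD('n))"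

text \<open>Testing with the bubble \<open>b\<close> on a ball around a point of \<open>F\<close> that is contained in the two simplices:
  the left-hand side times the flux of \<open>b\<close> is \<open>\<Sum>L. \<integral>\<^sub>L A L : (d \<otimes> \<nabla>b)\<close>, and
  \<open>\<integral> D\<^sup>2u : (d \<otimes> \<nabla>b) = \<integral> tr (D\<^sup>2u) d \<bullet> \<nabla>b\<close>, where \<open>d \<bullet> \<nabla>b\<close> has mean zero on each simplex because \<open>d\<close>
  is tangential.\<close>

lemma jump_estimate:
  assumes u: "u \<in> H2_0 \<Omega>" and T: "T \<in> adj \<T> F" and K: "K \<in> adj \<T> F" and ne: "T \<noteq> K" and d: "d \<bullet> \<nu> F = 0"
  shows "sqrt (diameter T ^ CARD('n)) * \<bar>\<Sum>L\<in>adj \<T> F. d \<bullet> (A L *v outer \<nu> F L)\<bar>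
    \<le> jump_const * norm d * (\<Sum>L\<in>adj \<T> F. l2 (vol L) (\<lambda>x. whess \<Omega> u x - A L))"
proof -
  let ?N = "CARD('n)" and ?\<omega> = "unit_vol TYPE('n)" and ?\<sigma> = "whess \<Omega> u"
  have adj: "adj \<T> F = {T, K}" by (rule adj_pair[OF T K ne])
  have T': "T \<in> \<T>" "F facet_of T" and K': "K \<in> \<T>" "F facet_of K" using T K by (auto simp: adj_iff)
  obtain x0 \<rho> where x0: "x0 \<in> F" "0 < \<rho>" "diameter T \<le> 4 * \<kappa> * (1 + \<kappa>) * \<rho>"
    "\<forall>K\<in>adj \<T> F. \<forall>y. norm (y - x0) \<le> 2 * \<rho> \<longrightarrow> (y - x0) \<bullet> outer \<nu> F K \<le> 0 \<longrightarrow> y \<in> K"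
    using half_balls[OF T'] by metis
  define b where "b = bubble x0 \<rho>"
  define G where "G = grad b"
  have Cb: "Ck (Suc 0) b" unfolding b_def by (rule Ck_bubble)
  have b0: "b x = 0" if "x \<notin> cball x0 \<rho>" for x unfolding b_def by (rule bubble_outside) (use x0(2) that in auto)
  have Gb: "norm (G x) \<le> 4 * \<rho> ^ 3 * indicator (cball x0 \<rho>) x" for x
    unfolding G_def b_def using x0(2) by (intro norm_grad_bubble) simp
  have G0: "G x = 0" if "x \<notin> cball x0 \<rho>" for x using Gb[of x] that by (simp add: indicator_def del: mem_cball)
  have Gi: "G x $ i = pd i b x" for x i by (simp add: G_def grad_def)
  have opp: "outer \<nu> F K = - outer \<nu> F T" by (rule outer_opposite[OF T K ne])
  have ball_sub: "ball x0 (2 * \<rho>) \<subseteq> T \<union> K"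
  proof
    fix y assume "y \<in> ball x0 (2 * \<rho>)"
    then have "norm (y - x0) \<le> 2 * \<rho>" by (simp add: dist_norm norm_minus_commute)
    then show "y \<in> T \<union> K" using x0(4) T K opp by (cases "(y - x0) \<bullet> outer \<nu> F T \<le> 0") auto
  qed
  have cb_sub: "cball x0 \<rho> \<subseteq> ball x0 (2 * \<rho>)" using x0(2) by auto
  have cb_TK: "cball x0 \<rho> \<subseteq> T \<union> K" using ball_sub cb_sub by blast
  have cb_dom: "cball x0 \<rho> \<subseteq> \<Omega>"
  proof -
    have "ball x0 (2 * \<rho>) \<subseteq> closure \<Omega>" using ball_sub T'(1) K'(1) Union_T by blast
    then have "ball x0 (2 * \<rho>) \<subseteq> interior (closure \<Omega>)" by (rule interior_maximal) simp
    then show ?thesis using cb_sub int_clos by blast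
  qed
  have cG: "continuous_on UNIV (\<lambda>x. v \<bullet> G x)" for v
    unfolding G_def inner_grad using Cb by (intro continuous_intros) simp
  have sG: "sq_int (vol \<Omega>) (\<lambda>x. v \<bullet> G x)" for v by (rule sq_int_continuous[OF bounded_dom dom_lebesgue cG])
  have sGi: "sq_int (vol \<Omega>) (\<lambda>x. G x $ i)" for i
    unfolding Gi using Cb by (intro sq_int_continuous[OF bounded_dom dom_lebesgue]) simp
  have sGv: "sq_int (vol \<Omega>) G" using sGi by (simp add: sq_int_vec_iff)
  define J where "J L = (LINT x|vol L. outer \<nu> F L \<bullet> G x)" for L
  have flux: "(LINT x|vol L. v \<bullet> G x) = (v \<bullet> outer \<nu> F L) * J L"
    and Jlow: "\<rho> ^ 3 / 4 * ((\<rho> / 4) ^ ?N * ?\<omega>) \<le> J L" if L: "L \<in> adj \<T> F" for L v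
  proof -
    have L': "L \<in> \<T>" "F facet_of L" using L by (auto simp: adj_iff)
    let ?m = "- outer \<nu> F L"
    let ?H = "{x. 0 \<le> (x - x0) \<bullet> ?m}"
    have m: "norm ?m = 1" "outer \<nu> F L \<bullet> outer \<nu> F L = 1" using outer_normal[OF L'] by (auto simp: unit_normal_def dot_square_norm)
    have LH: "x \<in> L \<longleftrightarrow> x \<in> ?H" if x: "x \<in> cball x0 \<rho>" for x
    proof
      assume "x \<in> L"
      then show "x \<in> ?H" using inner_not_outward(2)[OF L'] x0(1) by (auto simp: outward_def inner_diff_left)
    next
      assume "x \<in> ?H"
      then have "(x - x0) \<bullet> outer \<nu> F L \<le> 0" by simp
      moreover have "norm (x - x0) \<le> 2 * \<rho>" using x x0(2) by (simp add: dist_norm norm_minus_commute)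
      ultimately show "x \<in> L" using x0(4) L by blast
    qed
    have toH: "(LINT x|vol L. v \<bullet> G x) = (LINT x|lborel. indicator ?H x * (v \<bullet> G x))" for v
    proof -
      have "(LINT x|vol L. v \<bullet> G x) = (LINT x|lebesgue. indicator L x * (v \<bullet> G x))"
        using T_lebesgue[OF L'(1)] by (simp add: integral_restrict_space)
      also have "(\<lambda>x. indicator L x * (v \<bullet> G x)) = (\<lambda>x. indicator ?H x * (v \<bullet> G x))"
      proof
        fix x show "indicator L x * (v \<bullet> G x) = indicator ?H x * (v \<bullet> G x)"
          using LH[of x] G0[of x] by (cases "x \<in> cball x0 \<rho>") (auto simp: indicator_def simp del: mem_cball)
      qed
      also have "(LINT x|lebesgue. indicator ?H x * (v \<bullet> G x)) = (LINT x|lborel. indicator ?H x * (v \<bullet> G x))"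
      proof (rule integral_completion)
        have [measurable]: "?H \<in> sets borel" by (intro borel_closed closed_Collect_le continuous_intros)
        have [measurable]: "(\<lambda>x. v \<bullet> G x) \<in> borel_measurable borel" by (rule borel_measurable_continuous_onI[OF cG])
        show "(\<lambda>x. indicator ?H x * (v \<bullet> G x)) \<in> borel_measurable lborel" by measurable
      qed
      finally show ?thesis .
    qed
    note hs = bubble_half_space[where ?x0.0 = x0, OF m(1) x0(2), folded b_def, folded G_def]
    have JL: "J L = - (LINT x|lborel. indicator ?H x * (?m \<bullet> G x))" unfolding J_def toH by simp
    show "\<rho> ^ 3 / 4 * ((\<rho> / 4) ^ ?N * ?\<omega>) \<le> J L" unfolding JL by (rule hs(2))
    let ?\<tau> = "v - (v \<bullet> outer \<nu> F L) *\<^sub>R outer \<nu> F L"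
    have \<tau>: "?\<tau> \<bullet> ?m = 0" using m(2) by (simp add: inner_diff_left)
    have iL: "integrable (vol L) (\<lambda>x. w \<bullet> G x)" for w
      using sq_int_integrable[OF sub_ae_sq_int(1)[OF sub_ae_T_dom[OF L'(1)] sG] finite_T_measure[OF L'(1)]] .
    have "(LINT x|vol L. v \<bullet> G x) = (LINT x|vol L. ?\<tau> \<bullet> G x + (v \<bullet> outer \<nu> F L) * (outer \<nu> F L \<bullet> G x))"
      by (intro Bochner_Integration.integral_cong refl) (simp add: inner_diff_left)
    also have "\<dots> = (LINT x|vol L. ?\<tau> \<bullet> G x) + (v \<bullet> outer \<nu> F L) * J L"
      unfolding J_def by (subst Bochner_Integration.integral_add) (use iL in auto)
    also have "(LINT x|vol L. ?\<tau> \<bullet> G x) = 0" unfolding toH by (rule hs(1)[OF \<tau>])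
    finally show "(LINT x|vol L. v \<bullet> G x) = (v \<bullet> outer \<nu> F L) * J L" by simp
  qed
  \<comment> \<open>The integral of \<open>\<nabla>b\<close> over the union of the two simplices vanishes.\<close>
  have Jeq: "J K = J T"
  proof -
    have "(LINT x|lborel. indicator UNIV x * (\<Sum>i\<in>UNIV. outer \<nu> F T $ i * pd i b x)) = 0"
      by (rule integral_directional_derivative_eq_0[OF Cb compact_cball[of x0 \<rho>] b0]) auto
    then have "(LINT x|lborel. outer \<nu> F T \<bullet> G x) = 0" by (simp add: G_def inner_grad)
    moreover have "(LINT x|vol \<Omega>. outer \<nu> F T \<bullet> G x) = (LINT x|lborel. outer \<nu> F T \<bullet> G x)"
      by (rule integral_lebesgue_on_support[OF cG dom_lebesgue]) (metis G0 cb_dom inner_zero_right subsetD)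
    moreover have "(LINT x|vol \<Omega>. outer \<nu> F T \<bullet> G x) = (LINT x|vol T. outer \<nu> F T \<bullet> G x) + (LINT x|vol K. outer \<nu> F T \<bullet> G x)"
      by (rule pair_integral[OF sq_int_integrable[OF sG finite_measure_bounded_on[OF bounded_dom dom_lebesgue]] T'(1) K'(1) ne])
        (metis G0 cb_TK inner_zero_right subsetD)
    moreover have "outer \<nu> F T \<bullet> outer \<nu> F T = 1" using outer_normal[OF T'] by (simp add: unit_normal_def dot_square_norm)
    ultimately show ?thesis using flux[OF T, of "outer \<nu> F T"] flux[OF K, of "outer \<nu> F T"] opp by simp
  qed
  have s\<sigma>: "sq_int (vol \<Omega>) ?\<sigma>" by (rule sq_int_whess[OF open_dom u])
  have s\<sigma>ij: "sq_int (vol \<Omega>) (\<lambda>x. ?\<sigma> x $ i $ j)" for i j using s\<sigma> by (simp add: sq_int_vec_iff)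
  have int_ij: "integrable (vol \<Omega>) (\<lambda>x. ?\<sigma> x $ i $ j * G x $ k)" for i j k
    by (rule sq_int_inner_mult[OF s\<sigma>ij sGi])
  \<comment> \<open>Two integrations by parts; here it matters that \<open>\<sigma>\<close> is a Hessian.\<close>
  have swap: "(LINT x|vol \<Omega>. ?\<sigma> x $ i $ j * G x $ j) = (LINT x|vol \<Omega>. ?\<sigma> x $ j $ j * G x $ i)" for i j
    unfolding Gi whess_nth
    by (rule H2_0_double_parts[OF open_dom bounded_dom u Cb compact_cball[of x0 \<rho>] cb_dom b0])
  \<comment> \<open>\<open>f \<sigma>\<close> has integral zero, and that of \<open>f (A L)\<close> over \<open>L\<close> is a multiple of the term to be estimated.\<close>
  define f where "f M x = d \<bullet> (M *v G x) - trace M * (d \<bullet> G x)" for M x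
  have f_expand: "f M x = (\<Sum>i\<in>UNIV. \<Sum>j\<in>UNIV. d $ i * (M $ i $ j * G x $ j - M $ j $ j * G x $ i))" for M x
  proof -
    have "trace M * (d \<bullet> G x) = (\<Sum>j\<in>UNIV. \<Sum>i\<in>UNIV. d $ i * (M $ j $ j * G x $ i))"
      unfolding trace_def inner_vec_def sum_product by (intro sum.cong refl) simp
    also have "\<dots> = (\<Sum>i\<in>UNIV. \<Sum>j\<in>UNIV. d $ i * (M $ j $ j * G x $ i))" by (rule sum.swap)
    finally show ?thesis unfolding f_def inner_matrix_vector by (simp add: sum_subtractf right_diff_distrib)
  qed
  have f\<sigma>_int: "integrable (vol \<Omega>) (\<lambda>x. f (?\<sigma> x) x)"
    unfolding f_expand using int_ij by (intro Bochner_Integration.integrable_sum integrable_mult_right Bochner_Integration.integrable_diff)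
  have f\<sigma>0: "(LINT x|vol \<Omega>. f (?\<sigma> x) x) = 0"
  proof -
    have "(LINT x|vol \<Omega>. f (?\<sigma> x) x) = (\<Sum>i\<in>UNIV. \<Sum>j\<in>UNIV. d $ i *
        ((LINT x|vol \<Omega>. ?\<sigma> x $ i $ j * G x $ j) - (LINT x|vol \<Omega>. ?\<sigma> x $ j $ j * G x $ i)))"
      unfolding f_expand using int_ij by (simp add: Bochner_Integration.integral_sum)
    moreover have "d $ i * ((LINT x|vol \<Omega>. ?\<sigma> x $ i $ j * G x $ j) - (LINT x|vol \<Omega>. ?\<sigma> x $ j $ j * G x $ i)) = 0" for i j
      by (simp only: swap[of i j] diff_self mult_zero_right)
    ultimately show ?thesis by (simp only: sum.neutral_const)
  qed
  have fA: "(LINT x|vol L. f (A L) x) = J T * (d \<bullet> (A L *v outer \<nu> F L))" if L: "L \<in> adj \<T> F" for L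
  proof -
    have JL: "J L = J T" using L adj Jeq by auto
    have L': "L \<in> \<T>" using L by (simp add: adj_iff)
    have iL: "integrable (vol L) (\<lambda>x. w \<bullet> G x)" for w
      using sq_int_integrable[OF sub_ae_sq_int(1)[OF sub_ae_T_dom[OF L'] sG] finite_T_measure[OF L']] .
    have "d \<bullet> outer \<nu> F L = 0" using d outer_cases[of F L] by auto
    then have "(LINT x|vol L. d \<bullet> G x) = 0" using flux[OF L, of d] by simp
    moreover have tr: "d \<bullet> (A L *v y) = (transpose (A L) *v d) \<bullet> y" for y
      by (simp add: dot_lmul_matrix)
    ultimately have "(LINT x|vol L. f (A L) x) = (LINT x|vol L. (transpose (A L) *v d) \<bullet> G x)"
      unfolding f_def tr using iL by simp
    also have "\<dots> = J T * (d \<bullet> (A L *v outer \<nu> F L))" unfolding flux[OF L] tr JL by (simp add: mult.commute)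
    finally show ?thesis .
  qed
  have f_diff: "f (A L) x - f (?\<sigma> x) x = f (A L - ?\<sigma> x) x" for L x
    by (simp add: f_expand algebra_simps flip: sum_subtractf)
  have f_bound: "\<bar>f M x\<bar> \<le> 2 * real ?N * norm d * (norm M * norm (G x))" for M x
  proof -
    have "\<bar>d \<bullet> (M *v G x)\<bar> \<le> norm d * (real ?N * norm M * norm (G x))"
      by (rule order_trans[OF Cauchy_Schwarz_ineq2]) (intro mult_left_mono norm_matrix_vector_le norm_ge_zero)
    moreover have "\<bar>trace M * (d \<bullet> G x)\<bar> \<le> (real ?N * norm M) * (norm d * norm (G x))"
      unfolding abs_mult by (intro mult_mono abs_trace_le Cauchy_Schwarz_ineq2) auto
    ultimately show ?thesis unfolding f_def by (simp add: algebra_simps)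
  qed
  have lG: "l2 (vol L) G \<le> 4 * \<rho> ^ 3 * sqrt (\<rho> ^ ?N * ?\<omega>)" if L': "L \<in> \<T>" for L
  proof -
    have sL: "sq_int (vol L) G" by (rule sub_ae_sq_int(1)[OF sub_ae_T_dom[OF L'] sGv])
    have ic: "integrable lebesgue (\<lambda>x. (4 * \<rho> ^ 3)\<^sup>2 * indicator (cball x0 \<rho>) x)"
      using emeasure_lborel_cball_finite[of x0 \<rho>]
      by (intro integrable_mult_right integrable_real_indicator sets_lebesgue_compact compact_cball) (simp_all add: infinity_ennreal_def)
    have "(l2 (vol L) G)\<^sup>2 = (LINT x|lebesgue. indicator L x * (norm (G x))\<^sup>2)"
      using T_lebesgue[OF L'] by (simp add: l2_sq integral_restrict_space)
    also have "\<dots> \<le> (LINT x|lebesgue. (4 * \<rho> ^ 3)\<^sup>2 * indicator (cball x0 \<rho>) x)"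
    proof (rule integral_mono)
      show "integrable lebesgue (\<lambda>x. indicator L x * (norm (G x))\<^sup>2)"
        using sL T_lebesgue[OF L'] by (simp add: sq_int_def integrable_restrict_space)
      show "indicator L x * (norm (G x))\<^sup>2 \<le> (4 * \<rho> ^ 3)\<^sup>2 * indicator (cball x0 \<rho>) x" for x
      proof -
        have "(norm (G x))\<^sup>2 \<le> (4 * \<rho> ^ 3 * indicator (cball x0 \<rho>) x)\<^sup>2" using Gb by (rule power_mono) simp
        then show ?thesis by (auto simp: indicator_def power_mult_distrib simp del: mem_cball)
      qed
    qed (rule ic)
    also have "\<dots> = (4 * \<rho> ^ 3)\<^sup>2 * (\<rho> ^ ?N * ?\<omega>)"
      using x0(2) by (simp add: measure_cball)
    finally have "l2 (vol L) G \<le> sqrt ((4 * \<rho> ^ 3)\<^sup>2 * (\<rho> ^ ?N * ?\<omega>))" by (rule real_le_rsqrt)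
    then show ?thesis using x0(2) by (simp only: real_sqrt_mult real_sqrt_abs) simp
  qed
  let ?S = "\<Sum>L\<in>adj \<T> F. d \<bullet> (A L *v outer \<nu> F L)" and ?\<Delta> = "\<Sum>L\<in>adj \<T> F. l2 (vol L) (\<lambda>x. ?\<sigma> x - A L)"
  let ?R = "sqrt (\<rho> ^ ?N * ?\<omega>)"
  have R0: "?R > 0" using x0(2) unit_vol_pos[where 'n = 'n] by simp
  have fAint: "integrable (vol L) (\<lambda>x. f (A L) x)" and f\<sigma>L: "integrable (vol L) (\<lambda>x. f (?\<sigma> x) x)" if L: "L \<in> adj \<T> F" for L
  proof -
    have L': "L \<in> \<T>" using L by (simp add: adj_iff)
    have iL: "integrable (vol L) (\<lambda>x. G x $ i)" for i
      using sq_int_integrable[OF sub_ae_sq_int(1)[OF sub_ae_T_dom[OF L'] sGi] finite_T_measure[OF L']] .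
    show "integrable (vol L) (\<lambda>x. f (A L) x)"
      unfolding f_expand by (intro Bochner_Integration.integrable_sum integrable_mult_right Bochner_Integration.integrable_diff iL)
    show "integrable (vol L) (\<lambda>x. f (?\<sigma> x) x)" by (rule sub_ae_integrable[OF sub_ae_T_dom[OF L'] f\<sigma>_int])
  qed
  have "(LINT x|vol \<Omega>. f (?\<sigma> x) x) = (LINT x|vol T. f (?\<sigma> x) x) + (LINT x|vol K. f (?\<sigma> x) x)"
  proof (rule pair_integral[OF f\<sigma>_int T'(1) K'(1) ne])
    fix x assume "x \<notin> T \<union> K"
    then have "G x = 0" using G0 cb_TK by blast
    then show "f (?\<sigma> x) x = 0" by (simp add: f_def)
  qed
  then have sum\<sigma>: "(\<Sum>L\<in>adj \<T> F. LINT x|vol L. f (?\<sigma> x) x) = 0" using f\<sigma>0 adj ne by simp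
  have "J T * ?S = (\<Sum>L\<in>adj \<T> F. LINT x|vol L. f (A L) x) - (\<Sum>L\<in>adj \<T> F. LINT x|vol L. f (?\<sigma> x) x)"
    unfolding sum\<sigma> sum_distrib_left using fA by simp
  also have "\<dots> = (\<Sum>L\<in>adj \<T> F. LINT x|vol L. f (A L - ?\<sigma> x) x)"
    unfolding sum_subtractf[symmetric] f_diff[symmetric] using fAint f\<sigma>L by (intro sum.cong refl) simp
  finally have JS: "J T * ?S = (\<Sum>L\<in>adj \<T> F. LINT x|vol L. f (A L - ?\<sigma> x) x)" .
  have each: "\<bar>LINT x|vol L. f (A L - ?\<sigma> x) x\<bar> \<le> 2 * real ?N * norm d * (l2 (vol L) (\<lambda>x. ?\<sigma> x - A L) * (4 * \<rho> ^ 3 * ?R))"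
    if L: "L \<in> adj \<T> F" for L
  proof -
    have L': "L \<in> \<T>" using L by (simp add: adj_iff)
    have sL: "sq_int (vol L) G" by (rule sub_ae_sq_int(1)[OF sub_ae_T_dom[OF L'] sGv])
    have sM: "sq_int (vol L) (\<lambda>x. ?\<sigma> x - A L)"
      by (intro sq_int_diff sub_ae_sq_int(1)[OF sub_ae_T_dom[OF L'] s\<sigma>] sq_int_const finite_T_measure[OF L'])
    have "\<bar>LINT x|vol L. f (A L - ?\<sigma> x) x\<bar> \<le> (LINT x|vol L. 2 * real ?N * norm d * (norm (?\<sigma> x - A L) * norm (G x)))"
    proof (rule order_trans[OF integral_abs_bound integral_mono_AE'])
      show "integrable (vol L) (\<lambda>x. 2 * real ?N * norm d * (norm (?\<sigma> x - A L) * norm (G x)))"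
        using cauchy_schwarz_norm_l2(1)[OF sM sL] by simp
    qed (use f_bound[of "A L - ?\<sigma> _"] in \<open>auto simp: norm_minus_commute\<close>)
    also have "\<dots> = 2 * real ?N * norm d * (LINT x|vol L. norm (?\<sigma> x - A L) * norm (G x))" by simp
    also have "\<dots> \<le> 2 * real ?N * norm d * (l2 (vol L) (\<lambda>x. ?\<sigma> x - A L) * l2 (vol L) G)"
      by (intro mult_left_mono cauchy_schwarz_norm_l2(2)[OF sM sL]) auto
    also have "\<dots> \<le> 2 * real ?N * norm d * (l2 (vol L) (\<lambda>x. ?\<sigma> x - A L) * (4 * \<rho> ^ 3 * ?R))"
      by (intro mult_left_mono lG[OF L'] l2_nonneg) auto
    finally show ?thesis .
  qed
  have "\<rho> ^ 3 / 4 * ((\<rho> / 4) ^ ?N * ?\<omega>) * \<bar>?S\<bar> \<le> J T * \<bar>?S\<bar>" by (intro mult_right_mono Jlow[OF T]) simp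
  also have "\<dots> = \<bar>J T * ?S\<bar>"
  proof -
    have "0 \<le> \<rho> ^ 3 / 4 * ((\<rho> / 4) ^ ?N * ?\<omega>)" using x0(2) unit_vol_pos[where 'n = 'n] by simp
    then have "0 \<le> J T" using Jlow[OF T] by linarith
    then show ?thesis by (simp add: abs_mult)
  qed
  also have "\<dots> \<le> (\<Sum>L\<in>adj \<T> F. \<bar>LINT x|vol L. f (A L - ?\<sigma> x) x\<bar>)" unfolding JS by (rule sum_abs)
  also have "\<dots> \<le> (\<Sum>L\<in>adj \<T> F. 2 * real ?N * norm d * (l2 (vol L) (\<lambda>x. ?\<sigma> x - A L) * (4 * \<rho> ^ 3 * ?R)))"
    by (rule sum_mono) (rule each)
  also have "\<dots> = \<rho> ^ 3 * (8 * real ?N * norm d * ?\<Delta> * ?R)" by (simp add: sum_distrib_left sum_distrib_right mult_ac)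
  finally have "\<rho> ^ 3 * (1 / 4 * ((\<rho> / 4) ^ ?N * ?\<omega>) * \<bar>?S\<bar>) \<le> \<rho> ^ 3 * (8 * real ?N * norm d * ?\<Delta> * ?R)" by (simp add: mult_ac)
  then have "1 / 4 * ((\<rho> / 4) ^ ?N * ?\<omega>) * \<bar>?S\<bar> \<le> 8 * real ?N * norm d * ?\<Delta> * ?R"
    using x0(2) by (simp only: mult_le_cancel_left_pos zero_less_power)
  moreover have "(\<rho> / 4) ^ ?N * ?\<omega> = ?R * ?R / 4 ^ ?N" using x0(2) unit_vol_pos[where 'n = 'n] by (simp add: power_divide)
  moreover have "r * (r * s) \<le> r * ((32 * m * p) * e * D)" if "1 / 4 * (r * r / p) * s \<le> 8 * m * e * D * r" "p > 0" for r s m p e D :: real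
    using that by (simp add: field_simps)
  ultimately have "?R * (?R * \<bar>?S\<bar>) \<le> ?R * ((32 * real ?N * 4 ^ ?N) * norm d * ?\<Delta>)"
    by (metis (no_types, lifting) zero_less_numeral zero_less_power)
  then have RS: "?R * \<bar>?S\<bar> \<le> (32 * real ?N * 4 ^ ?N) * norm d * ?\<Delta>"
    using R0 by (simp only: mult_le_cancel_left_pos)
  let ?c = "4 * \<kappa> * (1 + \<kappa>)"
  have k1: "1 \<le> \<kappa>" using kappa_ge_1[OF T'(1)] .
  have "diameter T ^ ?N \<le> (?c * \<rho>) ^ ?N" using x0(3) diameter_pos[OF T'(1)] by (intro power_mono) auto
  also have "\<dots> = (?c ^ ?N / ?\<omega>) * (\<rho> ^ ?N * ?\<omega>)" using unit_vol_pos[where 'n = 'n] by (simp add: power_mult_distrib)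
  finally have "sqrt (diameter T ^ ?N) \<le> sqrt (?c ^ ?N / ?\<omega>) * ?R" unfolding real_sqrt_mult[symmetric] by (rule real_sqrt_le_mono)
  then have "sqrt (diameter T ^ ?N) * \<bar>?S\<bar> \<le> sqrt (?c ^ ?N / ?\<omega>) * (?R * \<bar>?S\<bar>)"
    unfolding mult.assoc[symmetric] by (rule mult_right_mono) simp
  also have "\<dots> \<le> sqrt (?c ^ ?N / ?\<omega>) * ((32 * real ?N * 4 ^ ?N) * norm d * ?\<Delta>)"
    using RS k1 unit_vol_pos[where 'n = 'n] by (intro mult_left_mono) auto
  also have "\<dots> = jump_const * norm d * ?\<Delta>" by (simp add: jump_const_def mult_ac)
  finally show ?thesis .
qed

end

section \<open>Piecewise smooth functions and piecewise derivatives\<close>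

lemma smooth_poly_le:
  fixes p :: "real^'n::finite \<Rightarrow> real"
  assumes "poly_le k p"
  shows "smooth p"
proof -
  obtain a where p: "p = (\<lambda>x. \<Sum>\<alpha> | sum \<alpha> (UNIV::'n set) \<le> k. a \<alpha> * (\<Prod>i\<in>UNIV. (x $ i) ^ \<alpha> i))"
    using assms unfolding poly_le_def by (auto simp: fun_eq_iff)
  show ?thesis unfolding smooth_def p by (intro allI Ck_sum Ck_cmult Ck_prod Ck_power Ck_coord)
qed

context mesh
begin

definition pw_smooth :: "(real^'n \<Rightarrow> real) \<Rightarrow> bool" where
  "pw_smooth v \<longleftrightarrow> (\<forall>T\<in>\<T>. \<exists>p. smooth p \<and> (\<forall>x\<in>interior T. v x = p x))"

lemma pw_smooth_Pk: "v \<in> Pk k \<T> \<Longrightarrow> pw_smooth v"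
  unfolding Pk_def pw_smooth_def using smooth_poly_le by fast

lemma AE_T_iff: "T \<in> \<T> \<Longrightarrow> (\<And>x. x \<in> interior T \<Longrightarrow> P x) \<Longrightarrow> AE x in vol T. P x"
  by (rule sub_ae_AE[OF sub_ae_T_interior]) auto

lemma AE_mesh:
  assumes "\<And>T. T \<in> \<T> \<Longrightarrow> AE x in vol T. P x"
  shows "AE x in vol \<Omega>. P x"
proof -
  have "AE x in lebesgue. \<forall>T\<in>\<T>. x \<in> T \<longrightarrow> P x"
    using assms T_lebesgue finite_T by (subst AE_finite_all) (auto simp: AE_restrict_space_iff)
  then have "AE x in lebesgue. x \<in> \<Omega> \<longrightarrow> P x"
    by eventually_elim (use Union_T closure_subset[of \<Omega>] in blast)
  then show ?thesis using dom_lebesgue by (simp add: AE_restrict_space_iff)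
qed

lemma pw_interior:
  assumes T: "T \<in> \<T>" and x: "x \<in> interior T"
  shows "pw \<T> D w x = D (interior T) w x"
proof -
  have "x \<notin> interior K" if "K \<in> \<T>" "K \<noteq> T" for K using interior_disjoint[OF that(1) T that(2)] x by auto
  then have "pw \<T> D w x = (\<Sum>K\<in>\<T>. if K = T then D (interior T) w x else 0)"
    unfolding pw_def using x by (intro sum.cong refl) auto
  then show ?thesis using T finite_T by simp
qed

lemma AE_T_of_interior:
  assumes T: "T \<in> \<T>" and P: "AE x in vol (interior T). P x"
  shows "AE x in vol T. P x"
  by (rule sub_ae_AE[OF sub_ae_T_interior[OF T] P])

lemma AE_pw: "T \<in> \<T> \<Longrightarrow> AE x in vol T. pw \<T> D w x = D (interior T) w x"
  by (rule AE_T_iff) (auto simp: pw_interior)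

text \<open>A common description of the two kinds of functions that occur, piecewise smooth ones and elements of
  \<open>H\<^sup>2\<^sub>0(\<Omega>)\<close>: weak first and second derivatives on one simplex.\<close>

definition H2_on :: "(real^'n) set \<Rightarrow> (real^'n \<Rightarrow> real) \<Rightarrow> ('n \<Rightarrow> real^'n \<Rightarrow> real) \<Rightarrow> ('n \<Rightarrow> 'n \<Rightarrow> real^'n \<Rightarrow> real) \<Rightarrow> bool" where
  "H2_on T v g h \<longleftrightarrow> sq_int (vol T) v \<and>
     (\<forall>i. weak_partial (interior T) i v (g i) \<and> sq_int (vol T) (g i)) \<and>
     (\<forall>i j. weak_partial (interior T) j (g i) (h i j) \<and> sq_int (vol T) (h i j))"

lemma H2_on_pw:
  assumes T: "T \<in> \<T>" and v: "H2_on T v g h"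
  shows "AE x in vol T. pw \<T> wgrad v x = (\<chi> i. g i x)"
    and "AE x in vol T. pw \<T> whess v x = (\<chi> i j. h i j x)"
    and "sq_int (vol T) (pw \<T> wgrad v)" "sq_int (vol T) (pw \<T> whess v)"
proof -
  note H = v[unfolded H2_on_def]
  have 1: "AE x in vol (interior T). wgrad (interior T) v x = (\<chi> i. g i x)"
    by (rule wgrad_AE[OF open_interior]) (use H in blast)
  have 2: "AE x in vol (interior T). whess (interior T) v x = (\<chi> i j. h i j x)"
    by (rule whess_AE[OF open_interior, where g = g]) (use H in blast)+
  show g: "AE x in vol T. pw \<T> wgrad v x = (\<chi> i. g i x)"
    using AE_pw[OF T, of wgrad v] AE_T_of_interior[OF T 1] by eventually_elim simp
  show h: "AE x in vol T. pw \<T> whess v x = (\<chi> i j. h i j x)"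
    using AE_pw[OF T, of whess v] AE_T_of_interior[OF T 2] by eventually_elim simp
  show "sq_int (vol T) (pw \<T> wgrad v)"
    by (rule sq_int_cong_AE[OF T_lebesgue[OF T] sq_int_chi[of _ g]]) (use H g in \<open>auto simp: eq_commute\<close>)
  show "sq_int (vol T) (pw \<T> whess v)"
    by (rule sq_int_cong_AE[OF T_lebesgue[OF T], of "\<lambda>x. \<chi> i j. h i j x"], intro sq_int_chi) (use H h in \<open>auto simp: eq_commute\<close>)
qed

lemma H2_on_diff:
  assumes "H2_on T v g h" "H2_on T v' g' h'"
  shows "H2_on T (\<lambda>x. v x - v' x) (\<lambda>i x. g i x - g' i x) (\<lambda>i j x. h i j x - h' i j x)"
  using assms unfolding H2_on_def by (auto intro!: sq_int_diff weak_partial_diff[OF open_interior])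

lemma smooth_sq_int: "T \<in> \<T> \<Longrightarrow> smooth p \<Longrightarrow> sq_int (vol T) p"
  using sq_int_continuous[OF bounded_T T_lebesgue] Ck_continuous smoothD by blast

lemma smooth_on_interior:
  assumes T: "T \<in> \<T>" and p: "smooth p" and v: "\<And>x. x \<in> interior T \<Longrightarrow> v x = p x"
  shows "AE x in vol T. p x = v x" "AE x in vol (interior T). p x = v x"
    "weak_partial (interior T) i v (pd i p)" "sq_int (vol T) v"
proof -
  show a: "AE x in vol T. p x = v x" by (rule AE_T_iff[OF T]) (simp add: v)
  then show b: "AE x in vol (interior T). p x = v x" by (rule sub_ae_AE[OF sub_ae_interior_T[OF T]])
  have o: "interior T \<in> sets lebesgue" by (rule sets_lebesgue_open) simp
  have m: "p \<in> borel_measurable (vol (interior T))" "pd i p \<in> borel_measurable (vol (interior T))"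
    using sub_ae_measurable[OF sub_ae_interior_T[OF T] sq_int_measurable[OF smooth_sq_int[OF T]]] p smooth_pd by blast+
  show "weak_partial (interior T) i v (pd i p)"
    by (rule weak_partial_cong_AE[OF weak_partial_classical[OF smoothD[OF p] open_interior] open_interior
          borel_measurable_AE_on[OF o m(1) b] m(2) b]) simp
  show "sq_int (vol T) v" by (rule sq_int_cong_AE[OF T_lebesgue[OF T] smooth_sq_int[OF T p] a])
qed

lemma H2_on_pw_smooth:
  assumes T: "T \<in> \<T>" and v: "pw_smooth v"
  shows "\<exists>g h. H2_on T v g h"
proof -
  obtain p where p: "smooth p" "\<And>x. x \<in> interior T \<Longrightarrow> v x = p x" using v T unfolding pw_smooth_def by blast
  have "H2_on T v (\<lambda>i. pd i p) (\<lambda>i j. pd j (pd i p))"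
    unfolding H2_on_def
    using smooth_on_interior(3,4)[OF T p] weak_partial_classical[OF smoothD[OF smooth_pd[OF p(1)]] open_interior]
      smooth_sq_int[OF T smooth_pd[OF p(1)]] smooth_sq_int[OF T smooth_pd[OF smooth_pd[OF p(1)]]] by blast
  then show ?thesis by blast
qed

lemma H2_on_H2_0:
  assumes T: "T \<in> \<T>" and z: "z \<in> H2_0 \<Omega>"
  shows "H2_on T z (\<lambda>i. wpd \<Omega> i z) (\<lambda>i j. wpd \<Omega> j (wpd \<Omega> i z))"
proof -
  note P = H2_0_props[OF open_dom z]
  note m = weak_partial_mono[OF _ open_dom open_interior interior_T_dom[OF T]]
  show ?thesis unfolding H2_on_def
    using m[OF P(2)] m[OF P(4)] sub_ae_sq_int(1)[OF sub_ae_T_dom[OF T]] P(1,3,5) by blast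
qed

lemma pw_smooth_sq_int:
  assumes v: "pw_smooth v"
  shows "sq_int (vol \<Omega>) v" "sq_int (vol \<Omega>) (pw \<T> wgrad v)" "sq_int (vol \<Omega>) (pw \<T> whess v)"
  using H2_on_pw_smooth[OF _ v] H2_on_pw(3,4) by (auto intro!: sq_int_mesh simp: H2_on_def) blast+

lemma pw_diff:
  assumes v: "pw_smooth v" and z: "z \<in> H2_0 \<Omega>"
  shows "T \<in> \<T> \<Longrightarrow> AE x in vol T. pw \<T> wgrad (\<lambda>x. v x - z x) x = pw \<T> wgrad v x - wgrad \<Omega> z x"
    and "T \<in> \<T> \<Longrightarrow> AE x in vol T. pw \<T> whess (\<lambda>x. v x - z x) x = pw \<T> whess v x - whess \<Omega> z x"
    and "T \<in> \<T> \<Longrightarrow> AE x in vol T. pw \<T> whess (\<lambda>x. z x - v x) x = whess \<Omega> z x - pw \<T> whess v x"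
proof -
  assume T: "T \<in> \<T>"
  obtain g h where H: "H2_on T v g h" using H2_on_pw_smooth[OF T v] by blast
  note Z = H2_on_H2_0[OF T z]
  note D = H2_on_diff[OF H Z] and E = H2_on_diff[OF Z H]
  show "AE x in vol T. pw \<T> wgrad (\<lambda>x. v x - z x) x = pw \<T> wgrad v x - wgrad \<Omega> z x"
    using H2_on_pw(1)[OF T H] H2_on_pw(1)[OF T D] by eventually_elim (simp add: vec_eq_iff wgrad_def)
  show "AE x in vol T. pw \<T> whess (\<lambda>x. v x - z x) x = pw \<T> whess v x - whess \<Omega> z x"
    using H2_on_pw(2)[OF T H] H2_on_pw(2)[OF T D] by eventually_elim (simp add: vec_eq_iff whess_nth)
  show "AE x in vol T. pw \<T> whess (\<lambda>x. z x - v x) x = whess \<Omega> z x - pw \<T> whess v x"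
    using H2_on_pw(2)[OF T H] H2_on_pw(2)[OF T E] by eventually_elim (simp add: vec_eq_iff whess_nth)
qed

lemma pw_wjac:
  assumes T: "T \<in> \<T>" and q: "\<And>i. smooth (q i)" "\<And>i x. x \<in> interior T \<Longrightarrow> \<theta> x $ i = q i x"
  shows "AE x in vol T. pw \<T> wjac \<theta> x = (\<chi> i j. pd j (q i) x)"
    and "AE x in vol T. \<theta> x = (\<chi> i. q i x)"
proof -
  have 1: "AE x in vol (interior T). wjac (interior T) \<theta> x = (\<chi> i j. pd j (q i) x)"
    by (rule wjac_AE[OF open_interior]) (rule smooth_on_interior(3)[OF T q])
  show "AE x in vol T. pw \<T> wjac \<theta> x = (\<chi> i j. pd j (q i) x)"
    using AE_pw[OF T, of wjac \<theta>] AE_T_of_interior[OF T 1] by eventually_elim simp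
  show "AE x in vol T. \<theta> x = (\<chi> i. q i x)"
    by (rule AE_T_iff[OF T]) (simp add: vec_eq_iff q(2))
qed

definition pw_smooth_vec :: "(real^'n \<Rightarrow> real^'n) \<Rightarrow> bool" where
  "pw_smooth_vec \<theta> \<longleftrightarrow> (\<forall>i. pw_smooth (\<lambda>x. \<theta> x $ i))"

lemma pw_smooth_vec_choose:
  assumes "pw_smooth_vec \<theta>"
  obtains q where "\<And>T i. T \<in> \<T> \<Longrightarrow> smooth (q T i)" "\<And>T i x. T \<in> \<T> \<Longrightarrow> x \<in> interior T \<Longrightarrow> \<theta> x $ i = q T i x"
proof -
  have "\<forall>T i. \<exists>p. T \<in> \<T> \<longrightarrow> smooth p \<and> (\<forall>x\<in>interior T. \<theta> x $ i = p x)"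
    using assms unfolding pw_smooth_vec_def pw_smooth_def by blast
  then obtain q where "\<forall>T i. T \<in> \<T> \<longrightarrow> smooth (q T i) \<and> (\<forall>x\<in>interior T. \<theta> x $ i = q T i x)"
    by metis
  then show ?thesis by (intro that) blast+
qed

lemma pw_wjac_sq_int:
  assumes "pw_smooth_vec \<theta>"
  shows "sq_int (vol \<Omega>) \<theta>" "sq_int (vol \<Omega>) (pw \<T> wjac \<theta>)"
proof -
  obtain q where q: "\<And>T i. T \<in> \<T> \<Longrightarrow> smooth (q T i)" "\<And>T i x. T \<in> \<T> \<Longrightarrow> x \<in> interior T \<Longrightarrow> \<theta> x $ i = q T i x"
    using pw_smooth_vec_choose[OF assms] by blast
  show "sq_int (vol \<Omega>) \<theta>"
  proof (rule sq_int_mesh)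
    fix T assume T: "T \<in> \<T>"
    show "sq_int (vol T) \<theta>"
      by (rule sq_int_cong_AE[OF T_lebesgue[OF T], of "\<lambda>x. \<chi> i. q T i x"], intro sq_int_chi smooth_sq_int[OF T] q(1)[OF T])
        (use pw_wjac(2)[of T "q T" \<theta>, OF T q(1)[OF T] q(2)[OF T]] in \<open>auto simp: eq_commute\<close>)
  qed
  show "sq_int (vol \<Omega>) (pw \<T> wjac \<theta>)"
  proof (rule sq_int_mesh)
    fix T assume T: "T \<in> \<T>"
    show "sq_int (vol T) (pw \<T> wjac \<theta>)"
      by (rule sq_int_cong_AE[OF T_lebesgue[OF T], of "\<lambda>x. \<chi> i j. pd j (q T i) x"], intro sq_int_chi smooth_sq_int[OF T] smooth_pd q(1)[OF T])
        (use pw_wjac(1)[of T "q T" \<theta>, OF T q(1)[OF T] q(2)[OF T]] in \<open>auto simp: eq_commute\<close>)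
  qed
qed

text \<open>The discrete gradient is linear only up to null sets, hence the weak derivative is compared
  instead of the polynomials.\<close>

lemma pw_wjac_linear:
  assumes \<theta>: "pw_smooth_vec \<theta>" "pw_smooth_vec \<eta>" "pw_smooth_vec \<zeta>"
    and lin: "AE x in vol \<Omega>. \<zeta> x = a *\<^sub>R \<theta> x + b *\<^sub>R \<eta> x"
  shows "AE x in vol \<Omega>. pw \<T> wjac \<zeta> x = a *\<^sub>R pw \<T> wjac \<theta> x + b *\<^sub>R pw \<T> wjac \<eta> x"
proof (rule AE_mesh)
  fix T assume T: "T \<in> \<T>"
  obtain q where q: "\<And>T i. T \<in> \<T> \<Longrightarrow> smooth (q T i)" "\<And>T i x. T \<in> \<T> \<Longrightarrow> x \<in> interior T \<Longrightarrow> \<theta> x $ i = q T i x"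
    using pw_smooth_vec_choose[OF \<theta>(1)] by blast
  obtain r where r: "\<And>T i. T \<in> \<T> \<Longrightarrow> smooth (r T i)" "\<And>T i x. T \<in> \<T> \<Longrightarrow> x \<in> interior T \<Longrightarrow> \<eta> x $ i = r T i x"
    using pw_smooth_vec_choose[OF \<theta>(2)] by blast
  obtain s where s: "\<And>T i. T \<in> \<T> \<Longrightarrow> smooth (s T i)" "\<And>T i x. T \<in> \<T> \<Longrightarrow> x \<in> interior T \<Longrightarrow> \<zeta> x $ i = s T i x"
    using pw_smooth_vec_choose[OF \<theta>(3)] by blast
  have wp: "weak_partial (interior T) j (\<lambda>x. \<zeta> x $ i) (\<lambda>x. a * pd j (q T i) x + b * pd j (r T i) x)" for i j
  proof -
    have l: "weak_partial (interior T) j (\<lambda>x. a * \<theta> x $ i + b * \<eta> x $ i) (\<lambda>x. a * pd j (q T i) x + b * pd j (r T i) x)"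
      by (intro weak_partial_linear_comb open_interior smooth_on_interior(3)[OF T q(1)[OF T] q(2)[OF T]] smooth_on_interior(3)[OF T r(1)[OF T] r(2)[OF T]])
    have m: "(\<lambda>x. \<zeta> x $ i) \<in> borel_measurable (vol (interior T))"
      using smooth_on_interior(3)[OF T s(1)[OF T] s(2)[OF T]]
      by (intro loc_integrable_measurable[OF open_interior]) (auto simp: weak_partial_def)
    have m2: "(\<lambda>x. a * pd j (q T i) x + b * pd j (r T i) x) \<in> borel_measurable (vol (interior T))"
      using l by (intro loc_integrable_measurable[OF open_interior]) (auto simp: weak_partial_def)
    have ae: "AE x in vol (interior T). a * \<theta> x $ i + b * \<eta> x $ i = \<zeta> x $ i"
      using sub_ae_AE[OF sub_ae_interior_dom[OF T] lin] by eventually_elim simp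
    show ?thesis by (rule weak_partial_cong_AE[OF l open_interior m m2 ae]) simp
  qed
  have "AE x in vol (interior T). wjac (interior T) \<zeta> x = (\<chi> i j. a * pd j (q T i) x + b * pd j (r T i) x)"
    by (rule wjac_AE[OF open_interior wp])
  then have "AE x in vol T. wjac (interior T) \<zeta> x = (\<chi> i j. a * pd j (q T i) x + b * pd j (r T i) x)"
    by (rule AE_T_of_interior[OF T])
  moreover have "AE x in vol T. pw \<T> wjac \<theta> x = (\<chi> i j. pd j (q T i) x)"
    by (rule pw_wjac(1)[OF T q(1)[OF T] q(2)[OF T]])
  moreover have "AE x in vol T. pw \<T> wjac \<eta> x = (\<chi> i j. pd j (r T i) x)"
    by (rule pw_wjac(1)[OF T r(1)[OF T] r(2)[OF T]])
  ultimately show "AE x in vol T. pw \<T> wjac \<zeta> x = a *\<^sub>R pw \<T> wjac \<theta> x + b *\<^sub>R pw \<T> wjac \<eta> x"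
    using AE_pw[OF T, of wjac \<zeta>]
    by eventually_elim (simp add: vec_eq_iff)
qed


section \<open>The projection onto piecewise constants\<close>

definition mean :: "(real^'n) set \<Rightarrow> (real^'n \<Rightarrow> 'b::euclidean_space) \<Rightarrow> 'b" where
  "mean T g = (LINT x|vol T. g x) /\<^sub>R measure lebesgue T"

lemma measure_T_pos: "T \<in> \<T> \<Longrightarrow> 0 < measure lebesgue T"
proof -
  assume T: "T \<in> \<T>"
  obtain z r where b: "0 < r" "cball z r \<subseteq> T" using inball[OF T] by blast
  have "0 < measure lborel (cball z r)" using b(1) unit_vol_pos[where 'n = 'n] by (simp add: measure_cball)
  also have "\<dots> = measure lebesgue (cball z r)" by simp
  also have "\<dots> \<le> measure lebesgue T"
    using b(2) T_lebesgue[OF T] bounded_T[OF T] by (intro measure_mono_fmeasurable sets_lebesgue_compact compact_cball lmeasurable_compact compact_T[OF T])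
  finally show ?thesis .
qed

lemma integral_const_T: "T \<in> \<T> \<Longrightarrow> (LINT x|vol T. c) = measure lebesgue T *\<^sub>R c" for c :: "'b::euclidean_space"
  using T_lebesgue by (simp add: measure_restrict_space)

lemma mean_orthogonal:
  assumes T: "T \<in> \<T>" and g: "sq_int (vol T) g"
  shows "(LINT x|vol T. (g x - mean T g) \<bullet> c) = 0"
    and "(LINT x|vol T. (g x - b) \<bullet> c) = measure lebesgue T * ((mean T g - b) \<bullet> c)"
proof -
  have i: "integrable (vol T) g" by (rule sq_int_integrable[OF g finite_T_measure[OF T]])
  interpret finite_measure "vol T" by (rule finite_T_measure[OF T])
  have *: "(LINT x|vol T. (g x - b) \<bullet> c) = measure lebesgue T * ((mean T g - b) \<bullet> c)" for b
  proof -
    have "(LINT x|vol T. (g x - b) \<bullet> c) = (LINT x|vol T. g x - b) \<bullet> c"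
      using i by (intro integral_inner_left) auto
    also have "(LINT x|vol T. g x - b) = measure lebesgue T *\<^sub>R (mean T g - b)"
      using i measure_T_pos[OF T] integral_const_T[OF T, of b] by (simp add: mean_def scaleR_diff_right)
    finally show ?thesis by simp
  qed
  show "(LINT x|vol T. (g x - b) \<bullet> c) = measure lebesgue T * ((mean T g - b) \<bullet> c)" by (rule *)
  show "(LINT x|vol T. (g x - mean T g) \<bullet> c) = 0" by (simp add: *)
qed

text \<open>Testing with functions that are constant on one simplex and vanish on the others shows that
  the mean values are the only possible values of the projection.\<close>

lemma Pi0_interior:
  fixes g :: "real^'n \<Rightarrow> 'b::euclidean_space"
  assumes g: "sq_int (vol \<Omega>) g" and T: "T \<in> \<T>" "x \<in> interior T"
  shows "Pi0 \<T> g x = mean T g"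
proof -
  have gT: "sq_int (vol K) g" if "K \<in> \<T>" for K by (rule sub_ae_sq_int(1)[OF sub_ae_T_dom[OF that] g])
  have UT: "\<Union>\<T> \<in> sets lebesgue" using T_lebesgue finite_T by (intro sets.finite_Union) auto
  have same: "sub_ae (\<Union>\<T>) \<Omega>" "sub_ae \<Omega> (\<Union>\<T>)"
  proof -
    have "AE x in lebesgue. x \<in> \<Union>\<T> \<longrightarrow> x \<in> \<Omega>" using AE_skeleton
    proof eventually_elim
      case (elim x)
      then show ?case using interior_T_iff interior_T_dom by blast
    qed
    then show "sub_ae (\<Union>\<T>) \<Omega>" using UT dom_lebesgue unfolding sub_ae_def by blast
    show "sub_ae \<Omega> (\<Union>\<T>)" using sub_ae_subset[OF dom_lebesgue UT] Union_T closure_subset by blast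
  qed
  have P0_sq: "sq_int (vol \<Omega>) p" if p: "p \<in> P0 \<T>" for p :: "real^'n \<Rightarrow> 'b"
  proof (rule sq_int_mesh)
    fix K assume K: "K \<in> \<T>"
    then obtain a where "\<And>x. x \<in> interior K \<Longrightarrow> p x = a" using p unfolding P0_def by blast
    then show "sq_int (vol K) p"
      by (intro sq_int_cong_AE[OF T_lebesgue[OF K] sq_int_const[OF finite_T_measure[OF K], of a]] AE_T_iff[OF K]) simp
  qed
  have split: "(LINT x|vol (\<Union>\<T>). (g x - q x) \<bullet> p x) = (\<Sum>K\<in>\<T>. measure lebesgue K * ((mean K g - a K) \<bullet> c K))"
    if q: "q \<in> P0 \<T>" "\<And>K x. K \<in> \<T> \<Longrightarrow> x \<in> interior K \<Longrightarrow> q x = a K" and p: "p \<in> P0 \<T>" "\<And>K x. K \<in> \<T> \<Longrightarrow> x \<in> interior K \<Longrightarrow> p x = c K"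
    for q p a c
  proof -
    have "(LINT x|vol (\<Union>\<T>). (g x - q x) \<bullet> p x) = (LINT x|vol \<Omega>. (g x - q x) \<bullet> p x)"
      by (rule same_ae_integral[OF same])
    also have "\<dots> = (\<Sum>K\<in>\<T>. LINT x|vol K. (g x - q x) \<bullet> p x)"
      by (intro integral_mesh sq_int_inner sq_int_diff g P0_sq q p)
    also have "\<dots> = (\<Sum>K\<in>\<T>. measure lebesgue K * ((mean K g - a K) \<bullet> c K))"
    proof (rule sum.cong[OF refl])
      fix K assume K: "K \<in> \<T>"
      have "(LINT x|vol K. (g x - q x) \<bullet> p x) = (LINT x|vol K. (g x - a K) \<bullet> c K)"
      proof (rule integral_cong_AE)
        show "AE x in vol K. (g x - q x) \<bullet> p x = (g x - a K) \<bullet> c K" by (rule AE_T_iff[OF K]) (simp add: q(2)[OF K] p(2)[OF K])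
        show "(\<lambda>x. (g x - q x) \<bullet> p x) \<in> borel_measurable (vol K)" "(\<lambda>x. (g x - a K) \<bullet> c K) \<in> borel_measurable (vol K)"
          using sq_int_measurable[OF gT[OF K]] sq_int_measurable[OF sub_ae_sq_int(1)[OF sub_ae_T_dom[OF K] P0_sq[OF q(1)]]]
            sq_int_measurable[OF sub_ae_sq_int(1)[OF sub_ae_T_dom[OF K] P0_sq[OF p(1)]]] by auto
      qed
      then show "(LINT x|vol K. (g x - q x) \<bullet> p x) = measure lebesgue K * ((mean K g - a K) \<bullet> c K)"
        using mean_orthogonal(2)[OF K gT[OF K]] by simp
    qed
    finally show ?thesis .
  qed
  define pc where "pc c x = (\<Sum>K\<in>\<T>. indicat_real (interior K) x *\<^sub>R c K)" for c :: "(real^'n) set \<Rightarrow> 'b" and x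
  have pc_int: "pc c x = c K" if "K \<in> \<T>" "x \<in> interior K" for c K x
  proof -
    have "x \<notin> interior L" if "L \<in> \<T>" "L \<noteq> K" for L using interior_disjoint[OF that(1) \<open>K \<in> \<T>\<close> that(2)] \<open>x \<in> interior K\<close> by auto
    then have "pc c x = (\<Sum>L\<in>\<T>. if L = K then c K else 0)"
      unfolding pc_def using \<open>x \<in> interior K\<close> by (intro sum.cong refl) auto
    then show ?thesis using \<open>K \<in> \<T>\<close> finite_T by simp
  qed
  have pc_P0: "pc c \<in> P0 \<T>" for c
  proof -
    have "pc c x = 0" if "x \<notin> (\<Union>T\<in>\<T>. interior T)" for x using that unfolding pc_def by (intro sum.neutral) auto
    then show ?thesis unfolding P0_def using pc_int by blast
  qed
  have iff: "(\<forall>p\<in>P0 \<T>. (LINT x|vol (\<Union>\<T>). (g x - q x) \<bullet> p x) = 0) \<longleftrightarrow> (\<forall>K\<in>\<T>. \<forall>x\<in>interior K. q x = mean K g)"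
    if q: "q \<in> P0 \<T>" for q
  proof -
    have "\<forall>K. \<exists>a. K \<in> \<T> \<longrightarrow> (\<forall>x\<in>interior K. q x = a)" using q unfolding P0_def by blast
    then obtain a where a: "\<And>K x. K \<in> \<T> \<Longrightarrow> x \<in> interior K \<Longrightarrow> q x = a K" by metis
    show ?thesis
    proof
      assume L: "\<forall>p\<in>P0 \<T>. (LINT x|vol (\<Union>\<T>). (g x - q x) \<bullet> p x) = 0"
      have "mean K g = a K" if K: "K \<in> \<T>" for K
      proof -
        let ?c = "\<lambda>L. if L = K then mean K g - a K else 0"
        have "0 = (\<Sum>L\<in>\<T>. measure lebesgue L * ((mean L g - a L) \<bullet> ?c L))"
          using L pc_P0[of ?c] split[OF q a pc_P0[of ?c] pc_int] by simp
        also have "\<dots> = (\<Sum>L\<in>\<T>. if L = K then measure lebesgue K * ((mean K g - a K) \<bullet> (mean K g - a K)) else 0)"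
          by (intro sum.cong refl) auto
        also have "\<dots> = measure lebesgue K * ((mean K g - a K) \<bullet> (mean K g - a K))" using K finite_T by simp
        finally show ?thesis using measure_T_pos[OF K] by simp
      qed
      then show "\<forall>K\<in>\<T>. \<forall>x\<in>interior K. q x = mean K g" using a by simp
    next
      assume R: "\<forall>K\<in>\<T>. \<forall>x\<in>interior K. q x = mean K g"
      show "\<forall>p\<in>P0 \<T>. (LINT x|vol (\<Union>\<T>). (g x - q x) \<bullet> p x) = 0"
      proof
        fix p :: "real^'n \<Rightarrow> 'b" assume p: "p \<in> P0 \<T>"
        have "\<forall>K. \<exists>a. K \<in> \<T> \<longrightarrow> (\<forall>x\<in>interior K. p x = a)" using p unfolding P0_def by blast
        then obtain c where c: "\<And>K x. K \<in> \<T> \<Longrightarrow> x \<in> interior K \<Longrightarrow> p x = c K" by metis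
        show "(LINT x|vol (\<Union>\<T>). (g x - q x) \<bullet> p x) = 0"
          using split[OF q R[rule_format] p c] by simp
      qed
    qed
  qed
  have "Pi0 \<T> g = pc (\<lambda>K. mean K g)"
    unfolding Pi0_def
  proof (rule the_equality)
    show "pc (\<lambda>K. mean K g) \<in> P0 \<T> \<and> (\<forall>p\<in>P0 \<T>. (LINT x|vol (\<Union>\<T>). (g x - pc (\<lambda>K. mean K g) x) \<bullet> p x) = 0)"
      using iff[OF pc_P0] pc_int pc_P0 by simp
  next
    fix q assume q: "q \<in> P0 \<T> \<and> (\<forall>p\<in>P0 \<T>. (LINT x|vol (\<Union>\<T>). (g x - q x) \<bullet> p x) = 0)"
    show "q = pc (\<lambda>K. mean K g)"
    proof
      fix x
      show "q x = pc (\<lambda>K. mean K g) x"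
      proof (cases "x \<in> (\<Union>T\<in>\<T>. interior T)")
        case True
        then show ?thesis using q iff[of q] pc_int by auto
      next
        case False
        then show ?thesis using q pc_P0[of "\<lambda>K. mean K g"] unfolding P0_def by simp
      qed
    qed
  qed
  then show ?thesis using pc_int[OF T] by simp
qed

lemma one_minus_Pi0_T:
  fixes g :: "real^'n \<Rightarrow> 'b::euclidean_space"
  assumes g: "sq_int (vol \<Omega>) g"
  shows "T \<in> \<T> \<Longrightarrow> l2 (vol T) (one_minus_Pi0 \<T> g) = l2 (vol T) (\<lambda>x. g x - mean T g)"
    and "sq_int (vol \<Omega>) (one_minus_Pi0 \<T> g)"
proof -
  have ae: "AE x in vol T. g x - mean T g = one_minus_Pi0 \<T> g x" if T: "T \<in> \<T>" for T
    by (rule AE_T_iff[OF T]) (simp add: one_minus_Pi0_def Pi0_interior[OF g T])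
  have sq: "sq_int (vol T) (\<lambda>x. g x - mean T g)" if T: "T \<in> \<T>" for T
    by (intro sq_int_diff sub_ae_sq_int(1)[OF sub_ae_T_dom[OF T] g] sq_int_const finite_T_measure[OF T])
  show "l2 (vol T) (one_minus_Pi0 \<T> g) = l2 (vol T) (\<lambda>x. g x - mean T g)" if T: "T \<in> \<T>"
    by (rule l2_cong_AE_on[OF T_lebesgue[OF T] sq_int_measurable[OF sq[OF T]] ae[OF T], symmetric])
  show "sq_int (vol \<Omega>) (one_minus_Pi0 \<T> g)"
    by (rule sq_int_mesh) (rule sq_int_cong_AE[OF T_lebesgue sq ae])
qed

lemma mean_best:
  fixes g :: "real^'n \<Rightarrow> 'b::euclidean_space"
  assumes T: "T \<in> \<T>" and g: "sq_int (vol T) g"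
  shows "l2 (vol T) (\<lambda>x. g x - mean T g) \<le> l2 (vol T) (\<lambda>x. g x - c)"
proof -
  interpret finite_measure "vol T" by (rule finite_T_measure[OF T])
  have sq: "sq_int (vol T) (\<lambda>x. g x - b)" for b by (intro sq_int_diff g sq_int_const finite_measure_axioms)
  have i1: "integrable (vol T) (\<lambda>x. (g x - b) \<bullet> b')" for b b' by (rule sq_int_inner[OF sq sq_int_const[OF finite_measure_axioms]])
  have i2: "integrable (vol T) (\<lambda>x. (g x - mean T g) \<bullet> (g x - mean T g))" by (rule sq_int_inner[OF sq sq])
  have "(l2 (vol T) (\<lambda>x. g x - c))\<^sup>2 = (LINT x|vol T. (g x - mean T g) \<bullet> (g x - mean T g)
      + ((g x - mean T g) \<bullet> (2 *\<^sub>R (mean T g - c)) + (mean T g - c) \<bullet> (mean T g - c)))"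
    unfolding l2_sq_inner by (intro Bochner_Integration.integral_cong refl) (simp add: inner_diff_left inner_diff_right inner_commute)
  also have "\<dots> = (l2 (vol T) (\<lambda>x. g x - mean T g))\<^sup>2 + (0 + (LINT x|vol T. (mean T g - c) \<bullet> (mean T g - c)))"
    unfolding l2_sq_inner mean_orthogonal(1)[OF T g, of "2 *\<^sub>R (mean T g - c)", symmetric]
    using i1 i2 by (subst Bochner_Integration.integral_add, simp, simp, subst Bochner_Integration.integral_add) auto
  also have "\<dots> \<ge> (l2 (vol T) (\<lambda>x. g x - mean T g))\<^sup>2" by (auto intro!: integral_nonneg_AE)
  finally show ?thesis using l2_nonneg by (rule power2_le_imp_le)
qed

text \<open>The mean value is the best approximation, so that the mean of \<open>h\<close> may replace
  that of \<open>g\<close>.\<close>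

lemma oscillation_triangle:
  fixes g h :: "real^'n \<Rightarrow> 'b::euclidean_space"
  assumes T: "T \<in> \<T>" and g: "sq_int (vol \<Omega>) g" and h: "sq_int (vol \<Omega>) h"
  shows "l2 (vol T) (one_minus_Pi0 \<T> g) \<le> l2 (vol T) (one_minus_Pi0 \<T> h) + l2 (vol T) (\<lambda>x. g x - h x)"
    and "l2 (vol T) (one_minus_Pi0 \<T> g) \<le> l2 (vol T) g"
proof -
  have gT: "sq_int (vol T) g" and hT: "sq_int (vol T) h" using sub_ae_sq_int(1)[OF sub_ae_T_dom[OF T]] g h by auto
  have "l2 (vol T) (\<lambda>x. g x - mean T g) \<le> l2 (vol T) (\<lambda>x. g x - mean T h)" by (rule mean_best[OF T gT])
  also have "\<dots> \<le> l2 (vol T) (\<lambda>x. g x - h x) + l2 (vol T) (\<lambda>x. h x - mean T h)"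
    by (rule l2_triangle_diff[OF gT hT sq_int_const[OF finite_T_measure[OF T]]])
  finally show "l2 (vol T) (one_minus_Pi0 \<T> g) \<le> l2 (vol T) (one_minus_Pi0 \<T> h) + l2 (vol T) (\<lambda>x. g x - h x)"
    using one_minus_Pi0_T(1)[OF g T] one_minus_Pi0_T(1)[OF h T] by simp
  show "l2 (vol T) (one_minus_Pi0 \<T> g) \<le> l2 (vol T) g"
    using mean_best[OF T gT, of 0] one_minus_Pi0_T(1)[OF g T] by simp
qed

end

section \<open>Gradient fluxes over the faces\<close>

lemma H1_conv_add_scaled:
  fixes U :: "(real^'n::finite) set"
  assumes U: "open U" "bounded U" and w: "H1_conv U w W \<phi>" "H1_conv U w' W' \<phi>'"
  shows "H1_conv U (\<lambda>x. c * w x + w' x) (\<lambda>k x. c * W k x + W' k x) (\<lambda>j x. c * \<phi> j x + \<phi>' j x)"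
proof -
  note U' = U(2) sets_lebesgue_open[OF U(1)]
  have lim: "(\<lambda>j. l2 (vol U) (\<lambda>x. (c * f x + f' x) - (c * g j x + g' j x))) \<longlonglongrightarrow> 0"
    if f: "sq_int (vol U) f" "sq_int (vol U) f'" and g: "\<And>j. Ck 0 (g j)" "\<And>j. Ck 0 (g' j)"
      and l: "(\<lambda>j. l2 (vol U) (\<lambda>x. f x - g j x)) \<longlonglongrightarrow> 0" "(\<lambda>j. l2 (vol U) (\<lambda>x. f' x - g' j x)) \<longlonglongrightarrow> 0"
    for f f' :: "real^'n \<Rightarrow> real" and g g'
  proof (rule tendsto_sandwich[OF _ _ tendsto_const])
    have gs: "sq_int (vol U) (g j)" "sq_int (vol U) (g' j)" for j
      using g by (auto intro!: sq_int_continuous U')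
    have "l2 (vol U) (\<lambda>x. (c * f x + f' x) - (c * g j x + g' j x))
        \<le> \<bar>c\<bar> * l2 (vol U) (\<lambda>x. f x - g j x) + l2 (vol U) (\<lambda>x. f' x - g' j x)" for j
    proof -
      have "l2 (vol U) (\<lambda>x. (c * f x + f' x) - (c * g j x + g' j x))
          = l2 (vol U) (\<lambda>x. c *\<^sub>R (f x - g j x) + (f' x - g' j x))"
        by (rule arg_cong[where f = "l2 _"]) (auto simp: algebra_simps)
      also have "\<dots> \<le> l2 (vol U) (\<lambda>x. c *\<^sub>R (f x - g j x)) + l2 (vol U) (\<lambda>x. f' x - g' j x)"
        by (intro l2_triangle sq_int_scale sq_int_diff f gs)
      finally show ?thesis by (simp only: l2_scale)
    qed
    then show "\<forall>\<^sub>F j in sequentially. l2 (vol U) (\<lambda>x. (c * f x + f' x) - (c * g j x + g' j x))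
        \<le> \<bar>c\<bar> * l2 (vol U) (\<lambda>x. f x - g j x) + l2 (vol U) (\<lambda>x. f' x - g' j x)" by simp
    show "(\<lambda>j. \<bar>c\<bar> * l2 (vol U) (\<lambda>x. f x - g j x) + l2 (vol U) (\<lambda>x. f' x - g' j x)) \<longlonglongrightarrow> 0"
      using tendsto_add[OF tendsto_mult_left[OF l(1), of "\<bar>c\<bar>"] l(2)] by simp
  qed (simp add: l2_nonneg)
  have C: "Ck (Suc 0) (\<phi> j)" "Ck (Suc 0) (\<phi>' j)" for j using w unfolding H1_conv_def by auto
  have C0: "Ck 0 (\<phi> j)" "Ck 0 (\<phi>' j)" "Ck 0 (pd i (\<phi> j))" "Ck 0 (pd i (\<phi>' j))" for i j
    using C Ck_Suc_imp Ck_pd by blast+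
  have p: "pd i (\<lambda>x. c * \<phi> j x + \<phi>' j x) = (\<lambda>x. c * pd i (\<phi> j) x + pd i (\<phi>' j) x)" for i j
    using pd_linear_comb[OF C, of i c j 1 j] by simp
  have sq: "sq_int (vol U) (\<lambda>x. c * f x + f' x)" if "sq_int (vol U) f" "sq_int (vol U) f'" for f f' :: "real^'n \<Rightarrow> real"
    using sq_int_add[OF sq_int_scale[OF that(1), of c] that(2)] by simp
  show ?thesis
    unfolding H1_conv_def p using w C0 C
    by (auto simp: H1_conv_def simp del: Ck.simps intro!: sq lim Ck_add Ck_cmult)
qed

text \<open>For the normal component of a gradient.\<close>

lemma H1_conv_sum:
  assumes U: "open U" "bounded U" and "finite A" and w: "\<And>i. H1_conv U (w i) (W i) (\<phi> i)"
  shows "H1_conv U (\<lambda>x. \<Sum>i\<in>A. c i * w i x) (\<lambda>k x. \<Sum>i\<in>A. c i * W i k x) (\<lambda>j x. \<Sum>i\<in>A. c i * \<phi> i j x)"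
  using \<open>finite A\<close>
proof (induction A)
  case empty
  show ?case by (auto simp: H1_conv_def pd_const l2_def sq_int_zero Ck_const simp del: Ck.simps)
next
  case (insert a A)
  then show ?case using H1_conv_add_scaled[OF U w insert.IH, of "c a" a] by simp
qed

lemma weak_partial_sum:
  assumes U: "open U" and "finite A" and w: "\<And>i. weak_partial U k (w i) (W i)"
  shows "weak_partial U k (\<lambda>x. \<Sum>i\<in>A. c i * w i x) (\<lambda>x. \<Sum>i\<in>A. c i * W i x)"
  using \<open>finite A\<close>
proof (induction A)
  case empty
  show ?case using weak_partial_classical[OF Ck_const U, of k 0] by (simp add: pd_const)
next
  case (insert a A)
  then show ?case using weak_partial_linear_comb[OF U w insert.IH, of "c a" a 1] by simp
qed

lemma cone_id_diff:
  fixes T :: "(real^'n::finite) set"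
  assumes T: "compact T" and g: "sq_int (vol T) g" "sq_int (vol T) g'"
    and G: "sq_int (vol T) G" "sq_int (vol T) G'"
    and cone: "cone_id \<nu> T g G I" "cone_id \<nu> T g' G' I'"
  shows "cone_id \<nu> T (\<lambda>x. g x - g' x) (\<lambda>x. G x - G' x) (\<lambda>F. I F - I' F)"
proof -
  note T' = compact_imp_bounded[OF T] sets_lebesgue_compact[OF T]
  have i1: "integrable (vol T) (\<lambda>x. real CARD('n) * g x)" "integrable (vol T) (\<lambda>x. real CARD('n) * g' x)"
    using sq_int_integrable[OF _ finite_measure_bounded_on[OF T']] g by auto
  have i2: "integrable (vol T) (\<lambda>x. (x - P) \<bullet> G x)" "integrable (vol T) (\<lambda>x. (x - P) \<bullet> G' x)" for P
    by (intro sq_int_inner sq_int_continuous T' G continuous_intros)+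
  have "(LINT x|vol T. real CARD('n) * (g x - g' x) + (x - P) \<bullet> (G x - G' x))
    = (LINT x|vol T. (real CARD('n) * g x + (x - P) \<bullet> G x) - (real CARD('n) * g' x + (x - P) \<bullet> G' x))" for P
    by (intro Bochner_Integration.integral_cong refl) (simp add: algebra_simps inner_diff_right)
  also have "\<dots> P = (LINT x|vol T. real CARD('n) * g x + (x - P) \<bullet> G x) - (LINT x|vol T. real CARD('n) * g' x + (x - P) \<bullet> G' x)" for P
    by (intro Bochner_Integration.integral_diff Bochner_Integration.integrable_add i1 i2)
  finally have "(LINT x|vol T. real CARD('n) * (g x - g' x) + (x - P) \<bullet> (G x - G' x))
    = (LINT x|vol T. real CARD('n) * g x + (x - P) \<bullet> G x) - (LINT x|vol T. real CARD('n) * g' x + (x - P) \<bullet> G' x)" for P .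
  note eq = this
  show ?thesis
    unfolding cone_id_def
  proof (intro allI impI)
    fix F P z assume a: "F facet_of T" "P \<in> T" "T = convex hull (insert P F)" "z \<in> F"
    show "(LINT x|vol T. real CARD('n) * (g x - g' x) + (x - P) \<bullet> (G x - G' x)) = \<bar>(P - z) \<bullet> \<nu> F\<bar> * (I F - I' F)"
      unfolding eq cone(1)[unfolded cone_id_def, rule_format, OF a] cone(2)[unfolded cone_id_def, rule_format, OF a] by (rule right_diff_distrib[symmetric])
  qed
qed

context mesh
begin

text \<open>A point of the face is a limit point of the open simplex.\<close>

lemma face_val_smooth:
  assumes T: "T \<in> adj \<T> F" and q: "\<And>i. smooth (q i)" "\<And>i x. x \<in> interior T \<Longrightarrow> \<theta> x $ i = q i x" and x: "x \<in> F"
  shows "face_val T \<theta> x = (\<chi> i. q i x)"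
proof -
  have T': "T \<in> \<T>" "F facet_of T" using T by (auto simp: adj_iff)
  have "x \<in> T" using facet_of_imp_subset[OF T'(2)] x by auto
  also have "T = closure (interior T)"
    using convex_closure_interior[OF convex_T[OF T'(1)] interior_T_ne[OF T'(1)]] compact_imp_closed[OF compact_T[OF T'(1)]] by simp
  finally have "x islimpt interior T"
    using interior_limit_point[of x "interior T"] unfolding closure_def by auto
  then have nt: "\<not> trivial_limit (at x within interior T)" by (simp add: trivial_limit_within)
  have "((\<lambda>y. \<chi> i. q i y) \<longlongrightarrow> (\<chi> i. q i x)) (at x within interior T)"
  proof (rule tendsto_vec_lambda)
    fix i
    have "continuous_on UNIV (q i)" using Ck_continuous smoothD[OF q(1)] by blast
    then show "(q i \<longlongrightarrow> q i x) (at x within interior T)"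
      by (simp add: continuous_on_eq_continuous_at continuous_at isCont_def tendsto_within_subset[of _ _ _ UNIV])
  qed
  moreover have "\<forall>\<^sub>F y in at x within interior T. (\<chi> i. q i y) = \<theta> y"
    unfolding eventually_at_filter by (simp add: vec_eq_iff q(2))
  ultimately have "(\<theta> \<longlongrightarrow> (\<chi> i. q i x)) (at x within interior T)" by (rule Lim_transform_eventually)
  then show ?thesis unfolding face_val_def by (rule tendsto_Lim[OF nt])
qed

lemma face_facts:
  assumes T: "T \<in> adj \<T> F"
  shows "space (face_measure F (\<nu> F)) = F" "finite_measure (face_measure F (\<nu> F))"
    "smooth p \<Longrightarrow> sq_int (face_measure F (\<nu> F)) p" "smooth p \<Longrightarrow> integrable (face_measure F (\<nu> F)) p"
proof -
  have T': "T \<in> \<T>" "F facet_of T" using T by (auto simp: adj_iff)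
  note S = simplex_facet(2-4)[OF simplex_T[OF T'(1)] T'(2)]
  obtain z where z: "z \<in> F" using S(3) by auto
  show "space (face_measure F (\<nu> F)) = F"
    by (rule flat_face.space_face_measure[OF flat_face_unit_normal[OF normal[OF T'] S(1,2) z]])
  show fin: "finite_measure (face_measure F (\<nu> F))"
    by (rule face_sq_int(1)[OF normal[OF T'] S continuous_on_const])
  show sq: "sq_int (face_measure F (\<nu> F)) p" if "smooth p"
    by (rule face_sq_int(2)[OF normal[OF T'] S]) (use Ck_continuous smoothD that in blast)
  show "integrable (face_measure F (\<nu> F)) p" if "smooth p" by (rule sq_int_integrable[OF sq[OF that] fin])
qed

lemma outer_sign: "outer \<nu> F T = (if outward (\<nu> F) F T then 1 else - 1) *\<^sub>R \<nu> F"
  by (simp add: outer_def)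

lemma adj_cases:
  assumes "T \<in> adj \<T> F"
  obtains "adj \<T> F = {T}" | K where "K \<in> adj \<T> F" "K \<noteq> T" "adj \<T> F = {T, K}"
proof (cases "\<exists>K\<in>adj \<T> F. K \<noteq> T")
  case True
  then show ?thesis using adj_pair[OF assms] that(2) by metis
next
  case False
  then show ?thesis using assms that(1) by blast
qed

lemma measure_T_le: "T \<in> \<T> \<Longrightarrow> measure lebesgue T \<le> diameter T ^ CARD('n) * unit_vol TYPE('n)"
proof -
  assume T: "T \<in> \<T>"
  obtain x where x: "x \<in> T" using interior_T_ne[OF T] interior_subset by blast
  have "T \<subseteq> cball x (diameter T)" using diameter_bounded_bound[OF bounded_T[OF T] x] by auto
  then have "measure lebesgue T \<le> measure lebesgue (cball x (diameter T))"
    by (intro measure_mono_fmeasurable T_lebesgue[OF T] lmeasurable_compact compact_cball)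
  also have "\<dots> = measure lborel (cball x (diameter T))" by simp
  also have "\<dots> = diameter T ^ CARD('n) * unit_vol TYPE('n)" using diameter_pos[OF T] by (simp add: measure_cball)
  finally show ?thesis .
qed

lemma integral_norm_le:
  fixes f :: "real^'n \<Rightarrow> 'b::euclidean_space"
  assumes T: "T \<in> \<T>" and f: "sq_int (vol T) f"
  shows "(LINT x|vol T. norm (f x)) \<le> sqrt (measure lebesgue T) * l2 (vol T) f"
proof -
  have "(LINT x|vol T. norm (f x) * norm (1::real)) \<le> l2 (vol T) f * l2 (vol T) (\<lambda>_. 1::real)"
    by (rule cauchy_schwarz_norm_l2(2)[OF f sq_int_const[OF finite_T_measure[OF T]]])
  moreover have "l2 (vol T) (\<lambda>_. 1::real) = sqrt (measure lebesgue T)"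
    unfolding l2_def using integral_const_T[OF T, of "1::real"] by simp
  ultimately show ?thesis by (simp add: mult.commute)
qed

end

locale scheme = mesh \<Omega> \<T> \<nu> \<kappa>
  for \<Omega> :: "(real^'n::finite) set" and \<T> \<nu> \<kappa> +
  fixes k m :: nat and V \<Theta> G J and c3 c4 cJ :: real
  assumes spaces: "discrete_spaces \<Omega> \<T> k V \<Theta> G"
    and jumps: "zero_mean_gradient_jump \<T> \<nu> V G"
    and hess_cons: "hessian_consistency c3 \<T> V G"
    and grad_cons: "gradient_consistency c4 \<T> V G"
    and smooth_op: "smoother cJ m \<Omega> \<T> \<nu> V G J"
begin

lemma V_pw_smooth: "w \<in> V \<Longrightarrow> pw_smooth w" and G_pw_smooth: "w \<in> V \<Longrightarrow> pw_smooth_vec (G w)"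
  and J_H2_0: "w \<in> V \<Longrightarrow> J w \<in> H2_0 \<Omega>"
  using spaces smooth_op pw_smooth_Pk unfolding discrete_spaces_def smoother_def pw_smooth_vec_def by blast+

text \<open>Both the flux of \<open>w\<close> over the facets of \<open>T\<close> and the contribution
  of \<open>T\<close> to the consistency error are bounded in terms of this quantity, and it is bounded
  by \<open>\<parallel>D\<^sub>h\<^sup>2w\<parallel>\<close> on the patch.\<close>

definition defect :: "(real^'n \<Rightarrow> real) \<Rightarrow> (real^'n) set \<Rightarrow> real" where
  "defect w T = l2 (vol T) (\<lambda>x. G w x - wgrad \<Omega> (J w) x) / diameter T
     + l2 (vol T) (\<lambda>x. D2h \<T> G w x - whess \<Omega> (J w) x)"

definition flux_const :: real where
  "flux_const = \<kappa> / 2 * (real CARD('n))\<^sup>2 * sqrt (unit_vol TYPE('n))"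

lemma sq_int_wgrad: "z \<in> H2_0 \<Omega> \<Longrightarrow> sq_int (vol \<Omega>) (wgrad \<Omega> z)"
  unfolding sq_int_vec_iff wgrad_nth using H2_0_props(3)[OF open_dom] by blast

text \<open>Here \<open>D T F\<close> is the integral over \<open>F\<close> of \<open>\<nabla>\<^sub>h w
  - \<nabla>(J w)\<close>, seen from \<open>T\<close>.  The first two properties are the divergence
  theorem and the trace inequality, applied to every component.  The integral of \<open>\<nabla>(J
  w)\<close> is a limit over test functions that do not depend on \<open>T\<close> and vanish on
  boundary faces, hence the next two follow from the vanishing mean of the jump of
  \<open>\<nabla>\<^sub>h w\<close>.  As the mean of \<open>\<nabla>\<^sub>h w\<close> is then the same
  from both sides, it is the mean of the average, which has the same normal component as that of
  \<open>\<nabla>(J w)\<close>.\<close>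

lemma flux_data:
  assumes w: "w \<in> V"
  obtains D :: "(real^'n) set \<Rightarrow> (real^'n) set \<Rightarrow> real^'n" where
    "\<And>T A. T \<in> \<T> \<Longrightarrow> (LINT x|vol T. A \<bullet> (D2h \<T> G w x - whess \<Omega> (J w) x))
       = (\<Sum>F | F facet_of T. D T F \<bullet> (A *v outer \<nu> F T))"
    "\<And>T F. T \<in> adj \<T> F \<Longrightarrow> norm (D T F) \<le> flux_const * sqrt (diameter T ^ CARD('n)) * defect w T"
    "\<And>T K F. T \<in> adj \<T> F \<Longrightarrow> K \<in> adj \<T> F \<Longrightarrow> D T F = D K F"
    "\<And>T F. adj \<T> F = {T} \<Longrightarrow> D T F = 0"
    "\<And>T F. T \<in> adj \<T> F \<Longrightarrow> D T F \<bullet> \<nu> F = 0"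
proof -
  let ?z = "J w" and ?H = "\<lambda>x. D2h \<T> G w x - whess \<Omega> (J w) x" and ?g = "\<lambda>x. G w x - wgrad \<Omega> (J w) x" and ?n = "real CARD('n)"
  have z: "?z \<in> H2_0 \<Omega>" by (rule J_H2_0[OF w])
  note zP = H2_0_props[OF open_dom z]
  obtain q where q: "\<And>T i. T \<in> \<T> \<Longrightarrow> smooth (q T i)" "\<And>T i x. T \<in> \<T> \<Longrightarrow> x \<in> interior T \<Longrightarrow> G w x $ i = q T i x"
    using pw_smooth_vec_choose[OF G_pw_smooth[OF w]] by blast
  obtain \<phi> where \<phi>: "\<And>j. test_fun \<Omega> (\<phi> j)"
    and conv: "\<And>i. H1_conv \<Omega> (wpd \<Omega> i ?z) (\<lambda>k. wpd \<Omega> k (wpd \<Omega> i ?z)) (\<lambda>j. pd i (\<phi> j))"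
    using H2_0_approx[OF open_dom bounded_dom z] by blast
  define I where "I i F = lim (\<lambda>j. LINT x|face_measure F (\<nu> F). pd i (\<phi> j) x)" for i F
  define Q where "Q T F i = (LINT x|face_measure F (\<nu> F). q T i x)" for T F i
  define D where "D T F = (\<chi> i. Q T F i - I i F)" for T F
  define e where "e T i x = q T i x - wpd \<Omega> i ?z x" for T i x
  define E where "E T i x = grad (q T i) x - (\<chi> k. wpd \<Omega> k (wpd \<Omega> i ?z) x)" for T i x
  have I_lim: "(\<lambda>j. LINT x|face_measure F (\<nu> F). pd i (\<phi> j) x) \<longlonglongrightarrow> I i F" if "T \<in> adj \<T> F" for T F i
  proof -
    have T: "T \<in> \<T>" "F facet_of T" using that by (auto simp: adj_iff)
    show ?thesis unfolding I_def
      by (rule face_integral_tendsto(2)[OF sub_ae_T_dom[OF T(1)] simplex_T[OF T(1)] bounded_dom conv normal[OF T(1)] T(2)])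
  qed
  have sq_parts: "sq_int (vol T) (q T i)" "sq_int (vol T) (grad (q T i))" "sq_int (vol T) (wpd \<Omega> i ?z)"
    "sq_int (vol T) (\<lambda>x. \<chi> k. wpd \<Omega> k (wpd \<Omega> i ?z) x)" if T: "T \<in> \<T>" for T i
    unfolding grad_def[abs_def]
    by (intro sq_int_chi smooth_sq_int[OF T] smooth_pd q(1)[OF T] sub_ae_sq_int(1)[OF sub_ae_T_dom[OF T]] zP)+
  have sq_e: "sq_int (vol T) (e T i)" "sq_int (vol T) (E T i)" if T: "T \<in> \<T>" for T i
    unfolding e_def[abs_def] E_def[abs_def] using sq_parts[OF T] by (auto intro!: sq_int_diff)
  have cone: "cone_id \<nu> T (e T i) (E T i) (\<lambda>F. D T F $ i)" if T: "T \<in> \<T>" for T i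
  proof -
    have "cone_id \<nu> T (q T i) (grad (q T i)) (\<lambda>F. Q T F i)"
      unfolding Q_def by (rule cone_id_smooth[OF simplex_T[OF T] normal[OF T] smoothD[OF q(1)[OF T]]])
    moreover have "cone_id \<nu> T (wpd \<Omega> i ?z) (\<lambda>x. \<chi> k. wpd \<Omega> k (wpd \<Omega> i ?z) x) (I i)"
      unfolding I_def[abs_def] by (rule face_integral_tendsto(1)[OF sub_ae_T_dom[OF T] simplex_T[OF T] bounded_dom conv normal[OF T]])
    ultimately show ?thesis
      unfolding e_def[abs_def] E_def[abs_def] D_def vec_lambda_beta
      by (intro cone_id_diff compact_T[OF T] sq_parts[OF T])
  qed
  have int_e: "integrable (vol T) (e T i)" "integrable (vol T) (\<lambda>x. norm (E T i x))"
    "integrable (vol T) (\<lambda>x. (x - P) \<bullet> E T i x)" "integrable (vol T) (\<lambda>x. v \<bullet> E T i x)" if T: "T \<in> \<T>" for T i P v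
  proof -
    show "integrable (vol T) (e T i)" "integrable (vol T) (\<lambda>x. norm (E T i x))"
      by (intro sq_int_integrable[OF _ finite_T_measure[OF T]] sq_e[OF T] sq_int_norm)+
    show "integrable (vol T) (\<lambda>x. (x - P) \<bullet> E T i x)"
      by (intro sq_int_inner sq_int_continuous bounded_T[OF T] T_lebesgue[OF T] sq_e[OF T] continuous_intros)
    show "integrable (vol T) (\<lambda>x. v \<bullet> E T i x)"
      by (intro sq_int_inner sq_int_const finite_T_measure[OF T] sq_e[OF T])
  qed
  have D2_AE: "AE x in vol T. \<forall>i. ?H x $ i = E T i x"
    and G_AE: "AE x in vol T. \<forall>i. ?g x $ i = e T i x" if T: "T \<in> \<T>" for T
  proof -
    have "AE x in vol T. pw \<T> wjac (G w) x = (\<chi> i j. pd j (q T i) x)"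
      by (rule pw_wjac(1)[OF T q(1)[OF T] q(2)[OF T]])
    then show "AE x in vol T. \<forall>i. ?H x $ i = E T i x"
      by eventually_elim (simp add: D2h_def E_def grad_def vec_eq_iff whess_nth)
    have "AE x in vol T. G w x = (\<chi> i. q T i x)"
      by (rule pw_wjac(2)[OF T q(1)[OF T] q(2)[OF T]])
    then show "AE x in vol T. \<forall>i. ?g x $ i = e T i x"
      by eventually_elim (simp add: e_def wgrad_def)
  qed
  have sq_G: "sq_int (vol T) ?g" and sq_D2: "sq_int (vol T) ?H"
    if T: "T \<in> \<T>" for T
    using sub_ae_sq_int(1)[OF sub_ae_T_dom[OF T]] pw_wjac_sq_int[OF G_pw_smooth[OF w]] sq_int_wgrad[OF z] sq_int_whess[OF open_dom z]
    unfolding D2h_def by (auto intro!: sq_int_diff)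
  show ?thesis
  proof (rule that[of D])
    show "(LINT x|vol T. A \<bullet> ?H x) = (\<Sum>F | F facet_of T. D T F \<bullet> (A *v outer \<nu> F T))"
      if T: "T \<in> \<T>" for T A
    proof -
      have "(LINT x|vol T. A \<bullet> ?H x) = (LINT x|vol T. (\<Sum>i\<in>UNIV. A $ i \<bullet> E T i x))"
      proof (rule integral_cong_AE)
        show "AE x in vol T. A \<bullet> ?H x = (\<Sum>i\<in>UNIV. A $ i \<bullet> E T i x)"
          using D2_AE[OF T] by eventually_elim (subst inner_vec_def, simp only:)
        show "(\<lambda>x. A \<bullet> ?H x) \<in> borel_measurable (vol T)"
          using sq_int_measurable[OF sq_D2[OF T]] by (intro borel_measurable_inner borel_measurable_const)
        show "(\<lambda>x. \<Sum>i\<in>UNIV. A $ i \<bullet> E T i x) \<in> borel_measurable (vol T)"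
          using int_e(4)[OF T] by (intro borel_measurable_sum borel_measurable_integrable)
      qed
      also have "\<dots> = (\<Sum>i\<in>UNIV. LINT x|vol T. A $ i \<bullet> E T i x)"
        by (rule Bochner_Integration.integral_sum[OF int_e(4)[OF T]])
      also have "\<dots> = (\<Sum>i\<in>UNIV. \<Sum>F | F facet_of T. (A $ i \<bullet> outer \<nu> F T) * D T F $ i)"
        by (intro sum.cong refl divergence_simplex[OF simplex_T[OF T] normal[OF T] int_e(1)[OF T] int_e(3)[OF T] cone[OF T]])
      also have "\<dots> = (\<Sum>F | F facet_of T. \<Sum>i\<in>UNIV. (A $ i \<bullet> outer \<nu> F T) * D T F $ i)" by (rule sum.swap)
      also have "\<dots> = (\<Sum>F | F facet_of T. D T F \<bullet> (A *v outer \<nu> F T))"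
        by (intro sum.cong refl) (simp add: inner_vec_def matrix_vector_mult_def mult.commute)
      finally show ?thesis .
    qed
    show "norm (D T F) \<le> flux_const * sqrt (diameter T ^ CARD('n)) * defect w T" if T: "T \<in> adj \<T> F" for T F
    proof -
      have T': "T \<in> \<T>" "F facet_of T" using T by (auto simp: adj_iff)
      obtain c r where b: "0 < r" "cball c r \<subseteq> T" "diameter T \<le> \<kappa> * r" using inball[OF T'(1)] by blast
      define a where "a = l2 (vol T) ?g"
      define d where "d = l2 (vol T) ?H"
      define s where "s = sqrt (measure lebesgue T)"
      define h where "h = diameter T"
      have h: "h > 0" "h \<le> \<kappa> * r" using diameter_pos[OF T'(1)] b(3) by (auto simp: h_def)
      have nn: "0 \<le> a" "0 \<le> d" "0 \<le> s" by (auto simp: a_def d_def s_def l2_nonneg)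
      have X: "defect w T = a / h + d" by (simp add: defect_def a_def d_def h_def)
      have X0: "0 \<le> a / h + d" using nn h by simp
      have comp: "\<bar>D T F $ i\<bar> \<le> \<kappa> / 2 * ?n * s * (a / h + d)" for i
      proof -
        have ea: "l2 (vol T) (e T i) \<le> a"
        proof -
          have "l2 (vol T) (\<lambda>x. ?g x $ i) = l2 (vol T) (e T i)"
          proof (rule l2_cong_AE_on[OF T_lebesgue[OF T'(1)]])
            show "(\<lambda>x. ?g x $ i) \<in> borel_measurable (vol T)"
              using sq_G[OF T'(1)] sq_int_vec_iff sq_int_measurable by blast
            show "AE x in vol T. ?g x $ i = e T i x" using G_AE[OF T'(1)] by eventually_elim blast
          qed
          then show ?thesis unfolding a_def using l2_component_le[OF sq_G[OF T'(1)], of i] by simp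
        qed
        have Ed: "l2 (vol T) (E T i) \<le> d"
        proof -
          have "l2 (vol T) (\<lambda>x. ?H x $ i) = l2 (vol T) (E T i)"
          proof (rule l2_cong_AE_on[OF T_lebesgue[OF T'(1)]])
            show "(\<lambda>x. ?H x $ i) \<in> borel_measurable (vol T)"
              using sq_D2[OF T'(1)] sq_int_vec_iff sq_int_measurable by blast
            show "AE x in vol T. ?H x $ i = E T i x" using D2_AE[OF T'(1)] by eventually_elim blast
          qed
          then show ?thesis unfolding d_def using l2_component_le[OF sq_D2[OF T'(1)], of i] by simp
        qed
        have "2 * r * \<bar>D T F $ i\<bar> \<le> ?n * (LINT x|vol T. \<bar>e T i x\<bar>) + h * (LINT x|vol T. norm (E T i x))"
          unfolding h_def
          by (rule cone_id_bound[OF simplex_T[OF T'(1)] T'(2) normal[OF T'] int_e(1)[OF T'(1)] sq_int_measurable[OF sq_e(2)[OF T'(1)]]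
                int_e(2)[OF T'(1)] cone[OF T'(1)] b(2,1)])
        also have "\<dots> \<le> ?n * (s * a) + h * (s * d)"
        proof (intro add_mono mult_left_mono)
          show "(LINT x|vol T. \<bar>e T i x\<bar>) \<le> s * a"
            using integral_norm_le[OF T'(1) sq_e(1)[OF T'(1)], of i] mult_left_mono[OF ea nn(3)] by (simp add: s_def)
          show "(LINT x|vol T. norm (E T i x)) \<le> s * d"
            using integral_norm_le[OF T'(1) sq_e(2)[OF T'(1)], of i] mult_left_mono[OF Ed nn(3)] by (simp add: s_def)
        qed (use h in auto)
        also have "\<dots> \<le> ?n * (s * a) + h * (?n * (s * d))"
          using nn h dim2 mult_right_mono[of 1 ?n "s * d"] by (intro add_left_mono mult_left_mono) auto
        also have "\<dots> = h * (?n * (s * (a / h + d)))" using h by (simp add: field_simps)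
        also have "\<dots> \<le> \<kappa> * r * (?n * (s * (a / h + d)))"
          using X0 nn h by (intro mult_right_mono) auto
        finally have "r * (2 * \<bar>D T F $ i\<bar>) \<le> r * (\<kappa> * (?n * (s * (a / h + d))))" by (simp add: mult_ac)
        then have "2 * \<bar>D T F $ i\<bar> \<le> \<kappa> * (?n * (s * (a / h + d)))" using b(1) by (simp only: mult_le_cancel_left_pos)
        then show ?thesis by (simp add: mult_ac)
      qed
      have "norm (D T F) \<le> (\<Sum>i\<in>UNIV. \<bar>D T F $ i\<bar>)" by (rule norm_le_l1_cart)
      also have "\<dots> \<le> ?n * (\<kappa> / 2 * ?n * s * (a / h + d))" using sum_bounded_above[of UNIV "\<lambda>i. \<bar>D T F $ i\<bar>", OF comp] by simp
      also have "\<dots> = (\<kappa> / 2 * ?n\<^sup>2 * (a / h + d)) * s" by (simp add: power2_eq_square)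
      also have "\<dots> \<le> (\<kappa> / 2 * ?n\<^sup>2 * (a / h + d)) * (sqrt (diameter T ^ CARD('n)) * sqrt (unit_vol TYPE('n)))"
      proof (rule mult_left_mono)
        show "s \<le> sqrt (diameter T ^ CARD('n)) * sqrt (unit_vol TYPE('n))"
          unfolding s_def real_sqrt_mult[symmetric] by (intro real_sqrt_le_mono measure_T_le[OF T'(1)])
        show "0 \<le> \<kappa> / 2 * ?n\<^sup>2 * (a / h + d)" using X0 kappa_ge_1[OF T'(1)] by simp
      qed
      finally show ?thesis by (simp add: flux_const_def X mult_ac)
    qed
    \<comment> \<open>A summand with sign \<open>- 1\<close> occurs where the fixed normal points into the simplex.\<close>
    have Q_sum: "(\<Sum>T\<in>adj \<T> F. (if outward (\<nu> F) F T then 1 else - 1) * Q T F i) = 0" if K: "K \<in> adj \<T> F" for K F i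
    proof -
      let ?M = "face_measure F (\<nu> F)" and ?s = "\<lambda>T. if outward (\<nu> F) F T then 1 else - 1 :: real"
      let ?f = "\<lambda>x. \<Sum>T\<in>adj \<T> F. ?s T *\<^sub>R (\<chi> i. q T i x)"
      have inT: "T \<in> \<T>" if "T \<in> adj \<T> F" for T using that by (simp add: adj_iff)
      have "sq_int ?M ?f"
        by (intro sq_int_sum sq_int_scale sq_int_chi face_facts(3)[OF K] q(1) inT)
      then have int: "integrable ?M ?f" by (rule sq_int_integrable[OF _ face_facts(2)[OF K]])
      have "F \<in> faces \<T>" using K unfolding faces_def adj_iff by blast
      then have "0 = (LINT x|?M. jump \<T> \<nu> F (G w) x)" using jumps w unfolding zero_mean_gradient_jump_def by simp
      also have "\<dots> = (LINT x|?M. ?f x)"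
      proof (rule Bochner_Integration.integral_cong[OF refl])
        fix x assume "x \<in> space ?M"
        then have x: "x \<in> F" by (simp add: face_facts(1)[OF K])
        have fv: "face_val T (G w) x = (\<chi> i. q T i x)" if T: "T \<in> adj \<T> F" for T
          by (rule face_val_smooth[OF T q(1)[OF inT[OF T]] q(2)[OF inT[OF T]] x])
        show "jump \<T> \<nu> F (G w) x = ?f x" unfolding jump_def by (intro sum.cong refl) (simp only: fv)
      qed
      finally have "0 = (LINT x|?M. ?f x) $ i" by simp
      also have "\<dots> = (LINT x|?M. ?f x $ i)" by (rule integral_bounded_linear[OF bounded_linear_vec_nth int, symmetric])
      also have "\<dots> = (LINT x|?M. (\<Sum>T\<in>adj \<T> F. ?s T * q T i x))" by simp
      also have "\<dots> = (\<Sum>T\<in>adj \<T> F. LINT x|?M. ?s T * q T i x)"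
        by (intro Bochner_Integration.integral_sum integrable_mult_right face_facts(4)[OF K] q(1) inT)
      also have "\<dots> = (\<Sum>T\<in>adj \<T> F. ?s T * Q T F i)" unfolding Q_def by simp
      finally show ?thesis by simp
    qed
    have Q_eq: "Q T F i = Q K F i" if T: "T \<in> adj \<T> F" and K: "K \<in> adj \<T> F" for T K F i
    proof (cases "T = K")
      case False
      have T': "T \<in> \<T>" "F facet_of T" using T by (auto simp: adj_iff)
      have "\<nu> F \<bullet> \<nu> F = 1" using normal[OF T'] by (simp add: unit_normal_def dot_square_norm)
      moreover have "outer \<nu> F K \<bullet> \<nu> F = - (outer \<nu> F T \<bullet> \<nu> F)" by (simp only: outer_opposite[OF T K False] inner_minus_left)
      ultimately have "(if outward (\<nu> F) F K then 1 else - 1) = - (if outward (\<nu> F) F T then 1 else - 1 :: real)"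
        unfolding outer_sign by simp
      then show ?thesis using Q_sum[OF T, of i] adj_pair[OF T K False] False by (auto split: if_splits)
    qed simp
    show "D T F = D K F" if "T \<in> adj \<T> F" "K \<in> adj \<T> F" for T K F
      unfolding D_def using Q_eq[OF that] by simp
    show "D T F = 0" if a: "adj \<T> F = {T}" for T F
    proof -
      have T: "T \<in> adj \<T> F" using a by simp
      have "Q T F i = 0" for i using Q_sum[OF T, of i] a by (simp split: if_splits)
      moreover have "I i F = 0" for i
      proof -
        have "(LINT x|face_measure F (\<nu> F). pd i (\<phi> j) x) = 0" for j
        proof -
          obtain K where K: "K \<subseteq> \<Omega>" "\<And>x. x \<notin> K \<Longrightarrow> pd i (\<phi> j) x = 0" using test_fun_obtain[OF test_fun_pd[OF \<phi>]] by metis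
          have "(LINT x|face_measure F (\<nu> F). pd i (\<phi> j) x) = (LINT x|face_measure F (\<nu> F). 0)"
            using K boundary_face[OF a] face_facts(1)[OF T] by (intro Bochner_Integration.integral_cong refl) blast
          then show ?thesis by simp
        qed
        then show ?thesis using LIMSEQ_unique[OF I_lim[OF T]] by simp
      qed
      ultimately show ?thesis by (simp add: D_def vec_eq_iff)
    qed
    show "D T F \<bullet> \<nu> F = 0" if T: "T \<in> adj \<T> F" for T F
    proof -
      let ?M = "face_measure F (\<nu> F)"
      let ?tr = "H1_trace \<Omega> F (\<nu> F) (\<lambda>y. wgrad \<Omega> ?z y \<bullet> \<nu> F)"
      have T': "T \<in> \<T>" "F facet_of T" using T by (auto simp: adj_iff)
      have inT: "K \<in> \<T>" if "K \<in> adj \<T> F" for K using that by (simp add: adj_iff)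
      have wn: "(\<lambda>y. wgrad \<Omega> ?z y \<bullet> \<nu> F) = (\<lambda>y. \<Sum>i\<in>UNIV. \<nu> F $ i * wpd \<Omega> i ?z y)"
        by (auto simp: inner_vec_def wgrad_def mult.commute)
      have wp: "weak_partial \<Omega> k (\<lambda>y. \<Sum>i\<in>UNIV. \<nu> F $ i * wpd \<Omega> i ?z y) (\<lambda>x. \<Sum>i\<in>UNIV. \<nu> F $ i * wpd \<Omega> k (wpd \<Omega> i ?z) x)" for k
        by (rule weak_partial_sum[OF open_dom finite zP(4)])
      have cv: "H1_conv \<Omega> (\<lambda>y. \<Sum>i\<in>UNIV. \<nu> F $ i * wpd \<Omega> i ?z y) (\<lambda>k x. \<Sum>i\<in>UNIV. \<nu> F $ i * wpd \<Omega> k (wpd \<Omega> i ?z) x)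
          (\<lambda>j x. \<Sum>i\<in>UNIV. \<nu> F $ i * pd i (\<phi> j) x)"
        by (rule H1_conv_sum[OF open_dom bounded_dom finite conv])
      have sm: "smooth (\<lambda>x. \<Sum>i\<in>UNIV. \<nu> F $ i * pd i (\<phi> j) x)" for j
        unfolding smooth_def using smoothD[OF smooth_pd[OF test_fun_smooth[OF \<phi>]]] by (intro allI Ck_sum Ck_cmult) blast
      note tr = H1_trace_integral[OF sub_ae_T_dom[OF T'(1)] simplex_T[OF T'(1)] open_dom bounded_dom wp cv sm normal[OF T'(1)] T'(2)]
      have "(\<lambda>j. LINT x|?M. (\<Sum>i\<in>UNIV. \<nu> F $ i * pd i (\<phi> j) x)) \<longlonglongrightarrow> (\<Sum>i\<in>UNIV. \<nu> F $ i * I i F)"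
      proof -
        have "(LINT x|?M. (\<Sum>i\<in>UNIV. \<nu> F $ i * pd i (\<phi> j) x)) = (\<Sum>i\<in>UNIV. \<nu> F $ i * (LINT x|?M. pd i (\<phi> j) x))" for j
          using face_facts(4)[OF T smooth_pd[OF test_fun_smooth[OF \<phi>]]] by (subst Bochner_Integration.integral_sum) auto
        then show ?thesis using I_lim[OF T] by (auto intro!: tendsto_sum tendsto_mult_left)
      qed
      then have tr1: "(LINT x|?M. ?tr x) = (\<Sum>i\<in>UNIV. \<nu> F $ i * I i F)" and tr2: "integrable ?M ?tr"
        unfolding wn using tr limI by auto
      let ?c = "real (card (adj \<T> F))"
      have c: "?c > 0" using T finite_T by (auto simp: card_gt_0_iff adj_def)
      let ?av = "\<lambda>x. \<Sum>K\<in>adj \<T> F. \<Sum>i\<in>UNIV. (\<nu> F $ i / ?c) * q K i x"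
      have av: "average \<T> F (G w) x \<bullet> \<nu> F = ?av x" if "x \<in> space ?M" for x
      proof -
        have x: "x \<in> F" using that by (simp add: face_facts(1)[OF T])
        have fv: "face_val K (G w) x = (\<chi> i. q K i x)" if K: "K \<in> adj \<T> F" for K
          by (rule face_val_smooth[OF K q(1)[OF inT[OF K]] q(2)[OF inT[OF K]] x])
        have "average \<T> F (G w) x \<bullet> \<nu> F = (\<Sum>K\<in>adj \<T> F. face_val K (G w) x \<bullet> \<nu> F) / ?c"
          unfolding average_def by (simp add: inner_sum_left divide_inverse mult.commute)
        also have "(\<Sum>K\<in>adj \<T> F. face_val K (G w) x \<bullet> \<nu> F) = (\<Sum>K\<in>adj \<T> F. \<Sum>i\<in>UNIV. \<nu> F $ i * q K i x)"
          by (intro sum.cong refl) (simp add: fv inner_vec_def mult.commute)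
        finally show ?thesis by (simp add: sum_divide_distrib)
      qed
      have iq: "integrable ?M (q K i)" if "K \<in> adj \<T> F" for K i by (rule face_facts(4)[OF T q(1)[OF inT[OF that]]])
      have av_i: "integrable ?M ?av" by (intro Bochner_Integration.integrable_sum integrable_mult_right iq)
      have "(LINT x|?M. ?av x) = (\<Sum>K\<in>adj \<T> F. \<Sum>i\<in>UNIV. (\<nu> F $ i / ?c) * Q K F i)"
      proof -
        have "(LINT x|?M. ?av x) = (\<Sum>K\<in>adj \<T> F. LINT x|?M. (\<Sum>i\<in>UNIV. (\<nu> F $ i / ?c) * q K i x))"
          by (intro Bochner_Integration.integral_sum Bochner_Integration.integrable_sum integrable_mult_right iq)
        also have "\<dots> = (\<Sum>K\<in>adj \<T> F. \<Sum>i\<in>UNIV. LINT x|?M. (\<nu> F $ i / ?c) * q K i x)"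
          by (intro sum.cong refl Bochner_Integration.integral_sum integrable_mult_right iq)
        finally show ?thesis unfolding Q_def by simp
      qed
      also have "\<dots> = (\<Sum>K\<in>adj \<T> F. \<Sum>i\<in>UNIV. (\<nu> F $ i / ?c) * Q T F i)"
        using Q_eq[OF _ T] by (intro sum.cong refl) simp
      also have "\<dots> = (\<Sum>i\<in>UNIV. \<nu> F $ i * Q T F i)" using c by (simp add: sum_distrib_left)
      finally have av1: "(LINT x|?M. ?av x) = (\<Sum>i\<in>UNIV. \<nu> F $ i * Q T F i)" .
      have "F \<in> faces \<T>" using T' unfolding faces_def by blast
      then have "0 = (LINT x|?M. ?tr x - average \<T> F (G w) x \<bullet> \<nu> F)"
        using smooth_op w unfolding smoother_def by simp
      also have "\<dots> = (LINT x|?M. ?tr x - ?av x)" by (rule Bochner_Integration.integral_cong[OF refl]) (simp only: av)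
      also have "\<dots> = (\<Sum>i\<in>UNIV. \<nu> F $ i * I i F) - (\<Sum>i\<in>UNIV. \<nu> F $ i * Q T F i)"
        using Bochner_Integration.integral_diff[OF tr2 av_i] by (simp only: tr1 av1)
      also have "\<dots> = - (D T F \<bullet> \<nu> F)" by (simp add: D_def inner_vec_def algebra_simps sum_subtractf)
      finally show ?thesis by simp
    qed
  qed
qed

end

section \<open>Sums over patches\<close>

context mesh
begin

definition overlap :: real where
  "overlap = (real CARD('n) + 1) * \<kappa> ^ CARD('n)"

lemma T_exists: "\<exists>T. T \<in> \<T>"
  using Union_T dom unfolding lipschitz_polytope_def by (metis Union_empty closure_eq_empty ex_in_conv)

lemma kappa_1: "1 \<le> \<kappa>"
  using T_exists kappa_ge_1 by blast

lemma overlap_ge_1: "1 \<le> overlap"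
  using mult_mono[of 1 "real CARD('n) + 1" 1 "\<kappa> ^ CARD('n)"] one_le_power[OF kappa_1, of "CARD('n)"] by (simp add: overlap_def)

lemma patch_square_sum:
  assumes c: "0 \<le> c" and a: "\<And>T. T \<in> \<T> \<Longrightarrow> 0 \<le> a T" "\<And>T. T \<in> \<T> \<Longrightarrow> a T \<le> c * sqrt (\<Sum>K\<in>nbrs T. (b K)\<^sup>2)"
  shows "(\<Sum>T\<in>\<T>. (a T)\<^sup>2) \<le> c\<^sup>2 * (overlap * (\<Sum>T\<in>\<T>. (b T)\<^sup>2))"
proof -
  have "(\<Sum>T\<in>\<T>. (a T)\<^sup>2) \<le> (\<Sum>T\<in>\<T>. c\<^sup>2 * (\<Sum>K\<in>nbrs T. (b K)\<^sup>2))"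
  proof (rule sum_mono)
    fix T assume T: "T \<in> \<T>"
    have "(a T)\<^sup>2 \<le> (c * sqrt (\<Sum>K\<in>nbrs T. (b K)\<^sup>2))\<^sup>2" using a[OF T] by (intro power_mono)
    then show "(a T)\<^sup>2 \<le> c\<^sup>2 * (\<Sum>K\<in>nbrs T. (b K)\<^sup>2)" by (simp add: power_mult_distrib sum_nonneg)
  qed
  also have "\<dots> = c\<^sup>2 * (\<Sum>T\<in>\<T>. \<Sum>K\<in>nbrs T. (b K)\<^sup>2)" by (simp add: sum_distrib_left)
  also have "\<dots> \<le> c\<^sup>2 * (overlap * (\<Sum>T\<in>\<T>. (b T)\<^sup>2))"
    unfolding overlap_def by (intro mult_left_mono sum_nbrs_le) auto
  finally show ?thesis .
qed

text \<open>The Cauchy--Schwarz inequality, once on every patch and once for the sum over the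
  simplices.\<close>

lemma patch_product_sum:
  assumes "\<And>T. T \<in> \<T> \<Longrightarrow> 0 \<le> b T"
  shows "(\<Sum>T\<in>\<T>. a T * (\<Sum>K\<in>nbrs T. b K)) \<le> overlap * (sqrt (\<Sum>T\<in>\<T>. (a T)\<^sup>2) * sqrt (\<Sum>T\<in>\<T>. (b T)\<^sup>2))"
proof -
  have o: "0 \<le> overlap" using overlap_ge_1 by simp
  have "(\<Sum>T\<in>\<T>. (\<Sum>K\<in>nbrs T. b K)\<^sup>2) \<le> (sqrt overlap)\<^sup>2 * (overlap * (\<Sum>T\<in>\<T>. (b T)\<^sup>2))"
  proof (rule patch_square_sum)
    fix T assume T: "T \<in> \<T>"
    show "0 \<le> (\<Sum>K\<in>nbrs T. b K)" using assms by (intro sum_nonneg) (auto simp: nbrs_def)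
    have "(\<Sum>K\<in>nbrs T. b K)\<^sup>2 \<le> (\<Sum>K\<in>nbrs T. (b K)\<^sup>2) * real (card (nbrs T))" by (rule sum_squared_le_sum_of_squares)
    also have "\<dots> \<le> (\<Sum>K\<in>nbrs T. (b K)\<^sup>2) * overlap"
      using card_nbrs[OF T] by (intro mult_left_mono) (auto simp: overlap_def sum_nonneg)
    finally have "(\<Sum>K\<in>nbrs T. b K) \<le> sqrt ((\<Sum>K\<in>nbrs T. (b K)\<^sup>2) * overlap)" by (rule real_le_rsqrt)
    then show "(\<Sum>K\<in>nbrs T. b K) \<le> sqrt overlap * sqrt (\<Sum>K\<in>nbrs T. (b K)\<^sup>2)" by (simp add: real_sqrt_mult mult.commute)
  qed (use o in simp)
  also have "\<dots> = overlap\<^sup>2 * (\<Sum>T\<in>\<T>. (b T)\<^sup>2)" using o by (simp add: power2_eq_square)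
  finally have B: "(\<Sum>T\<in>\<T>. (\<Sum>K\<in>nbrs T. b K)\<^sup>2) \<le> overlap\<^sup>2 * (\<Sum>T\<in>\<T>. (b T)\<^sup>2)" .
  have "(\<Sum>T\<in>\<T>. a T * (\<Sum>K\<in>nbrs T. b K))\<^sup>2 \<le> (\<Sum>T\<in>\<T>. (a T)\<^sup>2) * (\<Sum>T\<in>\<T>. (\<Sum>K\<in>nbrs T. b K)\<^sup>2)"
    by (rule Cauchy_Schwarz_ineq_sum)
  also have "\<dots> \<le> (\<Sum>T\<in>\<T>. (a T)\<^sup>2) * (overlap\<^sup>2 * (\<Sum>T\<in>\<T>. (b T)\<^sup>2))"
    by (intro mult_left_mono B sum_nonneg) simp
  finally have "(\<Sum>T\<in>\<T>. a T * (\<Sum>K\<in>nbrs T. b K)) \<le> sqrt ((\<Sum>T\<in>\<T>. (a T)\<^sup>2) * (overlap\<^sup>2 * (\<Sum>T\<in>\<T>. (b T)\<^sup>2)))"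
    by (rule real_le_rsqrt)
  also have "\<dots> = overlap * (sqrt (\<Sum>T\<in>\<T>. (a T)\<^sup>2) * sqrt (\<Sum>T\<in>\<T>. (b T)\<^sup>2))" using o by (simp add: real_sqrt_mult)
  finally show ?thesis .
qed

lemma l2_mesh_sqrt:
  fixes f :: "real^'n \<Rightarrow> 'b::euclidean_space"
  assumes "sq_int (vol \<Omega>) f"
  shows "sqrt (\<Sum>T\<in>\<T>. (l2 (vol T) f)\<^sup>2) = l2 (vol \<Omega>) f"
  using l2_mesh[OF assms] l2_nonneg[of "vol \<Omega>" f] by (metis real_sqrt_unique)

lemma l2_patch_le_sqrt:
  fixes f :: "real^'n \<Rightarrow> 'b::euclidean_space"
  assumes f: "sq_int (vol \<Omega>) f"
  shows "l2 (vol (patch \<T> T)) f \<le> sqrt (\<Sum>K\<in>nbrs T. (l2 (vol K) f)\<^sup>2)"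
  using l2_patch_le[OF f] by (rule real_le_rsqrt)

end


section \<open>The consistency error\<close>

context scheme
begin

lemma defect_nonneg: "T \<in> \<T> \<Longrightarrow> 0 \<le> defect w T"
  unfolding defect_def using diameter_pos[of T] by (intro add_nonneg_nonneg divide_nonneg_pos l2_nonneg) auto

lemma D2h_sq_int: "w \<in> V \<Longrightarrow> sq_int (vol \<Omega>) (D2h \<T> G w)"
  unfolding D2h_def by (rule pw_wjac_sq_int(2)[OF G_pw_smooth])

lemma const_nonneg: "0 \<le> jump_const" "0 \<le> flux_const"
  using kappa_1 unit_vol_pos[where 'n = 'n] by (auto simp: jump_const_def flux_const_def)

text \<open>After the divergence theorem on every simplex, the sum is rearranged by faces; the facets of
  one adjacent simplex carry a common tangential vector, and the jump estimate applies to it.\<close>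

lemma piecewise_constant_consistency:
  assumes u: "u \<in> H2_0 \<Omega>" and w: "w \<in> V"
  defines "\<delta> \<equiv> \<lambda>K. l2 (vol K) (one_minus_Pi0 \<T> (whess \<Omega> u))"
  shows "\<bar>\<Sum>T\<in>\<T>. LINT x|vol T. mean T (whess \<Omega> u) \<bullet> (D2h \<T> G w x - whess \<Omega> (J w) x)\<bar>
    \<le> (real CARD('n) + 1) * (jump_const * flux_const) * (\<Sum>T\<in>\<T>. defect w T * (\<Sum>K\<in>nbrs T. \<delta> K))"
proof -
  let ?\<sigma> = "whess \<Omega> u" and ?c = "jump_const * flux_const"
  have s\<sigma>: "sq_int (vol \<Omega>) ?\<sigma>" by (rule sq_int_whess[OF open_dom u])
  define N where "N T = (\<Sum>K\<in>nbrs T. \<delta> K)" for T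
  have \<delta>0: "0 \<le> \<delta> K" for K by (simp add: \<delta>_def l2_nonneg)
  have N0: "0 \<le> N T" for T unfolding N_def by (intro sum_nonneg \<delta>0)
  have c0: "0 \<le> ?c" using const_nonneg by simp
  obtain D :: "(real^'n) set \<Rightarrow> (real^'n) set \<Rightarrow> real^'n" where
    D1: "\<And>T A. T \<in> \<T> \<Longrightarrow> (LINT x|vol T. A \<bullet> (D2h \<T> G w x - whess \<Omega> (J w) x))
       = (\<Sum>F | F facet_of T. D T F \<bullet> (A *v outer \<nu> F T))"
    and D2: "\<And>T F. T \<in> adj \<T> F \<Longrightarrow> norm (D T F) \<le> flux_const * sqrt (diameter T ^ CARD('n)) * defect w T"
    and D3: "\<And>T K F. T \<in> adj \<T> F \<Longrightarrow> K \<in> adj \<T> F \<Longrightarrow> D T F = D K F"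
    and D4: "\<And>T F. adj \<T> F = {T} \<Longrightarrow> D T F = 0"
    and D5: "\<And>T F. T \<in> adj \<T> F \<Longrightarrow> D T F \<bullet> \<nu> F = 0"
    using flux_data[OF w] by blast
  define a where "a T F = D T F \<bullet> (mean T ?\<sigma> *v outer \<nu> F T)" for T F
  have finF: "finite (faces \<T>)"
  proof -
    have "faces \<T> = (\<Union>T\<in>\<T>. {F. F facet_of T})" by (auto simp: faces_def)
    then show ?thesis using finite_T card_facets_simplex(1)[OF simplex_T] by auto
  qed
  have adj_eq: "adj \<T> F = {T \<in> \<T>. F facet_of T}" for F by (auto simp: adj_iff)
  have fac_eq: "{F. F facet_of T} = {F \<in> faces \<T>. F facet_of T}" if "T \<in> \<T>" for T using that by (auto simp: faces_def)
  have swap: "(\<Sum>T\<in>\<T>. \<Sum>F | F facet_of T. g T F) = (\<Sum>F\<in>faces \<T>. \<Sum>T\<in>adj \<T> F. g T F)" for g :: "_ \<Rightarrow> _ \<Rightarrow> real"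
    unfolding adj_eq by (subst sum.swap_restrict[OF finite_T finF, symmetric]) (intro sum.cong fac_eq refl)
  have face: "\<bar>\<Sum>T\<in>adj \<T> F. a T F\<bar> \<le> (\<Sum>T\<in>adj \<T> F. ?c * (defect w T * N T))" if F: "F \<in> faces \<T>" for F
  proof -
    obtain T where T: "T \<in> adj \<T> F" using F unfolding faces_def adj_def by blast
    have T': "T \<in> \<T>" "F facet_of T" using T by (auto simp: adj_iff)
    have nonneg: "0 \<le> ?c * (defect w K * N K)" if "K \<in> adj \<T> F" for K
      using that defect_nonneg N0 c0 by (auto simp: adj_iff)
    show ?thesis
    proof (rule adj_cases[OF T])
      assume s: "adj \<T> F = {T}"
      then show ?thesis using D4[OF s] nonneg by (simp add: a_def)
    next
      fix K assume K: "K \<in> adj \<T> F" "K \<noteq> T" and s: "adj \<T> F = {T, K}"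
      let ?r = "sqrt (diameter T ^ CARD('n))" and ?S = "\<Sum>L\<in>adj \<T> F. a L F"
      have r: "?r > 0" using diameter_pos[OF T'(1)] by simp
      have "?S = (\<Sum>L\<in>adj \<T> F. D T F \<bullet> (mean L ?\<sigma> *v outer \<nu> F L))"
        unfolding a_def by (intro sum.cong refl) (simp add: D3[OF T])
      then have "?r * \<bar>?S\<bar> \<le> jump_const * norm (D T F) * (\<Sum>L\<in>adj \<T> F. l2 (vol L) (\<lambda>x. ?\<sigma> x - mean L ?\<sigma>))"
        using jump_estimate[OF u T K(1) not_sym[OF K(2)] D5[OF T], of "\<lambda>L. mean L ?\<sigma>"] by simp
      also have "(\<Sum>L\<in>adj \<T> F. l2 (vol L) (\<lambda>x. ?\<sigma> x - mean L ?\<sigma>)) = (\<Sum>L\<in>adj \<T> F. \<delta> L)"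
        unfolding \<delta>_def by (intro sum.cong refl one_minus_Pi0_T(1)[OF s\<sigma>, symmetric]) (simp add: adj_iff)
      also have "jump_const * norm (D T F) * (\<Sum>L\<in>adj \<T> F. \<delta> L) \<le> jump_const * (flux_const * ?r * defect w T) * N T"
      proof (intro mult_mono mult_left_mono D2[OF T] const_nonneg)
        obtain z where z: "z \<in> F" using simplex_facet(4)[OF simplex_T[OF T'(1)] T'(2)] by blast
        have "adj \<T> F \<subseteq> nbrs T"
          using z facet_of_imp_subset[OF T'(2)] facet_of_imp_subset by (fastforce simp: adj_iff nbrs_def)
        then show "(\<Sum>L\<in>adj \<T> F. \<delta> L) \<le> N T" unfolding N_def by (intro sum_mono2 finite_nbrs \<delta>0)
      qed (use const_nonneg defect_nonneg[OF T'(1)] r \<delta>0 in \<open>auto intro!: sum_nonneg\<close>)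
      finally have "?r * \<bar>?S\<bar> \<le> ?r * (?c * (defect w T * N T))" by (simp add: mult_ac)
      then have "\<bar>?S\<bar> \<le> ?c * (defect w T * N T)" using r by (simp only: mult_le_cancel_left_pos)
      also have "\<dots> \<le> (\<Sum>T\<in>adj \<T> F. ?c * (defect w T * N T))"
        using finite_T nonneg by (intro member_le_sum T) (auto simp: adj_def)
      finally show ?thesis .
    qed
  qed
  have "(\<Sum>T\<in>\<T>. LINT x|vol T. mean T ?\<sigma> \<bullet> (D2h \<T> G w x - whess \<Omega> (J w) x)) = (\<Sum>T\<in>\<T>. \<Sum>F | F facet_of T. a T F)"
    unfolding a_def by (intro sum.cong refl D1)
  also have "\<dots> = (\<Sum>F\<in>faces \<T>. \<Sum>T\<in>adj \<T> F. a T F)" by (rule swap)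
  finally have "\<bar>\<Sum>T\<in>\<T>. LINT x|vol T. mean T ?\<sigma> \<bullet> (D2h \<T> G w x - whess \<Omega> (J w) x)\<bar>
      \<le> (\<Sum>F\<in>faces \<T>. \<Sum>T\<in>adj \<T> F. ?c * (defect w T * N T))"
    by (simp only:) (rule order_trans[OF sum_abs sum_mono[OF face]])
  also have "\<dots> = (\<Sum>T\<in>\<T>. \<Sum>F | F facet_of T. ?c * (defect w T * N T))" by (rule swap[symmetric])
  also have "\<dots> \<le> (\<Sum>T\<in>\<T>. (real CARD('n) + 1) * (?c * (defect w T * N T)))"
  proof (rule sum_mono)
    fix T assume T: "T \<in> \<T>"
    have "real (card {F. F facet_of T}) \<le> real CARD('n) + 1" using card_facets_simplex(2)[OF simplex_T[OF T]] by linarith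
    then show "(\<Sum>F | F facet_of T. ?c * (defect w T * N T)) \<le> (real CARD('n) + 1) * (?c * (defect w T * N T))"
      using c0 defect_nonneg[OF T, of w] N0[of T] by (simp add: mult_right_mono)
  qed
  also have "\<dots> = (real CARD('n) + 1) * ?c * (\<Sum>T\<in>\<T>. defect w T * N T)" by (simp add: sum_distrib_left mult_ac)
  finally show ?thesis unfolding N_def .
qed

lemma scaled_H2_parts:
  assumes "T \<in> \<T>"
  shows "l2 (vol T) (pw \<T> wgrad v) / diameter T \<le> scaled_H2 \<T> T v"
    and "l2 (vol T) (pw \<T> whess v) \<le> scaled_H2 \<T> T v"
    and "l2 (vol T) (pw \<T> wgrad v) / diameter T + l2 (vol T) (pw \<T> whess v) \<le> scaled_H2 \<T> T v"
  using diameter_pos[OF assms] l2_nonneg[of "vol T" v] l2_nonneg[of "vol T" "pw \<T> wgrad v"]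
    l2_nonneg[of "vol T" "pw \<T> whess v"] by (auto simp: scaled_H2_def)

lemma hessian_difference:
  assumes w: "w \<in> V" and T: "T \<in> \<T>"
  shows "l2 (vol T) (\<lambda>x. D2h \<T> G w x - pw \<T> whess w x) \<le> \<bar>c3\<bar> * l2 (vol T) (one_minus_Pi0 \<T> (pw \<T> whess w))"
    and "l2 (vol T) (\<lambda>x. D2h \<T> G w x - pw \<T> whess w x) \<le> \<bar>c3\<bar> * l2 (vol T) (one_minus_Pi0 \<T> (D2h \<T> G w))"
proof -
  let ?a = "l2 (vol T) (one_minus_Pi0 \<T> (pw \<T> whess w))" and ?b = "l2 (vol T) (one_minus_Pi0 \<T> (D2h \<T> G w))"
  have "l2 (vol T) (\<lambda>x. D2h \<T> G w x - pw \<T> whess w x) \<le> c3 * min ?a ?b"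
    using hess_cons w T unfolding hessian_consistency_def by blast
  also have "\<dots> \<le> \<bar>c3\<bar> * min ?a ?b" by (intro mult_right_mono) (auto simp: l2_nonneg)
  finally have *: "l2 (vol T) (\<lambda>x. D2h \<T> G w x - pw \<T> whess w x) \<le> \<bar>c3\<bar> * min ?a ?b" .
  show "l2 (vol T) (\<lambda>x. D2h \<T> G w x - pw \<T> whess w x) \<le> \<bar>c3\<bar> * ?a" by (rule order_trans[OF * mult_left_mono]) auto
  show "l2 (vol T) (\<lambda>x. D2h \<T> G w x - pw \<T> whess w x) \<le> \<bar>c3\<bar> * ?b" by (rule order_trans[OF * mult_left_mono]) auto
qed

definition defect_const :: real where
  "defect_const = (\<bar>c4\<bar> + 1) * \<bar>c3\<bar> + 2 * \<bar>cJ\<bar> * (1 + \<bar>c3\<bar>)"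

text \<open>The choice \<open>\<psi> = 0\<close> in the minimum of the estimate for \<open>J\<close> is
  sufficient here.\<close>

lemma defect_le:
  assumes w: "w \<in> V" and T: "T \<in> \<T>"
  shows "defect w T \<le> defect_const * sqrt (\<Sum>K\<in>nbrs T. (l2 (vol K) (D2h \<T> G w))\<^sup>2)"
proof -
  let ?z = "J w" and ?H = "D2h \<T> G w" and ?P = "pw \<T> whess w" and ?g = "pw \<T> wgrad w" and ?h = "diameter T"
  let ?B = "sqrt (\<Sum>K\<in>nbrs T. (l2 (vol K) ?H)\<^sup>2)"
  let ?d = "\<lambda>x. w x - ?z x"
  have z: "?z \<in> H2_0 \<Omega>" by (rule J_H2_0[OF w])
  have pv: "pw_smooth w" by (rule V_pw_smooth[OF w])
  have sH: "sq_int (vol \<Omega>) ?H" by (rule D2h_sq_int[OF w])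
  note sw = pw_smooth_sq_int[OF pv]
  have sG: "sq_int (vol \<Omega>) (G w)" by (rule pw_wjac_sq_int(1)[OF G_pw_smooth[OF w]])
  have sz: "sq_int (vol \<Omega>) (wgrad \<Omega> ?z)" "sq_int (vol \<Omega>) (whess \<Omega> ?z)"
    by (rule sq_int_wgrad[OF z], rule sq_int_whess[OF open_dom z])
  note onT = sub_ae_sq_int(1)[OF sub_ae_T_dom]
  have HP: "l2 (vol K) (\<lambda>x. ?H x - ?P x) \<le> \<bar>c3\<bar> * l2 (vol K) ?H" if K: "K \<in> \<T>" for K
    by (rule order_trans[OF hessian_difference(2)[OF w K] mult_left_mono[OF oscillation_triangle(2)[OF K sH sH]]]) simp
  have P: "l2 (vol K) ?P \<le> (1 + \<bar>c3\<bar>) * l2 (vol K) ?H" if K: "K \<in> \<T>" for K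
  proof -
    have "l2 (vol K) ?P \<le> l2 (vol K) ?H + l2 (vol K) (\<lambda>x. ?P x - ?H x)"
      by (rule l2_triangle_sub[OF onT[OF K sw(3)] onT[OF K sH]])
    also have "l2 (vol K) (\<lambda>x. ?P x - ?H x) = l2 (vol K) (\<lambda>x. ?H x - ?P x)" by (rule l2_minus_commute)
    finally show ?thesis using HP[OF K] by (simp add: algebra_simps)
  qed
  have bB: "l2 (vol T) ?H \<le> ?B"
    by (rule real_le_rsqrt, rule member_le_sum[OF T_in_nbrs[OF T] _ finite_nbrs]) simp
  have scaled_B: "sqrt (\<Sum>K\<in>nbrs T. (l2 (vol K) f)\<^sup>2) \<le> (1 + \<bar>c3\<bar>) * ?B"
    if f: "\<And>K. K \<in> \<T> \<Longrightarrow> l2 (vol K) f \<le> (1 + \<bar>c3\<bar>) * l2 (vol K) ?H" for f :: "real^'n \<Rightarrow> real^'n^'n"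
  proof -
    have "(\<Sum>K\<in>nbrs T. (l2 (vol K) f)\<^sup>2) \<le> (\<Sum>K\<in>nbrs T. ((1 + \<bar>c3\<bar>) * l2 (vol K) ?H)\<^sup>2)"
      using f by (intro sum_mono power_mono l2_nonneg) (auto simp: nbrs_def)
    also have "\<dots> = (1 + \<bar>c3\<bar>)\<^sup>2 * (\<Sum>K\<in>nbrs T. (l2 (vol K) ?H)\<^sup>2)" by (simp add: power_mult_distrib sum_distrib_left)
    finally have "sqrt (\<Sum>K\<in>nbrs T. (l2 (vol K) f)\<^sup>2) \<le> sqrt ((1 + \<bar>c3\<bar>)\<^sup>2 * (\<Sum>K\<in>nbrs T. (l2 (vol K) ?H)\<^sup>2))"
      by (rule real_sqrt_le_mono)
    then show ?thesis by (simp add: real_sqrt_mult)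
  qed
  have sc: "scaled_H2 \<T> T ?d \<le> \<bar>cJ\<bar> * (2 * ((1 + \<bar>c3\<bar>) * ?B))"
  proof -
    let ?i = "\<lambda>\<psi>. l2 (vol (patch \<T> T)) (pw \<T> whess (\<lambda>x. \<psi> x - w x))"
    have z0: "(\<lambda>x. 0) \<in> H2_0 \<Omega>" by (rule zero_H2_0[OF open_dom])
    have bdd: "bdd_below (?i ` H2_0 \<Omega>)" by (intro bdd_belowI[of _ 0]) (auto simp: l2_nonneg)
    have wh0: "AE x in vol K. pw \<T> whess (\<lambda>x. 0 - w x) x = - ?P x" if K: "K \<in> \<T>" for K
    proof -
      have "AE x in vol \<Omega>. whess \<Omega> (\<lambda>x. 0) x = (\<chi> i j. 0)"
        using weak_partial_classical[OF Ck_const[of _ 0] open_dom] by (intro whess_AE[OF open_dom, where g = "\<lambda>i x. 0"]) (simp_all add: pd_const)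
      from sub_ae_AE[OF sub_ae_T_dom[OF K] this] pw_diff(3)[OF pv z0 K]
      show ?thesis by eventually_elim (simp add: vec_eq_iff)
    qed
    have "?i (\<lambda>x. 0) = l2 (vol (patch \<T> T)) (\<lambda>x. - ?P x)"
    proof (rule l2_cong_AE_on[symmetric])
      show "patch \<T> T \<in> sets lebesgue" unfolding patch_def by (intro sets_lebesgue_open) simp
      show "(\<lambda>x. - ?P x) \<in> borel_measurable (vol (patch \<T> T))"
        using sub_ae_sq_int(1)[OF sub_ae_patch_dom sq_int_uminus[OF sw(3)]] by (rule sq_int_measurable)
      show "AE x in vol (patch \<T> T). - ?P x = pw \<T> whess (\<lambda>x. 0 - w x) x"
      proof (rule eventually_mono)
        show "AE x in vol (patch \<T> T). pw \<T> whess (\<lambda>x. 0 - w x) x = - ?P x"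
          by (rule sub_ae_AE[OF sub_ae_patch_dom AE_mesh]) (rule wh0)
      qed (rule sym)
    qed
    also have "\<dots> = l2 (vol (patch \<T> T)) ?P" by (rule l2_uminus)
    also have "\<dots> \<le> (1 + \<bar>c3\<bar>) * ?B" by (rule order_trans[OF l2_patch_le_sqrt[OF sw(3)] scaled_B[OF P]])
    finally have i0: "?i (\<lambda>x. 0) \<le> (1 + \<bar>c3\<bar>) * ?B" .
    have inf: "(INF \<psi>\<in>H2_0 \<Omega>. ?i \<psi>) \<le> (1 + \<bar>c3\<bar>) * ?B" by (rule order_trans[OF cINF_lower[OF bdd z0] i0])
    have inf0: "0 \<le> (INF \<psi>\<in>H2_0 \<Omega>. ?i \<psi>)" using z0 by (intro cINF_greatest) (auto simp: l2_nonneg)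
    have pi: "l2 (vol (patch \<T> T)) (one_minus_Pi0 \<T> ?P) \<le> (1 + \<bar>c3\<bar>) * ?B"
      by (rule order_trans[OF l2_patch_le_sqrt[OF one_minus_Pi0_T(2)[OF sw(3)]] scaled_B])
        (rule order_trans[OF oscillation_triangle(2)[OF _ sw(3) sw(3)] P])
    have "scaled_H2 \<T> T ?d \<le> cJ * ((INF \<psi>\<in>H2_0 \<Omega>. ?i \<psi>) + l2 (vol (patch \<T> T)) (one_minus_Pi0 \<T> ?P))"
      using smooth_op w T unfolding smoother_def by blast
    also have "\<dots> \<le> \<bar>cJ\<bar> * ((INF \<psi>\<in>H2_0 \<Omega>. ?i \<psi>) + l2 (vol (patch \<T> T)) (one_minus_Pi0 \<T> ?P))"
      using inf0 by (intro mult_right_mono add_nonneg_nonneg l2_nonneg) auto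
    also have "\<dots> \<le> \<bar>cJ\<bar> * (2 * ((1 + \<bar>c3\<bar>) * ?B))" using inf pi by (intro mult_left_mono) auto
    finally show ?thesis .
  qed
  have g1: "l2 (vol T) (\<lambda>x. G w x - ?g x) / ?h \<le> \<bar>c4\<bar> * (\<bar>c3\<bar> * ?B)"
  proof -
    have "l2 (vol T) (\<lambda>x. ?g x - G w x) / ?h \<le> c4 * l2 (vol T) (\<lambda>x. ?P x - ?H x)"
      using grad_cons w T unfolding gradient_consistency_def by blast
    also have "\<dots> \<le> \<bar>c4\<bar> * l2 (vol T) (\<lambda>x. ?P x - ?H x)" by (intro mult_right_mono l2_nonneg) simp
    also have "l2 (vol T) (\<lambda>x. ?P x - ?H x) = l2 (vol T) (\<lambda>x. ?H x - ?P x)" by (rule l2_minus_commute)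
    also have "\<bar>c4\<bar> * \<dots> \<le> \<bar>c4\<bar> * (\<bar>c3\<bar> * ?B)"
      by (intro mult_left_mono order_trans[OF HP[OF T]] bB) auto
    also have "l2 (vol T) (\<lambda>x. ?g x - G w x) = l2 (vol T) (\<lambda>x. G w x - ?g x)" by (rule l2_minus_commute)
    finally show ?thesis .
  qed
  have g2: "l2 (vol T) (\<lambda>x. ?g x - wgrad \<Omega> ?z x) = l2 (vol T) (pw \<T> wgrad ?d)"
    by (rule l2_cong_AE_on[OF T_lebesgue[OF T] sq_int_measurable[OF sq_int_diff[OF onT[OF T sw(2)] onT[OF T sz(1)]]]],
        rule eventually_mono[OF pw_diff(1)[OF pv z T]]) simp
  have h2: "l2 (vol T) (\<lambda>x. ?P x - whess \<Omega> ?z x) = l2 (vol T) (pw \<T> whess ?d)"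
    by (rule l2_cong_AE_on[OF T_lebesgue[OF T] sq_int_measurable[OF sq_int_diff[OF onT[OF T sw(3)] onT[OF T sz(2)]]]],
        rule eventually_mono[OF pw_diff(2)[OF pv z T]]) simp
  have "l2 (vol T) (\<lambda>x. G w x - wgrad \<Omega> ?z x) / ?h
      \<le> (l2 (vol T) (\<lambda>x. G w x - ?g x) + l2 (vol T) (\<lambda>x. ?g x - wgrad \<Omega> ?z x)) / ?h"
    using diameter_pos[OF T] l2_triangle_diff[OF onT[OF T sG] onT[OF T sw(2)] onT[OF T sz(1)]] by (intro divide_right_mono) auto
  then have A: "l2 (vol T) (\<lambda>x. G w x - wgrad \<Omega> ?z x) / ?h \<le> \<bar>c4\<bar> * (\<bar>c3\<bar> * ?B) + l2 (vol T) (pw \<T> wgrad ?d) / ?h"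
    using g1 by (simp add: add_divide_distrib g2)
  have "l2 (vol T) (\<lambda>x. ?H x - ?P x) \<le> \<bar>c3\<bar> * ?B"
    by (rule order_trans[OF HP[OF T] mult_left_mono[OF bB]]) simp
  then have B: "l2 (vol T) (\<lambda>x. ?H x - whess \<Omega> ?z x) \<le> \<bar>c3\<bar> * ?B + l2 (vol T) (pw \<T> whess ?d)"
    using l2_triangle_diff[OF onT[OF T sH] onT[OF T sw(3)] onT[OF T sz(2)]] by (simp add: h2)
  have "defect w T \<le> \<bar>c4\<bar> * (\<bar>c3\<bar> * ?B) + \<bar>c3\<bar> * ?B + scaled_H2 \<T> T ?d"
    unfolding defect_def using A B scaled_H2_parts(3)[OF T, of ?d] by linarith
  also have "\<dots> \<le> \<bar>c4\<bar> * (\<bar>c3\<bar> * ?B) + \<bar>c3\<bar> * ?B + \<bar>cJ\<bar> * (2 * ((1 + \<bar>c3\<bar>) * ?B))" using sc by simp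
  also have "\<dots> = defect_const * ?B" unfolding defect_const_def by (simp add: algebra_simps)
  finally show ?thesis .
qed

definition consistency_const :: real where
  "consistency_const = ((real CARD('n) + 1) * (jump_const * flux_const) + 1) * (overlap * (defect_const * sqrt overlap))"

lemma consistency_error:
  assumes u: "u \<in> H2_0 \<Omega>" and w: "w \<in> V"
  shows "\<bar>LINT x|vol \<Omega>. whess \<Omega> u x \<bullet> (D2h \<T> G w x - whess \<Omega> (J w) x)\<bar>
    \<le> consistency_const * norm_h \<Omega> \<T> G w * l2 (vol \<Omega>) (one_minus_Pi0 \<T> (whess \<Omega> u))"
proof -
  let ?\<sigma> = "whess \<Omega> u" and ?c = "(real CARD('n) + 1) * (jump_const * flux_const)"
  let ?E = "\<lambda>x. D2h \<T> G w x - whess \<Omega> (J w) x"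
  define \<delta> where "\<delta> = (\<lambda>K. l2 (vol K) (one_minus_Pi0 \<T> ?\<sigma>))"
  have \<delta>0: "0 \<le> \<delta> K" for K by (simp add: \<delta>_def l2_nonneg)
  let ?X = "\<Sum>T\<in>\<T>. defect w T * (\<Sum>K\<in>nbrs T. \<delta> K)"
  have s\<sigma>: "sq_int (vol \<Omega>) ?\<sigma>" by (rule sq_int_whess[OF open_dom u])
  have sE: "sq_int (vol \<Omega>) ?E" by (intro sq_int_diff D2h_sq_int w sq_int_whess open_dom J_H2_0)
  note onT = sub_ae_sq_int(1)[OF sub_ae_T_dom]
  have dc: "0 \<le> defect_const" by (auto simp: defect_const_def)
  have split: "(LINT x|vol T. ?\<sigma> x \<bullet> ?E x) = (LINT x|vol T. (?\<sigma> x - mean T ?\<sigma>) \<bullet> ?E x) + (LINT x|vol T. mean T ?\<sigma> \<bullet> ?E x)"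
    if T: "T \<in> \<T>" for T
  proof -
    have "(LINT x|vol T. (?\<sigma> x - mean T ?\<sigma>) \<bullet> ?E x + mean T ?\<sigma> \<bullet> ?E x)
        = (LINT x|vol T. (?\<sigma> x - mean T ?\<sigma>) \<bullet> ?E x) + (LINT x|vol T. mean T ?\<sigma> \<bullet> ?E x)"
      by (intro Bochner_Integration.integral_add sq_int_inner sq_int_diff sq_int_const[OF finite_T_measure[OF T]] onT[OF T] s\<sigma> sE
          D2h_sq_int w sq_int_whess open_dom J_H2_0)
    then show ?thesis by (simp add: inner_diff_left)
  qed
  have fluct: "\<bar>LINT x|vol T. (?\<sigma> x - mean T ?\<sigma>) \<bullet> ?E x\<bar> \<le> defect w T * (\<Sum>K\<in>nbrs T. \<delta> K)" if T: "T \<in> \<T>" for T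
  proof -
    have "\<bar>LINT x|vol T. (?\<sigma> x - mean T ?\<sigma>) \<bullet> ?E x\<bar> \<le> l2 (vol T) (\<lambda>x. ?\<sigma> x - mean T ?\<sigma>) * l2 (vol T) ?E"
      by (rule cauchy_schwarz_l2[OF sq_int_diff[OF onT[OF T s\<sigma>] sq_int_const[OF finite_T_measure[OF T]]] onT[OF T sE]])
    also have "l2 (vol T) (\<lambda>x. ?\<sigma> x - mean T ?\<sigma>) = \<delta> T" unfolding \<delta>_def by (rule one_minus_Pi0_T(1)[OF s\<sigma> T, symmetric])
    also have "\<delta> T * l2 (vol T) ?E \<le> (\<Sum>K\<in>nbrs T. \<delta> K) * defect w T"
    proof (rule mult_mono)
      show "\<delta> T \<le> (\<Sum>K\<in>nbrs T. \<delta> K)" by (rule member_le_sum[OF T_in_nbrs[OF T] \<delta>0 finite_nbrs])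
      show "l2 (vol T) ?E \<le> defect w T" unfolding defect_def using diameter_pos[OF T] l2_nonneg by (simp add: l2_nonneg)
    qed (auto intro!: sum_nonneg \<delta>0 l2_nonneg)
    finally show ?thesis by (simp add: mult.commute)
  qed
  have f1: "\<bar>\<Sum>T\<in>\<T>. LINT x|vol T. (?\<sigma> x - mean T ?\<sigma>) \<bullet> ?E x\<bar> \<le> ?X"
    by (rule order_trans[OF sum_abs sum_mono]) (rule fluct)
  have f2: "\<bar>\<Sum>T\<in>\<T>. LINT x|vol T. mean T ?\<sigma> \<bullet> ?E x\<bar> \<le> ?c * ?X"
    unfolding \<delta>_def by (rule piecewise_constant_consistency[OF u w])
  have gen: "y + c * y = (c + 1) * y" for c y :: real by (simp add: algebra_simps)
  have "(LINT x|vol \<Omega>. ?\<sigma> x \<bullet> ?E x) = (\<Sum>T\<in>\<T>. LINT x|vol T. ?\<sigma> x \<bullet> ?E x)"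
    by (rule integral_mesh[OF sq_int_inner[OF s\<sigma> sE]])
  also have "\<dots> = (\<Sum>T\<in>\<T>. LINT x|vol T. (?\<sigma> x - mean T ?\<sigma>) \<bullet> ?E x) + (\<Sum>T\<in>\<T>. LINT x|vol T. mean T ?\<sigma> \<bullet> ?E x)"
    unfolding sum.distrib[symmetric] by (intro sum.cong refl split)
  finally have "\<bar>LINT x|vol \<Omega>. ?\<sigma> x \<bullet> ?E x\<bar> \<le> ?X + ?c * ?X"
    by (simp only:) (rule order_trans[OF abs_triangle_ineq add_mono[OF f1 f2]])
  also have "\<dots> = (?c + 1) * ?X" by (rule gen)
  also have "\<dots> \<le> (?c + 1) * (overlap * ((defect_const * sqrt overlap * norm_h \<Omega> \<T> G w) * l2 (vol \<Omega>) (one_minus_Pi0 \<T> ?\<sigma>)))"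
  proof (rule mult_left_mono)
    have "?X \<le> overlap * (sqrt (\<Sum>T\<in>\<T>. (defect w T)\<^sup>2) * sqrt (\<Sum>T\<in>\<T>. (\<delta> T)\<^sup>2))" by (rule patch_product_sum[OF \<delta>0])
    also have "sqrt (\<Sum>T\<in>\<T>. (\<delta> T)\<^sup>2) = l2 (vol \<Omega>) (one_minus_Pi0 \<T> ?\<sigma>)"
      unfolding \<delta>_def by (rule l2_mesh_sqrt[OF one_minus_Pi0_T(2)[OF s\<sigma>]])
    also have "overlap * (sqrt (\<Sum>T\<in>\<T>. (defect w T)\<^sup>2) * l2 (vol \<Omega>) (one_minus_Pi0 \<T> ?\<sigma>))
        \<le> overlap * ((defect_const * sqrt overlap * norm_h \<Omega> \<T> G w) * l2 (vol \<Omega>) (one_minus_Pi0 \<T> ?\<sigma>))"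
    proof (intro mult_left_mono mult_right_mono l2_nonneg)
      have "(\<Sum>T\<in>\<T>. (defect w T)\<^sup>2) \<le> defect_const\<^sup>2 * (overlap * (\<Sum>T\<in>\<T>. (l2 (vol T) (D2h \<T> G w))\<^sup>2))"
        by (rule patch_square_sum[OF dc defect_nonneg defect_le[OF w]])
      then have "sqrt (\<Sum>T\<in>\<T>. (defect w T)\<^sup>2) \<le> sqrt (defect_const\<^sup>2 * (overlap * (\<Sum>T\<in>\<T>. (l2 (vol T) (D2h \<T> G w))\<^sup>2)))"
        by (rule real_sqrt_le_mono)
      also have "\<dots> = defect_const * sqrt overlap * norm_h \<Omega> \<T> G w"
        using dc by (simp add: real_sqrt_mult l2_mesh_sqrt[OF D2h_sq_int[OF w]] norm_h_def)
      finally show "sqrt (\<Sum>T\<in>\<T>. (defect w T)\<^sup>2) \<le> defect_const * sqrt overlap * norm_h \<Omega> \<T> G w" .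
    qed (use overlap_ge_1 in simp)
    finally show "?X \<le> overlap * ((defect_const * sqrt overlap * norm_h \<Omega> \<T> G w) * l2 (vol \<Omega>) (one_minus_Pi0 \<T> ?\<sigma>))" .
    show "0 \<le> ?c + 1" using const_nonneg by simp
  qed
  also have "\<dots> = consistency_const * norm_h \<Omega> \<T> G w * l2 (vol \<Omega>) (one_minus_Pi0 \<T> ?\<sigma>)"
    unfolding consistency_const_def by (simp only: mult_ac)
  finally show ?thesis .
qed

end

section \<open>Loads and oscillation\<close>

text \<open>As \<open>J\<close> is linear up to null sets, functionals on
  \<open>H\<^sup>1\<^sub>0\<close> have to be evaluated at functions that vanish almost
  everywhere.\<close>

lemma AE_zero_H1_0:
  fixes U :: "(real^'n::finite) set"
  assumes U: "open U" and v: "v \<in> borel_measurable (vol U)" and ae: "AE x in vol U. v x = 0"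
  shows "v \<in> H1_0 U" "H1_norm U v = 0"
proof -
  have ae': "AE x in vol U. 0 = v x" using ae by eventually_elim simp
  have sv: "sq_int (vol U) v"
    by (rule sq_int_cong_AE[OF sets_lebesgue_open[OF U] sq_int_zero ae'])
  have l: "l2 (vol U) v = 0"
    using l2_cong_AE_on[OF sets_lebesgue_open[OF U] _ ae', of] by (simp add: l2_def)
  have wp: "weak_partial U i v (\<lambda>x. 0)" for i
    by (rule weak_partial_cong_AE[OF _ U v _ ae', of i "\<lambda>x. 0"])
      (use weak_partial_classical[OF Ck_const U, of i 0] in \<open>simp_all add: pd_const\<close>)
  have "(H1_norm U v)\<^sup>2 = 0"
    using H1_norm_sq[OF U sv wp sq_int_zero] l by (simp add: l2_def)
  then show n: "H1_norm U v = 0" by simp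
  have "v \<in> H1 U" unfolding H1_def in_l2_iff_sq_int using sv wp sq_int_zero by blast
  then show "v \<in> H1_0 U" unfolding H1_0_def using zero_test_fun n by (auto intro!: exI[of _ "\<lambda>j x. 0"])
qed

context scheme
begin

lemma V_scale: "w \<in> V \<Longrightarrow> (\<lambda>x. t * w x) \<in> V"
  and V_diff: "v \<in> V \<Longrightarrow> w \<in> V \<Longrightarrow> (\<lambda>x. v x - w x) \<in> V"
proof -
  have *: "(\<lambda>x. a *\<^sub>R v x + b *\<^sub>R w x) \<in> V" if "v \<in> V" "w \<in> V" for v w and a b :: real
    using spaces that unfolding discrete_spaces_def lin_space_def by blast
  show "(\<lambda>x. t * w x) \<in> V" if "w \<in> V" using *[OF that that, of t 0] by simp
  show "(\<lambda>x. v x - w x) \<in> V" if "v \<in> V" "w \<in> V" using *[OF that, of 1 "- 1"] by simp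
qed

lemma D2h_linear:
  assumes "v \<in> V" "w \<in> V" "(\<lambda>x. a * v x + b * w x) \<in> V"
  shows "AE x in vol \<Omega>. D2h \<T> G (\<lambda>x. a * v x + b * w x) x = a *\<^sub>R D2h \<T> G v x + b *\<^sub>R D2h \<T> G w x"
  unfolding D2h_def
  by (rule pw_wjac_linear[OF G_pw_smooth[OF assms(1)] G_pw_smooth[OF assms(2)] G_pw_smooth[OF assms(3)]])
    (use spaces assms(1,2) in \<open>auto simp: discrete_spaces_def lin_map_def\<close>)

lemma norm_h_scale:
  assumes w: "w \<in> V"
  shows "norm_h \<Omega> \<T> G (\<lambda>x. t * w x) = \<bar>t\<bar> * norm_h \<Omega> \<T> G w"
proof -
  have "AE x in vol \<Omega>. t *\<^sub>R D2h \<T> G w x = D2h \<T> G (\<lambda>x. t * w x) x"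
    using D2h_linear[OF w w, of t 0] V_scale[OF w, of t] by (auto elim: eventually_mono)
  then have "l2 (vol \<Omega>) (\<lambda>x. t *\<^sub>R D2h \<T> G w x) = norm_h \<Omega> \<T> G (\<lambda>x. t * w x)"
    unfolding norm_h_def by (rule l2_cong_AE_on[OF dom_lebesgue sq_int_measurable[OF sq_int_scale[OF D2h_sq_int[OF w]]]])
  then show ?thesis by (simp add: l2_scale norm_h_def)
qed

lemma load_scale:
  assumes load: "L2_load \<Omega> Lf \<or> (V \<subseteq> H1_0 \<Omega> \<and> Hm1_load \<Omega> Lf)" and w: "w \<in> V"
  shows "Lf (\<lambda>x. t * w x - J (\<lambda>x. t * w x) x) = t * (Lf w - Lf (J w))"
proof -
  let ?v = "\<lambda>x. t * w x"
  have v: "?v \<in> V" by (rule V_scale[OF w])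
  have sJ: "sq_int (vol \<Omega>) (J y)" if "y \<in> V" for y by (rule H2_0_props(1)[OF open_dom J_H2_0[OF that]])
  have "AE x in vol \<Omega>. J (\<lambda>x. t * w x + 0 * w x) x = t *\<^sub>R J w x + 0 *\<^sub>R J w x"
    using smooth_op w unfolding smoother_def lin_map_def by blast
  then have Jv: "AE x in vol \<Omega>. J ?v x = t * J w x" by simp
  from load show ?thesis
  proof
    assume "L2_load \<Omega> Lf"
    then obtain f where f: "sq_int (vol \<Omega>) f" and Lf: "\<And>v. Lf v = (LINT x|vol \<Omega>. f x * v x)"
      unfolding L2_load_def in_l2_iff_sq_int by blast
    note sw = pw_smooth_sq_int(1)[OF V_pw_smooth]
    have i: "integrable (vol \<Omega>) (\<lambda>x. f x * w x)" "integrable (vol \<Omega>) (\<lambda>x. f x * J w x)"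
      using sq_int_inner_mult[OF f] sw[OF w] sJ[OF w] by auto
    have "Lf (\<lambda>x. ?v x - J ?v x) = (LINT x|vol \<Omega>. t * (f x * w x - f x * J w x))"
      unfolding Lf
    proof (rule integral_cong_AE)
      show "(\<lambda>x. f x * (?v x - J ?v x)) \<in> borel_measurable (vol \<Omega>)"
        by (rule borel_measurable_times[OF sq_int_measurable[OF f] borel_measurable_diff[OF sq_int_measurable[OF sw[OF v]] sq_int_measurable[OF sJ[OF v]]]])
      show "(\<lambda>x. t * (f x * w x - f x * J w x)) \<in> borel_measurable (vol \<Omega>)"
        using i by (intro borel_measurable_integrable integrable_mult_right Bochner_Integration.integrable_diff)
      show "AE x in vol \<Omega>. f x * (?v x - J ?v x) = t * (f x * w x - f x * J w x)"
        using Jv by eventually_elim (simp add: algebra_simps)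
    qed
    then show ?thesis using i by (simp add: Lf)
  next
    assume H: "V \<subseteq> H1_0 \<Omega> \<and> Hm1_load \<Omega> Lf"
    then have lin: "Lf (\<lambda>x. a * y x + b * z x) = a * Lf y + b * Lf z" if "y \<in> H1_0 \<Omega>" "z \<in> H1_0 \<Omega>" for y z and a b :: real
      using that unfolding Hm1_load_def by blast
    obtain B where B: "\<And>y. y \<in> H1_0 \<Omega> \<Longrightarrow> \<bar>Lf y\<bar> \<le> B * H1_norm \<Omega> y" using H unfolding Hm1_load_def by blast
    have in0: "w \<in> H1_0 \<Omega>" "?v \<in> H1_0 \<Omega>" "J w \<in> H1_0 \<Omega>" "J ?v \<in> H1_0 \<Omega>"
      using H w v H2_0_subset_H1_0[OF open_dom bounded_dom J_H2_0] by auto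
    let ?d = "\<lambda>x. 1 * J ?v x + (- t) * J w x"
    have "?d \<in> borel_measurable (vol \<Omega>)"
      using sq_int_measurable[OF sJ[OF v]] sq_int_measurable[OF sJ[OF w]] by (intro borel_measurable_add borel_measurable_times borel_measurable_const)
    moreover have "AE x in vol \<Omega>. ?d x = 0" using Jv by eventually_elim simp
    ultimately have "\<bar>Lf ?d\<bar> \<le> B * 0" using AE_zero_H1_0[OF open_dom, of ?d] B[of ?d] by simp
    then have "Lf (J ?v) = t * Lf (J w)" using lin[OF in0(4,3), of 1 "- t"] by simp
    moreover have "Lf ?v = t * Lf w" using lin[OF in0(1,1), of t 0] by simp
    moreover have "Lf (\<lambda>x. ?v x - J ?v x) = Lf ?v - Lf (J ?v)" using lin[OF in0(2,4), of 1 "- 1"] by simp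
    ultimately show ?thesis by (simp add: right_diff_distrib)
  qed
qed

text \<open>The supremum is tested with \<open>- w / \<parallel>w\<parallel>\<^sub>h\<close>.\<close>

lemma oscillation_bound:
  assumes load: "L2_load \<Omega> Lf \<or> (V \<subseteq> H1_0 \<Omega> \<and> Hm1_load \<Omega> Lf)" and w: "w \<in> V"
    and o: "osc \<Omega> \<T> V G J Lf = ennreal b" "0 \<le> b" and s: "0 < norm_h \<Omega> \<T> G w"
  shows "- (Lf w - Lf (J w)) \<le> norm_h \<Omega> \<T> G w * b"
proof -
  let ?s = "norm_h \<Omega> \<T> G w"
  let ?v = "\<lambda>x. (- 1 / ?s) * w x"
  have v: "?v \<in> V" "norm_h \<Omega> \<T> G ?v = 1"
    using V_scale[OF w, of "- 1 / ?s"] norm_h_scale[OF w, of "- 1 / ?s"] s by (simp_all only: abs_divide) simp_all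
  then have "ennreal (Lf (\<lambda>x. ?v x - J ?v x)) \<le> osc \<Omega> \<T> V G J Lf"
    unfolding osc_def by (intro SUP_upper) simp
  then have "Lf (\<lambda>x. ?v x - J ?v x) \<le> b" unfolding o(1) using o(2) by (simp only: ennreal_le_iff)
  then have "(- 1 / ?s) * (Lf w - Lf (J w)) \<le> b" by (simp only: load_scale[OF load w])
  then show ?thesis using s by (simp add: field_simps)
qed


section \<open>The error estimate\<close>

definition interpolation_const :: "real \<Rightarrow> real" where
  "interpolation_const c5 = ((1 + \<bar>c3\<bar>) * \<bar>c5\<bar> + \<bar>c3\<bar>) * sqrt overlap"

lemma interpolation_error:
  assumes Q: "quasi_interpolation c5 \<Omega> \<T> V G Q" and u: "u \<in> H2_0 \<Omega>"
  shows "l2 (vol \<Omega>) (\<lambda>x. whess \<Omega> u x - D2h \<T> G (Q u) x)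
    \<le> interpolation_const c5 * l2 (vol \<Omega>) (one_minus_Pi0 \<T> (whess \<Omega> u))"
proof -
  let ?\<sigma> = "whess \<Omega> u" and ?H = "D2h \<T> G (Q u)" and ?P = "pw \<T> whess (Q u)"
  define \<delta> where "\<delta> = (\<lambda>K. l2 (vol K) (one_minus_Pi0 \<T> ?\<sigma>))"
  have q: "Q u \<in> V" using Q u unfolding quasi_interpolation_def by blast
  have pv: "pw_smooth (Q u)" by (rule V_pw_smooth[OF q])
  have s\<sigma>: "sq_int (vol \<Omega>) ?\<sigma>" by (rule sq_int_whess[OF open_dom u])
  have sH: "sq_int (vol \<Omega>) ?H" by (rule D2h_sq_int[OF q])
  have sP: "sq_int (vol \<Omega>) ?P" by (rule pw_smooth_sq_int(3)[OF pv])
  note onT = sub_ae_sq_int(1)[OF sub_ae_T_dom]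
  let ?c = "(1 + \<bar>c3\<bar>) * \<bar>c5\<bar> + \<bar>c3\<bar>"
  have each: "l2 (vol T) (\<lambda>x. ?\<sigma> x - ?H x) \<le> ?c * sqrt (\<Sum>K\<in>nbrs T. (\<delta> K)\<^sup>2)" if T: "T \<in> \<T>" for T
  proof -
    let ?N = "sqrt (\<Sum>K\<in>nbrs T. (\<delta> K)\<^sup>2)"
    have \<delta>N: "\<delta> T \<le> ?N" by (rule real_le_rsqrt, rule member_le_sum[OF T_in_nbrs[OF T] _ finite_nbrs]) simp
    have eq: "l2 (vol T) (\<lambda>x. ?\<sigma> x - ?P x) = l2 (vol T) (pw \<T> whess (\<lambda>x. u x - Q u x))"
      by (rule l2_cong_AE_on[OF T_lebesgue[OF T] sq_int_measurable[OF sq_int_diff[OF onT[OF T s\<sigma>] onT[OF T sP]]]],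
          rule eventually_mono[OF pw_diff(3)[OF pv u T]]) (rule sym)
    have "l2 (vol T) (\<lambda>x. ?\<sigma> x - ?P x) \<le> scaled_H2 \<T> T (\<lambda>x. u x - Q u x)"
      unfolding eq by (rule scaled_H2_parts(2)[OF T])
    also have "\<dots> \<le> c5 * l2 (vol (patch \<T> T)) (one_minus_Pi0 \<T> ?\<sigma>)"
      using Q u T unfolding quasi_interpolation_def by blast
    also have "\<dots> \<le> \<bar>c5\<bar> * l2 (vol (patch \<T> T)) (one_minus_Pi0 \<T> ?\<sigma>)" by (intro mult_right_mono l2_nonneg) simp
    also have "\<dots> \<le> \<bar>c5\<bar> * ?N"
      unfolding \<delta>_def by (intro mult_left_mono l2_patch_le_sqrt one_minus_Pi0_T(2)[OF s\<sigma>]) simp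
    finally have P: "l2 (vol T) (\<lambda>x. ?\<sigma> x - ?P x) \<le> \<bar>c5\<bar> * ?N" .
    have "l2 (vol T) (\<lambda>x. ?H x - ?P x) \<le> \<bar>c3\<bar> * l2 (vol T) (one_minus_Pi0 \<T> ?P)"
      by (rule hessian_difference(1)[OF q T])
    also have "l2 (vol T) (one_minus_Pi0 \<T> ?P) \<le> \<delta> T + l2 (vol T) (\<lambda>x. ?\<sigma> x - ?P x)"
      using oscillation_triangle(1)[OF T sP s\<sigma>] unfolding \<delta>_def by (simp only: l2_minus_commute[of _ ?P ?\<sigma>])
    also have "\<dots> \<le> ?N + \<bar>c5\<bar> * ?N" using \<delta>N P by simp
    finally have "l2 (vol T) (\<lambda>x. ?P x - ?H x) \<le> \<bar>c3\<bar> * (?N + \<bar>c5\<bar> * ?N)"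
      by (simp only: l2_minus_commute[of _ ?P ?H]) (simp add: mult_left_mono)
    then have "l2 (vol T) (\<lambda>x. ?\<sigma> x - ?H x) \<le> \<bar>c5\<bar> * ?N + \<bar>c3\<bar> * (?N + \<bar>c5\<bar> * ?N)"
      using l2_triangle_diff[OF onT[OF T s\<sigma>] onT[OF T sP] onT[OF T sH]] P by linarith
    also have "\<dots> = ?c * ?N" by (simp add: algebra_simps)
    finally show ?thesis .
  qed
  have "(\<Sum>T\<in>\<T>. (l2 (vol T) (\<lambda>x. ?\<sigma> x - ?H x))\<^sup>2) \<le> ?c\<^sup>2 * (overlap * (\<Sum>T\<in>\<T>. (\<delta> T)\<^sup>2))"
    by (rule patch_square_sum) (use each in \<open>auto simp: l2_nonneg\<close>)
  then have "sqrt (\<Sum>T\<in>\<T>. (l2 (vol T) (\<lambda>x. ?\<sigma> x - ?H x))\<^sup>2) \<le> sqrt (?c\<^sup>2 * (overlap * (\<Sum>T\<in>\<T>. (\<delta> T)\<^sup>2)))"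
    by (rule real_sqrt_le_mono)
  also have "\<dots> = ?c * sqrt overlap * sqrt (\<Sum>T\<in>\<T>. (\<delta> T)\<^sup>2)"
  proof -
    have "0 \<le> ?c" by simp
    then show ?thesis by (simp add: real_sqrt_mult)
  qed
  finally show ?thesis
    unfolding \<delta>_def l2_mesh_sqrt[OF sq_int_diff[OF s\<sigma> sH]] l2_mesh_sqrt[OF one_minus_Pi0_T(2)[OF s\<sigma>]] interpolation_const_def .
qed

definition basic_const :: "real \<Rightarrow> real" where
  "basic_const c5 = 2 * \<bar>interpolation_const c5\<bar> + \<bar>consistency_const\<bar> + 1"

definition error_const :: "real \<Rightarrow> real" where
  "error_const c5 = 2 * basic_const c5 + 2 * \<bar>c3\<bar> * (1 + basic_const c5)"

text \<open>The error identity for \<open>w = Q u - u\<^sub>h\<close>.\<close>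

lemma discrete_error:
  assumes Q: "quasi_interpolation c5 \<Omega> \<T> V G Q"
    and load: "L2_load \<Omega> Lf \<or> (V \<subseteq> H1_0 \<Omega> \<and> Hm1_load \<Omega> Lf)"
    and u: "solves_continuous \<Omega> Lf u" and uh: "solves_discrete \<Omega> \<T> V G Lf uh"
    and o: "osc \<Omega> \<T> V G J Lf = ennreal b" "0 \<le> b"
  shows "l2 (vol \<Omega>) (\<lambda>x. whess \<Omega> u x - D2h \<T> G uh x)
    \<le> basic_const c5 * (l2 (vol \<Omega>) (one_minus_Pi0 \<T> (whess \<Omega> u)) + b)"
proof -
  let ?\<sigma> = "whess \<Omega> u" and ?H = "D2h \<T> G (Q u)" and ?S = "D2h \<T> G uh"
  let ?w = "\<lambda>x. Q u x - uh x"
  let ?W = "D2h \<T> G ?w" and ?Z = "whess \<Omega> (J ?w)" and ?s = "norm_h \<Omega> \<T> G ?w"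
  define \<delta> where "\<delta> = l2 (vol \<Omega>) (one_minus_Pi0 \<T> ?\<sigma>)"
  have \<delta>0: "0 \<le> \<delta>" by (simp add: \<delta>_def l2_nonneg)
  have u0: "u \<in> H2_0 \<Omega>" using u unfolding solves_continuous_def by blast
  have q: "Q u \<in> V" using Q u0 unfolding quasi_interpolation_def by blast
  have uh0: "uh \<in> V" using uh unfolding solves_discrete_def by blast
  have w: "?w \<in> V" by (rule V_diff[OF q uh0])
  have z: "J ?w \<in> H2_0 \<Omega>" by (rule J_H2_0[OF w])
  have s: "sq_int (vol \<Omega>) ?\<sigma>" "sq_int (vol \<Omega>) ?H" "sq_int (vol \<Omega>) ?S"
    "sq_int (vol \<Omega>) ?W" "sq_int (vol \<Omega>) ?Z"
    by (intro sq_int_whess open_dom u0 z D2h_sq_int q uh0 w)+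
  have Wae: "AE x in vol \<Omega>. ?W x = ?H x - ?S x"
    using D2h_linear[OF q uh0, of 1 "- 1"] w by (auto elim: eventually_mono)
  note int = sq_int_inner Bochner_Integration.integrable_diff Bochner_Integration.integrable_add sq_int_diff s
  have cons: "(LINT x|vol \<Omega>. ?\<sigma> x \<bullet> ?Z x) = Lf (J ?w)" using u z unfolding solves_continuous_def by blast
  have disc: "(LINT x|vol \<Omega>. ?S x \<bullet> ?W x) = Lf ?w" using uh w unfolding solves_discrete_def by blast
  \<comment> \<open>The residuals of the continuous and of the discrete problem are inserted.\<close>
  have sq: "?s\<^sup>2 = (LINT x|vol \<Omega>. (?H x - ?\<sigma> x) \<bullet> ?W x) + (LINT x|vol \<Omega>. ?\<sigma> x \<bullet> (?W x - ?Z x)) - (Lf ?w - Lf (J ?w))"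
  proof -
    have "?s\<^sup>2 = (LINT x|vol \<Omega>. ?W x \<bullet> ?W x)" unfolding norm_h_def by (rule l2_sq_inner)
    also have "\<dots> = (LINT x|vol \<Omega>. (?H x - ?S x) \<bullet> ?W x)"
    proof (rule integral_cong_AE)
      show "AE x in vol \<Omega>. ?W x \<bullet> ?W x = (?H x - ?S x) \<bullet> ?W x" using Wae by eventually_elim simp
    qed (intro borel_measurable_integrable int)+
    also have "\<dots> = (LINT x|vol \<Omega>. (((?H x - ?\<sigma> x) \<bullet> ?W x + ?\<sigma> x \<bullet> (?W x - ?Z x)) + ?\<sigma> x \<bullet> ?Z x) - ?S x \<bullet> ?W x)"
      by (intro Bochner_Integration.integral_cong refl) (simp add: inner_diff_left inner_diff_right)
    also have "\<dots> = (LINT x|vol \<Omega>. ((?H x - ?\<sigma> x) \<bullet> ?W x + ?\<sigma> x \<bullet> (?W x - ?Z x)) + ?\<sigma> x \<bullet> ?Z x) - (LINT x|vol \<Omega>. ?S x \<bullet> ?W x)"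
      by (intro Bochner_Integration.integral_diff int)
    also have "(LINT x|vol \<Omega>. ((?H x - ?\<sigma> x) \<bullet> ?W x + ?\<sigma> x \<bullet> (?W x - ?Z x)) + ?\<sigma> x \<bullet> ?Z x)
        = (LINT x|vol \<Omega>. (?H x - ?\<sigma> x) \<bullet> ?W x + ?\<sigma> x \<bullet> (?W x - ?Z x)) + (LINT x|vol \<Omega>. ?\<sigma> x \<bullet> ?Z x)"
      by (intro Bochner_Integration.integral_add int)
    also have "(LINT x|vol \<Omega>. (?H x - ?\<sigma> x) \<bullet> ?W x + ?\<sigma> x \<bullet> (?W x - ?Z x))
        = (LINT x|vol \<Omega>. (?H x - ?\<sigma> x) \<bullet> ?W x) + (LINT x|vol \<Omega>. ?\<sigma> x \<bullet> (?W x - ?Z x))"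
      by (intro Bochner_Integration.integral_add int)
    finally show ?thesis unfolding cons disc by simp
  qed
  have Hs: "l2 (vol \<Omega>) (\<lambda>x. ?\<sigma> x - ?H x) \<le> \<bar>interpolation_const c5\<bar> * \<delta>"
    by (rule order_trans[OF interpolation_error[OF Q u0]]) (auto simp: \<delta>_def intro!: mult_right_mono l2_nonneg)
  have s_le: "?s \<le> (\<bar>interpolation_const c5\<bar> + \<bar>consistency_const\<bar>) * \<delta> + b"
  proof (cases "?s = 0")
    case True
    have "0 \<le> (\<bar>interpolation_const c5\<bar> + \<bar>consistency_const\<bar>) * \<delta> + b" using \<delta>0 o(2) by simp
    then show ?thesis using True by (simp only:)
  next
    case False
    then have s0: "0 < ?s" using l2_nonneg[of "vol \<Omega>" ?W] by (simp add: norm_h_def)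
    have "(LINT x|vol \<Omega>. (?H x - ?\<sigma> x) \<bullet> ?W x) \<le> l2 (vol \<Omega>) (\<lambda>x. ?H x - ?\<sigma> x) * l2 (vol \<Omega>) ?W"
      using cauchy_schwarz_l2[OF sq_int_diff[OF s(2,1)] s(4)] by linarith
    also have "l2 (vol \<Omega>) (\<lambda>x. ?H x - ?\<sigma> x) = l2 (vol \<Omega>) (\<lambda>x. ?\<sigma> x - ?H x)" by (rule l2_minus_commute)
    also have "\<dots> * l2 (vol \<Omega>) ?W \<le> (\<bar>interpolation_const c5\<bar> * \<delta>) * ?s"
      unfolding norm_h_def by (intro mult_right_mono Hs l2_nonneg)
    finally have 1: "(LINT x|vol \<Omega>. (?H x - ?\<sigma> x) \<bullet> ?W x) \<le> (\<bar>interpolation_const c5\<bar> * \<delta>) * ?s" .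
    have "(LINT x|vol \<Omega>. ?\<sigma> x \<bullet> (?W x - ?Z x)) \<le> consistency_const * ?s * \<delta>"
      using consistency_error[OF u0 w] unfolding \<delta>_def by linarith
    also have "\<dots> \<le> \<bar>consistency_const\<bar> * ?s * \<delta>" using s0 \<delta>0 by (intro mult_right_mono) auto
    finally have 2: "(LINT x|vol \<Omega>. ?\<sigma> x \<bullet> (?W x - ?Z x)) \<le> \<bar>consistency_const\<bar> * ?s * \<delta>" .
    have 3: "- (Lf ?w - Lf (J ?w)) \<le> ?s * b" by (rule oscillation_bound[OF load w o s0])
    have "?s\<^sup>2 \<le> (\<bar>interpolation_const c5\<bar> * \<delta>) * ?s + \<bar>consistency_const\<bar> * ?s * \<delta> + ?s * b"
      using sq 1 2 3 by linarith
    then have "?s * ?s \<le> ?s * ((\<bar>interpolation_const c5\<bar> + \<bar>consistency_const\<bar>) * \<delta> + b)"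
      unfolding power2_eq_square by (simp only: distrib_right distrib_left mult_ac add_ac)
    then show ?thesis using s0 by (simp only: mult_le_cancel_left_pos)
  qed
  have "l2 (vol \<Omega>) (\<lambda>x. ?H x - ?S x) = ?s"
    unfolding norm_h_def
    by (rule l2_cong_AE_on[OF dom_lebesgue sq_int_measurable[OF sq_int_diff[OF s(2,3)]]], rule eventually_mono[OF Wae]) (rule sym)
  then have "l2 (vol \<Omega>) (\<lambda>x. ?\<sigma> x - ?S x) \<le> \<bar>interpolation_const c5\<bar> * \<delta> + ((\<bar>interpolation_const c5\<bar> + \<bar>consistency_const\<bar>) * \<delta> + b)"
    using l2_triangle_diff[OF s(1,2,3)] Hs s_le by linarith
  also have "\<dots> \<le> basic_const c5 * (\<delta> + b)"
  proof -
    have "0 \<le> (2 * \<bar>interpolation_const c5\<bar> + \<bar>consistency_const\<bar>) * b + \<delta>" using \<delta>0 o(2) by simp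
    then show ?thesis unfolding basic_const_def by (simp add: algebra_simps)
  qed
  finally show ?thesis unfolding \<delta>_def .
qed

text \<open>The difference of the two discrete Hessians is bounded by the oscillation of the second one,
  and this by that of \<open>\<sigma>\<close> and the error.\<close>

lemma piecewise_error:
  assumes u: "u \<in> H2_0 \<Omega>" and uh: "uh \<in> V"
  shows "l2 (vol \<Omega>) (\<lambda>x. D2h \<T> G uh x - pw \<T> whess uh x)
    \<le> 2 * \<bar>c3\<bar> * (l2 (vol \<Omega>) (one_minus_Pi0 \<T> (whess \<Omega> u)) + l2 (vol \<Omega>) (\<lambda>x. whess \<Omega> u x - D2h \<T> G uh x))"
proof -
  let ?\<sigma> = "whess \<Omega> u" and ?S = "D2h \<T> G uh" and ?P = "pw \<T> whess uh"
  have s: "sq_int (vol \<Omega>) ?\<sigma>" "sq_int (vol \<Omega>) ?S" "sq_int (vol \<Omega>) ?P"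
    by (intro sq_int_whess open_dom u D2h_sq_int uh pw_smooth_sq_int V_pw_smooth)+
  define a where "a T = l2 (vol T) (one_minus_Pi0 \<T> ?\<sigma>)" for T
  define e where "e T = l2 (vol T) (\<lambda>x. ?\<sigma> x - ?S x)" for T
  have "(l2 (vol \<Omega>) (\<lambda>x. ?S x - ?P x))\<^sup>2 = (\<Sum>T\<in>\<T>. (l2 (vol T) (\<lambda>x. ?S x - ?P x))\<^sup>2)"
    by (rule l2_mesh[OF sq_int_diff[OF s(2,3)]])
  also have "\<dots> \<le> (\<Sum>T\<in>\<T>. (2 * \<bar>c3\<bar>)\<^sup>2 * ((a T)\<^sup>2 + (e T)\<^sup>2))"
  proof (rule sum_mono)
    fix T assume T: "T \<in> \<T>"
    have "l2 (vol T) (one_minus_Pi0 \<T> ?S) \<le> a T + e T"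
      using oscillation_triangle(1)[OF T s(2,1)] unfolding a_def e_def by (simp only: l2_minus_commute[of _ ?S ?\<sigma>])
    then have "l2 (vol T) (\<lambda>x. ?S x - ?P x) \<le> \<bar>c3\<bar> * (a T + e T)"
      using hessian_difference(2)[OF uh T] by (meson abs_ge_zero mult_left_mono order_trans)
    then have "(l2 (vol T) (\<lambda>x. ?S x - ?P x))\<^sup>2 \<le> (\<bar>c3\<bar> * (a T + e T))\<^sup>2" by (intro power_mono l2_nonneg)
    also have "\<dots> \<le> (\<bar>c3\<bar> * 2)\<^sup>2 * ((a T)\<^sup>2 + (e T)\<^sup>2)"
    proof -
      have "(x + y)\<^sup>2 = 2 * (x\<^sup>2 + y\<^sup>2) - (x - y)\<^sup>2" for x y :: real by (simp add: power2_eq_square algebra_simps)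
      then have le: "(x + y)\<^sup>2 \<le> 4 * (x\<^sup>2 + y\<^sup>2)" for x y :: real
        using zero_le_power2[of "x - y"] zero_le_power2[of x] zero_le_power2[of y] by (smt (verit))
      show ?thesis using mult_left_mono[OF le[of "a T" "e T"], of "\<bar>c3\<bar>\<^sup>2"] by (simp only: power_mult_distrib power2_abs) (simp add: algebra_simps)
    qed
    finally show "(l2 (vol T) (\<lambda>x. ?S x - ?P x))\<^sup>2 \<le> (2 * \<bar>c3\<bar>)\<^sup>2 * ((a T)\<^sup>2 + (e T)\<^sup>2)" by (simp only: mult.commute)
  qed
  also have "\<dots> = (2 * \<bar>c3\<bar>)\<^sup>2 * ((\<Sum>T\<in>\<T>. (a T)\<^sup>2) + (\<Sum>T\<in>\<T>. (e T)\<^sup>2))"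
    by (simp only: sum_distrib_left[symmetric] sum.distrib)
  also have "\<dots> = (2 * \<bar>c3\<bar>)\<^sup>2 * ((l2 (vol \<Omega>) (one_minus_Pi0 \<T> ?\<sigma>))\<^sup>2 + (l2 (vol \<Omega>) (\<lambda>x. ?\<sigma> x - ?S x))\<^sup>2)"
    unfolding a_def e_def l2_mesh[OF one_minus_Pi0_T(2)[OF s(1)]] l2_mesh[OF sq_int_diff[OF s(1,2)]] ..
  also have "\<dots> \<le> (2 * \<bar>c3\<bar>)\<^sup>2 * (l2 (vol \<Omega>) (one_minus_Pi0 \<T> ?\<sigma>) + l2 (vol \<Omega>) (\<lambda>x. ?\<sigma> x - ?S x))\<^sup>2"
    by (intro mult_left_mono) (simp_all add: power2_sum l2_nonneg)
  finally have "(l2 (vol \<Omega>) (\<lambda>x. ?S x - ?P x))\<^sup>2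
      \<le> (2 * \<bar>c3\<bar> * (l2 (vol \<Omega>) (one_minus_Pi0 \<T> ?\<sigma>) + l2 (vol \<Omega>) (\<lambda>x. ?\<sigma> x - ?S x)))\<^sup>2"
    by (simp only: power_mult_distrib)
  then show ?thesis by (rule power2_le_imp_le) (simp add: l2_nonneg)
qed

text \<open>If the oscillation is infinite, the right-hand side is infinite because the constant is
  positive.\<close>

lemma quasi_optimality:
  assumes Q: "quasi_interpolation c5 \<Omega> \<T> V G Q"
    and load: "L2_load \<Omega> Lf \<or> (V \<subseteq> H1_0 \<Omega> \<and> Hm1_load \<Omega> Lf)"
    and u: "solves_continuous \<Omega> Lf u" and uh: "solves_discrete \<Omega> \<T> V G Lf uh"
  shows "ennreal (l2 (vol \<Omega>) (\<lambda>x. whess \<Omega> u x - pw \<T> whess uh x)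
             + l2 (vol \<Omega>) (\<lambda>x. whess \<Omega> u x - D2h \<T> G uh x))
      \<le> ennreal (error_const c5) * (ennreal (l2 (vol \<Omega>) (one_minus_Pi0 \<T> (whess \<Omega> u)))
                      + osc \<Omega> \<T> V G J Lf)"
proof -
  let ?\<sigma> = "whess \<Omega> u" and ?S = "D2h \<T> G uh" and ?P = "pw \<T> whess uh"
  define \<delta> where "\<delta> = l2 (vol \<Omega>) (one_minus_Pi0 \<T> ?\<sigma>)"
  have \<delta>0: "0 \<le> \<delta>" by (simp add: \<delta>_def l2_nonneg)
  have b1: "1 \<le> basic_const c5" by (simp add: basic_const_def)
  have c0: "0 < error_const c5"
  proof -
    have "0 \<le> 2 * \<bar>c3\<bar> * (1 + basic_const c5)" using b1 by simp
    then show ?thesis using b1 unfolding error_const_def by linarith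
  qed
  have u0: "u \<in> H2_0 \<Omega>" and uh0: "uh \<in> V" using u uh unfolding solves_continuous_def solves_discrete_def by auto
  have s: "sq_int (vol \<Omega>) ?\<sigma>" "sq_int (vol \<Omega>) ?S" "sq_int (vol \<Omega>) ?P"
    by (intro sq_int_whess open_dom u0 D2h_sq_int uh0 pw_smooth_sq_int V_pw_smooth)+
  show ?thesis
  proof (cases "osc \<Omega> \<T> V G J Lf" rule: ennreal_cases)
    case (real b)
    let ?e = "l2 (vol \<Omega>) (\<lambda>x. ?\<sigma> x - ?S x)"
    have e: "?e \<le> basic_const c5 * (\<delta> + b)"
      unfolding \<delta>_def by (rule discrete_error[OF Q load u uh real(2,1)])
    have "l2 (vol \<Omega>) (\<lambda>x. ?\<sigma> x - ?P x) \<le> ?e + 2 * \<bar>c3\<bar> * (\<delta> + ?e)"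
      using l2_triangle_diff[OF s] piecewise_error[OF u0 uh0] unfolding \<delta>_def by linarith
    also have "\<dots> \<le> ?e + 2 * \<bar>c3\<bar> * ((\<delta> + b) + basic_const c5 * (\<delta> + b))"
      using e real(1) by (intro add_left_mono mult_left_mono) auto
    finally have "l2 (vol \<Omega>) (\<lambda>x. ?\<sigma> x - ?P x) + ?e \<le> 2 * (basic_const c5 * (\<delta> + b)) + 2 * \<bar>c3\<bar> * ((\<delta> + b) + basic_const c5 * (\<delta> + b))"
      using e by linarith
    also have "\<dots> = error_const c5 * (\<delta> + b)" unfolding error_const_def by (simp add: algebra_simps)
    finally have "ennreal (l2 (vol \<Omega>) (\<lambda>x. ?\<sigma> x - ?P x) + ?e) \<le> ennreal (error_const c5 * (\<delta> + b))" by (rule ennreal_leI)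
    also have "\<dots> = ennreal (error_const c5) * (ennreal \<delta> + osc \<Omega> \<T> V G J Lf)"
      using c0 \<delta>0 real by (simp add: ennreal_mult ennreal_plus)
    finally show ?thesis unfolding \<delta>_def .
  next
    case top
    then show ?thesis using c0 by (simp add: ennreal_mult_top)
  qed
qed

end

theorem theorem1p1:
  fixes \<kappa> c2 c3 c4 c5 cJ :: real and k m :: nat
  assumes "CARD('n::finite) \<in> {2, 3}"
  shows "\<exists>C::real. \<forall>(\<Omega>::(real^'n) set) \<T> \<nu> V\<^sub>h \<Theta>\<^sub>h G\<^sub>h J Lf u u\<^sub>h.
    lipschitz_polytope \<Omega> \<longrightarrow>
    regular_triangulation \<Omega> \<T> \<longrightarrow>
    shape_regular \<kappa> \<T> \<longrightarrow>
    face_normals \<Omega> \<T> \<nu> \<longrightarrow>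
    discrete_spaces \<Omega> \<T> k V\<^sub>h \<Theta>\<^sub>h G\<^sub>h \<longrightarrow>
    zero_mean_gradient_jump \<T> \<nu> V\<^sub>h G\<^sub>h \<longrightarrow>
    jump_bound c2 \<T> \<nu> V\<^sub>h \<longrightarrow>
    hessian_consistency c3 \<T> V\<^sub>h G\<^sub>h \<longrightarrow>
    gradient_consistency c4 \<T> V\<^sub>h G\<^sub>h \<longrightarrow>
    (\<exists>Q\<^sub>h. quasi_interpolation c5 \<Omega> \<T> V\<^sub>h G\<^sub>h Q\<^sub>h) \<longrightarrow>
    smoother cJ m \<Omega> \<T> \<nu> V\<^sub>h G\<^sub>h J \<longrightarrow>
    (L2_load \<Omega> Lf \<or> (V\<^sub>h \<subseteq> H1_0 \<Omega> \<and> Hm1_load \<Omega> Lf)) \<longrightarrow>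
    solves_continuous \<Omega> Lf u \<longrightarrow>
    solves_discrete \<Omega> \<T> V\<^sub>h G\<^sub>h Lf u\<^sub>h \<longrightarrow>
    ennreal (l2 (lebesgue_on \<Omega>) (\<lambda>x. whess \<Omega> u x - pw \<T> whess u\<^sub>h x)
             + l2 (lebesgue_on \<Omega>) (\<lambda>x. whess \<Omega> u x - D2h \<T> G\<^sub>h u\<^sub>h x))
      \<le> ennreal C * (ennreal (l2 (lebesgue_on \<Omega>) (one_minus_Pi0 \<T> (whess \<Omega> u)))
                      + osc \<Omega> \<T> V\<^sub>h G\<^sub>h J Lf)"
proof -
  have dim: "2 \<le> CARD('n)" using assms by auto
  show ?thesis
  proof (intro exI[of _ "scheme.error_const TYPE('n) \<kappa> c3 c4 cJ c5"] allI impI)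
    fix \<Omega> :: "(real^'n) set" and \<T> \<nu> V\<^sub>h \<Theta>\<^sub>h G\<^sub>h J Lf u u\<^sub>h
    assume mesh: "lipschitz_polytope \<Omega>" "regular_triangulation \<Omega> \<T>" "shape_regular \<kappa> \<T>" "face_normals \<Omega> \<T> \<nu>"
      and disc: "discrete_spaces \<Omega> \<T> k V\<^sub>h \<Theta>\<^sub>h G\<^sub>h" "zero_mean_gradient_jump \<T> \<nu> V\<^sub>h G\<^sub>h"
        "hessian_consistency c3 \<T> V\<^sub>h G\<^sub>h" "gradient_consistency c4 \<T> V\<^sub>h G\<^sub>h"
        "smoother cJ m \<Omega> \<T> \<nu> V\<^sub>h G\<^sub>h J"
      and Q: "\<exists>Q\<^sub>h. quasi_interpolation c5 \<Omega> \<T> V\<^sub>h G\<^sub>h Q\<^sub>h"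
      and load: "L2_load \<Omega> Lf \<or> (V\<^sub>h \<subseteq> H1_0 \<Omega> \<and> Hm1_load \<Omega> Lf)"
      and sol: "solves_continuous \<Omega> Lf u" "solves_discrete \<Omega> \<T> V\<^sub>h G\<^sub>h Lf u\<^sub>h"
    interpret scheme \<Omega> \<T> \<nu> \<kappa> k m V\<^sub>h \<Theta>\<^sub>h G\<^sub>h J c3 c4 cJ
      by unfold_locales (fact mesh disc dim)+
    obtain Q where "quasi_interpolation c5 \<Omega> \<T> V\<^sub>h G\<^sub>h Q" using Q by blast
    then show "ennreal (l2 (lebesgue_on \<Omega>) (\<lambda>x. whess \<Omega> u x - pw \<T> whess u\<^sub>h x)
             + l2 (lebesgue_on \<Omega>) (\<lambda>x. whess \<Omega> u x - D2h \<T> G\<^sub>h u\<^sub>h x))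
      \<le> ennreal (scheme.error_const TYPE('n) \<kappa> c3 c4 cJ c5) * (ennreal (l2 (lebesgue_on \<Omega>) (one_minus_Pi0 \<T> (whess \<Omega> u)))
                      + osc \<Omega> \<T> V\<^sub>h G\<^sub>h J Lf)"
      by (rule quasi_optimality[OF _ load sol])
  qed
qed

end
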